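(* Let $d\geq 3$ be an integer and let $\mathcal P$ be a general pencil of plane curves of degree $d$. Let $\mathcal M_{(2,2),d,\mathcal P}\subset(\mathbb P^2)^*$ be the curve of bitangent lines to curves in $\mathcal P$. Then $$\deg(\mathcal M_{(2,2),d,\mathcal P})=2d(d-2)(d-3).$$
   Context: We work over $\mathbb C$. $(\mathbb P^2)^*$ is the dual plane parametrizing lines; a pencil is a line in the projective space $|\mathcal O_{\mathbb P^2}(d)|$ of plane curves of degree $d$; "general" means belonging to a suitable dense Zariski open subset of the parameter space of pencils. Let $$\mathcal I_{(2,2),d}=\overline{\{(L,(p_1,p_2),C)\;:\;p_1\neq p_2,\ \operatorname{mult}_{p_i}(L,C)\geq 2,\ i=1,2\}}\subset(\mathbb P^2)^*\times(\mathbb P^2)^2\times|\mathcal O_{\mathbb P^2}(d)|,$$ where $\operatorname{mult}_p(L,C)$ is the intersection multiplicity at $p$ of the line $L$ and the curve $C$, and let $\pi_1,\pi_3$ be the projections to $(\mathbb P^2)^*$ and $|\mathcal O_{\mathbb P^2}(d)|$. Then $\mathcal M_{(2,2),d,\mathcal P}=\pi_1(\pi_3^{-1}(\mathcal P))$, regarded as a (reduced) plane curve; its degree is the number of lines in it passing through a general point of $\mathbb P^2$ (it is empty, of degree $0$, when $d=3$). *)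

theory Defs
  imports "HOL-Analysis.Analysis" "HOL-Library.Extended_Nat"
begin

section \<open>Zariski topologies\<close>

text \<open>
  A variety is presented through coordinate functions \<open>C\<close> on an ambient type.  Since the ground
  field is infinite, polynomials may be identified with polynomial functions.
\<close>

inductive_set polyfun :: "('v \<Rightarrow> complex) set \<Rightarrow> ('v \<Rightarrow> complex) set"
  for C :: "('v \<Rightarrow> complex) set" where
  const: "(\<lambda>_. c) \<in> polyfun C"
| coord: "x \<in> C \<Longrightarrow> x \<in> polyfun C"
| add: "f \<in> polyfun C \<Longrightarrow> g \<in> polyfun C \<Longrightarrow> (\<lambda>v. f v + g v) \<in> polyfun C"
| mult: "f \<in> polyfun C \<Longrightarrow> g \<in> polyfun C \<Longrightarrow> (\<lambda>v. f v * g v) \<in> polyfun C"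

definition zariski :: "('v \<Rightarrow> complex) set \<Rightarrow> 'v set \<Rightarrow> 'v topology" where
  "zariski C S = topology (\<lambda>U. U \<subseteq> S \<and> (\<exists>E \<subseteq> polyfun C. S - U = {v \<in> S. \<forall>f\<in>E. f v = 0}))"

lemma openin_zariski:
  "openin (zariski C S) U \<longleftrightarrow> U \<subseteq> S \<and> (\<exists>E \<subseteq> polyfun C. S - U = {v \<in> S. \<forall>f\<in>E. f v = 0})"
proof -
  let ?P = "\<lambda>U. U \<subseteq> S \<and> (\<exists>E \<subseteq> polyfun C. S - U = {v \<in> S. \<forall>f\<in>E. f v = 0})"
  have "istopology ?P"
    unfolding istopology_def
  proof (intro conjI allI impI)
    fix U V assume "?P U" "?P V"
    then obtain E F where EF: "U \<subseteq> S" "V \<subseteq> S" "E \<subseteq> polyfun C" "F \<subseteq> polyfun C"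
      and U: "S - U = {v \<in> S. \<forall>f\<in>E. f v = 0}" and V: "S - V = {v \<in> S. \<forall>f\<in>F. f v = 0}"
      by auto
    let ?G = "(\<lambda>(f, g) v. f v * g v) ` (E \<times> F)"
    have "?G \<subseteq> polyfun C" using EF by (auto intro!: polyfun.mult)
    moreover have "S - U \<inter> V = {v \<in> S. \<forall>f\<in>?G. f v = 0}"
    proof -
      have "S - U \<inter> V = (S - U) \<union> (S - V)" by blast
      also have "\<dots> = {v \<in> S. \<forall>f\<in>?G. f v = 0}" unfolding U V by auto
      finally show ?thesis .
    qed
    ultimately have "\<exists>G \<subseteq> polyfun C. S - U \<inter> V = {v \<in> S. \<forall>f\<in>G. f v = 0}" by blast
    then show "U \<inter> V \<subseteq> S" "\<exists>G \<subseteq> polyfun C. S - U \<inter> V = {v \<in> S. \<forall>f\<in>G. f v = 0}"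
      using EF by auto
  next
    fix \<K> assume K: "\<forall>K\<in>\<K>. ?P K"
    then show "\<Union>\<K> \<subseteq> S" by blast
    from K have "\<forall>K\<in>\<K>. \<exists>E. E \<subseteq> polyfun C \<and> S - K = {v \<in> S. \<forall>f\<in>E. f v = 0}" by blast
    then obtain E where EZ: "\<forall>K\<in>\<K>. E K \<subseteq> polyfun C \<and> S - K = {v \<in> S. \<forall>f\<in>E K. f v = 0}"
      by (rule bchoice[THEN exE])
    then have E: "E K \<subseteq> polyfun C" and Z: "S - K = {v \<in> S. \<forall>f\<in>E K. f v = 0}" if "K \<in> \<K>" for K
      using that by simp_all
    have "v \<in> S - \<Union>\<K> \<longleftrightarrow> v \<in> {v \<in> S. \<forall>f\<in>(\<Union>K\<in>\<K>. E K). f v = 0}" for v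
    proof (cases "v \<in> S")
      case True
      have "v \<notin> K \<longleftrightarrow> (\<forall>f\<in>E K. f v = 0)" if "K \<in> \<K>" for K
        using eqset_imp_iff[OF Z[OF that], of v] True by simp
      then show ?thesis using True by simp
    qed simp
    then have "S - \<Union>\<K> = {v \<in> S. \<forall>f\<in>(\<Union>K\<in>\<K>. E K). f v = 0}" by blast
    moreover have "(\<Union>K\<in>\<K>. E K) \<subseteq> polyfun C" using E by blast
    ultimately show "\<exists>G \<subseteq> polyfun C. S - \<Union>\<K> = {v \<in> S. \<forall>f\<in>G. f v = 0}" by blast
  qed
  then show ?thesis by (simp add: zariski_def topology_inverse')
qed

lemma topspace_zariski: "topspace (zariski C S) = S"
proof -
  have "openin (zariski C S) S"
    unfolding openin_zariski
    by (auto intro!: exI[of _ "{\<lambda>_. 1}"] polyfun.const)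
  then show ?thesis
    by (meson openin_subset openin_topspace openin_zariski subset_antisym)
qed

definition quotient_topology :: "'v topology \<Rightarrow> ('v \<Rightarrow> 'w) \<Rightarrow> 'w topology" where
  "quotient_topology X q =
     topology (\<lambda>U. U \<subseteq> q ` topspace X \<and> openin X {v \<in> topspace X. q v \<in> U})"

lemma openin_quotient_topology:
  "openin (quotient_topology X q) U \<longleftrightarrow>
     U \<subseteq> q ` topspace X \<and> openin X {v \<in> topspace X. q v \<in> U}"
proof -
  let ?P = "\<lambda>U. U \<subseteq> q ` topspace X \<and> openin X {v \<in> topspace X. q v \<in> U}"
  have "istopology ?P"
    unfolding istopology_def
  proof (intro conjI allI impI)
    fix U V assume a: "?P U" "?P V"
    have "{v \<in> topspace X. q v \<in> U \<inter> V} =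
        {v \<in> topspace X. q v \<in> U} \<inter> {v \<in> topspace X. q v \<in> V}" by blast
    with a show "U \<inter> V \<subseteq> q ` topspace X" "openin X {v \<in> topspace X. q v \<in> U \<inter> V}" by auto
  next
    fix \<K> assume a: "\<forall>K\<in>\<K>. ?P K"
    have "{v \<in> topspace X. q v \<in> \<Union>\<K>} = (\<Union>K\<in>\<K>. {v \<in> topspace X. q v \<in> K})" by blast
    with a show "\<Union>\<K> \<subseteq> q ` topspace X" "openin X {v \<in> topspace X. q v \<in> \<Union>\<K>}" by auto
  qed
  then show ?thesis by (simp add: quotient_topology_def topology_inverse')
qed

lemma topspace_quotient_topology: "topspace (quotient_topology X q) = q ` topspace X"
proof -
  have "{v \<in> topspace X. q v \<in> q ` topspace X} = topspace X" by blast
  then have "openin (quotient_topology X q) (q ` topspace X)"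
    by (simp add: openin_quotient_topology)
  then show ?thesis
    by (meson openin_subset openin_topspace openin_quotient_topology subset_antisym)
qed

definition generally :: "'v topology \<Rightarrow> ('v \<Rightarrow> bool) \<Rightarrow> bool" where
  "generally X Q \<longleftrightarrow>
     (\<exists>U. openin X U \<and> X closure_of U = topspace X \<and> (\<forall>v\<in>U. Q v))"

definition prod_coords ::
    "('v \<Rightarrow> complex) set \<Rightarrow> ('w \<Rightarrow> complex) set \<Rightarrow> ('v \<times> 'w \<Rightarrow> complex) set" where
  "prod_coords C D = (\<lambda>x. x \<circ> fst) ` C \<union> (\<lambda>x. x \<circ> snd) ` D"

section \<open>The projective plane and its dual\<close>

text \<open>
  A point of the plane is the complex span of a nonzero vector of homogeneous coordinates.  A line
  \<open>l\<^sub>1 x\<^sub>1 + l\<^sub>2 x\<^sub>2 + l\<^sub>3 x\<^sub>3 = 0\<close> is likewise the span of \<open>l\<close>, so the dual plane is represented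
  by the same set with the same topology.  The Zariski topology on a projective space is the
  quotient topology from the punctured affine cone: a set is closed iff its preimage is cut out by
  polynomials (which can then be taken homogeneous).
\<close>

definition pt :: "complex^3 \<Rightarrow> (complex^3) set" where
  "pt v = range (\<lambda>c. c *s v)"

definition coords3 :: "(complex^3 \<Rightarrow> complex) set" where
  "coords3 = range (\<lambda>i v. v $ i)"

definition plane :: "(complex^3) set topology" where
  "plane = quotient_topology (zariski coords3 {v. v \<noteq> 0}) pt"

definition pairing :: "complex^3 \<Rightarrow> complex^3 \<Rightarrow> complex" where
  "pairing l p = (\<Sum>i\<in>UNIV. l $ i * p $ i)"

definition on_line :: "(complex^3) set \<Rightarrow> (complex^3) set \<Rightarrow> bool" where
  "on_line P L \<longleftrightarrow> (\<forall>p\<in>P. \<forall>l\<in>L. pairing l p = 0)"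

text \<open>
  The degree of a reduced curve in the dual plane: the number of its members (lines) through a
  general point of the plane.
\<close>

definition has_degree :: "(complex^3) set set \<Rightarrow> nat \<Rightarrow> bool" where
  "has_degree M n \<longleftrightarrow>
     generally plane (\<lambda>P. finite {L \<in> M. on_line P L} \<and> card {L \<in> M. on_line P L} = n)"

section \<open>Plane curves and pencils\<close>

text \<open>
  A ternary form is given by its coefficients: \<open>F (i, j, k)\<close> is the coefficient of
  \<open>x\<^sub>1\<^sup>i x\<^sub>2\<^sup>j x\<^sub>3\<^sup>k\<close>.  A curve is the span of a nonzero form (so it may be reducible or
  non-reduced), and a pencil is the set of curves in the span of two independent forms.
\<close>

type_synonym form = "nat \<times> nat \<times> nat \<Rightarrow> complex"

definition exponents :: "nat \<Rightarrow> (nat \<times> nat \<times> nat) set" where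
  "exponents d = {(i, j, k). i + j + k = d}"

definition forms :: "nat \<Rightarrow> form set" where
  "forms d = {F. \<forall>m. m \<notin> exponents d \<longrightarrow> F m = 0}"

definition form_coords :: "nat \<Rightarrow> (form \<Rightarrow> complex) set" where
  "form_coords d = (\<lambda>m F. F m) ` exponents d"

definition curve :: "form \<Rightarrow> form set" where
  "curve F = range (\<lambda>c m. c * F m)"

definition independent_pairs :: "nat \<Rightarrow> (form \<times> form) set" where
  "independent_pairs d = {(F, G). F \<in> forms d \<and> G \<in> forms d \<and>
     (\<forall>s t. (\<lambda>m. s * F m + t * G m) = (\<lambda>_. 0) \<longrightarrow> s = 0 \<and> t = 0)}"

definition pencil :: "form \<times> form \<Rightarrow> form set set" where
  "pencil = (\<lambda>(F, G). {curve (\<lambda>m. s * F m + t * G m) | s t. (s, t) \<noteq> (0, 0)})"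

text \<open>
  The Grassmannian of lines in \<open>|O(d)|\<close>, as the quotient of the variety of independent pairs of
  forms by change of basis.
\<close>

definition pencils :: "nat \<Rightarrow> form set set topology" where
  "pencils d = quotient_topology
     (zariski (prod_coords (form_coords d) (form_coords d)) (independent_pairs d)) pencil"

section \<open>Bitangent lines\<close>

definition restrict_form :: "nat \<Rightarrow> form \<Rightarrow> complex^3 \<Rightarrow> complex^3 \<Rightarrow> complex poly" where
  "restrict_form d F p q =
     (\<Sum>(i, j, k)\<in>exponents d.
        smult (F (i, j, k)) ([:p$1, q$1:] ^ i * [:p$2, q$2:] ^ j * [:p$3, q$3:] ^ k))"

definition vanishing_order :: "complex poly \<Rightarrow> enat" where
  "vanishing_order f = (if f = 0 then \<infinity> else enat (order 0 f))"

text \<open>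
  The intersection multiplicity at \<open>p\<close> of the line \<open>l\<close> and the curve \<open>F\<close>: the order of vanishing
  at \<open>t = 0\<close> of \<open>F (p + t q)\<close>, where \<open>q\<close> is any second point of the line (the order does not
  depend on which one).  It is infinite if the curve contains the line.
\<close>

definition intersection_mult :: "nat \<Rightarrow> complex^3 \<Rightarrow> form \<Rightarrow> complex^3 \<Rightarrow> enat" where
  "intersection_mult d l F p =
     (if pairing l p = 0
      then vanishing_order (restrict_form d F p (SOME q. pairing l q = 0 \<and> q \<notin> pt p))
      else 0)"

type_synonym flag = "(complex^3) set \<times> ((complex^3) set \<times> (complex^3) set) \<times> form set"

text \<open>
  The Zariski topology on the product of the dual plane, two copies of the plane and \<open>|O(d)|\<close>
  (not the product topology), again as a quotient of the product of the punctured cones.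
\<close>

definition ambient :: "nat \<Rightarrow> flag topology" where
  "ambient d = quotient_topology
     (zariski
        (prod_coords coords3 (prod_coords (prod_coords coords3 coords3) (form_coords d)))
        {(l, (p1, p2), F). l \<noteq> 0 \<and> p1 \<noteq> 0 \<and> p2 \<noteq> 0 \<and> F \<in> forms d \<and> F \<noteq> (\<lambda>_. 0)})
     (\<lambda>(l, (p1, p2), F). (pt l, (pt p1, pt p2), curve F))"

definition incidence :: "nat \<Rightarrow> flag set" where
  "incidence d = ambient d closure_of
     {(pt l, (pt p1, pt p2), curve F) | l p1 p2 F.
        l \<noteq> 0 \<and> p1 \<noteq> 0 \<and> p2 \<noteq> 0 \<and> F \<in> forms d \<and> F \<noteq> (\<lambda>_. 0) \<and>
        pt p1 \<noteq> pt p2 \<and> intersection_mult d l F p1 \<ge> 2 \<and> intersection_mult d l F p2 \<ge> 2}"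

definition bitangent_lines :: "nat \<Rightarrow> form set set \<Rightarrow> (complex^3) set set" where
  "bitangent_lines d P = {L. \<exists>p1 p2 C. C \<in> P \<and> (L, (p1, p2), C) \<in> incidence d}"

end

theory Submission
  imports Defs "HOL-Complex_Analysis.Complex_Analysis" "HOL-Computational_Algebra.Fundamental_Theorem_Algebra"
begin

text \<open>
  The lines through a general point \<open>P\<close> form a family \<open>L\<^sub>y\<close>.  On \<open>L\<^sub>y\<close> the pencil is spanned by two
  polynomials \<open>f\<close>, \<open>g\<close> of degree \<open>d\<close> in one variable, and the points of tangency with members of
  the pencil are the \<open>2 d - 2\<close> roots \<open>x\<^sub>i\<close> of their Wronskian.  The line is bitangent iff two of these
  points lie on the same member, that is \<open>f(x\<^sub>i) g(x\<^sub>j) = f(x\<^sub>j) g(x\<^sub>i)\<close>.  This difference is divisible by the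
  cube of \<open>x\<^sub>i - x\<^sub>j\<close>.  The product of the quotients over all ordered pairs, multiplied by a power of
  the leading coefficient of the Wronskian and divided by a power of the resultant of \<open>f\<close> and \<open>g\<close>, does not
  depend on the coordinate on the line.  As a function of \<open>y\<close> it has nonzero limits at the lines which
  are inflectional, pass through a base point or are tangent at \<open>P\<close>, a double zero at each bitangent
  line, and growth of exact order \<open>4 d (d - 2) (d - 3)\<close> at infinity.  Hence it is a polynomial of that degree,
  and half of the degree is the number of bitangents.

  All degenerate configurations are excluded by dimension counts, since a polynomial map from a
  space of smaller dimension has its image in a hypersurface.  The closure in the definition of the
  incidence variety adds only lines with fourfold contact at one point, which are degenerate too.
\<close>

section \<open>Images of polynomial maps\<close>

text \<open>The cube has a simple source: \<open>(f/g)' = W/g^2\<close> for the Wronskian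
  \<open>W\<close>, so between two neighbouring zeros of \<open>W\<close> the quotient
  \<open>f/g\<close> changes only to third order. The exponents in the invariant are forced. The
  power of the leading coefficient of \<open>W\<close> makes it insensitive to an inversion of the
  coordinate, and the power of the resultant cancels the zeros that would arise on lines through a
  base point, where two critical points merge. Ordered pairs make the product visibly symmetric in
  the critical points, at the price of counting each bitangent twice. The main obstacle is that
  critical points are not polynomial functions of \<open>y\<close>. Nothing is expanded in terms of
  discriminants: the roots are labelled near one line at a time, only limits and differentiability
  off a finite set are established, and Liouville's theorem supplies the polynomial. Genericity of
  the pencil and of the point is a single polynomial condition on the coefficients of the pencil in
  affine coordinates at the point, so one pencil and one point satisfying it are enough.\<close>

lemma homogeneous_system_nontrivial:
  fixes c :: "'i \<Rightarrow> 'j \<Rightarrow> complex"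
  assumes "finite J" "finite I" "card J < card I"
  shows "\<exists>l. (\<exists>i\<in>I. l i \<noteq> 0) \<and> (\<forall>j\<in>J. (\<Sum>i\<in>I. l i * c i j) = 0)"
  using assms
proof (induction J arbitrary: I c rule: finite_induct)
  case empty
  then obtain i where "i \<in> I" by (metis all_not_in_conv card.empty less_irrefl)
  then show ?case by (intro exI[of _ "\<lambda>_. 1"]) auto
next
  case (insert j0 J)
  show ?case
  proof (cases "\<forall>i\<in>I. c i j0 = 0")
    case True
    have "card J < card I" using insert by simp
    from insert.IH[OF insert.prems(1) this, of c] obtain l where
      "\<exists>i\<in>I. l i \<noteq> 0" "\<forall>j\<in>J. (\<Sum>i\<in>I. l i * c i j) = 0" by blast
    with True show ?thesis by (intro exI[of _ l]) auto
  next
    case False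
    then obtain i0 where i0: "i0 \<in> I" "c i0 j0 \<noteq> 0" by blast
    let ?I = "I - {i0}"
    let ?c = "\<lambda>i j. c i j - c i j0 / c i0 j0 * c i0 j"
    have "card J < card ?I" using insert i0 by simp
    from insert.IH[OF _ this, of ?c] insert.prems obtain l where
      l: "\<exists>i\<in>?I. l i \<noteq> 0" "\<forall>j\<in>J. (\<Sum>i\<in>?I. l i * ?c i j) = 0" by auto
    \<comment> \<open>Back substitution: the value of the pivot unknown \<open>i0\<close> that
      solves the eliminated equation \<open>j0\<close>.\<close>
    define s where "s = - (\<Sum>i\<in>?I. l i * c i j0) / c i0 j0"
    define l' where "l' = l(i0 := s)"
    have sum': "(\<Sum>i\<in>I. l' i * c i j) = s * c i0 j + (\<Sum>i\<in>?I. l i * c i j)" for j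
    proof -
      have "(\<Sum>i\<in>I. l' i * c i j) = l' i0 * c i0 j + (\<Sum>i\<in>?I. l' i * c i j)"
        using i0 insert.prems by (simp add: sum.remove)
      also have "(\<Sum>i\<in>?I. l' i * c i j) = (\<Sum>i\<in>?I. l i * c i j)"
        by (rule sum.cong) (auto simp: l'_def)
      finally show ?thesis by (simp add: l'_def)
    qed
    have "(\<Sum>i\<in>I. l' i * c i j0) = 0" unfolding sum' using i0 by (simp add: s_def)
    moreover have "(\<Sum>i\<in>I. l' i * c i j) = 0" if "j \<in> J" for j
    proof -
      have "0 = (\<Sum>i\<in>?I. l i * ?c i j)" using l that by simp
      also have "\<dots> = (\<Sum>i\<in>?I. l i * c i j) - (\<Sum>i\<in>?I. l i * c i j0) / c i0 j0 * c i0 j"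
        by (simp add: algebra_simps sum_subtractf sum_distrib_left sum_distrib_right sum_divide_distrib)
      also have "\<dots> = (\<Sum>i\<in>I. l' i * c i j)" unfolding sum' by (simp add: s_def)
      finally show ?thesis by simp
    qed
    moreover have "\<exists>i\<in>I. l' i \<noteq> 0" using l(1) by (auto simp: l'_def)
    ultimately show ?thesis by (intro exI[of _ l']) auto
  qed
qed

definition monom_fun :: "'a set \<Rightarrow> ('a \<Rightarrow> nat) \<Rightarrow> ('a \<Rightarrow> complex) \<Rightarrow> complex" where
  "monom_fun A e v = (\<Prod>a\<in>A. v a ^ e a)"

text \<open>
  Induction on the number of variables: for fixed values of the other variables the sum is a
  polynomial in the new one, so that its coefficients vanish.
\<close>
lemma monom_fun_independent:
  assumes "finite A" and "e0 \<in> PiE A (\<lambda>_. {..D})"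
    and "\<And>v. (\<Sum>e\<in>PiE A (\<lambda>_. {..D}). l e * monom_fun A e v) = 0"
  shows "l e0 = 0"
  using assms
proof (induction A arbitrary: l e0 rule: finite_induct)
  case empty
  then show ?case by (auto simp: monom_fun_def)
next
  case (insert a A)
  let ?E = "PiE A (\<lambda>_. {..D})"
  have fin: "finite ?E" using insert by (simp add: finite_PiE)
  have eq: "PiE (insert a A) (\<lambda>_. {..D}) = (\<lambda>(k, e). e(a := k)) ` ({..D} \<times> ?E)"
    by (simp add: PiE_insert_eq)
  have inj: "inj_on (\<lambda>(k, e). e(a := k)) ({..D} \<times> ?E)"
    using insert.hyps(2) inj_combinator[of a A "\<lambda>_. {..D}"] by auto
  have mf: "monom_fun (insert a A) (e(a := k)) v = v a ^ k * monom_fun A e v" for e k v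
  proof -
    have "(\<Prod>b\<in>A. v b ^ (e(a := k)) b) = (\<Prod>b\<in>A. v b ^ e b)"
      by (rule prod.cong) (use insert.hyps in auto)
    then show ?thesis using insert.hyps by (simp add: monom_fun_def)
  qed
  have sum0: "(\<Sum>k\<le>D. (\<Sum>e\<in>?E. l (e(a := k)) * monom_fun A e v) * v a ^ k) = 0" for v
  proof -
    have "0 = (\<Sum>e\<in>PiE (insert a A) (\<lambda>_. {..D}). l e * monom_fun (insert a A) e v)"
      using insert.prems by simp
    also have "\<dots> = (\<Sum>(k, e)\<in>{..D} \<times> ?E. l (e(a := k)) * (v a ^ k * monom_fun A e v))"
      unfolding eq by (subst sum.reindex[OF inj]) (auto simp: mf case_prod_unfold intro!: sum.cong)
    also have "\<dots> = (\<Sum>k\<le>D. \<Sum>e\<in>?E. l (e(a := k)) * (v a ^ k * monom_fun A e v))"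
      by (simp add: sum.cartesian_product)
    also have "\<dots> = (\<Sum>k\<le>D. (\<Sum>e\<in>?E. l (e(a := k)) * monom_fun A e v) * v a ^ k)"
      by (simp add: sum_distrib_left sum_distrib_right algebra_simps)
    finally show ?thesis by simp
  qed
  have zero: "(\<Sum>e\<in>?E. l (e(a := k)) * monom_fun A e v) = 0" if "k \<le> D" for k v
  proof -
    have indep: "monom_fun A e (v(a := x)) = monom_fun A e v" for e x
      unfolding monom_fun_def by (rule prod.cong) (use insert.hyps in auto)
    have "(\<Sum>k\<le>D. (\<Sum>e\<in>?E. l (e(a := k)) * monom_fun A e v) * x ^ k) = 0" for x
      using sum0[of "v(a := x)"] by (simp add: indep)
    then show ?thesis using polyfun_eq_0[of "\<lambda>k. \<Sum>e\<in>?E. l (e(a := k)) * monom_fun A e v" D] that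
      by blast
  qed
  from insert.prems(1) obtain k e where ke: "k \<le> D" "e \<in> ?E" "e0 = e(a := k)"
    unfolding eq by auto
  show ?case using insert.IH[OF ke(2), of "\<lambda>e. l (e(a := k))"] zero[OF ke(1)] ke(3) by blast
qed

text \<open>\<open>D\<close> bounds every exponent separately, not the total degree, so the exponent
  vectors form a box with \<open>(D + 1) ^ card A\<close> elements.\<close>

definition mpoly :: "'a set \<Rightarrow> nat \<Rightarrow> (('a \<Rightarrow> complex) \<Rightarrow> complex) \<Rightarrow> bool" where
  "mpoly A D f \<longleftrightarrow> (\<exists>l. f = (\<lambda>v. \<Sum>e\<in>PiE A (\<lambda>_. {..D}). l e * monom_fun A e v))"

lemma mpoly_sum:
  assumes "finite I" "\<And>i. i \<in> I \<Longrightarrow> mpoly A D (f i)"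
  shows "mpoly A D (\<lambda>v. \<Sum>i\<in>I. c i * f i v)"
proof -
  from assms(2) have "\<forall>i\<in>I. \<exists>l. f i = (\<lambda>v. \<Sum>e\<in>PiE A (\<lambda>_. {..D}). l e * monom_fun A e v)"
    by (simp add: mpoly_def)
  then obtain l where l: "\<forall>i\<in>I. f i = (\<lambda>v. \<Sum>e\<in>PiE A (\<lambda>_. {..D}). l i e * monom_fun A e v)"
    by metis
  show ?thesis unfolding mpoly_def
  proof (intro exI[of _ "\<lambda>e. \<Sum>i\<in>I. c i * l i e"] ext)
    fix v
    have "(\<Sum>i\<in>I. c i * f i v) = (\<Sum>i\<in>I. \<Sum>e\<in>PiE A (\<lambda>_. {..D}). c i * l i e * monom_fun A e v)"
      using l by (intro sum.cong) (auto simp: sum_distrib_left mult.assoc)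
    also have "\<dots> = (\<Sum>e\<in>PiE A (\<lambda>_. {..D}). (\<Sum>i\<in>I. c i * l i e) * monom_fun A e v)"
      by (subst sum.swap) (simp add: sum_distrib_right)
    finally show "(\<Sum>i\<in>I. c i * f i v) = \<dots>" .
  qed
qed

lemma mpoly_monom:
  assumes "finite A" "\<And>a. a \<in> A \<Longrightarrow> e a \<le> D"
  shows "mpoly A D (monom_fun A e)"
proof -
  let ?e = "restrict e A"
  have e: "?e \<in> PiE A (\<lambda>_. {..D})" using assms by auto
  have "monom_fun A e v = (\<Sum>e'\<in>PiE A (\<lambda>_. {..D}). (if e' = ?e then 1 else 0) * monom_fun A e' v)" for v
  proof -
    have "monom_fun A e v = monom_fun A ?e v" unfolding monom_fun_def by (rule prod.cong) auto
    then show ?thesis using e assms(1)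
      by (simp add: if_distrib[of "\<lambda>x. x * _"] finite_PiE cong: if_cong)
  qed
  then show ?thesis unfolding mpoly_def by (intro exI[of _ "\<lambda>e'. if e' = ?e then 1 else 0"] ext)
qed

lemma mpoly_mult:
  assumes "finite A" "mpoly A D f" "mpoly A D' g"
  shows "mpoly A (D + D') (\<lambda>v. f v * g v)"
proof -
  obtain l l' where l: "f = (\<lambda>v. \<Sum>e\<in>PiE A (\<lambda>_. {..D}). l e * monom_fun A e v)"
    "g = (\<lambda>v. \<Sum>e\<in>PiE A (\<lambda>_. {..D'}). l' e * monom_fun A e v)"
    using assms unfolding mpoly_def by blast
  have mm: "monom_fun A e v * monom_fun A e' v = monom_fun A (\<lambda>a. e a + e' a) v" for e e' v
    by (simp add: monom_fun_def power_add prod.distrib)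
  have "f v * g v = (\<Sum>x\<in>PiE A (\<lambda>_. {..D}) \<times> PiE A (\<lambda>_. {..D'}).
      (l (fst x) * l' (snd x)) * monom_fun A (\<lambda>a. fst x a + snd x a) v)" for v
    unfolding l sum_product sum.cartesian_product mm[symmetric]
    by (auto intro!: sum.cong)
  moreover have "mpoly A (D + D') (\<lambda>v. \<Sum>x\<in>PiE A (\<lambda>_. {..D}) \<times> PiE A (\<lambda>_. {..D'}).
      (l (fst x) * l' (snd x)) * monom_fun A (\<lambda>a. fst x a + snd x a) v)"
    using assms(1) by (intro mpoly_sum mpoly_monom finite_cartesian_product finite_PiE)
      (auto intro!: add_mono)
  ultimately show ?thesis by presburger
qed

lemma mpoly_mono:
  assumes "finite A" "mpoly A D f" "D \<le> D'"
  shows "mpoly A D' f"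
proof -
  obtain l where l: "f = (\<lambda>v. \<Sum>e\<in>PiE A (\<lambda>_. {..D}). l e * monom_fun A e v)"
    using assms unfolding mpoly_def by blast
  show ?thesis unfolding l using assms
    by (intro mpoly_sum mpoly_monom finite_PiE) (auto intro: order_trans)
qed

lemma mpoly_const: "finite A \<Longrightarrow> mpoly A D (\<lambda>_. c)"
proof -
  assume A: "finite A"
  have "mpoly A D (\<lambda>v. \<Sum>i\<in>{()}. c * monom_fun A (\<lambda>_. 0) v)"
    using A by (intro mpoly_sum mpoly_monom) auto
  then show ?thesis by (simp add: monom_fun_def)
qed

abbreviation coords :: "'a set \<Rightarrow> (('a \<Rightarrow> complex) \<Rightarrow> complex) set" where
  "coords A \<equiv> (\<lambda>a v. v a) ` A"

lemma polyfun_imp_mpoly: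
  assumes "finite A" "f \<in> polyfun (coords A)"
  shows "\<exists>D. mpoly A D f"
  using assms(2)
proof (induction rule: polyfun.induct)
  case (const c)
  then show ?case using mpoly_const[OF assms(1)] by blast
next
  case (coord x)
  then obtain a where a: "a \<in> A" "x = (\<lambda>v. v a)" by blast
  have "monom_fun A (\<lambda>b. if b = a then 1 else 0) v = v a" for v
  proof -
    have "monom_fun A (\<lambda>b. if b = a then 1 else 0) v = (\<Prod>b\<in>A. if b = a then v b else 1)"
      unfolding monom_fun_def by (rule prod.cong) auto
    also have "\<dots> = v a" using a assms(1) by simp
    finally show ?thesis .
  qed
  then have "x = monom_fun A (\<lambda>b. if b = a then 1 else 0)" using a by auto
  moreover have "mpoly A 1 (monom_fun A (\<lambda>b. if b = a then 1 else 0))"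
    using assms(1) by (intro mpoly_monom) auto
  ultimately show ?case by metis
next
  case (add f g)
  then obtain D D' where D: "mpoly A D f" "mpoly A D' g" by blast
  have "mpoly A (max D D') (\<lambda>v. \<Sum>i\<in>{True,False}. 1 * (if i then f else g) v)"
    using D by (intro mpoly_sum) (auto intro: mpoly_mono[OF assms(1)])
  then show ?case by auto
next
  case (mult f g)
  then show ?case using mpoly_mult[OF assms(1)] by blast
qed

lemma polyfun_sum:
  "(\<And>i. i \<in> I \<Longrightarrow> f i \<in> polyfun C) \<Longrightarrow> (\<lambda>v. \<Sum>i\<in>I. f i v) \<in> polyfun C"
  by (induction I rule: infinite_finite_induct) (auto intro: polyfun.intros)

lemma polyfun_prod:
  "(\<And>i. i \<in> I \<Longrightarrow> f i \<in> polyfun C) \<Longrightarrow> (\<lambda>v. \<Prod>i\<in>I. f i v) \<in> polyfun C"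
  by (induction I rule: infinite_finite_induct) (auto intro: polyfun.intros)

lemma polyfun_power: "f \<in> polyfun C \<Longrightarrow> (\<lambda>v. f v ^ n) \<in> polyfun C"
  by (induction n) (auto intro: polyfun.intros)

text \<open>
  A count of monomials: a polynomial map cannot be dominant onto a space of larger dimension.
\<close>
lemma polynomial_image_in_hypersurface:
  fixes \<Gamma> :: "('a \<Rightarrow> complex) \<Rightarrow> 'b \<Rightarrow> complex"
  assumes A: "finite A" and B: "finite B" and AB: "card A < card B"
    and \<Gamma>: "\<And>b. b \<in> B \<Longrightarrow> (\<lambda>u. \<Gamma> u b) \<in> polyfun (coords A)"
  shows "\<exists>\<Phi>\<in>polyfun (coords B). (\<exists>v. \<Phi> v \<noteq> 0) \<and> (\<forall>u. \<Phi> (\<Gamma> u) = 0)"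
proof -
  have "\<forall>b\<in>B. \<exists>D. mpoly A D (\<lambda>u. \<Gamma> u b)" using polyfun_imp_mpoly[OF A] \<Gamma> by blast
  then obtain Db where Db: "\<forall>b\<in>B. mpoly A (Db b) (\<lambda>u. \<Gamma> u b)" by metis
  define \<delta> where "\<delta> = (\<Sum>b\<in>B. Db b)"
  have \<delta>: "mpoly A \<delta> (\<lambda>u. \<Gamma> u b)" if "b \<in> B" for b
  proof (rule mpoly_mono[OF A])
    show "mpoly A (Db b) (\<lambda>u. \<Gamma> u b)" using Db that by blast
    show "Db b \<le> \<delta>" unfolding \<delta>_def using that B by (intro member_le_sum) auto
  qed
  \<comment> \<open>\<open>D\<close> is chosen so that
    \<open>(m * D) ^ card A = D ^ (card A + 1)\<close>. The left side bounds the number of monomials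
    in the source variables, the right side is less than the number \<open>(D + 1) ^ card B\<close>
    in the target variables.\<close>
  define m where "m = \<delta> * card B + 1"
  define D where "D = m ^ card A"
  let ?I = "PiE B (\<lambda>_. {..D})"
  let ?J = "PiE A (\<lambda>_. {..\<delta> * D * card B})"
  have pow: "mpoly A (\<delta> * k) (\<lambda>u. \<Gamma> u b ^ k)" if "b \<in> B" for b k
  proof (induction k)
    case 0
    then show ?case using mpoly_const[OF A] by simp
  next
    case (Suc k)
    then show ?case using mpoly_mult[OF A \<delta>[OF that] Suc] by simp
  qed
  have prods: "mpoly A (\<delta> * D * card B') (\<lambda>u. \<Prod>b\<in>B'. \<Gamma> u b ^ e b)"
    if "finite B'" "B' \<subseteq> B" "\<forall>b\<in>B'. e b \<le> D" for B' e
    using that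
  proof (induction B' rule: finite_induct)
    case empty
    then show ?case using mpoly_const[OF A] by simp
  next
    case (insert b B')
    have "mpoly A (\<delta> * D) (\<lambda>u. \<Gamma> u b ^ e b)"
      using insert.prems by (intro mpoly_mono[OF A pow]) auto
    from mpoly_mult[OF A this insert.IH] insert show ?case by (simp add: algebra_simps)
  qed
  have "\<forall>e\<in>?I. \<exists>l. (\<lambda>u. monom_fun B e (\<Gamma> u)) = (\<lambda>v. \<Sum>e'\<in>?J. l e' * monom_fun A e' v)"
  proof
    fix e assume "e \<in> ?I"
    then have "\<forall>b\<in>B. e b \<le> D" by auto
    then have "mpoly A (\<delta> * D * card B) (\<lambda>u. monom_fun B e (\<Gamma> u))"
      unfolding monom_fun_def by (rule prods[OF B order_refl])
    then show "\<exists>l. (\<lambda>u. monom_fun B e (\<Gamma> u)) = (\<lambda>v. \<Sum>e'\<in>?J. l e' * monom_fun A e' v)"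
      by (simp add: mpoly_def)
  qed
  from bchoice[OF this] obtain c where c: "\<forall>e\<in>?I. (\<lambda>u. monom_fun B e (\<Gamma> u)) = (\<lambda>v. \<Sum>e'\<in>?J. c e e' * monom_fun A e' v)"
    by blast
  have "card ?J = (\<delta> * D * card B + 1) ^ card A" using A by (simp add: card_PiE)
  also have "\<dots> \<le> (m * D) ^ card A"
  proof (rule power_mono)
    have "D \<ge> 1" by (simp add: D_def m_def)
    then show "\<delta> * D * card B + 1 \<le> m * D" by (simp add: m_def algebra_simps)
  qed simp
  also have "\<dots> = D * D ^ card A" by (simp add: power_mult_distrib D_def)
  also have "\<dots> = D ^ (card A + 1)" by simp
  also have "\<dots> < (D + 1) ^ (card A + 1)" by (intro power_strict_mono) auto
  also have "\<dots> \<le> (D + 1) ^ card B" using AB by (intro power_increasing) auto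
  also have "\<dots> = card ?I" using B by (simp add: card_PiE)
  finally have "card ?J < card ?I" .
  from homogeneous_system_nontrivial[OF _ _ this, of c] A B obtain l where
    l: "\<exists>e\<in>?I. l e \<noteq> 0" "\<forall>e'\<in>?J. (\<Sum>e\<in>?I. l e * c e e') = 0" by (auto simp: finite_PiE)
  define \<Phi> where "\<Phi> = (\<lambda>v. \<Sum>e\<in>?I. l e * monom_fun B e v)"
  have "\<Phi> \<in> polyfun (coords B)" unfolding \<Phi>_def monom_fun_def
    by (intro polyfun_sum polyfun.mult polyfun.const polyfun_prod polyfun_power polyfun.coord) auto
  moreover have "\<exists>v. \<Phi> v \<noteq> 0"
    using monom_fun_independent[OF B, of _ D l] l(1) unfolding \<Phi>_def by blast
  moreover have "\<Phi> (\<Gamma> u) = 0" for u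
  proof -
    have "\<Phi> (\<Gamma> u) = (\<Sum>e\<in>?I. l e * (\<Sum>e'\<in>?J. c e e' * monom_fun A e' u))"
      unfolding \<Phi>_def using c by (intro sum.cong) (auto dest: fun_cong)
    also have "\<dots> = (\<Sum>e'\<in>?J. (\<Sum>e\<in>?I. l e * c e e') * monom_fun A e' u)"
      by (simp add: sum_distrib_left sum_distrib_right mult.assoc) (rule sum.swap)
    also have "\<dots> = 0" using l(2) by simp
    finally show ?thesis .
  qed
  ultimately show ?thesis by blast
qed

lemma polyfun_along_line:
  assumes "f \<in> polyfun C" and "\<And>c. c \<in> C \<Longrightarrow> \<exists>p. \<forall>\<tau>. c (\<gamma> \<tau>) = poly p \<tau>"
  shows "\<exists>p. \<forall>\<tau>. f (\<gamma> \<tau>) = poly p \<tau>"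
  using assms(1)
proof (induction rule: polyfun.induct)
  case (const c)
  then show ?case by (intro exI[of _ "[:c:]"]) simp
next
  case (coord x)
  then show ?case using assms(2) by blast
next
  case (add f g)
  then show ?case by (metis poly_add)
next
  case (mult f g)
  then show ?case by (metis poly_mult)
qed

text \<open>On the line joining \<open>v\<close> and \<open>w\<close> both functions become nonzero
  polynomials in one variable.\<close>

lemma polyfun_coords_prod_nonzero:
  assumes "f \<in> polyfun (coords A)" "g \<in> polyfun (coords A)" "f v \<noteq> 0" "g w \<noteq> 0"
  shows "\<exists>u. f u * g u \<noteq> 0"
proof -
  define \<gamma> where "\<gamma> = (\<lambda>\<tau> a. v a + \<tau> * (w a - v a))"
  have line: "\<exists>p. \<forall>\<tau>. c (\<gamma> \<tau>) = poly p \<tau>" if "c \<in> coords A" for c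
  proof -
    from that obtain a where "c = (\<lambda>v. v a)" by blast
    then show ?thesis by (intro exI[of _ "[:v a, w a - v a:]"]) (simp add: \<gamma>_def)
  qed
  obtain p where p: "\<forall>\<tau>. f (\<gamma> \<tau>) = poly p \<tau>"
    using polyfun_along_line[OF assms(1), of \<gamma>] line by blast
  obtain q where q: "\<forall>\<tau>. g (\<gamma> \<tau>) = poly q \<tau>"
    using polyfun_along_line[OF assms(2), of \<gamma>] line by blast
  note pq = p[rule_format] q[rule_format]
  have "\<gamma> 0 = v" "\<gamma> 1 = w" by (auto simp: \<gamma>_def)
  then have "poly p 0 \<noteq> 0" "poly q 1 \<noteq> 0" using assms(3,4) pq[symmetric] by simp_all
  then have "p \<noteq> 0" "q \<noteq> 0" by auto
  then have "p * q \<noteq> 0" by simp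
  then obtain \<tau> where "poly (p * q) \<tau> \<noteq> 0" using poly_all_0_iff_0 by blast
  then show ?thesis using pq by (intro exI[of _ "\<gamma> \<tau>"]) simp
qed

lemma polyfun_diff: "f \<in> polyfun C \<Longrightarrow> g \<in> polyfun C \<Longrightarrow> (\<lambda>v. f v - g v) \<in> polyfun C"
  using polyfun.add[OF _ polyfun.mult[OF polyfun.const[of "-1"]], of f C g] by simp

lemma polyfun_uminus: "f \<in> polyfun C \<Longrightarrow> (\<lambda>v. - f v) \<in> polyfun C"
  using polyfun.mult[OF polyfun.const[of "-1"], of f C] by simp

lemma polyfun_subst:
  assumes "f \<in> polyfun C" "\<And>c. c \<in> C \<Longrightarrow> (\<lambda>u. c (g u)) \<in> polyfun D"
  shows "(\<lambda>u. f (g u)) \<in> polyfun D"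
  using assms(1) by (induction rule: polyfun.induct) (auto intro: polyfun.intros assms(2))

lemma polyfun_coords_cong:
  assumes "f \<in> polyfun (coords A)" "\<And>a. a \<in> A \<Longrightarrow> v a = w a"
  shows "f v = f w"
  using assms(1) by (induction rule: polyfun.induct) (auto simp: assms(2))

section \<open>Polynomials whose coefficients vary polynomially\<close>

definition polyfam :: "('v \<Rightarrow> complex) set \<Rightarrow> ('v \<Rightarrow> complex poly) \<Rightarrow> bool" where
  "polyfam C p \<longleftrightarrow> (\<forall>i. (\<lambda>v. coeff (p v) i) \<in> polyfun C)"

lemma polyfam_const: "polyfam C (\<lambda>_. p)"
  by (simp add: polyfam_def polyfun.const)

lemma polyfam_pCons: "f \<in> polyfun C \<Longrightarrow> polyfam C p \<Longrightarrow> polyfam C (\<lambda>v. pCons (f v) (p v))"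
  unfolding polyfam_def
proof
  fix i assume a: "f \<in> polyfun C" "\<forall>i. (\<lambda>v. coeff (p v) i) \<in> polyfun C"
  then show "(\<lambda>v. coeff (pCons (f v) (p v)) i) \<in> polyfun C" by (cases i) auto
qed

lemma polyfam_add: "polyfam C p \<Longrightarrow> polyfam C q \<Longrightarrow> polyfam C (\<lambda>v. p v + q v)"
  by (simp add: polyfam_def polyfun.add)

lemma polyfam_diff: "polyfam C p \<Longrightarrow> polyfam C q \<Longrightarrow> polyfam C (\<lambda>v. p v - q v)"
  by (simp add: polyfam_def polyfun_diff)

lemma polyfam_mult: "polyfam C p \<Longrightarrow> polyfam C q \<Longrightarrow> polyfam C (\<lambda>v. p v * q v)"
  unfolding polyfam_def coeff_mult by (intro allI polyfun_sum polyfun.mult) auto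

lemma polyfam_smult: "f \<in> polyfun C \<Longrightarrow> polyfam C q \<Longrightarrow> polyfam C (\<lambda>v. smult (f v) (q v))"
  unfolding polyfam_def coeff_smult by (intro allI polyfun.mult) auto

lemma polyfam_monom: "f \<in> polyfun C \<Longrightarrow> polyfam C (\<lambda>v. monom (f v) n)"
  unfolding polyfam_def
proof
  fix i assume "f \<in> polyfun C"
  then show "(\<lambda>v. coeff (monom (f v) n) i) \<in> polyfun C"
    by (cases "n = i") (auto intro: polyfun.const)
qed

lemma polyfam_sum: "(\<And>i. i \<in> I \<Longrightarrow> polyfam C (p i)) \<Longrightarrow> polyfam C (\<lambda>v. \<Sum>i\<in>I. p i v)"
  unfolding polyfam_def coeff_sum by (intro allI polyfun_sum) auto

lemma polyfam_power: "polyfam C p \<Longrightarrow> polyfam C (\<lambda>v. p v ^ n)"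
  by (induction n) (auto intro: polyfam_const polyfam_mult)

lemma polyfam_prod: "(\<And>i. i \<in> I \<Longrightarrow> polyfam C (p i)) \<Longrightarrow> polyfam C (\<lambda>v. \<Prod>i\<in>I. p i v)"
  by (induction I rule: infinite_finite_induct) (auto intro: polyfam_const polyfam_mult)

lemma polyfam_subst:
  assumes "polyfam C f" "\<And>c. c \<in> C \<Longrightarrow> (\<lambda>u. c (g u)) \<in> polyfun D"
  shows "polyfam D (\<lambda>u. f (g u))"
  using assms unfolding polyfam_def by (auto intro: polyfun_subst)

lemmas polyfam_intros = polyfam_const polyfam_pCons polyfam_add polyfam_diff polyfam_mult
  polyfam_smult polyfam_monom polyfam_sum polyfam_power polyfam_prod polyfun.const
  polyfun.add polyfun.mult polyfun_diff polyfun_uminus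

section \<open>Families of binary forms\<close>

text \<open>
  A pair of polynomials \<open>F(x, y)\<close> (index \<open>False\<close>) and \<open>G(x, y)\<close> (index \<open>True\<close>) of total degree at
  most \<open>d\<close>; \<open>v (s, i, j)\<close> is the coefficient of \<open>x\<^sup>i y\<^sup>j\<close>.
\<close>
type_synonym vec = "bool \<times> nat \<times> nat \<Rightarrow> complex"

definition triangle :: "nat \<Rightarrow> (bool \<times> nat \<times> nat) set" where
  "triangle d = {(s, i, j). i + j \<le> d}"

definition col :: "nat \<Rightarrow> vec \<Rightarrow> bool \<Rightarrow> nat \<Rightarrow> complex poly" where
  "col d v s i = (if i \<le> d then \<Sum>j\<le>d - i. monom (v (s, i, j)) j else 0)"

definition slice :: "nat \<Rightarrow> vec \<Rightarrow> bool \<Rightarrow> complex \<Rightarrow> complex poly" where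
  "slice d v s y = (\<Sum>i\<le>d. monom (poly (col d v s i) y) i)"

definition slice_deriv :: "nat \<Rightarrow> vec \<Rightarrow> bool \<Rightarrow> complex \<Rightarrow> complex poly" where
  "slice_deriv d v s y = (\<Sum>i\<le>d. monom (poly (pderiv (col d v s i)) y) i)"

text \<open>The part of top degree \<open>d\<close>, evaluated at \<open>y = 1\<close>. It is the
  restriction of the pencil to the line \<open>y = infinity\<close> once \<open>x\<close> is
  rescaled by \<open>y\<close>, see \<open>slice_flip_0\<close>.\<close>

definition slice_inf :: "nat \<Rightarrow> vec \<Rightarrow> bool \<Rightarrow> complex poly" where
  "slice_inf d v s = (\<Sum>i\<le>d. monom (v (s, i, d - i)) i)"

lemma coeff_slice: "coeff (slice d v s y) i = (if i \<le> d then poly (col d v s i) y else 0)"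
  by (simp add: slice_def coeff_sum)

lemma coeff_slice_deriv:
  "coeff (slice_deriv d v s y) i = (if i \<le> d then poly (pderiv (col d v s i)) y else 0)"
  by (simp add: slice_deriv_def coeff_sum)

lemma coeff_slice_inf: "coeff (slice_inf d v s) i = (if i \<le> d then v (s, i, d - i) else 0)"
  by (simp add: slice_inf_def coeff_sum)

lemma coeff_col: "coeff (col d v s i) j = (if i + j \<le> d then v (s, i, j) else 0)"
  by (auto simp: col_def coeff_sum)

lemma finite_triangle: "finite (triangle d)"
proof (rule finite_subset)
  show "triangle d \<subseteq> UNIV \<times> {..d} \<times> {..d}" by (auto simp: triangle_def)
qed auto

lemma pcompose_power: "pcompose (p ^ n) q = pcompose p q ^ n"
  for p :: "'a :: comm_semiring_1 poly"
  by (induction n) (auto simp: pcompose_mult pcompose_1)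

lemma poly_recentre:
  fixes p :: "complex poly"
  assumes "degree p \<le> n"
  shows "p = (\<Sum>m\<le>n. smult (coeff (pcompose p [:y, 1:]) m) ([:- y, 1:] ^ m))"
proof -
  have "degree (pcompose p [:y, 1:]) \<le> n" using assms by (simp add: degree_pcompose)
  then have e: "pcompose p [:y, 1:] = (\<Sum>m\<le>n. monom (coeff (pcompose p [:y, 1:]) m) m)"
    by (rule poly_as_sum_of_monoms'[symmetric])
  have "p = pcompose (pcompose p [:y, 1:]) [:- y, 1:]"
    by (simp add: pcompose_assoc[symmetric] pcompose_pCons)
  also have "\<dots> = (\<Sum>m\<le>n. smult (coeff (pcompose p [:y, 1:]) m) ([:- y, 1:] ^ m))"
    by (subst e) (simp add: pcompose_sum monom_altdef pcompose_smult pcompose_power pcompose_pCons)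
  finally show ?thesis .
qed

lemma poly_recentre_1: "coeff (pcompose p [:y, 1:]) 1 = poly (pderiv p) y"
  for p :: "complex poly"
proof -
  have "coeff (pcompose p [:y, 1:]) 1 = coeff (pderiv (pcompose p [:y, 1:])) 0"
    by (simp add: coeff_pderiv del: poly_0_coeff_0)
  also have "\<dots> = poly (pderiv p) y"
    by (simp add: pderiv_pcompose poly_0_coeff_0[symmetric] poly_pcompose pderiv_pCons)
  finally show ?thesis .
qed

text \<open>
  Recentring at \<open>y\<close> turns the 1-jet of the family at \<open>y\<close> into coordinates; a locus of 1-jets of
  codimension two is met by a general family for no value of \<open>y\<close>.
\<close>
lemma jets_avoided:
  fixes K :: "'a set" and \<phi> \<psi> :: "bool \<Rightarrow> ('a \<Rightarrow> complex) \<Rightarrow> complex poly"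
  assumes K: "finite K" "card K \<le> 4 * d" and d: "d \<ge> 1"
    and \<phi>: "\<And>s. polyfam (coords K) (\<phi> s)" and \<psi>: "\<And>s. polyfam (coords K) (\<psi> s)"
  shows "\<exists>\<Phi>\<in>polyfun (coords (triangle d)). (\<exists>v. \<Phi> v \<noteq> 0) \<and>
    (\<forall>v y u. (\<forall>s. slice d v s y = \<phi> s u \<and> slice_deriv d v s y = \<psi> s u) \<longrightarrow> \<Phi> v = 0)"
proof -
  define rest where "rest = {(s, i, j). (s, i, j) \<in> triangle d \<and> j \<ge> 2}"
  \<comment> \<open>Parameters: the centre \<open>y\<close>, the parameters \<open>K\<close> of the
    1-jet, and the Taylor coefficients of order at least 2. The 1-jet has \<open>4 * d + 2\<close>
    coordinates, so \<open>card K \<le> 4 * d\<close> leaves \<open>A\<close> smaller than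
    \<open>triangle d\<close> even with \<open>y\<close> added.\<close>
  define A :: "(unit + 'a + bool \<times> nat \<times> nat) set" where
    "A = insert (Inl ()) (Inr ` (Inl ` K \<union> Inr ` rest))"
  define \<Gamma> :: "(unit + 'a + bool \<times> nat \<times> nat \<Rightarrow> complex) \<Rightarrow> bool \<times> nat \<times> nat \<Rightarrow> complex" where
    "\<Gamma> = (\<lambda>w (s, i, j). coeff (\<Sum>m\<le>d - i. smult
        (if m = 0 then coeff (\<phi> s (\<lambda>a. w (Inr (Inl a)))) i
         else if m = 1 then coeff (\<psi> s (\<lambda>a. w (Inr (Inl a)))) i
         else w (Inr (Inr (s, i, m)))) ([:- w (Inl ()), 1:] ^ m)) j)"
  have fin_rest: "finite rest" by (rule finite_subset[OF _ finite_triangle[of d]]) (auto simp: rest_def)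
  have finA: "finite A" unfolding A_def using K fin_rest by simp
  have "card A = Suc (card K + card rest)"
  proof -
    have "card (Inl ` K \<union> Inr ` rest) = card K + card rest"
      using K fin_rest by (subst card_Un_disjoint) (auto simp: card_image)
    then have "card (Inr ` (Inl ` K \<union> Inr ` rest) :: (unit + 'a + bool \<times> nat \<times> nat) set)
        = card K + card rest"
      by (subst card_image) auto
    moreover have "Inl () \<notin> (Inr ` (Inl ` K \<union> Inr ` rest) :: (unit + 'a + bool \<times> nat \<times> nat) set)"
      by auto
    ultimately show ?thesis unfolding A_def using K fin_rest
      by (subst card_insert_disjoint) auto
  qed
  moreover have "card (triangle d) = card rest + (4 * d + 2)"
  proof -
    let ?X = "(UNIV :: bool set) \<times> ({..d} \<times> {0::nat} \<union> {..<d} \<times> {1})"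
    have "triangle d = rest \<union> ?X" using d by (auto simp: triangle_def rest_def)
    moreover have "rest \<inter> ?X = {}" by (auto simp: rest_def)
    moreover have "card ?X = 4 * d + 2"
    proof -
      have "card ({..d} \<times> {0::nat} \<union> {..<d} \<times> {1}) = (d + 1) + d"
        by (subst card_Un_disjoint) (auto simp: card_cartesian_product)
      from card_cartesian_product[of "UNIV :: bool set" "{..d} \<times> {0::nat} \<union> {..<d} \<times> {1}"] this
      show ?thesis unfolding card_UNIV_bool by linarith
    qed
    ultimately show ?thesis using fin_rest by (metis card_Un_disjoint finite_triangle finite_Un)
  qed
  ultimately have card: "card A < card (triangle d)" using K by simp
  have sub: "polyfam (coords A) (\<lambda>w. p (\<lambda>a. w (Inr (Inl a))))" if "polyfam (coords K) p" for p
    using that by (rule polyfam_subst) (auto simp: A_def intro!: polyfun.coord)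
  have "(\<lambda>w. \<Gamma> w (s, i, j)) \<in> polyfun (coords A)" if b: "(s, i, j) \<in> triangle d" for s i j
  proof -
    have "polyfam (coords A) (\<lambda>w. \<Sum>m\<le>d - i. smult
        (if m = 0 then coeff (\<phi> s (\<lambda>a. w (Inr (Inl a)))) i
         else if m = 1 then coeff (\<psi> s (\<lambda>a. w (Inr (Inl a)))) i
         else w (Inr (Inr (s, i, m)))) ([:- w (Inl ()), 1:] ^ m))"
    proof (intro polyfam_sum polyfam_smult polyfam_power polyfam_pCons polyfun_uminus polyfun.const polyfam_const)
      show "(\<lambda>w. w (Inl ())) \<in> polyfun (coords A)" by (rule polyfun.coord) (auto simp: A_def)
    next
      fix m assume m: "m \<in> {..d - i}"
      have i: "i \<le> d" using b by (simp add: triangle_def)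
      consider "m = 0" | "m = 1" | "m \<ge> 2" by linarith
      then show "(\<lambda>w. if m = 0 then coeff (\<phi> s (\<lambda>a. w (Inr (Inl a)))) i
         else if m = 1 then coeff (\<psi> s (\<lambda>a. w (Inr (Inl a)))) i
         else w (Inr (Inr (s, i, m)))) \<in> polyfun (coords A)"
      proof cases
        case 1
        then show ?thesis using sub[OF \<phi>[of s]] by (simp add: polyfam_def)
      next
        case 2
        then show ?thesis using sub[OF \<psi>[of s]] by (simp add: polyfam_def)
      next
        case 3
        then have "(\<lambda>w. w (Inr (Inr (s, i, m)))) \<in> polyfun (coords A)"
          using m i by (intro polyfun.coord) (auto simp: A_def rest_def triangle_def)
        then show ?thesis using 3 by simp
      qed
    qed
    then show ?thesis by (simp add: polyfam_def \<Gamma>_def)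
  qed
  then have poly\<Gamma>: "\<And>b. b \<in> triangle d \<Longrightarrow> (\<lambda>w. \<Gamma> w b) \<in> polyfun (coords A)" by auto
  from polynomial_image_in_hypersurface[of A "triangle d" \<Gamma>, OF finA finite_triangle card poly\<Gamma>] obtain \<Phi> where
    \<Phi>: "\<Phi> \<in> polyfun (coords (triangle d))" "\<exists>v. \<Phi> v \<noteq> 0" "\<forall>u. \<Phi> (\<Gamma> u) = 0" by blast
  have "\<Phi> v = 0" if h: "\<forall>s. slice d v s y = \<phi> s u \<and> slice_deriv d v s y = \<psi> s u" for v y u
  proof -
    define w :: "unit + 'a + bool \<times> nat \<times> nat \<Rightarrow> complex" where
      "w = case_sum (\<lambda>_. y) (case_sum u (\<lambda>(s, i, m). coeff (pcompose (col d v s i) [:y, 1:]) m))"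
    have "v b = \<Gamma> w b" if "b \<in> triangle d" for b
    proof -
      obtain s i j where b: "b = (s, i, j)" by (cases b)
      with that have ij: "i + j \<le> d" by (simp add: triangle_def)
      have deg: "degree (col d v s i) \<le> d - i"
        using ij by (intro degree_le) (auto simp: coeff_col)
      have c0: "coeff (\<phi> s u) i = poly (col d v s i) y" 
        using h coeff_slice[of d v s y i] ij by simp
      have c1: "coeff (\<psi> s u) i = poly (pderiv (col d v s i)) y"
        using h coeff_slice_deriv[of d v s y i] ij by simp
      have "\<Gamma> w b = coeff (\<Sum>m\<le>d - i. smult (coeff (pcompose (col d v s i) [:y, 1:]) m) ([:- y, 1:] ^ m)) j"
        unfolding \<Gamma>_def b prod.case
        by (rule arg_cong[of _ _ "\<lambda>p. coeff p j"], rule sum.cong)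
          (auto simp: w_def c0 c1 poly_recentre_1[unfolded One_nat_def])
      also have "\<dots> = coeff (col d v s i) j" using poly_recentre[OF deg, of y] by simp
      finally show ?thesis using ij by (simp add: coeff_col b)
    qed
    then have "\<Phi> v = \<Phi> (\<Gamma> w)" by (rule polyfun_coords_cong[OF \<Phi>(1)])
    then show ?thesis using \<Phi>(3) by simp
  qed
  then show ?thesis using \<Phi> by blast
qed

text \<open>The index type is fixed as \<open>nat \<times> nat\<close> because an existential
  quantifier cannot range over types; the first component separates groups of parameters.\<close>

definition pairs_param :: "nat \<Rightarrow> (complex poly \<times> complex poly) set \<Rightarrow> bool" where
  "pairs_param k S \<longleftrightarrow> (\<exists>(K :: (nat \<times> nat) set) \<phi> \<gamma>. finite K \<and> card K \<le> k \<and>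
     polyfam (coords K) \<phi> \<and> polyfam (coords K) \<gamma> \<and> (\<forall>(f, g)\<in>S. \<exists>u. f = \<phi> u \<and> g = \<gamma> u))"

text \<open>Only the values are constrained. The derivative stays free and contributes
  \<open>2 * d\<close> parameters, as the coefficient of \<open>x^d\<close> is constant in
  \<open>y\<close>. A pair has \<open>2 * d + 2\<close> coefficients, so codimension two is
  demanded, one more than the parameter \<open>y\<close> can use up.\<close>

lemma pairs_avoided:
  assumes "pairs_param k S" "k \<le> 2 * d" "d \<ge> 1"
  shows "\<exists>\<Phi>\<in>polyfun (coords (triangle d)). (\<exists>v. \<Phi> v \<noteq> 0) \<and>
    (\<forall>v y. (slice d v False y, slice d v True y) \<in> S \<longrightarrow> \<Phi> v = 0)"
proof -
  obtain K :: "(nat \<times> nat) set" and \<phi> \<gamma> where K: "finite K" "card K \<le> k"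
    "polyfam (coords K) \<phi>" "polyfam (coords K) \<gamma>" "\<forall>(f, g)\<in>S. \<exists>u. f = \<phi> u \<and> g = \<gamma> u"
    using assms(1) unfolding pairs_param_def by blast
  define A :: "(nat \<times> nat + bool \<times> nat) set" where "A = Inl ` K \<union> Inr ` (UNIV \<times> {..<d})"
  have "finite A" unfolding A_def using K by simp
  moreover have "card A \<le> 4 * d"
  proof -
    have "card A = card K + 2 * d" unfolding A_def using K
      by (subst card_Un_disjoint) (auto simp: card_image card_cartesian_product)
    then show ?thesis using K assms by simp
  qed
  moreover have "polyfam (coords A) (\<lambda>w. if s then \<gamma> (\<lambda>a. w (Inl a)) else \<phi> (\<lambda>a. w (Inl a)))" for s
  proof -
    have sub: "polyfam (coords A) (\<lambda>w. p (\<lambda>a. w (Inl a)))" if "polyfam (coords K) p" for p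
      using that by (rule polyfam_subst) (auto simp: A_def intro!: polyfun.coord)
    show ?thesis using sub K by (cases s) auto
  qed
  moreover have "polyfam (coords A) (\<lambda>w. \<Sum>i<d. monom (w (Inr (s, i))) i)" for s
    by (intro polyfam_sum polyfam_monom polyfun.coord) (auto simp: A_def)
  ultimately obtain \<Phi> where \<Phi>: "\<Phi>\<in>polyfun (coords (triangle d))" "\<exists>v. \<Phi> v \<noteq> 0"
    "\<And>v y u. (\<forall>s. slice d v s y = (if s then \<gamma> (\<lambda>a. u (Inl a)) else \<phi> (\<lambda>a. u (Inl a))) \<and>
      slice_deriv d v s y = (\<Sum>i<d. monom (u (Inr (s, i))) i)) \<Longrightarrow> \<Phi> v = 0"
    using jets_avoided[of A d "\<lambda>s w. if s then \<gamma> (\<lambda>a. w (Inl a)) else \<phi> (\<lambda>a. w (Inl a))"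
      "\<lambda>s w. \<Sum>i<d. monom (w (Inr (s, i))) i"] assms(3) by blast
  have "\<Phi> v = 0" if S: "(slice d v False y, slice d v True y) \<in> S" for v y
  proof -
    obtain u where u: "slice d v False y = \<phi> u" "slice d v True y = \<gamma> u" using K S by blast
    define w :: "nat \<times> nat + bool \<times> nat \<Rightarrow> complex" where
      "w = case_sum u (\<lambda>(s, i). coeff (slice_deriv d v s y) i)"
    have "slice_deriv d v s y = (\<Sum>i<d. monom (w (Inr (s, i))) i)" for s
    proof (rule poly_eqI)
      fix i
      have "poly (pderiv (col d v s d)) y = 0"
      proof -
        have "degree (col d v s d) \<le> 0" by (rule degree_le) (auto simp: coeff_col)
        then have "pderiv (col d v s d) = 0" by (simp add: pderiv_eq_0_iff)
        then show ?thesis by simp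
      qed
      then show "coeff (slice_deriv d v s y) i = coeff (\<Sum>i<d. monom (w (Inr (s, i))) i) i"
        by (auto simp: coeff_sum w_def coeff_slice_deriv le_less)
    qed
    then show ?thesis using u by (intro \<Phi>(3)[of v y w]) (auto simp: w_def)
  qed
  then show ?thesis using \<Phi> by blast
qed

text \<open>On one fixed line no parameter \<open>y\<close> is spent, so codimension one is
  enough.\<close>

lemma pairs_avoided_inf:
  assumes "pairs_param k S" "k \<le> 2 * d + 1"
  shows "\<exists>\<Phi>\<in>polyfun (coords (triangle d)). (\<exists>v. \<Phi> v \<noteq> 0) \<and>
    (\<forall>v. (slice_inf d v False, slice_inf d v True) \<in> S \<longrightarrow> \<Phi> v = 0)"
proof -
  obtain K :: "(nat \<times> nat) set" and \<phi> \<gamma> where K: "finite K" "card K \<le> k"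
    "polyfam (coords K) \<phi>" "polyfam (coords K) \<gamma>" "\<forall>(f, g)\<in>S. \<exists>u. f = \<phi> u \<and> g = \<gamma> u"
    using assms(1) unfolding pairs_param_def by blast
  define rest where "rest = {(s, i, j). (s, i, j) \<in> triangle d \<and> i + j < d}"
  have fin_rest: "finite rest" by (rule finite_subset[OF _ finite_triangle[of d]]) (auto simp: rest_def)
  define A :: "(nat \<times> nat + bool \<times> nat \<times> nat) set" where "A = Inl ` K \<union> Inr ` rest"
  have finA: "finite A" unfolding A_def using K fin_rest by simp
  have "card A = card K + card rest" unfolding A_def using K fin_rest
    by (subst card_Un_disjoint) (auto simp: card_image)
  moreover have "card (triangle d) = card rest + (2 * d + 2)"
  proof -
    let ?X = "(\<lambda>(s, i). (s, i, d - i)) ` ((UNIV :: bool set) \<times> {..d})"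
    have "triangle d = rest \<union> ?X" by (force simp: triangle_def rest_def)
    moreover have "rest \<inter> ?X = {}" by (auto simp: rest_def)
    moreover have "card ?X = 2 * d + 2"
      by (subst card_image) (auto simp: inj_on_def card_cartesian_product)
    moreover have "finite ?X" by simp
    ultimately show ?thesis using fin_rest by (simp add: card_Un_disjoint)
  qed
  ultimately have card: "card A < card (triangle d)" using K assms by simp
  define \<Gamma> :: "(nat \<times> nat + bool \<times> nat \<times> nat \<Rightarrow> complex) \<Rightarrow> bool \<times> nat \<times> nat \<Rightarrow> complex" where
    "\<Gamma> = (\<lambda>w (s, i, j). if i + j < d then w (Inr (s, i, j)) else
       coeff (if s then \<gamma> (\<lambda>a. w (Inl a)) else \<phi> (\<lambda>a. w (Inl a))) i)"
  have sub: "polyfam (coords A) (\<lambda>w. p (\<lambda>a. w (Inl a)))" if "polyfam (coords K) p" for p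
    using that by (rule polyfam_subst) (auto simp: A_def intro!: polyfun.coord)
  have poly\<Gamma>: "(\<lambda>w. \<Gamma> w b) \<in> polyfun (coords A)" if "b \<in> triangle d" for b
  proof -
    obtain s i j where b: "b = (s, i, j)" by (cases b)
    show ?thesis
    proof (cases "i + j < d")
      case True
      then have "(\<lambda>w. w (Inr (s, i, j))) \<in> polyfun (coords A)"
        by (intro polyfun.coord) (auto simp: A_def rest_def triangle_def)
      then show ?thesis using True by (simp add: \<Gamma>_def b)
    next
      case False
      then show ?thesis using sub[OF K(3)] sub[OF K(4)]
        by (cases s) (simp_all add: \<Gamma>_def b polyfam_def)
    qed
  qed
  from polynomial_image_in_hypersurface[of A "triangle d" \<Gamma>, OF finA finite_triangle card poly\<Gamma>] obtain \<Phi> where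
    \<Phi>: "\<Phi> \<in> polyfun (coords (triangle d))" "\<exists>v. \<Phi> v \<noteq> 0" "\<forall>u. \<Phi> (\<Gamma> u) = 0" by blast
  have "\<Phi> v = 0" if S: "(slice_inf d v False, slice_inf d v True) \<in> S" for v
  proof -
    obtain u where u: "slice_inf d v False = \<phi> u" "slice_inf d v True = \<gamma> u" using K S by blast
    have "v b = \<Gamma> (case_sum u v) b" if "b \<in> triangle d" for b
    proof -
      obtain s i j where b: "b = (s, i, j)" by (cases b)
      have "coeff (slice_inf d v s) i = v b" if "\<not> i + j < d"
      proof -
        have "j = d - i" "i \<le> d" using that \<open>b \<in> triangle d\<close> by (auto simp: b triangle_def)
        then show ?thesis by (simp add: coeff_slice_inf b)
      qed
      then show ?thesis using u by (cases s) (auto simp: \<Gamma>_def b)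
    qed
    then have "\<Phi> v = \<Phi> (\<Gamma> (case_sum u v))" by (rule polyfun_coords_cong[OF \<Phi>(1)])
    then show ?thesis using \<Phi>(3) by simp
  qed
  then show ?thesis using \<Phi> by blast
qed

section \<open>Codimension counts for pencils with prescribed contact\<close>

definition thin :: "nat \<Rightarrow> (vec \<Rightarrow> bool) \<Rightarrow> bool" where
  "thin d P \<longleftrightarrow> (\<exists>\<Phi>\<in>polyfun (coords (triangle d)). (\<exists>v. \<Phi> v \<noteq> 0) \<and> (\<forall>v. P v \<longrightarrow> \<Phi> v = 0))"

lemma thin_disj: "thin d P \<Longrightarrow> thin d Q \<Longrightarrow> thin d (\<lambda>v. P v \<or> Q v)"
proof -
  assume "thin d P" "thin d Q"
  then obtain \<Phi> \<Psi> v w where *: "\<Phi> \<in> polyfun (coords (triangle d))" "\<Psi> \<in> polyfun (coords (triangle d))"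
    "\<Phi> v \<noteq> 0" "\<Psi> w \<noteq> 0" "\<forall>v. P v \<longrightarrow> \<Phi> v = 0" "\<forall>v. Q v \<longrightarrow> \<Psi> v = 0"
    unfolding thin_def by blast
  show ?thesis unfolding thin_def
  proof (intro bexI[of _ "\<lambda>u. \<Phi> u * \<Psi> u"] conjI allI impI)
    show "\<exists>u. \<Phi> u * \<Psi> u \<noteq> 0" 
      using polyfun_coords_prod_nonzero[of \<Phi> "triangle d" \<Psi> v w] *(1-4) by simp
    show "(\<lambda>u. \<Phi> u * \<Psi> u) \<in> polyfun (coords (triangle d))" 
      using polyfun.mult[OF *(1,2)] .
    show "\<Phi> u * \<Psi> u = 0" if "P u \<or> Q u" for u using that *(5,6) by auto
  qed
qed

lemma thin_mono: "thin d P \<Longrightarrow> (\<And>v. Q v \<Longrightarrow> P v) \<Longrightarrow> thin d Q"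
  unfolding thin_def by (elim bexE conjE) (intro bexI conjI allI impI, assumption, simp_all)

text \<open>The bound "degree below \<open>n\<close>" in a form that admits \<open>n = 0\<close>,
  where it forces \<open>r = 0\<close>.\<close>

definition small :: "complex poly \<Rightarrow> nat \<Rightarrow> bool" where
  "small r n \<longleftrightarrow> (\<forall>i\<ge>n. coeff r i = 0)"

lemma small_eq_sum: "small r n \<Longrightarrow> r = (\<Sum>i<n. monom (coeff r i) i)"
  by (rule poly_eqI) (auto simp: small_def coeff_sum)

text \<open>Two lists \<open>a\<close> and \<open>b\<close> will refer to the same points
  \<open>x\<close>; an exponent 0 lets a point occur for one polynomial and impose nothing on the
  other.\<close>

definition contact :: "nat list \<Rightarrow> (nat \<Rightarrow> complex) \<Rightarrow> complex poly" where
  "contact a x = (\<Prod>i<length a. [:- x i, 1:] ^ (a ! i))"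

lemma contact_Nil: "contact [] x = 1"
  by (simp add: contact_def)

lemma contact_Cons: "contact (e # a) x = [:- x 0, 1:] ^ e * contact a (\<lambda>i. x (Suc i))"
  unfolding contact_def by (simp add: prod.lessThan_Suc_shift del: prod.lessThan_Suc)

lemma degree_contact: "degree (contact a x) = sum_list a"
proof -
  have "degree (contact a x) = (\<Sum>i<length a. degree ([:- x i, 1:] ^ (a ! i)))"
    unfolding contact_def by (rule degree_prod_eq_sum_degree) auto
  also have "\<dots> = (\<Sum>i<length a. a ! i)" by (simp add: degree_power_eq)
  also have "\<dots> = sum_list a" by (simp add: sum_list_sum_nth atLeast0LessThan)
  finally show ?thesis .
qed

text \<open>\<open>e\<close> is a drop of the degree below \<open>d\<close>, that is contact at the
  point at infinity. The last conjunct makes the truncated difference, the number of free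
  coefficients of the quotient, exact.\<close>

lemma contact_dvd:
  assumes "contact a x dvd h" "h \<noteq> 0" "degree h + e \<le> d"
  shows "\<exists>r. h = contact a x * r \<and> small r (d + 1 - sum_list a - e) \<and> sum_list a + e \<le> d"
proof -
  obtain r where r: "h = contact a x * r" using assms by (auto elim: dvdE)
  have "contact a x \<noteq> 0" "r \<noteq> 0" using r assms by auto
  then have "degree h = sum_list a + degree r" unfolding r by (simp add: degree_mult_eq degree_contact)
  then show ?thesis using r assms by (intro exI[of _ r]) (auto simp: small_def intro!: coeff_eq_0)
qed

text \<open>One parametrisation for all contact loci: \<open>f\<close> and \<open>g\<close> are
  combinations of two members with prescribed contact, with coefficients that depend on
  \<open>s\<close> further parameters. The count is points, plus \<open>s\<close>, plus the
  coefficients of the two cofactors.\<close>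

lemma pairs_param_contact:
  fixes c11 c12 c21 c22 :: "(nat \<Rightarrow> complex) \<Rightarrow> complex"
  assumes "length b = length a" "length a + s + n1 + n2 \<le> k"
    and c: "c11 \<in> polyfun (coords {..<s})" "c12 \<in> polyfun (coords {..<s})"
      "c21 \<in> polyfun (coords {..<s})" "c22 \<in> polyfun (coords {..<s})"
  shows "pairs_param k {(f, g). \<exists>x \<tau> r r'. small r n1 \<and> small r' n2 \<and>
    f = smult (c11 \<tau>) (contact a x * r) + smult (c12 \<tau>) (contact b x * r') \<and>
    g = smult (c21 \<tau>) (contact a x * r) + smult (c22 \<tau>) (contact b x * r')}"
proof -
  define K :: "(nat \<times> nat) set" where
    "K = {0} \<times> {..<length a} \<union> {1} \<times> {..<s} \<union> {2} \<times> {..<n1} \<union> {3} \<times> {..<n2}"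
  define A where "A = (\<lambda>u :: nat \<times> nat \<Rightarrow> complex.
    contact a (\<lambda>i. u (0, i)) * (\<Sum>i<n1. monom (u (2, i)) i))"
  define B where "B = (\<lambda>u :: nat \<times> nat \<Rightarrow> complex.
    contact b (\<lambda>i. u (0, i)) * (\<Sum>i<n2. monom (u (3, i)) i))"
  define C where "C = (\<lambda>(c :: (nat \<Rightarrow> complex) \<Rightarrow> complex) (u :: nat \<times> nat \<Rightarrow> complex). c (\<lambda>i. u (1, i)))"
  have coord: "(\<lambda>u. u (n, i)) \<in> polyfun (coords K)" if "(n, i) \<in> K" for n i
    using that by (intro polyfun.coord) auto
  have AB: "polyfam (coords K) A" "polyfam (coords K) B"
    unfolding A_def B_def contact_def
    by (intro polyfam_intros coord; auto simp: K_def assms(1))+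
  have C: "C c \<in> polyfun (coords K)" if "c \<in> polyfun (coords {..<s})" for c
    unfolding C_def using that by (rule polyfun_subst) (clarify, rule coord, simp add: K_def)
  show ?thesis unfolding pairs_param_def
  proof (intro exI conjI)
    show "finite K" by (simp add: K_def)
    have "card K \<le> length a + s + n1 + n2" unfolding K_def
      by (intro order_trans[OF card_Un_le] add_mono) (auto simp: card_cartesian_product)
    then show "card K \<le> k" using assms by simp
    show "polyfam (coords K) (\<lambda>u. smult (C c11 u) (A u) + smult (C c12 u) (B u))"
      "polyfam (coords K) (\<lambda>u. smult (C c21 u) (A u) + smult (C c22 u) (B u))"
      by (intro polyfam_intros AB C c)+
    show "\<forall>(f, g)\<in>{(f, g). \<exists>x \<tau> r r'. small r n1 \<and> small r' n2 \<and>
      f = smult (c11 \<tau>) (contact a x * r) + smult (c12 \<tau>) (contact b x * r') \<and>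
      g = smult (c21 \<tau>) (contact a x * r) + smult (c22 \<tau>) (contact b x * r')}.
      \<exists>u. f = smult (C c11 u) (A u) + smult (C c12 u) (B u) \<and>
          g = smult (C c21 u) (A u) + smult (C c22 u) (B u)"
    proof safe
      fix x \<tau> r r' assume r: "small r n1" "small r' n2"
      define u :: "nat \<times> nat \<Rightarrow> complex" where "u = (\<lambda>(n, i). if n = 0 then x i else if n = 1 then \<tau> i
        else if n = 2 then coeff r i else coeff r' i)"
      have "A u = contact a x * r" "B u = contact b x * r'"
        using small_eq_sum[OF r(1)] small_eq_sum[OF r(2)] by (simp_all add: A_def B_def u_def)
      moreover have "C c u = c \<tau>" for c by (simp add: C_def u_def)
      ultimately show "\<exists>u. smult (c11 \<tau>) (contact a x * r) + smult (c12 \<tau>) (contact b x * r') =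
          smult (C c11 u) (A u) + smult (C c12 u) (B u) \<and>
          smult (c21 \<tau>) (contact a x * r) + smult (c22 \<tau>) (contact b x * r') =
          smult (C c21 u) (A u) + smult (C c22 u) (B u)" by (intro exI[of _ u]) simp
    qed
  qed
qed

lemma pairs_param_mono: "pairs_param k S \<Longrightarrow> T \<subseteq> S \<Longrightarrow> pairs_param k T"
proof -
  assume S: "pairs_param k S" "T \<subseteq> S"
  then obtain K :: "(nat \<times> nat) set" and \<phi> \<gamma> where K: "finite K" "card K \<le> k"
    "polyfam (coords K) \<phi>" "polyfam (coords K) \<gamma>" "\<forall>(f, g)\<in>S. \<exists>u. f = \<phi> u \<and> g = \<gamma> u"
    unfolding pairs_param_def by (elim exE conjE)
  have "\<forall>(f, g)\<in>T. \<exists>u. f = \<phi> u \<and> g = \<gamma> u" using K(5) S(2) unfolding Ball_def by (simp add: subset_iff)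
  then show ?thesis unfolding pairs_param_def using K(1-4)
    by (intro exI[of _ K] exI[of _ \<phi>] exI[of _ \<gamma>] conjI)
qed

text \<open>This locus and the next two involve \<open>f\<close> and \<open>g\<close> themselves, a
  movable member together with \<open>g\<close>, and two movable members; each movable member will
  cost one parameter.\<close>

definition pair_contact :: "nat \<Rightarrow> nat list \<Rightarrow> nat list \<Rightarrow> (complex poly \<times> complex poly) set" where
  "pair_contact d a b = {(f, g). \<exists>x. f \<noteq> 0 \<and> g \<noteq> 0 \<and> degree f \<le> d \<and> degree g \<le> d \<and>
     contact a x dvd f \<and> contact b x dvd g}"

definition member_contact :: "nat \<Rightarrow> nat \<Rightarrow> nat list \<Rightarrow> nat list \<Rightarrow> (complex poly \<times> complex poly) set" where
  "member_contact d e a b = {(f, g). \<exists>t x. f + smult t g \<noteq> 0 \<and> g \<noteq> 0 \<and>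
     degree (f + smult t g) + e \<le> d \<and> degree g \<le> d \<and>
     contact a x dvd f + smult t g \<and> contact b x dvd g}"

definition members_contact :: "nat \<Rightarrow> nat \<Rightarrow> nat list \<Rightarrow> nat list \<Rightarrow> (complex poly \<times> complex poly) set" where
  "members_contact d e a b = {(f, g). \<exists>t t' x. t \<noteq> t' \<and> f + smult t g \<noteq> 0 \<and> f + smult t' g \<noteq> 0 \<and>
     degree (f + smult t g) + e \<le> d \<and> degree (f + smult t' g) \<le> d \<and>
     contact a x dvd f + smult t g \<and> contact b x dvd f + smult t' g}"

lemma pairs_param_empty: "pairs_param k {}"
  unfolding pairs_param_def by (intro exI[of _ "{}"] exI[of _ "\<lambda>_. 0"]) (auto simp: polyfam_const)

lemma pair_contact_param:
  assumes "length b = length a" "length a + 2 * d + 2 \<le> k + sum_list a + sum_list b"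
  shows "pairs_param k (pair_contact d a b)"
\<comment> \<open>With more contact than the degree allows the locus is empty; otherwise the
  truncated subtractions are exact.\<close>
proof (cases "sum_list a \<le> d \<and> sum_list b \<le> d")
  case True
  show ?thesis
  proof (rule pairs_param_mono[OF pairs_param_contact[of b a 0 "d + 1 - sum_list a" "d + 1 - sum_list b" k
        "\<lambda>_. 1" "\<lambda>_. 0" "\<lambda>_. 0" "\<lambda>_. 1"]])
    show "pair_contact d a b \<subseteq> {(f, g). \<exists>x \<tau> r r'. small r (d + 1 - sum_list a) \<and>
      small r' (d + 1 - sum_list b) \<and>
      f = smult ((\<lambda>_. 1) \<tau>) (contact a x * r) + smult ((\<lambda>_. 0) \<tau>) (contact b x * r') \<and>
      g = smult ((\<lambda>_. 0) \<tau>) (contact a x * r) + smult ((\<lambda>_. 1) \<tau>) (contact b x * r')}"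
      unfolding pair_contact_def
      using contact_dvd[of a _ _ 0 d] contact_dvd[of b _ _ 0 d] by auto metis
  qed (use assms True in \<open>auto intro: polyfun.const\<close>)
next
  case False
  then have "pair_contact d a b = {}"
    unfolding pair_contact_def
    using contact_dvd[of a _ _ 0 d] contact_dvd[of b _ _ 0 d] by auto
  then show ?thesis by (simp add: pairs_param_empty)
qed

lemma member_contact_param:
  assumes "length b = length a" "length a + 2 * d + 3 \<le> k + sum_list a + e + sum_list b"
  shows "pairs_param k (member_contact d e a b)"
proof (cases "sum_list a + e \<le> d \<and> sum_list b \<le> d")
  case True
  show ?thesis
  proof (rule pairs_param_mono[OF pairs_param_contact[of b a 1 "d + 1 - sum_list a - e" "d + 1 - sum_list b" k
        "\<lambda>_. 1" "\<lambda>\<tau>. - \<tau> 0" "\<lambda>_. 0" "\<lambda>_. 1"]])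
    show "member_contact d e a b \<subseteq> {(f, g). \<exists>x (\<tau> :: nat \<Rightarrow> complex) r r'. small r (d + 1 - sum_list a - e) \<and>
      small r' (d + 1 - sum_list b) \<and>
      f = smult ((\<lambda>_. 1) \<tau>) (contact a x * r) + smult (- \<tau> 0) (contact b x * r') \<and>
      g = smult ((\<lambda>_. 0) \<tau>) (contact a x * r) + smult ((\<lambda>_. 1) \<tau>) (contact b x * r')}"
    proof (intro subsetI, goal_cases)
      case (1 p)
      then obtain f g t x where p: "p = (f, g)" and
        a: "f + smult t g \<noteq> 0" "g \<noteq> 0" "degree (f + smult t g) + e \<le> d" "degree g \<le> d"
        "contact a x dvd f + smult t g" "contact b x dvd g"
        unfolding member_contact_def by blast
      obtain r where r: "f + smult t g = contact a x * r" "small r (d + 1 - sum_list a - e)"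
        using contact_dvd[OF a(5,1,3)] by blast
      obtain r' where r': "g = contact b x * r'" "small r' (d + 1 - sum_list b)"
        using contact_dvd[OF a(6,2), of 0 d] a(4) by auto
      have "f = contact a x * r - smult t g" using r(1) by (simp add: algebra_simps)
      then show ?case unfolding p using r r'
        by (intro CollectI case_prodI exI[of _ x] exI[of _ "\<lambda>_. t"] exI[of _ r] exI[of _ r'] conjI) auto
    qed
  qed (use assms True in \<open>auto intro!: polyfun.const polyfun_uminus intro: polyfun.coord\<close>)
next
  case False
  then have "member_contact d e a b = {}"
    unfolding member_contact_def
    using contact_dvd[of a _ _ e d] contact_dvd[of b _ _ 0 d] by auto
  then show ?thesis by (simp add: pairs_param_empty)
qed

lemma members_contact_param:
  assumes "length b = length a" "length a + 2 * d + 4 \<le> k + sum_list a + e + sum_list b"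
  shows "pairs_param k (members_contact d e a b)"
proof (cases "sum_list a + e \<le> d \<and> sum_list b \<le> d")
  case True
  show ?thesis
  proof (rule pairs_param_mono[OF pairs_param_contact[of b a 2 "d + 1 - sum_list a - e" "d + 1 - sum_list b" k
        "\<lambda>\<tau>. - \<tau> 1" "\<lambda>\<tau>. \<tau> 0" "\<lambda>_. 1" "\<lambda>_. - 1"]])
    show "members_contact d e a b \<subseteq> {(f, g). \<exists>x (\<tau> :: nat \<Rightarrow> complex) r r'. small r (d + 1 - sum_list a - e) \<and>
      small r' (d + 1 - sum_list b) \<and>
      f = smult (- \<tau> 1) (contact a x * r) + smult (\<tau> 0) (contact b x * r') \<and>
      g = smult ((\<lambda>_. 1) \<tau>) (contact a x * r) + smult ((\<lambda>_. - 1) \<tau>) (contact b x * r')}"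
    proof (intro subsetI, goal_cases)
      case (1 p)
      then obtain f g t t' x where p: "p = (f, g)" and
        a: "t \<noteq> t'" "f + smult t g \<noteq> 0" "f + smult t' g \<noteq> 0" "degree (f + smult t g) + e \<le> d"
        "degree (f + smult t' g) \<le> d" "contact a x dvd f + smult t g" "contact b x dvd f + smult t' g"
        unfolding members_contact_def by blast
      obtain r where r: "f + smult t g = contact a x * r" "small r (d + 1 - sum_list a - e)"
        using contact_dvd[OF a(6,2,4)] by blast
      obtain r' where r': "f + smult t' g = contact b x * r'" "small r' (d + 1 - sum_list b)"
        using contact_dvd[OF a(7,3), of 0 d] a(5) by auto
      \<comment> \<open>\<open>f\<close> and \<open>g\<close> are recovered from the two members by
        a linear system whose determinant is \<open>t - t'\<close> up to sign; its inverse is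
        absorbed into the cofactors.\<close>
      let ?c = "inverse (t - t')"
      have c: "(t - t') * ?c = 1" using a(1) by simp
      have g1: "smult ?c ((f + smult t g) - (f + smult t' g)) = smult ((t - t') * ?c) g"
        and f1: "smult ?c (smult t (f + smult t' g) - smult t' (f + smult t g)) = smult ((t - t') * ?c) f"
        by (rule poly_eqI; simp add: algebra_simps)+
      have g: "g = contact a x * smult ?c r - contact b x * smult ?c r'"
        using g1 unfolding c r(1) r'(1) by (simp add: smult_diff_right)
      have f: "f = smult t (contact b x * smult ?c r') - smult t' (contact a x * smult ?c r)"
        using f1 unfolding c r(1) r'(1) by (simp add: smult_diff_right mult.commute[of ?c])
      define \<tau> where "\<tau> = (\<lambda>i::nat. if i = 0 then t else t')"
      have \<tau>: "\<tau> 0 = t" "\<tau> 1 = t'" by (simp_all add: \<tau>_def)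
      have s: "small (smult ?c r) (d + 1 - sum_list a - e)" "small (smult ?c r') (d + 1 - sum_list b)"
        using r(2) r'(2) by (simp_all add: small_def)
      have "f = smult (- \<tau> 1) (contact a x * smult ?c r) + smult (\<tau> 0) (contact b x * smult ?c r')"
        "g = smult 1 (contact a x * smult ?c r) + smult (- 1) (contact b x * smult ?c r')"
        unfolding \<tau> f g by (simp_all add: algebra_simps)
      then show ?case unfolding p using s by blast
    qed
  qed (use assms True in \<open>auto intro!: polyfun.const polyfun_uminus intro: polyfun.coord\<close>)
next
  case False
  then have "members_contact d e a b = {}"
    unfolding members_contact_def
    using contact_dvd[of a _ _ e d] contact_dvd[of b _ _ 0 d] by auto
  then show ?thesis by (simp add: pairs_param_empty)
qed

lemma thin_pairs:
  assumes "pairs_param (2 * d) S" "d \<ge> 1"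
  shows "thin d (\<lambda>v. \<exists>y. (slice d v False y, slice d v True y) \<in> S)"
  using pairs_avoided[OF assms(1) order_refl assms(2)] unfolding thin_def by blast

lemma thin_pairs_inf:
  assumes "pairs_param (2 * d + 1) S"
  shows "thin d (\<lambda>v. (slice_inf d v False, slice_inf d v True) \<in> S)"
  using pairs_avoided_inf[OF assms(1) order_refl] unfolding thin_def by blast

text \<open>A bitangent at which the two branches of critical values have the same velocity.\<close>
lemma thin_nontransversal:
  assumes d: "d \<ge> 3"
  shows "thin d (\<lambda>v. \<exists>y t \<mu> x1 x2. slice d v False y + smult t (slice d v True y) \<noteq> 0 \<and>
    [:- x1, 1:]^2 * [:- x2, 1:]^2 dvd slice d v False y + smult t (slice d v True y) \<and>
    [:- x1, 1:] * [:- x2, 1:] dvd slice_deriv d v False y + smult t (slice_deriv d v True y)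
      - smult \<mu> (slice d v True y))"
proof -
  \<comment> \<open>Two points, the member \<open>t\<close> with the velocity \<open>\<mu>\<close>,
    then the coefficients of the cofactor \<open>r\<close>, of \<open>g\<close>, of the corrected
    cofactor \<open>w'\<close> and of the derivative of \<open>g\<close>: together exactly
    \<open>4 * d\<close>.\<close>
  define K :: "(nat \<times> nat) set" where "K = {0} \<times> {..<2} \<union> {1} \<times> {..<2} \<union> {2} \<times> {..<d-3}
    \<union> {3} \<times> {..<d+1} \<union> {4} \<times> {..<d-2} \<union> {5} \<times> {..<d}"
  define q where "q = (\<lambda>u :: nat \<times> nat \<Rightarrow> complex. [:- u (0,0), 1:] * [:- u (0,1), 1:])"
  define P where "P = (\<lambda>n m (u :: nat \<times> nat \<Rightarrow> complex). \<Sum>i<m. monom (u (n, i)) i)"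
  define \<phi> where "\<phi> = (\<lambda>s u. if s then P 3 (d+1) u else (q u)^2 * P 2 (d-3) u - smult (u (1,0)) (P 3 (d+1) u))"
  \<comment> \<open>The derivatives have degree below \<open>d\<close>, so the coefficient of
    \<open>x^d\<close> forces the top coefficient of the cofactor \<open>w\<close> to be
    \<open>- \<mu>\<close> times that of \<open>g\<close>. Splitting off this monomial saves the one
    parameter that the count cannot afford.\<close>
  define \<psi> where "\<psi> = (\<lambda>s u. if s then P 5 d u else
     smult (u (1,1)) (P 3 (d+1) u) - smult (u (1,0)) (P 5 d u) +
     q u * (P 4 (d-2) u - monom (u (1,1) * u (3,d)) (d-2)))"
  have coord: "(\<lambda>u. u (n, i)) \<in> polyfun (coords K)" if "(n, i) \<in> K" for n i
    using that by (intro polyfun.coord) auto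
  have P: "polyfam (coords K) (P 2 (d-3))" "polyfam (coords K) (P 3 (d+1))"
    "polyfam (coords K) (P 4 (d-2))" "polyfam (coords K) (P 5 d)"
    unfolding P_def by (intro polyfam_intros coord; auto simp: K_def)+
  have q: "polyfam (coords K) q" unfolding q_def
    by (intro polyfam_intros coord) (auto simp: K_def)
  have u: "(\<lambda>u. u (1, 0)) \<in> polyfun (coords K)" "(\<lambda>u. u (1, 1)) \<in> polyfun (coords K)"
    "(\<lambda>u. u (3, d)) \<in> polyfun (coords K)"
    by (rule coord; simp add: K_def)+
  have "polyfam (coords K) (\<phi> s)" for s
    unfolding \<phi>_def by (cases s; simp only: if_True if_False; intro polyfam_intros P q u)
  moreover have "polyfam (coords K) (\<psi> s)" for s
    unfolding \<psi>_def by (cases s; simp only: if_True if_False; intro polyfam_intros P q u)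
  moreover have "finite K" by (simp add: K_def)
  moreover have "card K \<le> 4 * d"
  proof -
    have "card K \<le> 2 + 2 + (d - 3) + (d + 1) + (d - 2) + d" unfolding K_def
      by (intro order_trans[OF card_Un_le] add_mono) (auto simp: card_cartesian_product)
    then show ?thesis using d by simp
  qed
  moreover have "d \<ge> 1" using d by simp
  ultimately obtain \<Phi> where \<Phi>: "\<Phi>\<in>polyfun (coords (triangle d))" "\<exists>v. \<Phi> v \<noteq> 0"
    "\<And>v y u. (\<forall>s. slice d v s y = \<phi> s u \<and> slice_deriv d v s y = \<psi> s u) \<Longrightarrow> \<Phi> v = 0"
    using jets_avoided[of K d \<phi> \<psi>] by blast
  have "\<Phi> v = 0" if h: "slice d v False y + smult t (slice d v True y) \<noteq> 0"
    "[:- x1, 1:]^2 * [:- x2, 1:]^2 dvd slice d v False y + smult t (slice d v True y)"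
    "[:- x1, 1:] * [:- x2, 1:] dvd slice_deriv d v False y + smult t (slice_deriv d v True y)
      - smult \<mu> (slice d v True y)" for v y t \<mu> x1 x2
  proof -
    let ?f = "slice d v False y" and ?g = "slice d v True y"
    let ?f' = "slice_deriv d v False y" and ?g' = "slice_deriv d v True y"
    let ?q = "[:- x1, 1:] * [:- x2, 1:]"
    have deg: "degree (?f + smult t ?g) \<le> d"
      by (intro degree_le) (auto simp: coeff_slice)
    have c: "contact [2,2] (\<lambda>i. if i = 0 then x1 else x2) = [:- x1, 1:]^2 * [:- x2, 1:]^2"
      unfolding contact_Cons contact_Nil by (simp only: mult_1_right if_True nat.simps if_False refl simp_thms)
    obtain r where r: "?f + smult t ?g = [:- x1, 1:]^2 * [:- x2, 1:]^2 * r" "small r (d - 3)" "d \<ge> 4"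
    proof -
      have "\<exists>r. ?f + smult t ?g = [:- x1, 1:]^2 * [:- x2, 1:]^2 * r \<and>
          small r (d + 1 - sum_list [2, 2] - 0) \<and> sum_list [2, 2] + 0 \<le> d"
        using contact_dvd[of "[2,2]" "\<lambda>i. if i = 0 then x1 else x2", unfolded c, OF h(2,1), of 0 d] deg
        by simp
      then obtain r where "?f + smult t ?g = [:- x1, 1:]^2 * [:- x2, 1:]^2 * r"
          "small r (d + 1 - sum_list [2, 2] - 0)" "sum_list [2, 2] + 0 \<le> d" by (elim exE conjE)
      then show thesis by (intro that[of r]) simp_all
    qed
    obtain w where w: "?f' + smult t ?g' - smult \<mu> ?g = ?q * w" using h(3) by (auto elim: dvdE)
    have cd: "coeff ?f' i = 0" "coeff ?g' i = 0" if "i \<ge> d" for i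
    proof -
      have "poly (pderiv (col d v s d)) y = 0" for s
      proof -
        have "degree (col d v s d) \<le> 0" by (rule degree_le) (auto simp: coeff_col)
        then have "pderiv (col d v s d) = 0" by (simp add: pderiv_eq_0_iff)
        then show ?thesis by simp
      qed
      then show "coeff ?f' i = 0" "coeff ?g' i = 0" using that by (auto simp: coeff_slice_deriv)
    qed
    have qw: "coeff (?q * w) i = (if i = 0 then 0 else if i = 1 then 0 else coeff w (i - 2)) -
       (x1 + x2) * (if i = 0 then 0 else coeff w (i - 1)) + x1 * x2 * coeff w i" for i
      by (cases i; cases "i - 1") (auto simp: coeff_pCons algebra_simps)
    have wz: "coeff w i = 0" if "i \<ge> d - 1" for i
    proof (cases "w = 0")
      case False
      have "degree (?q * w) = 2 + degree w" using False by (subst degree_mult_eq) (auto simp: degree_mult_eq)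
      moreover have "degree (?q * w) \<le> d" unfolding w[symmetric]
        by (intro degree_le) (auto simp: coeff_slice cd)
      ultimately show ?thesis using that d by (intro coeff_eq_0) auto
    qed simp
    have "coeff (?q * w) d = coeff w (d - 2)" unfolding qw using d wz by simp
    moreover have "coeff (?q * w) d = - \<mu> * coeff ?g d" unfolding w[symmetric] by (simp add: cd)
    ultimately have top: "coeff w (d - 2) = - \<mu> * coeff ?g d" by simp
    define w' where "w' = w + monom (\<mu> * coeff ?g d) (d - 2)"
    have w': "small w' (d - 2)" unfolding small_def w'_def
    proof (intro allI impI)
      fix i assume "d - 2 \<le> i"
      then consider "i = d - 2" | "i \<ge> d - 1" by linarith
      then show "coeff (w + monom (\<mu> * coeff ?g d) (d - 2)) i = 0"
        using top wz d by cases auto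
    qed
    have sg: "small ?g (d + 1)" by (auto simp: small_def coeff_slice)
    have sg': "small ?g' d" by (simp add: small_def cd)
    define u :: "nat \<times> nat \<Rightarrow> complex" where "u = (\<lambda>(n, i).
      if n = 0 then (if i = 0 then x1 else x2) else if n = 1 then (if i = 0 then t else \<mu>)
      else if n = 2 then coeff r i else if n = 3 then coeff ?g i else if n = 4 then coeff w' i
      else coeff ?g' i)"
    have Pu: "P 2 (d-3) u = r" "P 3 (d+1) u = ?g" "P 4 (d-2) u = w'" "P 5 d u = ?g'"
      using small_eq_sum[OF r(2)] small_eq_sum[OF sg] small_eq_sum[OF w'] small_eq_sum[OF sg']
      by (simp_all add: P_def u_def)
    have qu: "q u = ?q" by (simp add: q_def u_def)
    have u1: "u (1,0) = t" "u (1,1) = \<mu>" "u (3,d) = coeff ?g d" by (simp_all add: u_def)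
    have "?f = ?q^2 * r - smult t ?g"
      unfolding power_mult_distrib r(1)[symmetric] by simp
    moreover have "?f' = smult \<mu> ?g - smult t ?g' + ?q * (w' - monom (\<mu> * coeff ?g d) (d - 2))"
      using w by (simp add: w'_def algebra_simps)
    ultimately have "slice d v s y = \<phi> s u \<and> slice_deriv d v s y = \<psi> s u" for s
      unfolding \<phi>_def \<psi>_def by (cases s) (simp_all only: Pu qu u1 if_True if_False)
    then show ?thesis using \<Phi>(3)[of v y u] by blast
  qed
  then show ?thesis unfolding thin_def using \<Phi>(1,2) by blast
qed

text \<open>
  Loci of pairs of codimension at least two.  The first number is the order of contact at the
  point at infinity of the line, the lists are the orders of contact at unspecified finite points,
  with one or two members of the pencil.
\<close>
definition degenerate :: "nat \<Rightarrow> (complex poly \<times> complex poly) set list" where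
  "degenerate d =
    [{(f, g). g = 0 \<and> degree f \<le> d}, {(f, g). (\<exists>t. f + smult t g = 0) \<and> degree g \<le> d},
     member_contact d 0 [4] [0], member_contact d 0 [3,2] [0,0],
     member_contact d 0 [2,2,2] [0,0,0], member_contact d 0 [1,2,2] [1,0,0],
     member_contact d 0 [2,2] [1,0], member_contact d 0 [3] [1],
     pair_contact d [1,1] [1,1], member_contact d 2 [2] [0], member_contact d 2 [1] [1],
     member_contact d 3 [] [], pair_contact d [1] [2], pair_contact d [0,0] [2,2],
     pair_contact d [0] [4], members_contact d 0 [2,2,0,0] [0,0,2,2],
     members_contact d 2 [0,0] [2,2]]"

text \<open>Loci of codimension at least one, to be avoided on a single line.\<close>
definition degenerate_inf :: "nat \<Rightarrow> (complex poly \<times> complex poly) set list" where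
  "degenerate_inf d =
    [{(f, g). g = 0 \<and> degree f \<le> d}, {(f, g). (\<exists>t. f + smult t g = 0) \<and> degree g \<le> d},
     member_contact d 0 [3] [0], pair_contact d [1] [1], member_contact d 2 [] [],
     pair_contact d [0] [2], member_contact d 0 [2,2] [0,0]]"

definition generic_line :: "nat \<Rightarrow> complex poly \<Rightarrow> complex poly \<Rightarrow> bool" where
  "generic_line d f g \<longleftrightarrow> degree f \<le> d \<and> degree g \<le> d \<and> (\<forall>S\<in>set (degenerate d). (f, g) \<notin> S)"

definition generic_line_inf :: "nat \<Rightarrow> complex poly \<Rightarrow> complex poly \<Rightarrow> bool" where
  "generic_line_inf d f g \<longleftrightarrow>
     degree f \<le> d \<and> degree g \<le> d \<and> (\<forall>S\<in>set (degenerate_inf d). (f, g) \<notin> S)"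

text \<open>At a point of contact \<open>t = - f / g\<close>, and the \<open>y\<close>-derivative of
  \<open>- f / g\<close> there is \<open>- (f' + t g') / g\<close>. A common value
  \<open>\<mu>\<close> of \<open>(f' + t g') / g\<close> at both points means that the two critical
  values move with equal velocity.\<close>

definition transversal :: "complex poly \<Rightarrow> complex poly \<Rightarrow> complex poly \<Rightarrow> complex poly \<Rightarrow> bool" where
  "transversal f g f' g' \<longleftrightarrow> (\<forall>t \<mu> x1 x2. f + smult t g \<noteq> 0 \<longrightarrow>
     [:- x1, 1:]^2 * [:- x2, 1:]^2 dvd f + smult t g \<longrightarrow>
     \<not> [:- x1, 1:] * [:- x2, 1:] dvd f' + smult t g' - smult \<mu> g)"

text \<open>The first clause says that the second curve misses the point \<open>P\<close>, so that
  \<open>g\<close> has degree exactly \<open>d\<close> on every line.\<close>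

definition generic :: "nat \<Rightarrow> vec \<Rightarrow> bool" where
  "generic d v \<longleftrightarrow> v (True, d, 0) \<noteq> 0 \<and>
     generic_line_inf d (slice_inf d v False) (slice_inf d v True) \<and>
     (\<forall>y. generic_line d (slice d v False y) (slice d v True y) \<and>
       transversal (slice d v False y) (slice d v True y) (slice_deriv d v False y) (slice_deriv d v True y))"

lemma pairs_param_zero:
  "d + 1 \<le> k \<Longrightarrow> pairs_param k {(f, g). g = 0 \<and> degree f \<le> d}"
  by (rule pairs_param_mono[OF pairs_param_contact[of "[]" "[]" 0 "d + 1" 0 k
        "\<lambda>_. 1" "\<lambda>_. 0" "\<lambda>_. 0" "\<lambda>_. 0"]])
    (auto intro: polyfun.const intro!: exI[of _ 0] simp: contact_Nil small_def coeff_eq_0)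

lemma pairs_param_proportional:
  assumes "d + 2 \<le> k"
  shows "pairs_param k {(f, g). (\<exists>t. f + smult t g = 0) \<and> degree g \<le> d}"
proof (rule pairs_param_mono[OF pairs_param_contact[of "[]" "[]" 1 0 "d + 1" k
        "\<lambda>_. 0" "\<lambda>\<tau>. - \<tau> 0" "\<lambda>_. 0" "\<lambda>_. 1"]])
  show "{(f, g). (\<exists>t. f + smult t g = 0) \<and> degree g \<le> d}
    \<subseteq> {(f, g). \<exists>x (\<tau> :: nat \<Rightarrow> complex) r r'. small r 0 \<and> small r' (d + 1) \<and>
           f = smult 0 (contact [] x * r) + smult (- \<tau> 0) (contact [] x * r') \<and>
           g = smult 0 (contact [] x * r) + smult 1 (contact [] x * r')}"
  proof (intro subsetI, goal_cases)
    case (1 p)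
    then obtain f g t where p: "p = (f, g)" "f + smult t g = 0" "degree g \<le> d" by blast
    define \<tau> where "\<tau> = (\<lambda>i::nat. t)"
    have "small 0 0" "small g (d + 1)" using p by (simp_all add: small_def coeff_eq_0)
    moreover have "f = smult 0 (1 * 0) + smult (- \<tau> 0) (1 * g)" "g = smult 0 (1 * 0) + smult 1 (1 * g)"
      using p by (simp_all add: \<tau>_def eq_neg_iff_add_eq_0)
    ultimately show ?case unfolding p(1) contact_Nil by blast
  qed
qed (use assms in \<open>auto intro!: polyfun.const polyfun_uminus intro: polyfun.coord\<close>)

lemma thin_slices:
  assumes "\<forall>S\<in>set L. pairs_param (2 * d) S" "d \<ge> 1"
  shows "thin d (\<lambda>v. \<exists>S\<in>set L. \<exists>y. (slice d v False y, slice d v True y) \<in> S)"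
  using assms(1)
proof (induction L)
  case Nil
  show ?case unfolding thin_def by (auto intro!: bexI[of _ "\<lambda>_. 1"] polyfun.const)
next
  case (Cons S L)
  from thin_disj[OF thin_pairs[of d S, OF _ assms(2)] Cons.IH] Cons.prems show ?case
    by (auto elim!: thin_mono)
qed

lemma thin_slices_inf:
  assumes "\<forall>S\<in>set L. pairs_param (2 * d + 1) S"
  shows "thin d (\<lambda>v. \<exists>S\<in>set L. (slice_inf d v False, slice_inf d v True) \<in> S)"
  using assms(1)
proof (induction L)
  case Nil
  show ?case unfolding thin_def by (auto intro!: bexI[of _ "\<lambda>_. 1"] polyfun.const)
next
  case (Cons S L)
  from thin_disj[OF thin_pairs_inf[of d S] Cons.IH] Cons.prems show ?case
    by (auto elim!: thin_mono)
qed

lemma degree_slice: "degree (slice d v s y) \<le> d"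
  by (intro degree_le) (auto simp: coeff_slice)

lemma degree_slice_inf: "degree (slice_inf d v s) \<le> d"
  by (intro degree_le) (auto simp: coeff_slice_inf)

lemma thin_not_generic:
  assumes "d \<ge> 3"
  shows "thin d (\<lambda>v. \<not> generic d v)"
proof -
  \<comment> \<open>In every contact entry the total contact exceeds the number of points plus the
    number of movable members by at least two; in \<open>degenerate_inf\<close> below it exceeds
    them by one.\<close>
  have "\<forall>S\<in>set (degenerate d). pairs_param (2 * d) S"
    unfolding degenerate_def using assms
    by (auto intro!: pairs_param_zero pairs_param_proportional pair_contact_param
        member_contact_param members_contact_param)
  from thin_slices[OF this] assms have t1: "thin d (\<lambda>v. \<exists>S\<in>set (degenerate d). \<exists>y. (slice d v False y, slice d v True y) \<in> S)"
    by simp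
  have "\<forall>S\<in>set (degenerate_inf d). pairs_param (2 * d + 1) S"
    unfolding degenerate_inf_def using assms
    by (auto intro!: pairs_param_zero pairs_param_proportional pair_contact_param
        member_contact_param members_contact_param)
  from thin_slices_inf[OF this] have t2: "thin d (\<lambda>v. \<exists>S\<in>set (degenerate_inf d). (slice_inf d v False, slice_inf d v True) \<in> S)" .
  have t3: "thin d (\<lambda>v. v (True, d, 0) = 0)"
    unfolding thin_def
    by (intro bexI[of _ "\<lambda>v. v (True, d, 0)"] conjI exI[of _ "\<lambda>_. 1"] polyfun.coord) (auto simp: triangle_def)
  show ?thesis
  proof (rule thin_mono[OF thin_disj[OF thin_disj[OF t1 t2] thin_disj[OF t3 thin_nontransversal[OF assms]]]], rule ccontr)
    fix v
    assume ng: "\<not> generic d v"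
    assume n: "\<not> (((\<exists>S\<in>set (degenerate d). \<exists>y. (slice d v False y, slice d v True y) \<in> S) \<or>
       (\<exists>S\<in>set (degenerate_inf d). (slice_inf d v False, slice_inf d v True) \<in> S)) \<or> v (True, d, 0) = 0 \<or>
       (\<exists>y t \<mu> x1 x2. slice d v False y + smult t (slice d v True y) \<noteq> 0 \<and>
    [:- x1, 1:]^2 * [:- x2, 1:]^2 dvd slice d v False y + smult t (slice d v True y) \<and>
    [:- x1, 1:] * [:- x2, 1:] dvd slice_deriv d v False y + smult t (slice_deriv d v True y)
      - smult \<mu> (slice d v True y)))"
    note n1 = n[unfolded de_Morgan_disj, THEN conjunct1, THEN conjunct1]
      and n2 = n[unfolded de_Morgan_disj, THEN conjunct1, THEN conjunct2]
      and n3 = n[unfolded de_Morgan_disj, THEN conjunct2, THEN conjunct1]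
      and n4 = n[unfolded de_Morgan_disj, THEN conjunct2, THEN conjunct2]
    have "generic_line d (slice d v False y) (slice d v True y)" for y
      unfolding generic_line_def using n1 degree_slice by auto
    moreover have "generic_line_inf d (slice_inf d v False) (slice_inf d v True)"
      unfolding generic_line_inf_def using n2 degree_slice_inf by auto
    moreover have "transversal (slice d v False y) (slice d v True y) (slice_deriv d v False y)
        (slice_deriv d v True y)" for y
      unfolding transversal_def using n4 by (intro allI impI notI) metis
    ultimately have "generic d v" unfolding generic_def using n3 by simp
    with ng show False ..
  qed
qed

section \<open>Configurations excluded on a single generic line\<close>

definition lin :: "complex \<Rightarrow> complex poly" where "lin x = [:- x, 1:]"

lemma contact_simps:
  "contact [a] (\<lambda>i. [x] ! i) = lin x ^ a"
  "contact [a,b] (\<lambda>i. [x,y] ! i) = lin x ^ a * lin y ^ b"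
  "contact [a,b,c] (\<lambda>i. [x,y,z] ! i) = lin x ^ a * lin y ^ b * lin z ^ c"
  "contact [a,b,c,e] (\<lambda>i. [x,y,z,w] ! i) = lin x ^ a * lin y ^ b * lin z ^ c * lin w ^ e"
  unfolding contact_Cons contact_Nil lin_def by (simp_all only: nth_Cons_0 nth_Cons_Suc mult_1_right mult.assoc)

lemma member_contactI:
  assumes "contact a x dvd f + smult t g" "contact b x dvd g" "f + smult t g \<noteq> 0" "g \<noteq> 0"
    "degree (f + smult t g) + e \<le> d" "degree g \<le> d"
  shows "(f, g) \<in> member_contact d e a b"
  using assms unfolding member_contact_def by blast

lemma members_contactI:
  assumes "contact a x dvd f + smult t g" "contact b x dvd f + smult t' g" "t \<noteq> t'"
    "f + smult t g \<noteq> 0" "f + smult t' g \<noteq> 0"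
    "degree (f + smult t g) + e \<le> d" "degree (f + smult t' g) \<le> d"
  shows "(f, g) \<in> members_contact d e a b"
  using assms unfolding members_contact_def by blast

lemma pair_contactI:
  assumes "contact a x dvd f" "contact b x dvd g" "f \<noteq> 0" "g \<noteq> 0" "degree f \<le> d" "degree g \<le> d"
  shows "(f, g) \<in> pair_contact d a b"
  using assms unfolding pair_contact_def by blast

locale generic_pencil =
  fixes d :: nat and f g :: "complex poly"
  assumes d: "d \<ge> 3" and gen: "generic_line d f g"
begin

lemma deg_f: "degree f \<le> d" and deg_g: "degree g \<le> d"
  using gen by (auto simp: generic_line_def)

lemma deg_member: "degree (f + smult t g) \<le> d"
  using deg_f deg_g by (meson degree_add_le degree_smult_le order_trans)

lemma not_deg: "S \<in> set (degenerate d) \<Longrightarrow> (f, g) \<notin> S"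
  using gen by (simp add: generic_line_def)

lemma g_nz: "g \<noteq> 0"
  using not_deg[of "{(f, g). g = 0 \<and> degree f \<le> d}"] deg_f by (auto simp: degenerate_def)

lemma member_nz: "f + smult t g \<noteq> 0"
  using not_deg[of "{(f, g). (\<exists>t. f + smult t g = 0) \<and> degree g \<le> d}"] deg_g
  by (auto simp: degenerate_def)

lemma f_nz: "f \<noteq> 0"
  using member_nz[of 0] by simp

lemma no_member:
  assumes "member_contact d e a b \<in> set (degenerate d)" "degree (f + smult t g) + e \<le> d"
    "contact a x dvd f + smult t g" "contact b x dvd g"
  shows False
  using not_deg[OF assms(1)] member_contactI[OF assms(3,4) member_nz g_nz assms(2) deg_g] by blast

lemma no_member4: "\<not> lin x ^ 4 dvd f + smult t g"
  using no_member[of 0 "[4]" "[0]" t "\<lambda>i. [x] ! i", unfolded contact_simps] deg_member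
  by (auto simp: degenerate_def)

lemma no_member32: "\<not> lin x ^ 3 * lin y ^ 2 dvd f + smult t g"
  using no_member[of 0 "[3,2]" "[0,0]" t "\<lambda>i. [x,y] ! i", unfolded contact_simps] deg_member
  by (auto simp: degenerate_def)

lemma no_member222: "\<not> lin x ^ 2 * lin y ^ 2 * lin z ^ 2 dvd f + smult t g"
  using no_member[of 0 "[2,2,2]" "[0,0,0]" t "\<lambda>i. [x,y,z] ! i", unfolded contact_simps] deg_member
  by (auto simp: degenerate_def)

lemma no_base_bitangent: "lin z dvd g \<Longrightarrow> \<not> lin z * lin x ^ 2 * lin y ^ 2 dvd f + smult t g"
  using no_member[of 0 "[1,2,2]" "[1,0,0]" t "\<lambda>i. [z,x,y] ! i", unfolded contact_simps] deg_member
  by (auto simp: degenerate_def)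

lemma no_bitangent_at_base: "lin z dvd g \<Longrightarrow> \<not> lin z ^ 2 * lin x ^ 2 dvd f + smult t g"
  using no_member[of 0 "[2,2]" "[1,0]" t "\<lambda>i. [z,x] ! i", unfolded contact_simps] deg_member
  by (auto simp: degenerate_def)

lemma no_flex_at_base: "lin z dvd g \<Longrightarrow> \<not> lin z ^ 3 dvd f + smult t g"
  using no_member[of 0 "[3]" "[1]" t "\<lambda>i. [z] ! i", unfolded contact_simps] deg_member
  by (auto simp: degenerate_def)

lemma no_tangent_P: "degree (f + smult t g) + 2 \<le> d \<Longrightarrow> \<not> lin x ^ 2 dvd f + smult t g"
  using no_member[of 2 "[2]" "[0]" t "\<lambda>i. [x] ! i", unfolded contact_simps]
  by (auto simp: degenerate_def)

lemma no_base_P: "degree (f + smult t g) + 2 \<le> d \<Longrightarrow> lin x dvd g \<Longrightarrow> \<not> lin x dvd f + smult t g"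
  using no_member[of 2 "[1]" "[1]" t "\<lambda>i. [x] ! i", unfolded contact_simps]
  by (auto simp: degenerate_def)

lemma no_flex_P: "\<not> degree (f + smult t g) + 3 \<le> d"
  using no_member[of 3 "[]" "[]" t] by (auto simp: degenerate_def contact_Nil)

lemma no_pair:
  assumes "pair_contact d a b \<in> set (degenerate d)" "contact a x dvd f" "contact b x dvd g"
  shows False
  using not_deg[OF assms(1)] pair_contactI[OF assms(2,3) f_nz g_nz deg_f deg_g] by blast

lemma no_two_base: "lin x * lin y dvd f \<Longrightarrow> \<not> lin x * lin y dvd g"
  using no_pair[of "[1,1]" "[1,1]" "\<lambda>i. [x,y] ! i", unfolded contact_simps]
  by (auto simp: degenerate_def)

lemma no_base_tangent_g: "lin x dvd f \<Longrightarrow> \<not> lin x ^ 2 dvd g"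
  using no_pair[of "[1]" "[2]" "\<lambda>i. [x] ! i", unfolded contact_simps]
  by (auto simp: degenerate_def)

lemma no_bitangent_g: "\<not> lin x ^ 2 * lin y ^ 2 dvd g"
  using no_pair[of "[0,0]" "[2,2]" "\<lambda>i. [x,y] ! i", unfolded contact_simps]
  by (auto simp: degenerate_def)

lemma no_4_g: "\<not> lin x ^ 4 dvd g"
  using no_pair[of "[0]" "[4]" "\<lambda>i. [x] ! i", unfolded contact_simps]
  by (auto simp: degenerate_def)

lemma no_members:
  assumes "members_contact d e a b \<in> set (degenerate d)" "degree (f + smult t g) + e \<le> d" "t \<noteq> t'"
    "contact a x dvd f + smult t g" "contact b x dvd f + smult t' g"
  shows False
  using not_deg[OF assms(1)]
    members_contactI[OF assms(4,5,3) member_nz member_nz assms(2) deg_member] by blast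

lemma no_two_bitangents:
  "t \<noteq> t' \<Longrightarrow> lin x ^ 2 * lin y ^ 2 dvd f + smult t g \<Longrightarrow> \<not> lin z ^ 2 * lin w ^ 2 dvd f + smult t' g"
  using no_members[of 0 "[2,2,0,0]" "[0,0,2,2]" t t' "\<lambda>i. [x,y,z,w] ! i", unfolded contact_simps] deg_member
  by (auto simp: degenerate_def)

lemma no_P_bitangent:
  "t \<noteq> t' \<Longrightarrow> degree (f + smult t g) + 2 \<le> d \<Longrightarrow> \<not> lin x ^ 2 * lin y ^ 2 dvd f + smult t' g"
  using no_members[of 2 "[0,0]" "[2,2]" t t' "\<lambda>i. [x,y] ! i", unfolded contact_simps]
  by (auto simp: degenerate_def)

end

locale generic_pencil_inf =
  fixes d :: nat and f g :: "complex poly"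
  assumes d: "d \<ge> 3" and gen: "generic_line_inf d f g"
begin

lemma deg_f: "degree f \<le> d" and deg_g: "degree g \<le> d"
  using gen by (auto simp: generic_line_inf_def)

lemma deg_member: "degree (f + smult t g) \<le> d"
  using deg_f deg_g by (meson degree_add_le degree_smult_le order_trans)

lemma not_deg: "S \<in> set (degenerate_inf d) \<Longrightarrow> (f, g) \<notin> S"
  using gen by (simp add: generic_line_inf_def)

lemma g_nz: "g \<noteq> 0"
  using not_deg[of "{(f, g). g = 0 \<and> degree f \<le> d}"] deg_f by (auto simp: degenerate_inf_def)

lemma member_nz: "f + smult t g \<noteq> 0"
  using not_deg[of "{(f, g). (\<exists>t. f + smult t g = 0) \<and> degree g \<le> d}"] deg_g
  by (auto simp: degenerate_inf_def)

lemma f_nz: "f \<noteq> 0"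
  using member_nz[of 0] by simp

lemma no_member:
  assumes "member_contact d e a b \<in> set (degenerate_inf d)" "degree (f + smult t g) + e \<le> d"
    "contact a x dvd f + smult t g" "contact b x dvd g"
  shows False
  using not_deg[OF assms(1)] member_contactI[OF assms(3,4) member_nz g_nz assms(2) deg_g] by blast

lemma no_pair:
  assumes "pair_contact d a b \<in> set (degenerate_inf d)" "contact a x dvd f" "contact b x dvd g"
  shows False
  using not_deg[OF assms(1)] pair_contactI[OF assms(2,3) f_nz g_nz deg_f deg_g] by blast

lemma no_flex: "\<not> lin x ^ 3 dvd f + smult t g"
  using no_member[of 0 "[3]" "[0]" t "\<lambda>i. [x] ! i", unfolded contact_simps] deg_member
  by (auto simp: degenerate_inf_def)

lemma no_base: "lin x dvd f \<Longrightarrow> \<not> lin x dvd g"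
  using no_pair[of "[1]" "[1]" "\<lambda>i. [x] ! i", unfolded contact_simps]
  by (auto simp: degenerate_inf_def)

lemma no_P: "\<not> degree (f + smult t g) + 2 \<le> d"
  using no_member[of 2 "[]" "[]" t] by (auto simp: degenerate_inf_def contact_Nil)

lemma no_tangent_g: "\<not> lin x ^ 2 dvd g"
  using no_pair[of "[0]" "[2]" "\<lambda>i. [x] ! i", unfolded contact_simps]
  by (auto simp: degenerate_inf_def)

lemma no_bitangent: "\<not> lin x ^ 2 * lin y ^ 2 dvd f + smult t g"
  using no_member[of 0 "[2,2]" "[0,0]" t "\<lambda>i. [x,y] ! i", unfolded contact_simps] deg_member
  by (auto simp: degenerate_inf_def)

end

section \<open>Roots of a polynomial depending on a parameter\<close>

text \<open>The roots come labelled, with repetitions. Using the coefficient at \<open>n\<close>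
  instead of the leading one keeps \<open>n\<close> fixed in a family; its nonvanishing says that no
  root has escaped to infinity.\<close>

definition splits :: "nat \<Rightarrow> complex poly \<Rightarrow> (nat \<Rightarrow> complex) \<Rightarrow> bool" where
  "splits n p X \<longleftrightarrow> p = smult (coeff p n) (\<Prod>i<n. lin (X i)) \<and> coeff p n \<noteq> 0"

lemma poly_lin [simp]: "poly (lin x) y = y - x"
  by (simp add: lin_def)

lemma lin_nz [simp]: "lin x \<noteq> 0"
  by (simp add: lin_def)

lemma degree_lin [simp]: "degree (lin x) = 1"
  by (simp add: lin_def)

lemma lin_dvd_iff: "lin x dvd p \<longleftrightarrow> poly p x = 0"
  by (simp add: lin_def poly_eq_0_iff_dvd)

lemma degree_prod_lin: "degree (\<Prod>i\<in>I. lin (X i)) = card I" if "finite I"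
proof -
  have "degree (\<Prod>i\<in>I. lin (X i)) = (\<Sum>i\<in>I. degree (lin (X i)))"
    by (rule degree_prod_eq_sum_degree) auto
  then show ?thesis by simp
qed

lemma splits_degree: "splits n p X \<Longrightarrow> degree p = n"
proof -
  assume "splits n p X"
  then have p: "p = smult (coeff p n) (\<Prod>i<n. lin (X i))" and "coeff p n \<noteq> 0" by (auto simp: splits_def)
  have "degree (smult (coeff p n) (\<Prod>i<n. lin (X i))) = n"
    using \<open>coeff p n \<noteq> 0\<close> by (simp add: degree_prod_lin)
  then show ?thesis using p by simp
qed

lemma splits_poly: "splits n p X \<Longrightarrow> poly p x = coeff p n * (\<Prod>i<n. x - X i)"
  by (metis (no_types, lifting) poly_lin poly_prod poly_smult prod.cong splits_def)

lemma splits_root_iff: "splits n p X \<Longrightarrow> poly p x = 0 \<longleftrightarrow> (\<exists>i<n. x = X i)"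
  by (auto simp: splits_poly splits_def)

lemma splits_exists:
  assumes "degree p = n" "p \<noteq> 0"
  shows "\<exists>X. splits n p X"
proof -
  obtain A where A: "size A = n" "p = smult (lead_coeff p) (\<Prod>x\<in>#A. [:- x, 1:])"
    using alg_closed_imp_factorization[OF assms(2)] assms(1) by blast
  obtain xs where xs: "mset xs = A" using ex_mset by blast
  have "(\<Prod>x\<in>#A. [:- x, 1:]) = (\<Prod>x\<leftarrow>xs. lin x)"
    by (simp add: xs[symmetric] prod_mset_prod_list[symmetric] lin_def)
  also have "\<dots> = (\<Prod>i<n. lin (xs ! i))"
    using A xs by (auto simp: prod.list_conv_set_nth atLeast0LessThan)
  finally show ?thesis using A(2) assms unfolding splits_def
    by (intro exI[of _ "\<lambda>i. xs ! i"]) (simp, metis leading_coeff_0_iff)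
qed

lemma splits_unique:
  assumes "splits n p X" "splits n p Y"
  shows "\<exists>\<pi>. \<pi> permutes {..<n} \<and> (\<forall>i<n. Y i = X (\<pi> i))"
proof -
  have pr: "proots p = image_mset X (mset_set {..<n})" if "splits n p X" for X
  proof -
    have p: "p = smult (coeff p n) (\<Prod>i<n. lin (X i))" and nz: "coeff p n \<noteq> 0"
      using that by (auto simp: splits_def)
    have "proots p = proots (smult (coeff p n) (\<Prod>i<n. lin (X i)))" using p by simp
    also have "\<dots> = proots (\<Prod>i<n. lin (X i))" using nz by simp
    also have "\<dots> = (\<Sum>i<n. proots (lin (X i)))" by (rule proots_prod) auto
    also have "\<dots> = (\<Sum>i<n. {#X i#})" by (simp add: lin_def)
    also have "\<dots> = image_mset X (mset_set {..<n})"
      by (induction n) (auto simp: lessThan_Suc)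
    finally show ?thesis .
  qed
  have "image_mset Y (mset_set {..<n}) = image_mset X (mset_set {..<n})"
    using pr[OF assms(1)] pr[OF assms(2)] by simp
  from image_mset_eq_implies_permutes[OF finite_lessThan this] obtain \<pi> where
    "\<pi> permutes {..<n}" "\<forall>x\<in>{..<n}. Y x = X (\<pi> x)" .
  then show ?thesis by (intro exI[of _ \<pi>]) simp
qed

lemma splits_permute:
  assumes "splits n p X" "\<pi> permutes {..<n}"
  shows "splits n p (\<lambda>i. X (\<pi> i))"
proof -
  have "(\<Prod>i<n. lin (X (\<pi> i))) = (\<Prod>i<n. lin (X i))"
    using prod.permute[OF assms(2), of "\<lambda>i. lin (X i)"] by (simp add: comp_def)
  then show ?thesis using assms(1) by (simp add: splits_def)
qed

lemma convergent_subsequence_finite: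
  fixes X :: "nat \<Rightarrow> nat \<Rightarrow> complex"
  assumes "\<And>i. i < n \<Longrightarrow> bounded (range (\<lambda>k. X k i))"
  shows "\<exists>r. strict_mono r \<and> (\<forall>i<n. convergent (\<lambda>k. X (r k) i))"
  using assms
proof (induction n)
  case 0
  show ?case by (intro exI[of _ id]) (auto simp: strict_mono_def)
next
  case (Suc n)
  then obtain r where r: "strict_mono r" "\<forall>i<n. convergent (\<lambda>k. X (r k) i)" by auto
  have "bounded (range (\<lambda>k. X (r k) n))"
    by (rule bounded_subset[OF Suc.prems[of n]]) auto
  then obtain l s where s: "strict_mono s" "((\<lambda>k. X (r k) n) \<circ> s) \<longlonglongrightarrow> l"
    using bounded_imp_convergent_subsequence by blast
  have "convergent (\<lambda>k. X (r (s k)) i)" if "i < Suc n" for i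
  proof (cases "i = n")
    case True
    then show ?thesis using s(2) by (auto simp: comp_def convergent_def)
  next
    case False
    then have "convergent (\<lambda>k. X (r k) i)" using r that by simp
    from convergent_subseq_convergent[OF this s(1)] show ?thesis by (simp add: comp_def)
  qed
  then have "\<forall>i<Suc n. convergent (\<lambda>k. X ((r \<circ> s) k) i)" by simp
  then show ?case using strict_mono_o[OF r(1) s(1)] by blast
qed

lemma poly_bounded_sum:
  fixes p :: "'a :: comm_ring_1 poly"
  assumes "degree p \<le> n"
  shows "poly p x = (\<Sum>i\<le>n. coeff p i * x ^ i)"
proof -
  have "poly p x = poly (\<Sum>i\<le>n. monom (coeff p i) i) x"
    by (simp only: poly_as_sum_of_monoms'[OF assms])
  then show ?thesis by (simp add: poly_sum poly_monom)
qed

lemma root_bound: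
  fixes p :: "complex poly"
  assumes "coeff p n \<noteq> 0" "degree p \<le> n" "poly p x = 0"
  shows "norm x \<le> 1 + (\<Sum>i<n. norm (coeff p i)) / norm (coeff p n)"
proof (cases "norm x \<le> 1")
  case True
  then show ?thesis by (smt (verit) divide_nonneg_nonneg norm_ge_zero sum_nonneg)
next
  case False
  then have x: "norm x > 1" by simp
  have "n \<noteq> 0" using assms by (intro notI) (auto elim!: degree_eq_zeroE)
  then obtain m where m: "n = Suc m" using not0_implies_Suc by blast
  have "0 = (\<Sum>i\<le>n. coeff p i * x ^ i)"
    using assms(2,3) poly_bounded_sum by metis
  then have "coeff p n * x ^ n = - (\<Sum>i<n. coeff p i * x ^ i)"
    by (simp add: lessThan_Suc_atMost[symmetric] eq_neg_iff_add_eq_0 add.commute)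
  then have "norm (coeff p n) * norm x ^ n = norm (\<Sum>i<n. coeff p i * x ^ i)"
    by (metis norm_minus_cancel norm_mult norm_power)
  also have "\<dots> \<le> (\<Sum>i<n. norm (coeff p i) * norm x ^ m)"
    by (rule order_trans[OF norm_sum], rule sum_mono)
      (use x m in \<open>auto simp: norm_mult norm_power intro!: mult_left_mono power_increasing\<close>)
  also have "\<dots> = (\<Sum>i<n. norm (coeff p i)) * norm x ^ m" by (simp add: sum_distrib_right)
  finally have "norm (coeff p n) * norm x * norm x ^ m \<le> (\<Sum>i<n. norm (coeff p i)) * norm x ^ m"
    by (simp add: m mult.assoc)
  moreover have "norm x ^ m > 0" using x by (intro zero_less_power) linarith
  ultimately have "norm (coeff p n) * norm x \<le> (\<Sum>i<n. norm (coeff p i))"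
    by (simp add: mult_le_cancel_right)
  then have "norm x \<le> (\<Sum>i<n. norm (coeff p i)) / norm (coeff p n)"
    using assms(1) by (simp add: field_simps)
  then show ?thesis by simp
qed

text \<open>\<open>root_bound\<close> keeps the roots bounded, so they converge along a subsequence.
  Comparing values shows that the limits split \<open>q\<close>, and uniqueness up to a permutation
  allows them to be renumbered as \<open>Y\<close>.\<close>

lemma roots_limit:
  assumes p: "\<And>k. splits n (p k) (X k)" and lim: "\<And>i. (\<lambda>k. coeff (p k) i) \<longlonglongrightarrow> coeff q i"
    and q: "splits n q Y"
  shows "\<exists>r X'. strict_mono r \<and> (\<forall>k. splits n (p (r k)) (X' k)) \<and> (\<forall>i<n. (\<lambda>k. X' k i) \<longlonglongrightarrow> Y i)"
proof -
  have qn: "coeff q n \<noteq> 0" using q by (simp add: splits_def)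
  have bnd: "bounded (range (\<lambda>k. X k i))" if "i < n" for i
  proof -
    let ?B = "\<lambda>k. 1 + (\<Sum>i<n. norm (coeff (p k) i)) / norm (coeff (p k) n)"
    have "?B \<longlonglongrightarrow> 1 + (\<Sum>i<n. norm (coeff q i)) / norm (coeff q n)"
      using lim qn by (intro tendsto_intros) auto
    then have "Bseq ?B" by (intro convergent_imp_Bseq convergentI)
    then obtain K where K: "\<And>k. norm (?B k) \<le> K" unfolding Bseq_def by blast
    have le: "norm (X k i) \<le> ?B k" for k
      using p[of k] that splits_degree[OF p[of k]] splits_root_iff[OF p[of k]]
      by (intro root_bound) (auto simp: splits_def)
    have "norm (X k i) \<le> K" for k
      using order_trans[OF le[of k] order_trans[OF abs_ge_self K[of k, unfolded real_norm_def]]] .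
    then show ?thesis by (auto simp: bounded_iff)
  qed
  obtain r where r: "strict_mono r" "\<forall>i<n. convergent (\<lambda>k. X (r k) i)"
    using convergent_subsequence_finite[of n X, OF bnd] by blast
  define \<xi> where "\<xi> = (\<lambda>i. lim (\<lambda>k. X (r k) i))"
  have \<xi>: "(\<lambda>k. X (r k) i) \<longlonglongrightarrow> \<xi> i" if "i < n" for i
    using r that by (simp add: \<xi>_def convergent_LIMSEQ_iff)
  have lim': "(\<lambda>k. coeff (p (r k)) i) \<longlonglongrightarrow> coeff q i" for i
    using LIMSEQ_subseq_LIMSEQ[OF lim r(1)] by (simp add: comp_def)
  have "poly q x = poly (smult (coeff q n) (\<Prod>i<n. lin (\<xi> i))) x" for x
  proof (rule LIMSEQ_unique)
    have "poly (p (r k)) x = (\<Sum>i\<le>n. coeff (p (r k)) i * x ^ i)" for k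
      using splits_degree[OF p] by (simp add: poly_altdef)
    moreover have "poly q x = (\<Sum>i\<le>n. coeff q i * x ^ i)"
      using splits_degree[OF q] by (simp add: poly_altdef)
    ultimately show "(\<lambda>k. poly (p (r k)) x) \<longlonglongrightarrow> poly q x"
      using lim' by (simp only:) (intro tendsto_intros)
    show "(\<lambda>k. poly (p (r k)) x) \<longlonglongrightarrow> poly (smult (coeff q n) (\<Prod>i<n. lin (\<xi> i))) x"
      unfolding splits_poly[OF p] by (auto simp: poly_prod intro!: tendsto_intros lim' \<xi>)
  qed
  then have "splits n q \<xi>" using qn by (simp add: splits_def poly_eq_poly_eq_iff[symmetric] fun_eq_iff)
  from splits_unique[OF this q] obtain \<pi> where \<pi>: "\<pi> permutes {..<n}" "\<forall>i<n. Y i = \<xi> (\<pi> i)" by blast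
  show ?thesis
  proof (intro exI[of _ r] exI[of _ "\<lambda>k i. X (r k) (\<pi> i)"] conjI allI impI)
    show "(\<lambda>k. X (r k) (\<pi> i)) \<longlonglongrightarrow> Y i" if "i < n" for i
      using \<xi>[of "\<pi> i"] \<pi> that permutes_in_image[OF \<pi>(1), of i] by simp
  qed (use r splits_permute[OF p \<pi>(1)] in auto)
qed

text \<open>
  The roots can be labelled so that each of them is continuous at the given point, whatever the
  multiplicities: choose a labelling that is nearly closest to the given one.
\<close>
lemma root_selection:
  fixes p :: "complex \<Rightarrow> complex poly"
  assumes lim: "\<And>i. ((\<lambda>y. coeff (p y) i) \<longlongrightarrow> coeff (p y0) i) (at y0)"
    and deg: "\<And>y. degree (p y) \<le> n" and Y: "splits n (p y0) Y"
  shows "\<exists>x. (\<forall>y. coeff (p y) n \<noteq> 0 \<longrightarrow> splits n (p y) (\<lambda>i. x i y)) \<and>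
    (\<forall>i<n. x i y0 = Y i \<and> (x i \<longlongrightarrow> Y i) (at y0))"
proof -
  define D where "D = (\<lambda>Z. \<Sum>i<n. dist (Z i) (Y i))"
  \<comment> \<open>The slack \<open>dist y y0\<close> makes it unnecessary to attain the infimum;
    it vanishes at \<open>y0\<close>, where \<open>Y\<close> itself is at distance 0.\<close>
  have "\<exists>Z. coeff (p y) n \<noteq> 0 \<longrightarrow> splits n (p y) Z \<and>
      (\<forall>Z'. splits n (p y) Z' \<longrightarrow> D Z \<le> D Z' + dist y y0)" for y
  proof (cases "coeff (p y) n \<noteq> 0 \<and> y \<noteq> y0")
    case True
    let ?S = "D ` {Z. splits n (p y) Z}"
    have "degree (p y) = n" "p y \<noteq> 0" using deg[of y] True by (auto intro: le_antisym le_degree)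
    then have ne: "?S \<noteq> {}" using splits_exists by auto
    have bdd: "bdd_below ?S" by (intro bdd_belowI[of _ 0]) (auto simp: D_def intro: sum_nonneg)
    have "Inf ?S < Inf ?S + dist y y0" using True by simp
    then obtain Z where Z: "splits n (p y) Z" "D Z < Inf ?S + dist y y0"
      using cInf_lessD[OF ne] by blast
    have "D Z \<le> D Z' + dist y y0" if "splits n (p y) Z'" for Z'
      using cInf_lower[OF _ bdd, of "D Z'"] Z that by auto
    then show ?thesis using Z by blast
  next
    case False
    then show ?thesis using Y by (intro exI[of _ Y]) (auto simp: D_def intro!: sum_nonneg)
  qed
  then obtain Z where Z: "\<And>y. coeff (p y) n \<noteq> 0 \<longrightarrow> splits n (p y) (Z y) \<and>
      (\<forall>Z'. splits n (p y) Z' \<longrightarrow> D (Z y) \<le> D Z' + dist y y0)" by metis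
  define x where "x = (\<lambda>i y. Z y i)"
  have nz0: "coeff (p y0) n \<noteq> 0" using Y by (simp add: splits_def)
  then have "D (Z y0) \<le> D Y + dist y0 y0" using Z[of y0] Y by blast
  then have "D (Z y0) \<le> 0" by (simp add: D_def)
  moreover have "dist (Z y0 i) (Y i) \<le> D (Z y0)" if "i < n" for i
    unfolding D_def using that by (intro member_le_sum) auto
  ultimately have at: "x i y0 = Y i" if "i < n" for i
    unfolding x_def using that by (metis dist_le_zero_iff order_trans)
  have D: "((\<lambda>y. D (Z y)) \<longlongrightarrow> 0) (at y0)"
  proof (rule ccontr)
    \<comment> \<open>Otherwise the chosen labellings stay at distance at least \<open>e\<close>
      along a sequence tending to \<open>y0\<close>, while \<open>roots_limit\<close> yields
      labellings arbitrarily close to \<open>Y\<close>, against near minimality.\<close>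
    assume "\<not> ((\<lambda>y. D (Z y)) \<longlongrightarrow> 0) (at y0)"
    then obtain e where e: "e > 0" "\<And>\<delta>. \<delta> > 0 \<Longrightarrow> \<exists>y. y \<noteq> y0 \<and> dist y y0 < \<delta> \<and> \<not> D (Z y) < e"
      unfolding LIM_def by (auto simp: D_def abs_of_nonneg sum_nonneg)
    have "eventually (\<lambda>y. coeff (p y) n \<noteq> 0) (at y0)"
      using lim[of n] nz0 by (rule tendsto_imp_eventually_ne)
    then obtain \<delta>0 where \<delta>0: "\<delta>0 > 0" "\<And>y. y \<noteq> y0 \<Longrightarrow> dist y y0 < \<delta>0 \<Longrightarrow> coeff (p y) n \<noteq> 0"
      by (auto simp: eventually_at)
    have "\<exists>y. y \<noteq> y0 \<and> dist y y0 < min \<delta>0 (inverse (real (Suc k))) \<and> \<not> D (Z y) < e" for k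
      by (rule e(2)) (use \<delta>0(1) in simp)
    then obtain s where s: "\<And>k. s k \<noteq> y0 \<and> dist (s k) y0 < min \<delta>0 (inverse (real (Suc k))) \<and> \<not> D (Z (s k)) < e"
      by metis
    have lims: "s \<longlonglongrightarrow> y0"
    proof (rule LIMSEQ_I)
      fix \<epsilon> :: real assume "\<epsilon> > 0"
      then obtain k0 where "inverse (real (Suc k0)) < \<epsilon>" using reals_Archimedean by blast
      moreover have "norm (s k - y0) < inverse (real (Suc k0))" if "k \<ge> k0" for k
      proof -
        have "norm (s k - y0) < inverse (real (Suc k))" using s[of k] by (simp add: dist_norm)
        also have "\<dots> \<le> inverse (real (Suc k0))" using that by (simp add: field_simps)
        finally show ?thesis .
      qed
      ultimately show "\<exists>k0. \<forall>k\<ge>k0. norm (s k - y0) < \<epsilon>" by (meson less_trans)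
    qed
    have spl: "splits n (p (s k)) (Z (s k))" for k using s[of k] \<delta>0 Z[of "s k"] by auto
    have "(\<lambda>k. coeff (p (s k)) i) \<longlonglongrightarrow> coeff (p y0) i" for i
      by (rule tendsto_compose_at[OF lims lim[of i], simplified comp_def]) (use s in auto)
    from roots_limit[OF spl this Y] obtain r X' where X': "strict_mono r"
      "\<forall>k. splits n (p (s (r k))) (X' k)" "\<forall>i<n. (\<lambda>k. X' k i) \<longlonglongrightarrow> Y i" by blast
    have "(\<lambda>k. D (X' k) + dist (s (r k)) y0) \<longlonglongrightarrow> (\<Sum>i<n. dist (Y i) (Y i)) + dist y0 y0"
      unfolding D_def using X' LIMSEQ_subseq_LIMSEQ[OF lims X'(1)]
      by (intro tendsto_intros) (auto simp: comp_def)
    then have "(\<lambda>k. D (X' k) + dist (s (r k)) y0) \<longlonglongrightarrow> 0" by simp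
    then have "eventually (\<lambda>k. D (X' k) + dist (s (r k)) y0 < e) sequentially"
      using e(1) by (rule order_tendstoD)
    then obtain k where "D (X' k) + dist (s (r k)) y0 < e" by (auto simp: eventually_sequentially)
    moreover have "D (Z (s (r k))) \<le> D (X' k) + dist (s (r k)) y0"
      using Z[of "s (r k)"] X'(2) s[of "r k"] \<delta>0 by auto
    ultimately show False using s[of "r k"] by auto
  qed
  have "(x i \<longlongrightarrow> Y i) (at y0)" if "i < n" for i
  proof -
    have "((\<lambda>y. dist (x i y) (Y i)) \<longlongrightarrow> 0) (at y0)"
    proof (rule tendsto_sandwich[OF _ _ tendsto_const D])
      show "eventually (\<lambda>y. dist (x i y) (Y i) \<le> D (Z y)) (at y0)"
        unfolding D_def x_def using that by (intro always_eventually allI member_le_sum) auto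
    qed auto
    then show ?thesis by (rule tendsto_dist_iff[THEN iffD2])
  qed
  then show ?thesis using at Z by (intro exI[of _ x]) (auto simp: x_def)
qed

section \<open>Polynomial families in one parameter\<close>

text \<open>The uniform bound on the degree makes such a family a polynomial in both variables, see
  \<open>family_eval\<close>.\<close>

definition family :: "(complex \<Rightarrow> complex poly) \<Rightarrow> bool" where
  "family p \<longleftrightarrow> polyfam {\<lambda>y. y} p \<and> (\<exists>N. \<forall>y. degree (p y) \<le> N)"

lemma polyfun_id: "f \<in> polyfun {\<lambda>y. y} \<longleftrightarrow> (\<exists>q. \<forall>y. f y = poly q y)"
proof
  assume "f \<in> polyfun {\<lambda>y. y}"
  then show "\<exists>q. \<forall>y. f y = poly q y"
  proof (induction rule: polyfun.induct)
    case (const c)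
    show ?case by (intro exI[of _ "[:c:]"]) simp
  next
    case (coord x)
    then show ?case by (intro exI[of _ "[:0, 1:]"]) simp
  next
    case (add f g)
    then show ?case by (metis poly_add)
  next
    case (mult f g)
    then show ?case by (metis poly_mult)
  qed
next
  assume "\<exists>q. \<forall>y. f y = poly q y"
  then obtain q where "f = (\<lambda>y. poly q y)" by blast
  moreover have "(\<lambda>y. poly q y) \<in> polyfun {\<lambda>y. y}"
  proof (induction q)
    case 0
    show ?case by (simp add: polyfun.const)
  next
    case (pCons a q)
    have "(\<lambda>y. y) \<in> polyfun {\<lambda>y. y}" by (rule polyfun.coord) simp
    then show ?case using pCons by (simp add: polyfun.add polyfun.mult polyfun.const)
  qed
  ultimately show "f \<in> polyfun {\<lambda>y. y}" by simp
qed

lemma polyfun_id_deriv: "f \<in> polyfun {\<lambda>y. y} \<Longrightarrow> f field_differentiable (at y)"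
  unfolding polyfun_id by (metis (no_types) field_differentiable_def ext poly_DERIV)

lemma polyfun_id_tendsto: "f \<in> polyfun {\<lambda>y. y} \<Longrightarrow> (f \<longlongrightarrow> f y) (at y)"
  using polyfun_id_deriv field_differentiable_imp_continuous_at continuous_at by blast

lemma family_coeff: "family p \<Longrightarrow> (\<lambda>y. coeff (p y) i) \<in> polyfun {\<lambda>y. y}"
  by (simp add: family_def polyfam_def)

lemma family_mult: "family p \<Longrightarrow> family q \<Longrightarrow> family (\<lambda>y. p y * q y)"
proof -
  assume pq: "family p" "family q"
  then obtain N M where "\<And>y. degree (p y) \<le> N" "\<And>y. degree (q y) \<le> M" by (auto simp: family_def)
  then have "degree (p y * q y) \<le> N + M" for y by (meson add_mono degree_mult_le order_trans)
  then show ?thesis using pq by (auto simp: family_def polyfam_mult)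
qed

lemma family_diff: "family p \<Longrightarrow> family q \<Longrightarrow> family (\<lambda>y. p y - q y)"
proof -
  assume pq: "family p" "family q"
  then obtain N M where "\<And>y. degree (p y) \<le> N" "\<And>y. degree (q y) \<le> M" by (auto simp: family_def)
  then have "degree (p y - q y) \<le> max N M" for y
    by (intro degree_diff_le) (auto intro: le_max_iff_disj[THEN iffD2])
  then show ?thesis using pq by (auto simp: family_def polyfam_diff)
qed

lemma family_pderiv: "family p \<Longrightarrow> family (\<lambda>y. pderiv (p y))"
proof -
  assume p: "family p"
  then obtain N where N: "\<And>y. degree (p y) \<le> N" by (auto simp: family_def)
  have "degree (pderiv (p y)) \<le> N" for y using N[of y] by (simp add: degree_pderiv)
  moreover have "polyfam {\<lambda>y. y} (\<lambda>y. pderiv (p y))"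
    using p by (auto simp: family_def polyfam_def coeff_pderiv intro!: polyfun.mult polyfun.const)
  ultimately show ?thesis by (auto simp: family_def)
qed

lemma family_pderivs: "family p \<Longrightarrow> family (\<lambda>y. (pderiv ^^ k) (p y))"
  by (induction k) (auto dest: family_pderiv)

lemma family_eval:
  assumes "family p"
  shows "\<exists>N c. \<forall>y x. poly (p y) x = (\<Sum>i\<le>N. poly (c i) y * x ^ i)"
proof -
  from assms obtain N where N: "\<And>y. degree (p y) \<le> N" by (auto simp: family_def)
  have "\<forall>i. \<exists>q. \<forall>y. coeff (p y) i = poly q y" using family_coeff[OF assms] by (simp add: polyfun_id)
  then obtain c where c: "\<And>i y. coeff (p y) i = poly (c i) y" by metis
  show ?thesis
  proof (intro exI allI)
    fix y x
    have "poly (p y) x = (\<Sum>i\<le>N. coeff (p y) i * x ^ i)"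
      using N by (rule poly_bounded_sum)
    then show "poly (p y) x = (\<Sum>i\<le>N. poly (c i) y * x ^ i)" by (simp add: c)
  qed
qed

lemma family_tendsto:
  assumes "family p" "(x \<longlongrightarrow> a) (at y0)"
  shows "((\<lambda>y. poly (p y) (x y)) \<longlongrightarrow> poly (p y0) a) (at y0)"
proof -
  from family_eval[OF assms(1)] obtain N c where *: "\<And>y x. poly (p y) x = (\<Sum>i\<le>N. poly (c i) y * x ^ i)" by blast
  show ?thesis unfolding * by (intro tendsto_intros assms)
qed

lemma family_deriv:
  assumes "family p" "x field_differentiable (at y0)"
  shows "(\<lambda>y. poly (p y) (x y)) field_differentiable (at y0)"
proof -
  from family_eval[OF assms(1)] obtain N c where *: "\<And>y x. poly (p y) x = (\<Sum>i\<le>N. poly (c i) y * x ^ i)" by blast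
  have "(\<lambda>y. poly (c i) y) field_differentiable (at y0)" for i
    using poly_DERIV field_differentiable_def by blast
  then show ?thesis unfolding * using assms(2)
    by (intro field_differentiable_sum field_differentiable_mult field_differentiable_power) auto
qed

section \<open>Critical points of a pencil of binary forms\<close>

definition wronskian :: "complex poly \<Rightarrow> complex poly \<Rightarrow> complex poly" where
  "wronskian f g = pderiv f * g - f * pderiv g"

text \<open>The Taylor coefficient of order \<open>k\<close> at \<open>a\<close>, equal to the
  \<open>k\<close>-th derivative divided by \<open>fact k\<close> (\<open>tc_eq\<close>).\<close>

definition tc :: "complex poly \<Rightarrow> nat \<Rightarrow> complex \<Rightarrow> complex" where
  "tc p k a = coeff (pcompose p [:a, 1:]) k"

lemma tc_0: "tc p 0 a = poly p a"
  by (simp add: tc_def)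

lemma tc_Suc: "of_nat (Suc k) * tc p (Suc k) a = tc (pderiv p) k a"
proof -
  have "of_nat (Suc k) * tc p (Suc k) a = coeff (pderiv (pcompose p [:a, 1:])) k"
    by (simp only: tc_def coeff_pderiv)
  also have "pderiv (pcompose p [:a, 1:]) = pcompose (pderiv p) [:a, 1:]"
    by (simp add: pderiv_pcompose pderiv_pCons)
  finally show ?thesis by (simp add: tc_def)
qed

lemma tc_eq: "tc p k a = poly ((pderiv ^^ k) p) a / fact k"
proof (induction k arbitrary: p)
  case 0
  show ?case by (simp add: tc_0)
next
  case (Suc k)
  have "of_nat (Suc k) * tc p (Suc k) a = poly ((pderiv ^^ k) (pderiv p)) a / fact k"
    unfolding tc_Suc Suc by simp
  then show ?case by (simp add: funpow_swap1 field_simps del: of_nat_Suc)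
qed

lemma tc_1: "tc p 1 a = poly (pderiv p) a"
  using tc_Suc[of 0 p a] by (simp add: tc_0)

lemma tc_2: "2 * tc p 2 a = poly (pderiv (pderiv p)) a"
  using tc_Suc[of 1 p a] tc_1[of "pderiv p" a] by (simp add: numeral_2_eq_2)

lemma tc_3: "6 * tc p 3 a = poly (pderiv (pderiv (pderiv p))) a"
proof -
  have "3 * tc p 3 a = tc (pderiv p) 2 a" using tc_Suc[of 2 p a] by (simp add: numeral_3_eq_3)
  then have "2 * (3 * tc p 3 a) = poly (pderiv (pderiv (pderiv p))) a" using tc_2[of "pderiv p" a] by simp
  then show ?thesis by simp
qed

lemma taylor:
  assumes "degree p \<le> N"
  shows "poly p x = (\<Sum>k\<le>N. tc p k a * (x - a) ^ k)"
proof -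
  have "poly p x = poly (\<Sum>m\<le>N. smult (tc p m a) ([:- a, 1:] ^ m)) x"
    unfolding tc_def by (simp only: poly_recentre[OF assms, symmetric])
  then show ?thesis by (simp add: poly_sum)
qed

lemma lin_power_dvd:
  assumes "\<And>k. k < m \<Longrightarrow> tc p k a = 0"
  shows "lin a ^ m dvd p"
proof -
  have "lin a ^ m dvd (\<Sum>k\<le>degree p. smult (tc p k a) (lin a ^ k))"
  proof (rule dvd_sum)
    fix k
    show "lin a ^ m dvd smult (tc p k a) (lin a ^ k)"
      using assms[of k] by (cases "k < m") (simp_all add: dvd_smult le_imp_power_dvd)
  qed
  then show ?thesis using poly_recentre[of p "degree p" a] by (simp add: tc_def lin_def)
qed

lemma lin_square_dvd: "lin a ^ 2 dvd p \<longleftrightarrow> poly p a = 0 \<and> poly (pderiv p) a = 0"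
proof
  assume "lin a ^ 2 dvd p"
  then obtain q where "p = lin a ^ 2 * q" by (elim dvdE)
  then show "poly p a = 0 \<and> poly (pderiv p) a = 0"
    by (simp add: pderiv_mult power2_eq_square)
next
  assume "poly p a = 0 \<and> poly (pderiv p) a = 0"
  then show "lin a ^ 2 dvd p"
    by (intro lin_power_dvd) (auto simp: less_2_cases_iff tc_0 tc_1[unfolded One_nat_def])
qed

lemma lin_cancel:
  assumes "a \<noteq> b" "lin a ^ i dvd lin b ^ j * q"
  shows "lin a ^ i dvd q"
proof (cases "q = 0")
  case False
  have "order a (lin b ^ j) = 0" using assms(1) by (intro order_0I) simp
  then have "order a (lin b ^ j * q) = order a q" using False by (simp add: order_mult)
  then show ?thesis using assms(2) False by (simp add: lin_def order_divides)
qed simp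

lemma lin_mult_dvd:
  assumes "a \<noteq> b" "lin a ^ i dvd p" "lin b ^ j dvd p"
  shows "lin a ^ i * lin b ^ j dvd p"
proof -
  obtain q where q: "p = lin b ^ j * q" using assms(3) by (elim dvdE)
  then have "lin a ^ i dvd q" using lin_cancel[OF assms(1)] assms(2) by blast
  then show ?thesis unfolding q by (simp add: mult.commute[of "lin a ^ i"] mult_dvd_mono)
qed

lemma lin_mult_dvd3:
  assumes "a \<noteq> b" "a \<noteq> c" "b \<noteq> c" "lin a ^ i dvd p" "lin b ^ j dvd p" "lin c ^ k dvd p"
  shows "lin a ^ i * lin b ^ j * lin c ^ k dvd p"
proof -
  obtain q where q: "p = lin c ^ k * q" using assms(6) by (elim dvdE)
  then have "lin a ^ i dvd q" "lin b ^ j dvd q" using lin_cancel assms by blast+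
  then have "lin a ^ i * lin b ^ j dvd q" by (rule lin_mult_dvd[OF assms(1)])
  then show ?thesis unfolding q by (simp add: mult.commute[of "lin a ^ i * lin b ^ j"] mult_dvd_mono)
qed

text \<open>
  A Bezoutian of the pencil divided by the cube of \<open>x - a\<close>, corrected by terms that vanish at
  critical points.
\<close>
definition kern :: "nat \<Rightarrow> complex poly \<Rightarrow> complex poly \<Rightarrow> complex \<Rightarrow> complex \<Rightarrow> complex" where
  "kern d f g a x =
     (\<Sum>k=3..d. (tc f k a * poly g a - poly f a * tc g k a) * (x - a) ^ (k - 3)) -
     (\<Sum>k=2..2*d. tc (wronskian f g) k a * (x - a) ^ (k - 2)) / 2"

lemma pderiv_wronskian:
  "pderiv (wronskian f g) = pderiv (pderiv f) * g - f * pderiv (pderiv g)"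
  by (simp add: wronskian_def pderiv_diff pderiv_mult algebra_simps)

lemma degree_wronskian_le:
  assumes "degree f \<le> d" "degree g \<le> d"
  shows "degree (wronskian f g) \<le> 2 * d"
  unfolding wronskian_def
proof (intro degree_diff_le)
  show "degree (pderiv f * g) \<le> 2 * d"
    using assms degree_mult_le[of "pderiv f" g] by (simp add: degree_pderiv)
  show "degree (f * pderiv g) \<le> 2 * d"
    using assms degree_mult_le[of f "pderiv g"] by (simp add: degree_pderiv)
qed

text \<open>Expand the left side in \<open>u = x - a\<close>. Its coefficients of orders 0, 1, 2 are
  0, \<open>W(a)\<close> and \<open>W'(a) / 2\<close>, exactly those of \<open>u\<close> times the
  mean of \<open>W(x)\<close> and \<open>W(a)\<close>. What remains is divisible by
  \<open>u^3\<close>, and \<open>kern\<close> is the quotient.\<close>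

lemma kern_identity:
  assumes "degree f \<le> d" "degree g \<le> d" "d \<ge> 3"
  shows "poly f x * poly g a - poly f a * poly g x =
    (x - a) * ((poly (wronskian f g) x + poly (wronskian f g) a) / 2 + (x - a)^2 * kern d f g a x)"
proof -
  let ?W = "wronskian f g"
  define u where "u = x - a"
  define c where "c = (\<lambda>k. tc f k a * poly g a - poly f a * tc g k a)"
  have pow: "u ^ k = u ^ m * u ^ (k - m)" if "m \<le> k" for k m
    using that by (metis le_add_diff_inverse power_add)
  have split3: "(\<Sum>k\<le>d. h k) = h 0 + h 1 + h 2 + (\<Sum>k=3..d. h k)" for h :: "nat \<Rightarrow> complex"
  proof -
    have "{..d} = insert 0 (insert 1 (insert 2 {3..d}))" using assms(3) by auto
    then show ?thesis by (simp add: add.assoc)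
  qed
  have split2: "(\<Sum>k\<le>2*d. h k) = h 0 + h 1 + (\<Sum>k=2..2*d. h k)" for h :: "nat \<Rightarrow> complex"
  proof -
    have "{..2*d} = insert 0 (insert 1 {2..2*d})" using assms(3) by auto
    then show ?thesis by (simp add: add.assoc)
  qed
  have "poly f x * poly g a - poly f a * poly g x = (\<Sum>k\<le>d. c k * u ^ k)"
    unfolding taylor[OF assms(1), of x a] taylor[OF assms(2), of x a] c_def u_def
    by (simp add: sum_distrib_left sum_distrib_right sum_subtractf[symmetric] algebra_simps)
  also have "\<dots> = c 0 + c 1 * u + c 2 * u^2 + (\<Sum>k=3..d. c k * u ^ k)"
    unfolding split3 by simp
  also have "(\<Sum>k=3..d. c k * u ^ k) = u^3 * (\<Sum>k=3..d. c k * u ^ (k - 3))"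
    unfolding sum_distrib_left by (rule sum.cong[OF refl], subst pow[of 3]) simp_all
  finally have E: "poly f x * poly g a - poly f a * poly g x =
    c 0 + c 1 * u + c 2 * u^2 + u^3 * (\<Sum>k=3..d. c k * u ^ (k - 3))" .
  have "poly ?W x = tc ?W 0 a + tc ?W 1 a * u + (\<Sum>k=2..2*d. tc ?W k a * u ^ k)"
    unfolding taylor[OF degree_wronskian_le[OF assms(1,2)], of x a] split2 by (simp add: u_def)
  also have "(\<Sum>k=2..2*d. tc ?W k a * u ^ k) = u^2 * (\<Sum>k=2..2*d. tc ?W k a * u ^ (k - 2))"
    unfolding sum_distrib_left by (rule sum.cong[OF refl], subst pow[of 2]) simp_all
  finally have W: "poly ?W x = tc ?W 0 a + tc ?W 1 a * u + u^2 * (\<Sum>k=2..2*d. tc ?W k a * u ^ (k - 2))" .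
  have c0: "c 0 = 0" by (simp add: c_def tc_0)
  have c1: "c 1 = poly ?W a" unfolding c_def tc_1 by (simp add: wronskian_def)
  have c2: "2 * c 2 = tc ?W 1 a"
    unfolding tc_1 c_def pderiv_wronskian by (simp add: tc_2[symmetric] algebra_simps)
  have K: "kern d f g a x = (\<Sum>k=3..d. c k * u ^ (k - 3)) - (\<Sum>k=2..2*d. tc ?W k a * u ^ (k - 2)) / 2"
    by (simp add: kern_def c_def u_def)
  show ?thesis unfolding E K W u_def[symmetric] c0 c1 c2[symmetric] tc_0
    by (simp add: field_simps power2_eq_square power3_eq_cube)
qed

lemma kern_root:
  assumes "degree f \<le> d" "degree g \<le> d" "d \<ge> 3" "poly (wronskian f g) x = 0" "poly (wronskian f g) a = 0"
  shows "poly f x * poly g a - poly f a * poly g x = (x - a)^3 * kern d f g a x"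
  using kern_identity[OF assms(1-3), of x a] assms(4,5) by (simp add: power2_eq_square power3_eq_cube)

lemma kern_root_eq:
  assumes "degree f \<le> d" "degree g \<le> d" "d \<ge> 3" "poly (wronskian f g) x = 0" "poly (wronskian f g) a = 0" "x \<noteq> a"
  shows "kern d f g a x = (poly f x * poly g a - poly f a * poly g x) / (x - a)^3"
  using kern_root[OF assms(1-5)] assms(6) by simp

lemma kern_root_sym:
  assumes "degree f \<le> d" "degree g \<le> d" "d \<ge> 3" "poly (wronskian f g) x = 0" "poly (wronskian f g) a = 0" "x \<noteq> a"
  shows "kern d f g a x = kern d f g x a"
proof -
  have "kern d f g x a = (poly f a * poly g x - poly f x * poly g a) / (a - x)^3"
    using kern_root_eq[of f d g a x] assms by simp
  also have "(a - x)^3 = - ((x - a)^3)" by (simp add: power3_eq_cube algebra_simps)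
  finally show ?thesis unfolding kern_root_eq[OF assms] by (simp add: minus_divide_left)
qed

lemma kern_diag:
  assumes "d \<ge> 3"
  shows "kern d f g a a = tc f 3 a * poly g a - poly f a * tc g 3 a - tc (wronskian f g) 2 a / 2"
proof -
  have "(\<Sum>k=3..d. (tc f k a * poly g a - poly f a * tc g k a) * (a - a) ^ (k - 3)) =
     (\<Sum>k\<in>{3}. (tc f k a * poly g a - poly f a * tc g k a) * (a - a) ^ (k - 3))"
    using assms by (intro sum.mono_neutral_right) auto
  moreover have "(\<Sum>k=2..2*d. tc (wronskian f g) k a * (a - a) ^ (k - 2)) =
     (\<Sum>k\<in>{2}. tc (wronskian f g) k a * (a - a) ^ (k - 2))"
    using assms by (intro sum.mono_neutral_right) auto
  ultimately show ?thesis by (simp add: kern_def)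
qed

lemma wronskian_swap: "wronskian g f = - wronskian f g"
  by (simp add: wronskian_def algebra_simps)

lemma wronskian_member: "wronskian (f + smult t g) g = wronskian f g"
  by (simp add: wronskian_def pderiv_add pderiv_smult algebra_simps)

lemma tc_add: "tc (p + q) k a = tc p k a + tc q k a"
  by (simp add: tc_def pcompose_add)

lemma tc_smult: "tc (smult t p) k a = t * tc p k a"
  by (simp add: tc_def pcompose_smult)

lemma tc_uminus: "tc (- p) k a = - tc p k a"
  by (simp add: tc_def pcompose_uminus)

text \<open>A double root of the Wronskian makes the first two derivatives of \<open>h\<close>
  vanish at \<open>a\<close>, and then the diagonal value of \<open>kern\<close> is
  \<open>tc h 3 a * poly g a\<close> times \<open>- 1 / 2\<close>.\<close>

lemma hyperflex_aux:
  assumes d: "d \<ge> 3" and W: "poly (wronskian h g) a = 0" "poly (pderiv (wronskian h g)) a = 0"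
    and h: "poly h a = 0" "poly g a \<noteq> 0" and K: "kern d h g a a = 0"
  shows "lin a ^ 4 dvd h"
proof -
  have 1: "poly (pderiv h) a = 0" using W(1) h by (simp add: wronskian_def)
  have 2: "poly (pderiv (pderiv h)) a = 0" using W(2) h by (simp add: pderiv_wronskian)
  have "2 * tc (wronskian h g) 2 a = poly (pderiv (pderiv (pderiv h))) a * poly g a"
    unfolding tc_2 pderiv_wronskian by (simp add: pderiv_diff pderiv_mult 1 2 h)
  also have "\<dots> = 6 * tc h 3 a * poly g a" by (simp add: tc_3)
  finally have "tc (wronskian h g) 2 a = 3 * tc h 3 a * poly g a" by simp
  then have "tc h 3 a = 0" using K h by (simp add: kern_diag[OF d])
  moreover have "tc h 2 a = 0" using tc_2[of h a] 2 by simp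
  moreover have "tc h 1 a = 0" using 1 by (simp only: tc_1)
  moreover have "tc h 0 a = 0" using h by (simp only: tc_0)
  moreover have "k = 0 \<or> k = 1 \<or> k = 2 \<or> k = 3" if "k < 4" for k :: nat using that by linarith
  ultimately show ?thesis by (intro lin_power_dvd) metis
qed

text \<open>Here \<open>g\<close> stands for the member at \<open>t = infinity\<close>.\<close>

definition members :: "complex poly \<Rightarrow> complex poly \<Rightarrow> complex poly set" where
  "members f g = insert g (range (\<lambda>t. f + smult t g))"

lemma member_through: "\<exists>m\<in>members f g. poly m a = 0"
proof (cases "poly g a = 0")
  case False
  then have "poly (f + smult (- poly f a / poly g a) g) a = 0" by simp
  then show ?thesis unfolding members_def by blast
qed (auto simp: members_def)

lemma member_critical:
  assumes "m \<in> members f g" "poly m a = 0" "poly (wronskian f g) a = 0"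
    "\<not> (poly f a = 0 \<and> poly g a = 0)"
  shows "lin a ^ 2 dvd m"
proof -
  from assms(1) consider "m = g" | t where "m = f + smult t g" by (auto simp: members_def)
  then have "poly (pderiv m) a = 0"
  proof cases
    case 1
    then show ?thesis using assms by (auto simp: wronskian_def)
  next
    case 2
    then have "poly (wronskian m g) a = 0" using assms(3) by (simp add: wronskian_member)
    then show ?thesis using assms(2,4) 2 by (auto simp: wronskian_def)
  qed
  then show ?thesis using assms(2) by (simp add: lin_square_dvd)
qed

lemma member_shared:
  assumes "m \<in> members f g" "poly m a = 0" "\<not> (poly f a = 0 \<and> poly g a = 0)"
    "poly f b * poly g a = poly f a * poly g b"
  shows "poly m b = 0"
proof -
  from assms(1) consider "m = g" | t where "m = f + smult t g" by (auto simp: members_def)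
  then show ?thesis
  proof cases
    case 1
    then show ?thesis using assms by auto
  next
    case 2
    then have fa: "poly f a = - t * poly g a" using assms(2) by (simp add: eq_neg_iff_add_eq_0)
    then have "poly g a \<noteq> 0" using assms(3) by auto
    moreover have "poly g a * poly m b = 0" using assms(4) 2 fa by (simp add: algebra_simps)
    ultimately show ?thesis by simp
  qed
qed

text \<open>The diagonal of \<open>kern\<close> does not change when \<open>f\<close> is replaced by
  \<open>f + t g\<close>, and changes sign when \<open>f\<close> and \<open>g\<close> are exchanged.
  Hence the member through \<open>a\<close> may be put in first place.\<close>

lemma hyperflex:
  assumes d: "d \<ge> 3" and W: "poly (wronskian f g) a = 0" "poly (pderiv (wronskian f g)) a = 0"
    and nb: "\<not> (poly f a = 0 \<and> poly g a = 0)" and K: "kern d f g a a = 0"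
  shows "\<exists>m\<in>members f g. lin a ^ 4 dvd m"
proof (cases "poly g a = 0")
  case False
  define t where "t = - poly f a / poly g a"
  define h where "h = f + smult t g"
  have h0: "poly h a = 0" using False by (simp add: h_def t_def)
  have Wh: "wronskian h g = wronskian f g" by (simp add: h_def wronskian_member)
  have "kern d h g a a = kern d f g a a"
    unfolding kern_diag[OF d] Wh by (simp add: h_def tc_add tc_smult algebra_simps)
  then have "lin a ^ 4 dvd h" using hyperflex_aux[OF d _ _ h0 False] W K by (simp add: Wh)
  then show ?thesis by (auto simp: members_def h_def)
next
  case True
  have "kern d g f a a = - kern d f g a a"
    unfolding kern_diag[OF d] wronskian_swap[of g f] by (simp add: tc_uminus algebra_simps)
  then have "lin a ^ 4 dvd g"
    using hyperflex_aux[OF d, of g f a] W K True nb by (simp add: wronskian_swap[of g f] pderiv_minus)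
  then show ?thesis by (auto simp: members_def)
qed

lemma splits_double_root:
  assumes "splits n p X" "i < n" "j < n" "i \<noteq> j" "X i = X j"
  shows "poly p (X i) = 0 \<and> poly (pderiv p) (X i) = 0"
proof -
  have "(\<Prod>k<n. lin (X k)) = lin (X i) * (\<Prod>k\<in>{..<n} - {i}. lin (X k))"
    using assms by (simp add: prod.remove)
  also have "(\<Prod>k\<in>{..<n} - {i}. lin (X k)) = lin (X j) * (\<Prod>k\<in>{..<n} - {i} - {j}. lin (X k))"
    using assms by (subst prod.remove[of _ j]) auto
  finally have "(\<Prod>k<n. lin (X k)) = lin (X i) ^ 2 * (\<Prod>k\<in>{..<n} - {i} - {j}. lin (X k))"
    using assms(5) by (simp add: power2_eq_square mult.assoc)
  then have "lin (X i) ^ 2 dvd p"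
    using assms(1) unfolding splits_def by (metis dvd_smult dvd_triv_left)
  then show ?thesis by (simp add: lin_square_dvd)
qed

lemma splits_simple_root:
  assumes "splits n p X" "i < n" "\<And>j. j < n \<Longrightarrow> j \<noteq> i \<Longrightarrow> X j \<noteq> X i"
  shows "poly (pderiv p) (X i) \<noteq> 0"
proof -
  have "(\<Prod>k<n. lin (X k)) = lin (X i) * (\<Prod>k\<in>{..<n} - {i}. lin (X k))"
    using assms by (simp add: prod.remove)
  then have p: "p = smult (coeff p n) (lin (X i) * (\<Prod>k\<in>{..<n} - {i}. lin (X k)))"
    using assms(1) unfolding splits_def by simp
  have "poly (pderiv p) (X i) = coeff p n * (\<Prod>k\<in>{..<n} - {i}. X i - X k)"
    by (subst p) (simp add: pderiv_smult pderiv_mult poly_prod, simp add: lin_def pderiv_pCons)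
  moreover have "(\<Prod>k\<in>{..<n} - {i}. X i - X k) \<noteq> 0"
    using assms(3) by (auto simp: eq_commute[of "X i"])
  ultimately show ?thesis using assms(1) by (simp add: splits_def)
qed

section \<open>The invariant of a pencil on one line\<close>

definition offdiag :: "nat set \<Rightarrow> (nat \<times> nat) set" where
  "offdiag S = {(i, j). i \<in> S \<and> j \<in> S \<and> i \<noteq> j}"

lemma finite_offdiag [simp]: "finite S \<Longrightarrow> finite (offdiag S)"
  by (rule finite_subset[of _ "S \<times> S"]) (auto simp: offdiag_def)

lemma prod_offdiag_insert:
  fixes k :: "nat \<times> nat \<Rightarrow> complex"
  assumes "finite S" "i \<notin> S"
  shows "(\<Prod>p\<in>offdiag (insert i S). k p) = (\<Prod>p\<in>offdiag S. k p) * (\<Prod>j\<in>S. k (i, j) * k (j, i))"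
proof -
  have eq: "offdiag (insert i S) = offdiag S \<union> ((\<lambda>j. (i, j)) ` S \<union> (\<lambda>j. (j, i)) ` S)"
    using assms(2) by (auto simp: offdiag_def)
  have "(\<Prod>p\<in>offdiag (insert i S). k p) =
      (\<Prod>p\<in>offdiag S. k p) * (\<Prod>p\<in>(\<lambda>j. (i, j)) ` S \<union> (\<lambda>j. (j, i)) ` S. k p)"
    unfolding eq using assms finite_offdiag[OF assms(1)]
    by (intro prod.union_disjoint) (auto simp: offdiag_def)
  also have "(\<Prod>p\<in>(\<lambda>j. (i, j)) ` S \<union> (\<lambda>j. (j, i)) ` S. k p) =
      (\<Prod>p\<in>(\<lambda>j. (i, j)) ` S. k p) * (\<Prod>p\<in>(\<lambda>j. (j, i)) ` S. k p)"
    using assms by (intro prod.union_disjoint) auto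
  also have "\<dots> = (\<Prod>j\<in>S. k (i, j)) * (\<Prod>j\<in>S. k (j, i))"
    by (simp add: prod.reindex inj_on_def)
  finally show ?thesis by (simp add: prod.distrib)
qed

text \<open>
  The two factors are the discriminant-like product over pairs of critical points and a power of
  the resultant of \<open>f\<close> and \<open>g\<close>; the quotient is invariant under changes of coordinate and
  detects bitangents.  The exponents make it so.
\<close>
definition bival :: "nat \<Rightarrow> complex poly \<Rightarrow> complex poly \<Rightarrow> (nat \<Rightarrow> complex) \<Rightarrow> (nat \<Rightarrow> complex) \<Rightarrow> complex" where
  "bival d f g X Z =
     coeff (wronskian f g) (2*d-2) ^ (2*(2*d-3)*(d-3)) *
       (\<Prod>(i, j)\<in>offdiag {..<2*d-2}. kern d f g (X i) (X j)) /
     (coeff g d ^ d * (\<Prod>j<d. poly f (Z j))) ^ (4*d-8)"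

text \<open>The choices are harmless: the invariant is symmetric in both sets of roots, so every
  pair of labellings gives the same value (\<open>bifun_eq\<close>).\<close>

definition bifun :: "nat \<Rightarrow> complex poly \<Rightarrow> complex poly \<Rightarrow> complex" where
  "bifun d f g = bival d f g (SOME X. splits (2*d-2) (wronskian f g) X) (SOME Z. splits d g Z)"

lemma bifun_eq:
  assumes X: "splits (2*d-2) (wronskian f g) X" and Z: "splits d g Z"
  shows "bifun d f g = bival d f g X Z"
proof -
  let ?n = "2*d-2"
  define X' where "X' = (SOME X. splits (2*d-2) (wronskian f g) X)"
  define Z' where "Z' = (SOME Z. splits d g Z)"
  have "splits (2*d-2) (wronskian f g) X'" unfolding X'_def using someI[of "splits (2*d-2) (wronskian f g)" X] X by simp
  from splits_unique[OF X this] obtain \<pi> where \<pi>: "\<pi> permutes {..<?n}" "\<forall>i<?n. X' i = X (\<pi> i)" by blast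
  have "splits d g Z'" unfolding Z'_def using someI[of "splits d g" Z] Z by simp
  from splits_unique[OF Z this] obtain \<sigma> where \<sigma>: "\<sigma> permutes {..<d}" "\<forall>i<d. Z' i = Z (\<sigma> i)" by blast
  have "(\<Prod>j<d. poly f (Z' j)) = (\<Prod>j<d. poly f (Z (\<sigma> j)))" using \<sigma>(2) by (intro prod.cong) auto
  also have "\<dots> = (\<Prod>j<d. poly f (Z j))"
    using prod.permute[OF \<sigma>(1), of "\<lambda>j. poly f (Z j)"] by (simp add: comp_def)
  finally have 1: "(\<Prod>j<d. poly f (Z' j)) = (\<Prod>j<d. poly f (Z j))" .
  have mem: "\<pi> i \<in> {..<?n} \<longleftrightarrow> i \<in> {..<?n}" "inv \<pi> i \<in> {..<?n} \<longleftrightarrow> i \<in> {..<?n}" for i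
    by (rule permutes_in_image[OF \<pi>(1)], rule permutes_in_image[OF permutes_inv[OF \<pi>(1)]])
  have inj: "\<pi> i = \<pi> j \<longleftrightarrow> i = j" "inv \<pi> i = inv \<pi> j \<longleftrightarrow> i = j" for i j
    using permutes_inj[OF \<pi>(1)] permutes_inj[OF permutes_inv[OF \<pi>(1)]] by (simp_all add: inj_eq)
  have bij: "bij_betw (\<lambda>(i, j). (\<pi> i, \<pi> j)) (offdiag {..<?n}) (offdiag {..<?n})"
  proof (rule bij_betwI[where g = "\<lambda>(i, j). (inv \<pi> i, inv \<pi> j)"])
    show "(\<lambda>(i, j). (\<pi> i, \<pi> j)) \<in> offdiag {..<?n} \<rightarrow> offdiag {..<?n}"
      by (rule funcsetI, clarsimp simp only: offdiag_def mem inj mem_Collect_eq prod.case, simp)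
    show "(\<lambda>(i, j). (inv \<pi> i, inv \<pi> j)) \<in> offdiag {..<?n} \<rightarrow> offdiag {..<?n}"
      by (rule funcsetI, clarsimp simp only: offdiag_def mem inj mem_Collect_eq prod.case, simp)
  qed (auto simp only: permutes_inverses[OF \<pi>(1)] prod.case split_paired_all)
  have "(\<Prod>(i, j)\<in>offdiag {..<?n}. kern d f g (X' i) (X' j)) =
      (\<Prod>p\<in>offdiag {..<?n}. (\<lambda>(i, j). kern d f g (X i) (X j)) ((\<lambda>(i, j). (\<pi> i, \<pi> j)) p))"
    using \<pi>(2) by (intro prod.cong) (auto simp: offdiag_def)
  also have "\<dots> = (\<Prod>(i, j)\<in>offdiag {..<?n}. kern d f g (X i) (X j))"
    by (rule prod.reindex_bij_betw[OF bij])
  finally show ?thesis unfolding bifun_def X'_def[symmetric] Z'_def[symmetric] bival_def 1 by simp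
qed

definition nzlim :: "complex filter \<Rightarrow> (complex \<Rightarrow> complex) \<Rightarrow> bool" where
  "nzlim F f \<longleftrightarrow> (\<exists>c. c \<noteq> 0 \<and> (f \<longlongrightarrow> c) F)"

lemma nzlimI: "(f \<longlongrightarrow> c) F \<Longrightarrow> c \<noteq> 0 \<Longrightarrow> nzlim F f"
  by (auto simp: nzlim_def)

lemma nzlim_mult: "nzlim F f \<Longrightarrow> nzlim F g \<Longrightarrow> nzlim F (\<lambda>y. f y * g y)"
  unfolding nzlim_def by (metis tendsto_mult mult_eq_0_iff)

lemma nzlim_divide: "nzlim F f \<Longrightarrow> nzlim F g \<Longrightarrow> nzlim F (\<lambda>y. f y / g y)"
  unfolding nzlim_def by (metis tendsto_divide divide_eq_0_iff)

lemma nzlim_const: "c \<noteq> 0 \<Longrightarrow> nzlim F (\<lambda>_. c)"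
  unfolding nzlim_def by (intro exI[of _ c]) auto

lemma nzlim_power: "nzlim F f \<Longrightarrow> nzlim F (\<lambda>y. f y ^ k)"
  unfolding nzlim_def by (metis tendsto_power power_eq_0_iff)

lemma nzlim_uminus: "nzlim F f \<Longrightarrow> nzlim F (\<lambda>y. - f y)"
  unfolding nzlim_def by (metis tendsto_minus neg_equal_0_iff_equal)

lemma nzlim_prod: "(\<And>i. i \<in> I \<Longrightarrow> nzlim F (f i)) \<Longrightarrow> nzlim F (\<lambda>y. \<Prod>i\<in>I. f i y)"
  by (induction I rule: infinite_finite_induct) (auto intro: nzlim_const nzlim_mult)

lemma nzlim_cong: "eventually (\<lambda>y. f y = g y) F \<Longrightarrow> nzlim F g \<Longrightarrow> nzlim F f"
  unfolding nzlim_def using tendsto_cong by blast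

text \<open>The terms of degree \<open>2 * d - 1\<close> cancel, since they form the Wronskian of
  two multiples of \<open>x^d\<close>.\<close>

lemma degree_wronskian:
  assumes "degree f \<le> d" "degree g \<le> d" "d \<ge> 1"
  shows "degree (wronskian f g) \<le> 2 * d - 2"
proof -
  have aux: "degree (pderiv p * q) \<le> 2 * d - 2" if "degree p \<le> i" "degree q \<le> j" "i + j < 2 * d" for p q :: "complex poly" and i j
  proof (cases "degree p = 0")
    case True
    then have "pderiv p = 0" by (simp add: pderiv_eq_0_iff)
    then show ?thesis by simp
  next
    case False
    then show ?thesis using that degree_mult_le[of "pderiv p" q] by (simp add: degree_pderiv)
  qed
  have bil: "degree (wronskian p q) \<le> 2 * d - 2" if "degree p \<le> i" "degree q \<le> j" "i + j < 2 * d" for p q i j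
    unfolding wronskian_def using aux[of p i q j] aux[of q j p i] that
    by (intro degree_diff_le) (auto simp: mult.commute[of p] add.commute)
  define f1 where "f1 = f - monom (coeff f d) d"
  define g1 where "g1 = g - monom (coeff g d) d"
  have lower: "degree f1 \<le> d - 1" "degree g1 \<le> d - 1"
    unfolding f1_def g1_def using assms
    by (auto intro!: degree_le simp: le_degree coeff_eq_0 not_le)
  have top: "wronskian (monom a d) (monom b d) = 0" for a b :: complex
    by (simp add: wronskian_def pderiv_monom mult_monom algebra_simps)
  have "wronskian f g = wronskian (monom (coeff f d) d) g1 + wronskian f1 (monom (coeff g d) d) + wronskian f1 g1"
  proof -
    have f: "f = f1 + monom (coeff f d) d" and g: "g = g1 + monom (coeff g d) d" by (simp_all add: f1_def g1_def)
    have "wronskian (f1 + m) (g1 + m') = wronskian m g1 + wronskian f1 m' + wronskian f1 g1 + wronskian m m'" for m m'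
      by (simp add: wronskian_def pderiv_add algebra_simps)
    then show ?thesis using top by (metis add.right_neutral f g)
  qed
  moreover have "degree (wronskian (monom (coeff f d) d) g1) \<le> 2 * d - 2"
    using assms(3) lower by (intro bil[of _ d _ "d - 1"]) (auto simp: degree_monom_le)
  moreover have "degree (wronskian f1 (monom (coeff g d) d)) \<le> 2 * d - 2"
    using assms(3) lower by (intro bil[of _ "d - 1" _ d]) (auto simp: degree_monom_le)
  moreover have "degree (wronskian f1 g1) \<le> 2 * d - 2"
    using assms(3) lower by (intro bil[of _ "d - 1" _ "d - 1"]) auto
  ultimately show ?thesis by (auto intro!: degree_add_le)
qed

lemma family_tc_tendsto:
  assumes "family p" "(u \<longlongrightarrow> a) (at y0)"
  shows "((\<lambda>y. tc (p y) k (u y)) \<longlongrightarrow> tc (p y0) k a) (at y0)"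
  unfolding tc_eq by (intro tendsto_divide tendsto_const family_tendsto family_pderivs assms) simp

lemma family_tc_deriv:
  assumes "family p" "u field_differentiable (at y0)"
  shows "(\<lambda>y. tc (p y) k (u y)) field_differentiable (at y0)"
  unfolding tc_eq by (intro field_differentiable_divide field_differentiable_const family_deriv family_pderivs assms) simp

lemma family_has_derivative:
  assumes p: "family p" and N: "\<And>y. degree (p y) \<le> N" "degree pd \<le> N"
    and pd: "\<And>i. ((\<lambda>y. coeff (p y) i) has_field_derivative coeff pd i) (at y0)"
    and x: "(x has_field_derivative x') (at y0)"
  shows "((\<lambda>y. poly (p y) (x y)) has_field_derivative
    poly pd (x y0) + poly (pderiv (p y0)) (x y0) * x') (at y0)"
proof -
  have 1: "((\<lambda>y. \<Sum>i\<le>N. coeff (p y) i * x y ^ i) has_field_derivative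
     (\<Sum>i\<le>N. coeff pd i * x y0 ^ i + of_nat i * (x y0 ^ (i - 1) * x') * coeff (p y0) i)) (at y0)"
    by (rule DERIV_sum) (rule DERIV_mult[OF pd] DERIV_power[OF x, THEN DERIV_cong] | simp)+
  have "((\<lambda>z. \<Sum>i\<le>N. coeff (p y0) i * z ^ i) has_field_derivative
     (\<Sum>i\<le>N. of_nat i * z ^ (i - 1) * coeff (p y0) i)) (at z)" for z
    by (auto intro!: derivative_eq_intros sum.cong)
  then have "(poly (p y0) has_field_derivative (\<Sum>i\<le>N. of_nat i * z ^ (i - 1) * coeff (p y0) i)) (at z)" for z
    using poly_bounded_sum[OF N(1)] by presburger
  from DERIV_unique[OF this poly_DERIV] have
    2: "poly (pderiv (p y0)) z = (\<Sum>i\<le>N. of_nat i * z ^ (i - 1) * coeff (p y0) i)" for z by simp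
  show ?thesis
    using 1 unfolding poly_bounded_sum[OF N(1)] poly_bounded_sum[OF N(2)] 2
    by (simp add: sum.distrib sum_distrib_left sum_distrib_right algebra_simps)
qed

text \<open>A direct implicit function argument. Taylor expansion at \<open>a = x y0\<close> gives
  \<open>p_y(x) = p_y(a) + (x - a) Q(y)\<close>, where \<open>Q\<close> tends to the nonzero
  derivative at the root. So the difference quotient of \<open>x\<close> is minus that of
  \<open>p_y(a)\<close> divided by \<open>Q\<close>.\<close>

lemma simple_root_differentiable:
  assumes p: "family p" and x: "(x \<longlongrightarrow> x y0) (at y0)"
    and root: "eventually (\<lambda>y. poly (p y) (x y) = 0) (at y0)"
    and simple: "poly (p y0) (x y0) = 0" "poly (pderiv (p y0)) (x y0) \<noteq> 0"
  shows "x field_differentiable (at y0)"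
proof -
  obtain N where N: "\<And>y. degree (p y) \<le> N" using p by (auto simp: family_def)
  define a where "a = x y0"
  define Q where "Q = (\<lambda>y. \<Sum>k<N. tc (p y) (Suc k) a * (x y - a) ^ k)"
  have "N \<noteq> 0"
  proof
    assume "N = 0"
    then have "pderiv (p y0) = 0" using N[of y0] by (simp add: pderiv_eq_0_iff)
    then show False using simple by simp
  qed
  have eq: "poly (p y) (x y) = poly (p y) a + (x y - a) * Q y" for y
  proof -
    have "poly (p y) (x y) = (\<Sum>k\<le>N. tc (p y) k a * (x y - a) ^ k)" by (rule taylor[OF N])
    also have "\<dots> = tc (p y) 0 a + (\<Sum>k<N. tc (p y) (Suc k) a * (x y - a) ^ Suc k)"
      unfolding lessThan_Suc_atMost[symmetric] by (subst sum.lessThan_Suc_shift) simp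
    finally show ?thesis by (simp add: Q_def tc_0 sum_distrib_left algebra_simps)
  qed
  have "(Q \<longlongrightarrow> (\<Sum>k<N. tc (p y0) (Suc k) a * (a - a) ^ k)) (at y0)"
    unfolding Q_def using x by (intro tendsto_intros family_tc_tendsto p) (auto simp: a_def)
  also have "(\<Sum>k<N. tc (p y0) (Suc k) a * (a - a) ^ k) = (\<Sum>k\<in>{0}. tc (p y0) (Suc k) a * (a - a) ^ k)"
    using \<open>N \<noteq> 0\<close> by (intro sum.mono_neutral_right) auto
  also have "\<dots> = poly (pderiv (p y0)) a" using tc_1[of "p y0" a] by simp
  finally have Q: "(Q \<longlongrightarrow> poly (pderiv (p y0)) a) (at y0)" .
  have Qnz: "eventually (\<lambda>y. Q y \<noteq> 0) (at y0)"
    by (rule tendsto_imp_eventually_ne[OF Q]) (use simple in \<open>simp add: a_def\<close>)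
  have "(\<lambda>y. poly (p y) a) field_differentiable (at y0)"
    by (intro family_deriv p field_differentiable_const)
  then obtain D where "((\<lambda>y. poly (p y) a) has_field_derivative D) (at y0)"
    by (auto simp: field_differentiable_def)
  then have D: "((\<lambda>y. poly (p y) a / (y - y0)) \<longlongrightarrow> D) (at y0)"
    using simple(1) by (simp add: has_field_derivative_iff a_def)
  have L: "((\<lambda>y. - (poly (p y) a / (y - y0)) / Q y) \<longlongrightarrow> - D / poly (pderiv (p y0)) a) (at y0)"
    using D Q simple by (intro tendsto_intros) (auto simp: a_def)
  have ev: "eventually (\<lambda>y. (x y - x y0) / (y - y0) = - (poly (p y) a / (y - y0)) / Q y) (at y0)"
    using Qnz root
  proof eventually_elim
    case (elim y)
    have "poly (p y) a + (x y - a) * Q y = 0" using eq[of y] elim(2) by simp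
    then have "poly (p y) a = - ((x y - a) * Q y)" by (simp add: eq_neg_iff_add_eq_0)
    then show ?case using elim(1) by (simp add: a_def)
  qed
  have "((\<lambda>y. (x y - x y0) / (y - y0)) \<longlongrightarrow> - D / poly (pderiv (p y0)) a) (at y0)"
    using L unfolding tendsto_cong[OF ev] .
  then show ?thesis unfolding field_differentiable_def has_field_derivative_iff by blast
qed

section \<open>The invariant along a family of lines\<close>

locale pencil_family =
  fixes d :: nat and f g :: "complex \<Rightarrow> complex poly"
  assumes d: "d \<ge> 3" and famf: "family f" and famg: "family g"
    and degf: "\<And>y. degree (f y) \<le> d" and degg: "\<And>y. degree (g y) \<le> d"
begin

abbreviation W where "W y \<equiv> wronskian (f y) (g y)"

lemma family_W: "family (\<lambda>y. W y)"
  unfolding wronskian_def by (intro family_diff family_mult family_pderiv famf famg)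

lemma degW: "degree (W y) \<le> 2 * d - 2"
  using degree_wronskian[OF degf degg] d by simp

lemma kern_tendsto:
  assumes "(u \<longlongrightarrow> a) (at y0)" "(v \<longlongrightarrow> b) (at y0)"
  shows "((\<lambda>y. kern d (f y) (g y) (u y) (v y)) \<longlongrightarrow> kern d (f y0) (g y0) a b) (at y0)"
  unfolding kern_def by (intro tendsto_intros family_tc_tendsto family_tendsto famf famg family_W assms) simp

lemma kern_differentiable:
  assumes "u field_differentiable (at y0)" "v field_differentiable (at y0)"
  shows "(\<lambda>y. kern d (f y) (g y) (u y) (v y)) field_differentiable (at y0)"
  unfolding kern_def
  by (intro field_differentiable_diff field_differentiable_sum field_differentiable_mult
      field_differentiable_divide field_differentiable_power field_differentiable_const
      family_tc_deriv family_deriv famf famg family_W assms) simp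

lemma selection:
  assumes "splits (2*d-2) (W y0) X" "splits d (g y0) Z"
  shows "\<exists>x z. (\<forall>i<2*d-2. x i y0 = X i \<and> (x i \<longlongrightarrow> X i) (at y0)) \<and>
    (\<forall>j<d. z j y0 = Z j \<and> (z j \<longlongrightarrow> Z j) (at y0)) \<and>
    eventually (\<lambda>y. splits (2*d-2) (W y) (\<lambda>i. x i y) \<and> splits d (g y) (\<lambda>j. z j y)) (at y0) \<and>
    splits (2*d-2) (W y0) (\<lambda>i. x i y0) \<and> splits d (g y0) (\<lambda>j. z j y0)"
proof -
  have lim: "((\<lambda>y. coeff (p y) i) \<longlongrightarrow> coeff (p y0) i) (at y0)" if "family p" for p i
    using polyfun_id_tendsto[OF family_coeff[OF that]] .
  obtain x where x: "\<And>y. coeff (W y) (2*d-2) \<noteq> 0 \<Longrightarrow> splits (2*d-2) (W y) (\<lambda>i. x i y)"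
    "\<forall>i<2*d-2. x i y0 = X i \<and> (x i \<longlongrightarrow> X i) (at y0)"
    using root_selection[of "\<lambda>y. W y" y0 "2*d-2" X, OF lim[OF family_W] degW assms(1)] by blast
  obtain z where z: "\<And>y. coeff (g y) d \<noteq> 0 \<Longrightarrow> splits d (g y) (\<lambda>i. z i y)"
    "\<forall>i<d. z i y0 = Z i \<and> (z i \<longlongrightarrow> Z i) (at y0)"
    using root_selection[of g y0 d Z, OF lim[OF famg] degg assms(2)] by blast
  have W0: "coeff (W y0) (2*d-2) \<noteq> 0" and g0: "coeff (g y0) d \<noteq> 0" using assms by (auto simp: splits_def)
  have "eventually (\<lambda>y. coeff (W y) (2*d-2) \<noteq> 0) (at y0)" "eventually (\<lambda>y. coeff (g y) d \<noteq> 0) (at y0)"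
    using tendsto_imp_eventually_ne[OF lim[OF family_W] W0] tendsto_imp_eventually_ne[OF lim[OF famg] g0] .
  then have "eventually (\<lambda>y. splits (2*d-2) (W y) (\<lambda>i. x i y) \<and> splits d (g y) (\<lambda>j. z j y)) (at y0)"
    by eventually_elim (use x z in auto)
  then show ?thesis using x(2) z(2) x(1)[OF W0] z(1)[OF g0] by blast
qed

lemma bifun_differentiable:
  assumes X: "splits (2*d-2) (W y0) X" "inj_on X {..<2*d-2}" and Z: "splits d (g y0) Z" "inj_on Z {..<d}"
    and nb: "\<And>a. \<not> (poly (f y0) a = 0 \<and> poly (g y0) a = 0)"
  shows "(\<lambda>y. bifun d (f y) (g y)) field_differentiable (at y0)"
proof -
  from selection[OF X(1) Z(1)] obtain x z where
    x: "\<And>i. i < 2*d-2 \<Longrightarrow> x i y0 = X i" "\<And>i. i < 2*d-2 \<Longrightarrow> (x i \<longlongrightarrow> X i) (at y0)" and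
    z: "\<And>i. i < d \<Longrightarrow> z i y0 = Z i" "\<And>i. i < d \<Longrightarrow> (z i \<longlongrightarrow> Z i) (at y0)" and
    ev: "eventually (\<lambda>y. splits (2*d-2) (W y) (\<lambda>i. x i y) \<and> splits d (g y) (\<lambda>j. z j y)) (at y0)" and
    at: "splits (2*d-2) (W y0) (\<lambda>i. x i y0)" "splits d (g y0) (\<lambda>j. z j y0)" by blast
  have dx: "x i field_differentiable (at y0)" if i: "i < 2*d-2" for i
  proof (rule simple_root_differentiable[OF family_W])
    show "(x i \<longlongrightarrow> x i y0) (at y0)" using x i by simp
    show "eventually (\<lambda>y. poly (W y) (x i y) = 0) (at y0)" using ev
      by eventually_elim (use i splits_root_iff in blast)
    show "poly (W y0) (x i y0) = 0" using at(1) i splits_root_iff by blast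
    show "poly (pderiv (W y0)) (x i y0) \<noteq> 0" unfolding x(1)[OF i]
      by (rule splits_simple_root[OF X(1) i]) (use X(2) i in \<open>auto simp: inj_on_def\<close>)
  qed
  have dz: "z i field_differentiable (at y0)" if i: "i < d" for i
  proof (rule simple_root_differentiable[OF famg])
    show "(z i \<longlongrightarrow> z i y0) (at y0)" using z i by simp
    show "eventually (\<lambda>y. poly (g y) (z i y) = 0) (at y0)" using ev
      by eventually_elim (use i splits_root_iff in blast)
    show "poly (g y0) (z i y0) = 0" using at(2) i splits_root_iff by blast
    show "poly (pderiv (g y0)) (z i y0) \<noteq> 0" unfolding z(1)[OF i]
      by (rule splits_simple_root[OF Z(1) i]) (use Z(2) i in \<open>auto simp: inj_on_def\<close>)
  qed
  have prod: "(\<lambda>y. \<Prod>i\<in>I. F i y) field_differentiable (at y0)"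
    if "\<And>i. i \<in> I \<Longrightarrow> F i field_differentiable (at y0)" for F :: "'i \<Rightarrow> complex \<Rightarrow> complex" and I
    using that by (induction I rule: infinite_finite_induct)
      (auto intro: field_differentiable_mult field_differentiable_const)
  have "(\<lambda>y. bival d (f y) (g y) (\<lambda>i. x i y) (\<lambda>j. z j y)) field_differentiable (at y0)"
    unfolding bival_def case_prod_unfold
  proof (intro field_differentiable_divide field_differentiable_mult field_differentiable_power prod
      polyfun_id_deriv[OF family_coeff] family_W famg kern_differentiable family_deriv famf)
    show "(coeff (g y0) d ^ d * (\<Prod>j<d. poly (f y0) (z j y0))) ^ (4 * d - 8) \<noteq> 0"
      using nb at(2) splits_root_iff[OF at(2)] by (auto simp: splits_def)
  qed (auto simp: offdiag_def intro: dx dz)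
  moreover have "eventually (\<lambda>y. bifun d (f y) (g y) = bival d (f y) (g y) (\<lambda>i. x i y) (\<lambda>j. z j y)) (at y0)"
    using ev by eventually_elim (simp add: bifun_eq)
  then have "eventually (\<lambda>y. bifun d (f y) (g y) = bival d (f y) (g y) (\<lambda>i. x i y) (\<lambda>j. z j y)) (nhds y0)"
    using bifun_eq[OF at] by (simp add: eventually_nhds_conv_at)
  from DERIV_cong_ev[OF refl this refl] have
    "((\<lambda>y. bifun d (f y) (g y)) has_field_derivative D) (at y0) \<longleftrightarrow>
     ((\<lambda>y. bival d (f y) (g y) (\<lambda>i. x i y) (\<lambda>j. z j y)) has_field_derivative D) (at y0)" for D .
  ultimately show ?thesis unfolding field_differentiable_def by blast
qed

lemma bifun_lim_regular:
  assumes X: "splits (2*d-2) (W y0) X" and Z: "splits d (g y0) Z"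
    and nb: "\<And>a. \<not> (poly (f y0) a = 0 \<and> poly (g y0) a = 0)"
    and K: "\<And>i j. (i, j) \<in> offdiag {..<2*d-2} \<Longrightarrow> kern d (f y0) (g y0) (X i) (X j) \<noteq> 0"
  shows "nzlim (at y0) (\<lambda>y. bifun d (f y) (g y))"
proof -
  from selection[OF X Z] obtain x z where
    x: "\<And>i. i < 2*d-2 \<Longrightarrow> x i y0 = X i" "\<And>i. i < 2*d-2 \<Longrightarrow> (x i \<longlongrightarrow> X i) (at y0)" and
    z: "\<And>i. i < d \<Longrightarrow> z i y0 = Z i" "\<And>i. i < d \<Longrightarrow> (z i \<longlongrightarrow> Z i) (at y0)" and
    ev: "eventually (\<lambda>y. splits (2*d-2) (W y) (\<lambda>i. x i y) \<and> splits d (g y) (\<lambda>j. z j y)) (at y0)"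
    by blast
  have "nzlim (at y0) (\<lambda>y. bival d (f y) (g y) (\<lambda>i. x i y) (\<lambda>j. z j y))"
    unfolding bival_def case_prod_unfold
  proof (intro nzlim_divide nzlim_mult nzlim_power nzlim_prod)
    show "nzlim (at y0) (\<lambda>y. coeff (W y) (2*d-2))" "nzlim (at y0) (\<lambda>y. coeff (g y) d)"
      using polyfun_id_tendsto[OF family_coeff[OF family_W]] polyfun_id_tendsto[OF family_coeff[OF famg]] X Z
      by (auto simp: splits_def intro!: nzlimI)
    fix p assume p: "p \<in> offdiag {..<2*d-2}"
    then show "nzlim (at y0) (\<lambda>y. kern d (f y) (g y) (x (fst p) y) (x (snd p) y))"
      by (intro nzlimI[OF kern_tendsto[OF x(2) x(2)]] K) (auto simp: offdiag_def)
  next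
    fix j assume "j \<in> {..<d}"
    then show "nzlim (at y0) (\<lambda>y. poly (f y) (z j y))"
      using nb[of "Z j"] splits_root_iff[OF Z] by (intro nzlimI[OF family_tendsto[OF famf z(2)]]) auto
  qed
  then show ?thesis
    by (rule nzlim_cong[rotated]) (use ev in eventually_elim, simp add: bifun_eq)
qed

end

lemma wronskian_root_of_square:
  assumes "lin a ^ 2 dvd f + smult t g"
  shows "poly (wronskian f g) a = 0"
proof -
  have "poly (wronskian (f + smult t g) g) a = 0"
    using assms unfolding lin_square_dvd by (simp add: wronskian_def)
  then show ?thesis by (simp add: wronskian_member)
qed

lemma members_square_cases:
  assumes "generic_pencil d f g" "m \<in> members f g" "lin a ^ 2 * lin b ^ 2 dvd m"
  shows "\<exists>t. m = f + smult t g"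
  using assms generic_pencil.no_bitangent_g[OF assms(1)] by (auto simp: members_def)

context generic_pencil
begin

text \<open>If the two points coincide, vanishing means contact of order four
  (\<open>hyperflex\<close>), which is excluded. If they differ, they are critical points on the
  same member.\<close>

lemma kern_zero:
  assumes X: "splits (2*d-2) (wronskian f g) X" and ij: "(i, j) \<in> offdiag {..<2*d-2}"
    and nb: "\<not> (poly f (X i) = 0 \<and> poly g (X i) = 0)" "\<not> (poly f (X j) = 0 \<and> poly g (X j) = 0)"
    and K: "kern d f g (X i) (X j) = 0"
  shows "X i \<noteq> X j \<and> (\<exists>t. lin (X i) ^ 2 * lin (X j) ^ 2 dvd f + smult t g)"
proof -
  have i: "i < 2*d-2" "j < 2*d-2" "i \<noteq> j" using ij by (auto simp: offdiag_def)
  have Wi: "poly (wronskian f g) (X i) = 0" "poly (wronskian f g) (X j) = 0"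
    using splits_root_iff[OF X] i by auto
  show ?thesis
  proof (cases "X i = X j")
    case True
    then have "poly (pderiv (wronskian f g)) (X i) = 0" using splits_double_root[OF X i] by simp
    from hyperflex[OF d Wi(1) this nb(1)] K True obtain m where "m \<in> members f g" "lin (X i) ^ 4 dvd m"
      by auto
    then show ?thesis using no_4_g no_member4 by (auto simp: members_def)
  next
    case False
    obtain m where m: "m \<in> members f g" "poly m (X i) = 0" using member_through by blast
    have "poly f (X j) * poly g (X i) = poly f (X i) * poly g (X j)"
      using kern_root[OF deg_f deg_g d Wi(2,1)] K by simp
    from member_shared[OF m nb(1) this] have m': "poly m (X j) = 0" .
    have "lin (X i) ^ 2 * lin (X j) ^ 2 dvd m"
      by (rule lin_mult_dvd[OF False member_critical[OF m Wi(1) nb(1)] member_critical[OF m(1) m' Wi(2) nb(2)]])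
    then show ?thesis using members_square_cases[of d f g m] m(1) False generic_pencil_axioms by blast
  qed
qed

lemma bitangent_no_base:
  assumes "x1 \<noteq> x2" "lin x1 ^ 2 * lin x2 ^ 2 dvd f + smult t g"
  shows "\<not> (poly f z = 0 \<and> poly g z = 0)"
proof
  assume z: "poly f z = 0 \<and> poly g z = 0"
  then have zg: "lin z dvd g" and zm: "lin z ^ 1 dvd f + smult t g" by (simp_all add: lin_dvd_iff)
  have 1: "lin x1 ^ 2 dvd f + smult t g" "lin x2 ^ 2 dvd f + smult t g"
    using assms(2) by (auto intro: dvd_mult_left dvd_mult_right)
  consider "z = x1" | "z = x2" | "z \<noteq> x1" "z \<noteq> x2" by blast
  then show False
  proof cases
    case 1
    then show False using no_bitangent_at_base[OF zg] assms(2) by blast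
  next
    case 2
    then show False using no_bitangent_at_base[OF zg, of x1 t] assms(2) by (simp add: mult.commute)
  next
    case 3
    then show False using no_base_bitangent[OF zg, of x1 x2 t] lin_mult_dvd3[OF 3 assms(1) zm 1] by simp
  qed
qed

lemma base_unique: "poly f a = 0 \<Longrightarrow> poly g a = 0 \<Longrightarrow> poly f b = 0 \<Longrightarrow> poly g b = 0 \<Longrightarrow> a = b"
  using no_two_base[of a b] lin_mult_dvd[of a b 1 f 1] lin_mult_dvd[of a b 1 g 1]
  by (auto simp: lin_dvd_iff)

lemma base_g_simple:
  assumes "poly f a = 0" "poly g a = 0"
  shows "poly (pderiv g) a \<noteq> 0"
  using no_base_tangent_g[of a] assms by (auto simp: lin_dvd_iff lin_square_dvd)

text \<open>A double root of the Wronskian would raise the contact at \<open>x1\<close> to three,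
  and contact of orders 3 and 2 on one member is excluded.\<close>

lemma bitangent_simple:
  assumes "x1 \<noteq> x2" "lin x1 ^ 2 * lin x2 ^ 2 dvd f + smult t g"
  shows "poly (pderiv (wronskian f g)) x1 \<noteq> 0"
proof
  assume 0: "poly (pderiv (wronskian f g)) x1 = 0"
  let ?h = "f + smult t g"
  have h: "lin x1 ^ 2 dvd ?h" "lin x2 ^ 2 dvd ?h"
    using assms(2) by (auto intro: dvd_mult_left dvd_mult_right)
  have h0: "poly ?h x1 = 0" "poly (pderiv ?h) x1 = 0" using h(1) unfolding lin_square_dvd by auto
  have "poly g x1 \<noteq> 0" using bitangent_no_base[OF assms, of x1] h0(1) by auto
  moreover have "poly (pderiv (wronskian ?h g)) x1 = 0" using 0 by (simp only: wronskian_member)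
  then have "poly (pderiv (pderiv ?h)) x1 * poly g x1 = 0"
    unfolding pderiv_wronskian using h0 by simp
  ultimately have "poly (pderiv (pderiv ?h)) x1 = 0" by simp
  then have "tc ?h 2 x1 = 0" using tc_2[of ?h x1] by simp
  moreover have "tc ?h 1 x1 = 0" using h0 by (simp only: tc_1)
  moreover have "tc ?h 0 x1 = 0" using h0 by (simp only: tc_0)
  moreover have "k = 0 \<or> k = 1 \<or> k = 2" if "k < 3" for k :: nat using that by linarith
  ultimately have "lin x1 ^ 3 dvd ?h" by (intro lin_power_dvd) metis
  then show False using no_member32 lin_mult_dvd[OF assms(1) _ h(2)] by blast
qed

end

context pencil_family
begin

text \<open>Only the two orders of the pair of contact points give a vanishing factor: any other
  would mean a second bitangent member or a third point of contact. Each of the two vanishes to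
  first order by transversality, hence the exponent 2.\<close>

lemma bifun_lim_bitangent:
  assumes X: "splits (2*d-2) (W y0) X" and Z: "splits d (g y0) Z"
    and gen: "generic_pencil d (f y0) (g y0)"
    and bit: "x1 \<noteq> x2" "lin x1 ^ 2 * lin x2 ^ 2 dvd f y0 + smult t (g y0)"
    and fd: "\<And>i. ((\<lambda>y. coeff (f y) i) has_field_derivative coeff fd i) (at y0)" "degree fd \<le> d"
    and gd: "\<And>i. ((\<lambda>y. coeff (g y) i) has_field_derivative coeff gd i) (at y0)" "degree gd \<le> d"
    and tr: "transversal (f y0) (g y0) fd gd"
  shows "nzlim (at y0) (\<lambda>y. bifun d (f y) (g y) / (y - y0) ^ 2)"
proof -
  interpret gp: generic_pencil d "f y0" "g y0" by (rule gen)
  let ?n = "2*d-2" and ?f = "f y0" and ?g = "g y0"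
  let ?h = "?f + smult t ?g"
  have bit': "x2 \<noteq> x1" "lin x2 ^ 2 * lin x1 ^ 2 dvd ?h" using bit by (simp_all add: mult.commute)
  have h: "lin x1 ^ 2 dvd ?h" "lin x2 ^ 2 dvd ?h"
    using bit by (auto intro: dvd_mult_left dvd_mult_right)
  have nb: "\<not> (poly ?f a = 0 \<and> poly ?g a = 0)" for a using gp.bitangent_no_base[OF bit] .
  have W12: "poly (W y0) x1 = 0" "poly (W y0) x2 = 0" using wronskian_root_of_square h by blast+
  obtain i1 i2 where i: "i1 < ?n" "i2 < ?n" "X i1 = x1" "X i2 = x2"
    using W12 splits_root_iff[OF X] by metis
  have uniq1: "k = i1" if "k < ?n" "X k = x1" for k
    using splits_double_root[OF X that(1) i(1)] gp.bitangent_simple[OF bit] that i by auto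
  have uniq2: "k = i2" if "k < ?n" "X k = x2" for k
    using splits_double_root[OF X that(1) i(2)] gp.bitangent_simple[OF bit'] that i by auto
  have i12: "i1 \<noteq> i2" using i bit by auto
  have K: "kern d ?f ?g (X k) (X l) \<noteq> 0"
    if kl: "(k, l) \<in> offdiag {..<?n}" "(k, l) \<noteq> (i1, i2)" "(k, l) \<noteq> (i2, i1)" for k l
  proof
    assume "kern d ?f ?g (X k) (X l) = 0"
    from gp.kern_zero[OF X kl(1) nb nb this] obtain t' where
      t': "X k \<noteq> X l" "lin (X k) ^ 2 * lin (X l) ^ 2 dvd ?f + smult t' ?g" by blast
    have "t' = t" using gp.no_two_bitangents[of t t' x1 x2 "X k" "X l"] bit t' by blast
    then have hk: "lin (X k) ^ 2 dvd ?h" "lin (X l) ^ 2 dvd ?h"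
      using t'(2) by (auto intro: dvd_mult_left dvd_mult_right)
    have "z = x1 \<or> z = x2" if "lin z ^ 2 dvd ?h" for z
      using gp.no_member222[of x1 x2 z t] lin_mult_dvd3[OF bit(1) _ _ h that] by blast
    then have "X k \<in> {x1, x2}" "X l \<in> {x1, x2}" using hk by blast+
    then have "(k, l) = (i1, i2) \<or> (k, l) = (i2, i1)"
      using uniq1 uniq2 kl(1) t'(1) by (auto simp: offdiag_def)
    then show False using kl by blast
  qed
  from selection[OF X Z] obtain x z where
    x: "\<And>i. i < ?n \<Longrightarrow> x i y0 = X i" "\<And>i. i < ?n \<Longrightarrow> (x i \<longlongrightarrow> X i) (at y0)" and
    z: "\<And>i. i < d \<Longrightarrow> z i y0 = Z i" "\<And>i. i < d \<Longrightarrow> (z i \<longlongrightarrow> Z i) (at y0)" and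
    ev: "eventually (\<lambda>y. splits ?n (W y) (\<lambda>i. x i y) \<and> splits d (g y) (\<lambda>j. z j y)) (at y0)"
    by blast
  define P where "P = offdiag {..<?n} - {(i1, i2)} - {(i2, i1)}"
  have prodP: "(\<Prod>p\<in>offdiag {..<?n}. k p) = k (i1, i2) * (k (i2, i1) * (\<Prod>p\<in>P. k p))" for k :: "nat \<times> nat \<Rightarrow> complex"
  proof -
    have "(i1, i2) \<in> offdiag {..<?n}" "(i2, i1) \<in> offdiag {..<?n} - {(i1, i2)}"
      using i i12 by (auto simp: offdiag_def)
    then show ?thesis unfolding P_def by (simp add: prod.remove)
  qed
  define k12 where "k12 = (\<lambda>y. kern d (f y) (g y) (x i1 y) (x i2 y))"
  define k21 where "k21 = (\<lambda>y. kern d (f y) (g y) (x i2 y) (x i1 y))"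
  have root: "eventually (\<lambda>y. poly (W y) (x i1 y) = 0) (at y0)" "eventually (\<lambda>y. poly (W y) (x i2 y) = 0) (at y0)"
    using ev by (eventually_elim, use i splits_root_iff in blast)+
  have "x i1 field_differentiable (at y0)"
    by (rule simple_root_differentiable[OF family_W])
      (use x i root W12 gp.bitangent_simple[OF bit] in auto)
  then obtain x1' where x1': "(x i1 has_field_derivative x1') (at y0)" by (auto simp: field_differentiable_def)
  have "x i2 field_differentiable (at y0)"
    by (rule simple_root_differentiable[OF family_W])
      (use x i root W12 gp.bitangent_simple[OF bit'] in auto)
  then obtain x2' where x2': "(x i2 has_field_derivative x2') (at y0)" by (auto simp: field_differentiable_def)
  have at: "x i1 y0 = x1" "x i2 y0 = x2" using x i by auto
  define E where "E = (\<lambda>y. poly (f y) (x i2 y) * poly (g y) (x i1 y) - poly (f y) (x i1 y) * poly (g y) (x i2 y))"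
  \<comment> \<open>\<open>e\<close> is the derivative of \<open>E\<close>. The velocities of the
    critical points drop out, because they are multiplied by the \<open>x\<close>-derivative of
    \<open>f + t g\<close>, which is zero at the points of contact.\<close>
  define e where "e = poly ?g x1 * (poly fd x2 + t * poly gd x2) - poly ?g x2 * (poly fd x1 + t * poly gd x1)"
  have h0: "poly ?h x1 = 0" "poly (pderiv ?h) x1 = 0" "poly ?h x2 = 0" "poly (pderiv ?h) x2 = 0"
    using h unfolding lin_square_dvd by auto
  then have fx: "poly ?f x1 = - t * poly ?g x1" "poly ?f x2 = - t * poly ?g x2"
    "poly (pderiv ?f) x1 = - t * poly (pderiv ?g) x1" "poly (pderiv ?f) x2 = - t * poly (pderiv ?g) x2"
    by (simp_all add: eq_neg_iff_add_eq_0 pderiv_add pderiv_smult)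
  have gx: "poly ?g x1 \<noteq> 0" "poly ?g x2 \<noteq> 0" using nb[of x1] nb[of x2] fx by auto
  have "(E has_field_derivative e) (at y0)"
    unfolding E_def
    by (rule DERIV_cong[OF DERIV_diff[OF DERIV_mult[OF family_has_derivative[OF famf degf fd(2) fd(1) x2']
          family_has_derivative[OF famg degg gd(2) gd(1) x1']]
          DERIV_mult[OF family_has_derivative[OF famf degf fd(2) fd(1) x1']
          family_has_derivative[OF famg degg gd(2) gd(1) x2']]]])
      (simp add: at fx e_def algebra_simps)
  moreover have E0: "E y0 = 0" by (simp add: E_def at fx)
  ultimately have Elim: "((\<lambda>y. E y / (y - y0)) \<longlongrightarrow> e) (at y0)" by (simp add: has_field_derivative_iff)
  have "e \<noteq> 0"
  proof
    assume e0: "e = 0"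
    \<comment> \<open>If \<open>e\<close> were 0, the quotient \<open>(fd + t gd) / g\<close> would
      take the same value \<open>\<mu>\<close> at both points, against transversality.\<close>
    define \<mu> where "\<mu> = (poly fd x1 + t * poly gd x1) / poly ?g x1"
    let ?k = "fd + smult t gd - smult \<mu> ?g"
    have "poly ?k x1 = 0" using gx by (simp add: \<mu>_def)
    moreover have "poly ?k x2 = 0" using gx e0 by (simp add: \<mu>_def e_def field_simps)
    ultimately have "lin x1 ^ 1 * lin x2 ^ 1 dvd ?k" using bit(1) by (intro lin_mult_dvd) (auto simp: lin_dvd_iff)
    then show False using tr gp.member_nz[of t] bit(2) unfolding transversal_def lin_def by auto
  qed
  have ne: "eventually (\<lambda>y. x i2 y - x i1 y \<noteq> 0) (at y0)"
    by (rule tendsto_imp_eventually_ne[OF tendsto_diff[OF x(2) x(2)]]) (use i bit in auto)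
  have k12eq: "eventually (\<lambda>y. k12 y / (y - y0) = E y / (y - y0) / (x i2 y - x i1 y) ^ 3) (at y0)"
    using ne root by eventually_elim (simp add: k12_def E_def kern_root_eq[OF degf degg d])
  have k21eq: "eventually (\<lambda>y. k21 y / (y - y0) = E y / (y - y0) / (x i2 y - x i1 y) ^ 3) (at y0)"
    using ne root k12eq
    by eventually_elim (simp add: k12_def k21_def E_def kern_root_sym[OF degf degg d, symmetric])
  have nzE: "nzlim (at y0) (\<lambda>y. E y / (y - y0) / (x i2 y - x i1 y) ^ 3)"
    by (intro nzlim_divide[OF nzlimI[OF Elim \<open>e \<noteq> 0\<close>] nzlim_power[OF nzlimI[OF tendsto_diff[OF x(2) x(2)]]]])
      (use i bit in auto)
  have "nzlim (at y0) (\<lambda>y. coeff (W y) ?n ^ (2*(2*d-3)*(d-3)) *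
     ((k12 y / (y - y0)) * ((k21 y / (y - y0)) * (\<Prod>p\<in>P. kern d (f y) (g y) (x (fst p) y) (x (snd p) y)))) /
     (coeff (g y) d ^ d * (\<Prod>j<d. poly (f y) (z j y))) ^ (4*d-8))"
  proof (intro nzlim_divide[of _ "\<lambda>y. _ y * _ y"] nzlim_mult nzlim_power nzlim_prod)
    show "nzlim (at y0) (\<lambda>y. coeff (W y) ?n)" "nzlim (at y0) (\<lambda>y. coeff (g y) d)"
      using polyfun_id_tendsto[OF family_coeff[OF family_W]] polyfun_id_tendsto[OF family_coeff[OF famg]] X Z
      by (auto simp: splits_def intro!: nzlimI)
    show "nzlim (at y0) (\<lambda>y. k12 y / (y - y0))" by (rule nzlim_cong[OF k12eq nzE])
    show "nzlim (at y0) (\<lambda>y. k21 y / (y - y0))" by (rule nzlim_cong[OF k21eq nzE])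
  next
    fix p assume p: "p \<in> P"
    then have "fst p < ?n" "snd p < ?n" by (auto simp: P_def offdiag_def)
    moreover have "kern d ?f ?g (X (fst p)) (X (snd p)) \<noteq> 0"
      using p by (intro K) (auto simp: P_def)
    ultimately show "nzlim (at y0) (\<lambda>y. kern d (f y) (g y) (x (fst p) y) (x (snd p) y))"
      by (intro nzlimI[OF kern_tendsto[OF x(2) x(2)]])
  next
    fix j assume "j \<in> {..<d}"
    then show "nzlim (at y0) (\<lambda>y. poly (f y) (z j y))"
      using nb[of "Z j"] splits_root_iff[OF Z] by (intro nzlimI[OF family_tendsto[OF famf z(2)]]) auto
  qed
  then show ?thesis
  proof (rule nzlim_cong[rotated])
    show "eventually (\<lambda>y. bifun d (f y) (g y) / (y - y0)^2 = coeff (W y) ?n ^ (2*(2*d-3)*(d-3)) *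
     ((k12 y / (y - y0)) * ((k21 y / (y - y0)) * (\<Prod>p\<in>P. kern d (f y) (g y) (x (fst p) y) (x (snd p) y)))) /
     (coeff (g y) d ^ d * (\<Prod>j<d. poly (f y) (z j y))) ^ (4*d-8)) (at y0)"
      using ev
    proof eventually_elim
      case (elim y)
      then have "bifun d (f y) (g y) = bival d (f y) (g y) (\<lambda>i. x i y) (\<lambda>j. z j y)"
        by (intro bifun_eq) auto
      then show ?case
        by (simp add: bival_def prodP case_prod_unfold k12_def k21_def power2_eq_square)
    qed
  qed
qed

text \<open>Two critical points \<open>x1\<close>, \<open>x2\<close> and one root of
  \<open>g\<close> run into the base point. At a critical point \<open>f = g f' / g'\<close>, so
  every \<open>kern\<close> factor that pairs \<open>x1\<close> or \<open>x2\<close> with one of the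
  other \<open>2 * d - 4\<close> critical points is \<open>g(x1)\<close> or \<open>g(x2)\<close>
  times a quantity \<open>U\<close> with nonzero limit. Both orders together give
  \<open>(g(x1) g(x2)) ^ (4 * d - 8)\<close>, while the resultant is \<open>g(x1) g(x2)\<close>
  times a quantity \<open>V\<close> with nonzero limit. This is the origin of the exponent of the
  resultant.\<close>

lemma bifun_lim_base:
  assumes X: "splits (2*d-2) (W y0) X" and Z: "splits d (g y0) Z"
    and gen: "generic_pencil d (f y0) (g y0)"
    and base: "poly (f y0) b = 0" "poly (g y0) b = 0"
    and nb: "eventually (\<lambda>y. \<forall>a. \<not> (poly (f y) a = 0 \<and> poly (g y) a = 0)) (at y0)"
  shows "nzlim (at y0) (\<lambda>y. bifun d (f y) (g y))"
proof -
  interpret gp: generic_pencil d "f y0" "g y0" by (rule gen)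
  let ?n = "2*d-2" and ?f = "f y0" and ?g = "g y0"
  have g': "poly (pderiv ?g) b \<noteq> 0" by (rule gp.base_g_simple[OF base])
  define t where "t = - poly (pderiv ?f) b / poly (pderiv ?g) b"
  let ?h = "?f + smult t ?g"
  have h0: "poly ?h b = 0" "poly (pderiv ?h) b = 0"
    using base g' by (simp_all add: pderiv_add pderiv_diff pderiv_smult t_def)
  have h2: "lin b ^ 2 dvd ?h" using h0 by (simp only: lin_square_dvd)
  have gb: "lin b dvd ?g" using base by (simp add: lin_dvd_iff)
  have W0: "poly (W y0) b = 0" using base by (simp add: wronskian_def)
  have W1: "poly (pderiv (W y0)) b = 0" using base by (simp add: pderiv_wronskian)
  \<comment> \<open>The base point is not a triple root of the Wronskian: otherwise the member
    tangent to the line at \<open>b\<close> would have contact three there.\<close>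
  have W2: "tc (W y0) 2 b \<noteq> 0"
  proof
    assume "tc (W y0) 2 b = 0"
    then have "poly (pderiv (pderiv (wronskian ?h ?g))) b = 0" using tc_2[of "W y0" b] by (simp add: wronskian_member)
    then have "poly (pderiv (pderiv ?h)) b * poly (pderiv ?g) b = 0"
      unfolding pderiv_wronskian using h0 base by (simp add: pderiv_diff pderiv_mult)
    then have "poly (pderiv (pderiv ?h)) b = 0" using g' by simp
    then have "tc ?h 2 b = 0" using tc_2[of ?h b] by simp
    moreover have "tc ?h 1 b = 0" using h0 by (simp only: tc_1)
    moreover have "tc ?h 0 b = 0" using h0 by (simp only: tc_0)
    moreover have "k = 0 \<or> k = 1 \<or> k = 2" if "k < 3" for k :: nat using that by linarith
    ultimately have "lin b ^ 3 dvd ?h" by (intro lin_power_dvd) metis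
    then show False using gp.no_flex_at_base[OF gb] by blast
  qed
  obtain i1 where i1: "i1 < ?n" "X i1 = b" using W0 splits_root_iff[OF X] by metis
  obtain i2 where i2: "i2 < ?n" "i2 \<noteq> i1" "X i2 = b"
    using splits_simple_root[OF X i1(1)] W1 i1 by metis
  define J where "J = {..<?n} - {i1} - {i2}"
  have J: "finite J" "i1 \<notin> J" "i2 \<notin> J" "{..<?n} = insert i1 (insert i2 J)" "i1 \<notin> insert i2 J"
    using i1 i2 by (auto simp: J_def)
  have cardJ: "card J = 2*d-4" unfolding J_def using i1 i2 by (simp add: card_Diff_singleton)
  have XJ: "X j \<noteq> b" if j: "j \<in> J" for j
  proof
    assume "X j = b"
    have "(\<Prod>k<?n. lin (X k)) = lin b ^ 3 * (\<Prod>k\<in>J - {j}. lin (X k))"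
    proof -
      have "(\<Prod>k<?n. lin (X k)) = lin (X i1) * (lin (X i2) * (\<Prod>k\<in>J. lin (X k)))"
        unfolding J(4) using J by simp
      also have "(\<Prod>k\<in>J. lin (X k)) = lin (X j) * (\<Prod>k\<in>J - {j}. lin (X k))"
        using J(1) j by (simp add: prod.remove)
      finally show ?thesis using i1 i2 \<open>X j = b\<close> by (simp add: power3_eq_cube mult.assoc)
    qed
    then have "lin b ^ 3 dvd W y0" using X unfolding splits_def by (metis dvd_smult dvd_triv_left)
    then obtain q where q: "W y0 = lin b ^ 3 * q" by (elim dvdE)
    have "poly (pderiv (pderiv (W y0))) b = 0"
      unfolding q by (simp add: pderiv_mult pderiv_add power3_eq_cube)
    then show False using W2 tc_2[of "W y0" b] by simp
  qed
  have nbJ: "\<not> (poly ?f (X j) = 0 \<and> poly ?g (X j) = 0)" if "j \<in> J" for j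
    using gp.base_unique[OF base] XJ[OF that] by blast
  have KJ: "kern d ?f ?g (X (fst p)) (X (snd p)) \<noteq> 0" if p: "p \<in> offdiag J" for p
  proof
    assume K0: "kern d ?f ?g (X (fst p)) (X (snd p)) = 0"
    have p': "(fst p, snd p) \<in> offdiag {..<?n}" "fst p \<in> J" "snd p \<in> J"
      using p by (auto simp: offdiag_def J_def)
    from gp.kern_zero[OF X p'(1) nbJ[OF p'(2)] nbJ[OF p'(3)] K0] obtain t' where
      "X (fst p) \<noteq> X (snd p)" "lin (X (fst p)) ^ 2 * lin (X (snd p)) ^ 2 dvd ?f + smult t' ?g" by blast
    from gp.bitangent_no_base[OF this] base show False by blast
  qed
  \<comment> \<open>Since \<open>f\<close> and \<open>g\<close> both vanish at \<open>b\<close>,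
    only the term \<open>- tc (W y0) 2 b / 2\<close> of the diagonal value survives.\<close>
  have Kb: "kern d ?f ?g b b \<noteq> 0" using W2 base by (simp add: kern_diag[OF d])
  obtain j0 where j0: "j0 < d" "Z j0 = b" using base(2) splits_root_iff[OF Z] by metis
  define J' where "J' = {..<d} - {j0}"
  have J': "finite J'" "j0 \<notin> J'" "{..<d} = insert j0 J'" using j0 by (auto simp: J'_def)
  have ZJ: "Z j \<noteq> b" if "j \<in> J'" for j
    using splits_double_root[OF Z, of j j0] that j0 g' by (auto simp: J'_def)
  have fZJ: "poly ?f (Z j) \<noteq> 0" if "j \<in> J'" for j
  proof -
    have "poly ?g (Z j) = 0" using splits_root_iff[OF Z] that by (auto simp: J'_def)
    then show ?thesis using gp.base_unique[OF base] ZJ[OF that] by blast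
  qed
  from selection[OF X Z] obtain x z where
    x: "\<And>i. i < ?n \<Longrightarrow> x i y0 = X i" "\<And>i. i < ?n \<Longrightarrow> (x i \<longlongrightarrow> X i) (at y0)" and
    z: "\<And>i. i < d \<Longrightarrow> z i y0 = Z i" "\<And>i. i < d \<Longrightarrow> (z i \<longlongrightarrow> Z i) (at y0)" and
    ev: "eventually (\<lambda>y. splits ?n (W y) (\<lambda>i. x i y) \<and> splits d (g y) (\<lambda>j. z j y)) (at y0)"
    by blast
  have xJ: "(x j \<longlongrightarrow> X j) (at y0)" if "j \<in> J" for j using x(2) that by (simp add: J_def)
  have zJ: "(z j \<longlongrightarrow> Z j) (at y0)" if "j \<in> J'" for j using z(2) that by (simp add: J'_def)
  have x1: "(x i1 \<longlongrightarrow> b) (at y0)" and x2: "(x i2 \<longlongrightarrow> b) (at y0)" using x(2) i1 i2 by metis+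
  have z0: "(z j0 \<longlongrightarrow> b) (at y0)" using z(2) j0 by metis
  have lc: "nzlim (at y0) (\<lambda>y. coeff (W y) ?n)" "nzlim (at y0) (\<lambda>y. coeff (g y) d)"
    using polyfun_id_tendsto[OF family_coeff[OF family_W]] polyfun_id_tendsto[OF family_coeff[OF famg]] X Z
    by (auto simp: splits_def intro!: nzlimI)
  have g'lim: "nzlim (at y0) (\<lambda>y. poly (pderiv (g y)) (u y))" if "(u \<longlongrightarrow> b) (at y0)" for u
    using family_tendsto[OF family_pderiv[OF famg] that] g' by (rule nzlimI)
  \<comment> \<open>near the base point \<open>g\<close> vanishes to first order at the root \<open>z j0\<close> only\<close>
  define w where "w = (\<lambda>i y. coeff (g y) d * (\<Prod>j\<in>J'. x i y - z j y))"
  have w: "nzlim (at y0) (w i)" if "(x i \<longlongrightarrow> b) (at y0)" for i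
    unfolding w_def using that zJ ZJ
    by (intro nzlim_mult lc nzlim_prod nzlimI[OF tendsto_diff]) auto
  define V where "V = (\<lambda>y. coeff (g y) d ^ d * ((\<Prod>j\<in>J'. poly (f y) (z j y)) *
     (- coeff (W y) ?n * (\<Prod>j\<in>J. z j0 y - x j y) / (poly (pderiv (g y)) (z j0 y) * (w i1 y * w i2 y)))))"
  have V: "nzlim (at y0) V"
    unfolding V_def
  proof (intro nzlim_mult nzlim_divide nzlim_uminus lc nzlim_power nzlim_prod g'lim z0 w x1 x2)
    show "nzlim (at y0) (\<lambda>y. poly (f y) (z j y))" if "j \<in> J'" for j
      by (rule nzlimI[OF family_tendsto[OF famf zJ[OF that]] fZJ[OF that]])
    show "nzlim (at y0) (\<lambda>y. z j0 y - x j y)" if "j \<in> J" for j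
      by (rule nzlimI[OF tendsto_diff[OF z0 xJ[OF that]]]) (use XJ[OF that] in auto)
  qed
  define U where "U = (\<lambda>i j y. (poly (f y) (x j y) - poly (pderiv (f y)) (x i y) / poly (pderiv (g y)) (x i y) *
     poly (g y) (x j y)) / (x j y - x i y) ^ 3)"
  have U: "nzlim (at y0) (U i j)" if xi: "(x i \<longlongrightarrow> b) (at y0)" and j: "j \<in> J" for i j
  proof -
    have "((\<lambda>y. poly (f y) (x j y) - poly (pderiv (f y)) (x i y) / poly (pderiv (g y)) (x i y) * poly (g y) (x j y))
      \<longlongrightarrow> poly ?f (X j) - poly (pderiv ?f) b / poly (pderiv ?g) b * poly ?g (X j)) (at y0)"
      using g' by (intro tendsto_diff tendsto_mult tendsto_divide family_tendsto family_pderiv famf famg xi xJ j)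
    moreover have "poly ?f (X j) - poly (pderiv ?f) b / poly (pderiv ?g) b * poly ?g (X j) \<noteq> 0"
    proof
      assume "poly ?f (X j) - poly (pderiv ?f) b / poly (pderiv ?g) b * poly ?g (X j) = 0"
      then have hj: "poly ?h (X j) = 0" by (simp add: t_def)
      have "poly (W y0) (X j) = 0" using splits_root_iff[OF X] j by (auto simp: J_def)
      then have "lin (X j) ^ 2 dvd ?h"
        using hj nbJ[OF j] by (intro member_critical[of _ ?f ?g]) (auto simp: members_def)
      then show False using gp.no_bitangent_at_base[OF gb] lin_mult_dvd[OF _ h2] XJ[OF j] by metis
    qed
    ultimately show ?thesis unfolding U_def
      by (intro nzlim_divide nzlim_power nzlimI[OF tendsto_diff[OF xJ[OF j] xi]]) (auto intro: nzlimI simp: XJ[OF j])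
  qed
  let ?k = "\<lambda>y p. kern d (f y) (g y) (x (fst p) y) (x (snd p) y)"
  define N where "N = (\<lambda>y. coeff (W y) ?n ^ (2*(2*d-3)*(d-3)) *
     ((\<Prod>p\<in>offdiag J. ?k y p) * (\<Prod>j\<in>J. (U i2 j y)^2) * (?k y (i1, i2) * ?k y (i2, i1) * (\<Prod>j\<in>J. (U i1 j y)^2))) /
     V y ^ (4*d-8))"
  have N: "nzlim (at y0) N"
    unfolding N_def
  proof (intro nzlim_divide nzlim_mult nzlim_power nzlim_prod lc V U x1 x2)
    fix p assume p: "p \<in> offdiag J"
    then have "fst p \<in> J" "snd p \<in> J" by (auto simp: offdiag_def)
    then show "nzlim (at y0) (\<lambda>y. ?k y p)" by (intro nzlimI[OF kern_tendsto[OF xJ xJ]] KJ[OF p])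
  next
    show "nzlim (at y0) (\<lambda>y. ?k y (i1, i2))" "nzlim (at y0) (\<lambda>y. ?k y (i2, i1))"
      using nzlimI[OF kern_tendsto[OF x1 x2] Kb] nzlimI[OF kern_tendsto[OF x2 x1] Kb] by simp_all
  qed auto
  have nz: "eventually (\<lambda>y. h y \<noteq> 0) (at y0)" if "nzlim (at y0) h" for h
    using that tendsto_imp_eventually_ne by (auto simp: nzlim_def)
  have evJ: "eventually (\<lambda>y. \<forall>j\<in>J. x j y - x i y \<noteq> 0) (at y0)" if "(x i \<longlongrightarrow> b) (at y0)" for i
    using J(1) that XJ
    by (intro eventually_ball_finite ballI tendsto_imp_eventually_ne[OF tendsto_diff[OF xJ]]) auto
  show ?thesis
  proof (rule nzlim_cong[OF _ N])
    show "eventually (\<lambda>y. bifun d (f y) (g y) = N y) (at y0)"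
      using ev nb nz[OF g'lim[OF x1]] nz[OF g'lim[OF x2]] nz[OF g'lim[OF z0]] nz[OF w[OF x1]] nz[OF w[OF x2]]
        evJ[OF x1] evJ[OF x2]
    proof eventually_elim
      case (elim y)
      have sX: "splits ?n (W y) (\<lambda>i. x i y)" and sZ: "splits d (g y) (\<lambda>j. z j y)" using elim(1) by auto
      have Wr: "poly (W y) (x i y) = 0" if "i < ?n" for i using splits_root_iff[OF sX] that by blast
      have lt: "i1 < ?n" "i2 < ?n" "\<And>j. j \<in> J \<Longrightarrow> j < ?n" using i1 i2 by (auto simp: J_def)
      let ?g1 = "poly (g y) (x i1 y)" and ?g2 = "poly (g y) (x i2 y)"
      have gw: "poly (g y) (x i y) = (x i y - z j0 y) * w i y" for i
        unfolding splits_poly[OF sZ] w_def J'(3) using J' by (simp add: mult.assoc mult.left_commute)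
      have fg: "poly (f y) (x i y) = poly (g y) (x i y) * (poly (pderiv (f y)) (x i y) / poly (pderiv (g y)) (x i y))"
        if "i < ?n" "poly (pderiv (g y)) (x i y) \<noteq> 0" for i
        using Wr[OF that(1)] that(2) by (simp add: wronskian_def field_simps)
      have gnz: "poly (g y) (x i y) \<noteq> 0" if "i < ?n" "poly (pderiv (g y)) (x i y) \<noteq> 0" for i
        using fg[OF that] elim(2) by auto
      have kU: "kern d (f y) (g y) (x i y) (x j y) * kern d (f y) (g y) (x j y) (x i y) = poly (g y) (x i y)^2 * (U i j y)^2"
        if "i < ?n" "poly (pderiv (g y)) (x i y) \<noteq> 0" "j \<in> J" "x j y - x i y \<noteq> 0" for i j
      proof -
        have "kern d (f y) (g y) (x i y) (x j y) =
          (poly (f y) (x j y) * poly (g y) (x i y) - poly (f y) (x i y) * poly (g y) (x j y)) / (x j y - x i y)^3"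
          using that lt(3) by (intro kern_root_eq degf degg d Wr) auto
        also have "\<dots> = poly (g y) (x i y) * U i j y"
          unfolding U_def fg[OF that(1,2)] by (simp add: algebra_simps)
        finally have "kern d (f y) (g y) (x i y) (x j y) = poly (g y) (x i y) * U i j y" .
        moreover have "kern d (f y) (g y) (x i y) (x j y) = kern d (f y) (g y) (x j y) (x i y)"
          using that lt(3) by (intro kern_root_sym degf degg d Wr) auto
        ultimately show ?thesis by (simp add: power2_eq_square mult_ac)
      qed
      \<comment> \<open>At a root \<open>z\<close> of \<open>g\<close> the Wronskian equals
        \<open>- f g'\<close>. Written as the product over its roots, it exhibits the factor
        \<open>(x1 - z) (x2 - z)\<close>, which also occurs in \<open>g(x1) g(x2)\<close>.\<close>
      have fz: "poly (f y) (z j0 y) = - coeff (W y) ?n * ((x i1 y - z j0 y) * (x i2 y - z j0 y)) *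
         (\<Prod>j\<in>J. z j0 y - x j y) / poly (pderiv (g y)) (z j0 y)"
      proof -
        have "poly (g y) (z j0 y) = 0" using splits_root_iff[OF sZ] j0 by blast
        then have "poly (W y) (z j0 y) = - poly (f y) (z j0 y) * poly (pderiv (g y)) (z j0 y)"
          by (simp add: wronskian_def)
        moreover have "poly (W y) (z j0 y) = coeff (W y) ?n * ((z j0 y - x i1 y) * ((z j0 y - x i2 y) * (\<Prod>j\<in>J. z j0 y - x j y)))"
          unfolding splits_poly[OF sX] J(4) using J by simp
        ultimately show ?thesis using elim(5) by (simp add: field_simps)
      qed
      have base_res: "coeff (g y) d ^ d * (\<Prod>j<d. poly (f y) (z j y)) = (?g1 * ?g2) * V y"
      proof -
        have "(\<Prod>j<d. poly (f y) (z j y)) = poly (f y) (z j0 y) * (\<Prod>j\<in>J'. poly (f y) (z j y))"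
          unfolding J'(3) using J' by simp
        moreover have "L * (- c * (u * v) * D / p * P) = (u * w1 * (v * w2)) * (L * (P * (- c * D / (p * (w1 * w2)))))"
          if "w1 \<noteq> 0" "w2 \<noteq> 0" "p \<noteq> 0" for L c u v D p P w1 w2 :: complex
          using that by (simp add: divide_simps)
        ultimately show ?thesis unfolding V_def fz gw using elim(5-7) by metis
      qed
      have g12: "?g1 \<noteq> 0" "?g2 \<noteq> 0" using gnz lt elim by auto
      have p1: "(\<Prod>j\<in>J. ?k y (i1, j) * ?k y (j, i1)) = ?g1 ^ (4*d-8) * (\<Prod>j\<in>J. (U i1 j y)^2)"
      proof -
        have "(\<Prod>j\<in>J. ?k y (i1, j) * ?k y (j, i1)) = (\<Prod>j\<in>J. ?g1^2 * (U i1 j y)^2)"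
          using kU[of i1] lt elim by (intro prod.cong) auto
        also have "\<dots> = (?g1^2) ^ (2*d-4) * (\<Prod>j\<in>J. (U i1 j y)^2)" by (simp add: prod.distrib cardJ)
        also have "(?g1^2) ^ (2*d-4) = ?g1 ^ (4*d-8)"
          by (simp add: power_mult[symmetric] right_diff_distrib')
        finally show ?thesis .
      qed
      have p2: "(\<Prod>j\<in>J. ?k y (i2, j) * ?k y (j, i2)) = ?g2 ^ (4*d-8) * (\<Prod>j\<in>J. (U i2 j y)^2)"
      proof -
        have "(\<Prod>j\<in>J. ?k y (i2, j) * ?k y (j, i2)) = (\<Prod>j\<in>J. ?g2^2 * (U i2 j y)^2)"
          using kU[of i2] lt elim by (intro prod.cong) auto
        also have "\<dots> = (?g2^2) ^ (2*d-4) * (\<Prod>j\<in>J. (U i2 j y)^2)" by (simp add: prod.distrib cardJ)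
        also have "(?g2^2) ^ (2*d-4) = ?g2 ^ (4*d-8)"
          by (simp add: power_mult[symmetric] right_diff_distrib')
        finally show ?thesis .
      qed
      have "(\<Prod>p\<in>offdiag {..<?n}. ?k y p) = (\<Prod>p\<in>offdiag J. ?k y p) * (\<Prod>j\<in>J. ?k y (i2, j) * ?k y (j, i2)) *
          (?k y (i1, i2) * ?k y (i2, i1) * (\<Prod>j\<in>J. ?k y (i1, j) * ?k y (j, i1)))"
        unfolding J(4) using J by (simp add: prod_offdiag_insert mult_ac)
      also have "\<dots> = (?g1 * ?g2) ^ (4*d-8) * ((\<Prod>p\<in>offdiag J. ?k y p) * (\<Prod>j\<in>J. (U i2 j y)^2) *
          (?k y (i1, i2) * ?k y (i2, i1) * (\<Prod>j\<in>J. (U i1 j y)^2)))"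
        unfolding p1 p2 power_mult_distrib by (simp only: mult_ac)
      finally have pr: "(\<Prod>p\<in>offdiag {..<?n}. ?k y p) = \<dots>" .
      show ?case unfolding bifun_eq[OF sX sZ] bival_def case_prod_unfold pr base_res N_def power_mult_distrib[of "?g1 * ?g2"]
        using g12 by simp
    qed
  qed
qed

end

section \<open>Changes of coordinate\<close>

lemma poly_eqI_cofinite:
  fixes p q :: "complex poly"
  assumes "\<And>x. x \<noteq> a \<Longrightarrow> poly p x = poly q x"
  shows "p = q"
proof (rule ccontr)
  assume "p \<noteq> q"
  then have "finite {x. poly (p - q) x = 0}" by (intro poly_roots_finite) simp
  moreover have "UNIV - {a} \<subseteq> {x. poly (p - q) x = 0}" using assms by auto
  ultimately have "finite (UNIV - {a})" by (rule rev_finite_subset)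
  then show False using infinite_UNIV_char_0[where ?'a = complex] by simp
qed

text \<open>Pairs of pencils related by a Moebius change of the coordinate on the line.\<close>
lemma bival_transform:
  fixes \<kappa> \<sigma> :: "nat \<Rightarrow> complex"
  assumes d: "d \<ge> 3" and deg: "degree f \<le> d" "degree g \<le> d" "degree f1 \<le> d" "degree g1 \<le> d"
    and X: "splits (2*d-2) (wronskian f g) X" "inj_on X {..<2*d-2}"
    and X1: "splits (2*d-2) (wronskian f1 g1) X1"
    and \<kappa>: "\<And>i. i < 2*d-2 \<Longrightarrow> poly f1 (X1 i) = \<kappa> i ^ d * poly f (X i) \<and> poly g1 (X1 i) = \<kappa> i ^ d * poly g (X i)"
    and dif: "\<And>i j. i < 2*d-2 \<Longrightarrow> j < 2*d-2 \<Longrightarrow> X1 j - X1 i = \<delta> * (\<kappa> i * \<kappa> j) * (X j - X i)"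
    and nz: "\<delta> \<noteq> 0" "\<And>i. i < 2*d-2 \<Longrightarrow> \<kappa> i \<noteq> 0"
  shows "(\<Prod>(i, j)\<in>offdiag {..<2*d-2}. kern d f1 g1 (X1 i) (X1 j)) =
    (\<Prod>(i, j)\<in>offdiag {..<2*d-2}. kern d f g (X i) (X j) * ((\<kappa> i * \<kappa> j) ^ (d - 3) / \<delta> ^ 3))"
proof (rule prod.cong[OF refl], clarify)
  fix i j assume "(i, j) \<in> offdiag {..<2*d-2}"
  then have ij: "i < 2*d-2" "j < 2*d-2" "i \<noteq> j" by (auto simp: offdiag_def)
  have ne: "X i \<noteq> X j" using X(2) ij by (auto simp: inj_on_def)
  have "X1 j - X1 i \<noteq> 0" using dif[OF ij(1,2)] nz ij ne by auto
  then have ne1: "X1 j \<noteq> X1 i" by auto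
  have W: "poly (wronskian f g) (X i) = 0" "poly (wronskian f g) (X j) = 0"
    "poly (wronskian f1 g1) (X1 i) = 0" "poly (wronskian f1 g1) (X1 j) = 0"
    using splits_root_iff[OF X(1)] splits_root_iff[OF X1] ij by auto
  let ?E = "poly f (X j) * poly g (X i) - poly f (X i) * poly g (X j)"
  have "kern d f1 g1 (X1 i) (X1 j) =
    (poly f1 (X1 j) * poly g1 (X1 i) - poly f1 (X1 i) * poly g1 (X1 j)) / (X1 j - X1 i) ^ 3"
    using kern_root_eq[OF deg(3,4) d W(4,3) ne1] .
  also have "\<dots> = ((\<kappa> i * \<kappa> j) ^ d * ?E) / (\<delta> * (\<kappa> i * \<kappa> j) * (X j - X i)) ^ 3"
  proof -
    have "poly f1 (X1 j) * poly g1 (X1 i) - poly f1 (X1 i) * poly g1 (X1 j) = (\<kappa> i * \<kappa> j) ^ d * ?E"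
      using \<kappa>[OF ij(1)] \<kappa>[OF ij(2)] by (simp add: algebra_simps power_mult_distrib)
    then show ?thesis by (simp only: dif[OF ij(1,2)])
  qed
  also have "(\<kappa> i * \<kappa> j) ^ d = (\<kappa> i * \<kappa> j) ^ (d - 3) * (\<kappa> i * \<kappa> j) ^ 3"
    using d by (simp add: power_add[symmetric])
  also have "(\<kappa> i * \<kappa> j) ^ (d - 3) * (\<kappa> i * \<kappa> j) ^ 3 * ?E / (\<delta> * (\<kappa> i * \<kappa> j) * (X j - X i)) ^ 3 =
      ?E / (X j - X i) ^ 3 * ((\<kappa> i * \<kappa> j) ^ (d - 3) / \<delta> ^ 3)"
    using nz ij by (simp add: power_mult_distrib mult_ac)
  also have "?E / (X j - X i) ^ 3 = kern d f g (X i) (X j)"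
    using kern_root_eq[OF deg(1,2) d W(2,1)] ne by simp
  finally show "kern d f1 g1 (X1 i) (X1 j) = kern d f g (X i) (X j) * ((\<kappa> i * \<kappa> j) ^ (d - 3) / \<delta> ^ 3)" .
qed

text \<open>Each index occurs in \<open>2 * (card S - 1)\<close> ordered pairs.\<close>

lemma prod_offdiag_pair:
  fixes c :: "nat \<Rightarrow> complex"
  assumes "finite S"
  shows "(\<Prod>(i, j)\<in>offdiag S. c i * c j) = (\<Prod>i\<in>S. c i) ^ (2 * (card S - 1))"
  using assms
proof (induction S rule: finite_induct)
  case empty
  show ?case by (simp add: offdiag_def)
next
  case (insert i S)
  have "(\<Prod>p\<in>offdiag (insert i S). (\<lambda>(i, j). c i * c j) p) =
    (\<Prod>p\<in>offdiag S. (\<lambda>(i, j). c i * c j) p) * (\<Prod>j\<in>S. (c i * c j)^2)"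
    using insert by (subst prod_offdiag_insert) (auto simp: power2_eq_square mult_ac)
  also have "(\<Prod>j\<in>S. (c i * c j)^2) = c i ^ (2 * card S) * (\<Prod>j\<in>S. c j)^2"
    by (simp add: power_mult_distrib prod.distrib power_mult prod_power_distrib)
  also have "(\<Prod>p\<in>offdiag S. (\<lambda>(i, j). c i * c j) p) = (\<Prod>i\<in>S. c i) ^ (2 * (card S - 1))"
    by (rule insert.IH)
  finally have e: "(\<Prod>(i, j)\<in>offdiag (insert i S). c i * c j) =
      prod c S ^ (2 * (card S - 1)) * (c i ^ (2 * card S) * (prod c S)^2)" .
  show ?case
  proof (cases "card S")
    case 0
    then have "S = {}" using insert by simp
    moreover from this have "offdiag (insert i S) = {}" by (auto simp: offdiag_def)
    ultimately show ?thesis by simp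
  next
    case (Suc m)
    then show ?thesis unfolding e using insert
      by (simp add: power_mult_distrib power_add power2_eq_square mult_ac)
  qed
qed

lemma card_offdiag: "finite S \<Longrightarrow> card (offdiag S) = card S * (card S - 1)"
proof (induction S rule: finite_induct)
  case empty
  show ?case by (simp add: offdiag_def)
next
  case (insert i S)
  have eq: "offdiag (insert i S) = offdiag S \<union> ((\<lambda>j. (i, j)) ` S \<union> (\<lambda>j. (j, i)) ` S)"
    using insert(2) by (auto simp: offdiag_def)
  have "card (offdiag (insert i S)) = card (offdiag S) + (card S + card S)"
    unfolding eq using insert
    by (subst card_Un_disjoint, simp, simp, force simp: offdiag_def, subst card_Un_disjoint)
      (auto simp: card_image inj_on_def)
  then show ?case using insert by (cases "card S") auto
qed

text \<open>This is \<open>x^d p(c + 1/x)\<close>, see \<open>poly_rev_poly\<close>. The new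
  coordinate sends \<open>c\<close> to infinity and infinity to 0.\<close>

definition rev_poly :: "nat \<Rightarrow> complex \<Rightarrow> complex poly \<Rightarrow> complex poly" where
  "rev_poly d c p = (\<Sum>i\<le>d. monom (tc p (d - i) c) i)"

lemma coeff_rev_poly: "coeff (rev_poly d c p) i = (if i \<le> d then tc p (d - i) c else 0)"
  by (simp add: rev_poly_def coeff_sum)

lemma degree_rev_poly: "degree (rev_poly d c p) \<le> d"
  by (intro degree_le) (auto simp: coeff_rev_poly)

lemma tc_top:
  assumes "degree p \<le> n"
  shows "tc p n c = coeff p n"
proof (cases "degree p = n")
  case True
  have "lead_coeff (pcompose p [:c, 1:]) = lead_coeff p * lead_coeff [:c, 1:] ^ degree p"
    by (rule lead_coeff_comp) simp
  then show ?thesis using True by (simp add: tc_def degree_pcompose)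
next
  case False
  then have "degree p < n" using assms by simp
  then show ?thesis by (simp add: tc_def coeff_eq_0 degree_pcompose)
qed

lemma poly_rev_poly:
  assumes "degree p \<le> d" "x \<noteq> 0"
  shows "poly (rev_poly d c p) x = x ^ d * poly p (c + 1 / x)"
proof -
  have "poly p (c + 1 / x) = (\<Sum>k\<le>d. tc p k c * (1 / x) ^ k)"
    using taylor[OF assms(1), of "c + 1 / x" c] by simp
  then have "x ^ d * poly p (c + 1 / x) = (\<Sum>k\<le>d. tc p k c * x ^ (d - k))"
    using assms(2) by (auto simp: sum_distrib_left power_diff power_one_over field_simps intro!: sum.cong)
  also have "\<dots> = (\<Sum>k\<le>d. tc p (d - k) c * x ^ k)"
    by (rule sum.reindex_bij_witness[of _ "\<lambda>k. d - k" "\<lambda>k. d - k"]) auto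
  also have "\<dots> = poly (rev_poly d c p) x" by (simp add: rev_poly_def poly_sum poly_monom)
  finally show ?thesis by simp
qed

lemma poly_rev_poly_0: "degree p \<le> d \<Longrightarrow> poly (rev_poly d c p) 0 = coeff p d"
  by (simp add: poly_0_coeff_0 coeff_rev_poly tc_top)

lemma rev_poly_member: "rev_poly d c (f + smult t g) = rev_poly d c f + smult t (rev_poly d c g)"
  by (rule poly_eqI) (simp add: coeff_rev_poly tc_add tc_smult)

lemma pderiv_rev_poly:
  assumes "degree p \<le> d" "x \<noteq> 0" "d \<ge> 2"
  shows "poly (pderiv (rev_poly d c p)) x =
    of_nat d * x ^ (d - 1) * poly p (c + 1 / x) - x ^ (d - 2) * poly (pderiv p) (c + 1 / x)"
proof -
  have "((\<lambda>x. x ^ d * poly p (c + 1 / x)) has_field_derivative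
    of_nat d * x ^ (d - 1) * poly p (c + 1 / x) + x ^ d * (poly (pderiv p) (c + 1 / x) * (- 1 / x^2))) (at x)"
    using assms(2)
    by (auto intro!: derivative_eq_intros DERIV_chain2[of "poly p", OF poly_DERIV] simp: power2_eq_square)
  moreover have ev: "eventually (\<lambda>x. poly (rev_poly d c p) x = x ^ d * poly p (c + 1 / x)) (nhds x)"
    by (rule eventually_mono[OF t1_space_nhds[OF assms(2)]]) (rule poly_rev_poly[OF assms(1)])
  ultimately have "(poly (rev_poly d c p) has_field_derivative
    of_nat d * x ^ (d - 1) * poly p (c + 1 / x) + x ^ d * (poly (pderiv p) (c + 1 / x) * (- 1 / x^2))) (at x)"
    using DERIV_cong_ev[OF refl ev refl] by blast
  from DERIV_unique[OF poly_DERIV this] have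
    "poly (pderiv (rev_poly d c p)) x = of_nat d * x ^ (d - 1) * poly p (c + 1 / x) +
       x ^ d * (poly (pderiv p) (c + 1 / x) * (- 1 / x^2))" .
  moreover have "x ^ d = x ^ (d - 2) * x^2" using assms(3) by (metis le_add_diff_inverse2 power_add)
  ultimately show ?thesis using assms(2) by simp
qed

text \<open>The Wronskian behaves as a form of degree \<open>2 * d - 2\<close>; the sign comes from
  the derivative \<open>- 1 / x^2\<close> of the substitution.\<close>

lemma wronskian_rev_poly:
  assumes "degree f \<le> d" "degree g \<le> d" "d \<ge> 2"
  shows "wronskian (rev_poly d c f) (rev_poly d c g) = - rev_poly (2*d-2) c (wronskian f g)"
proof (rule poly_eqI_cofinite[of 0])
  fix x :: complex assume x: "x \<noteq> 0"
  have "x ^ (2*d-2) = x ^ (d - 2) * x ^ d" using assms(3) by (simp add: power_add[symmetric] mult_2)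
  moreover have "poly (rev_poly (2*d-2) c (wronskian f g)) x = x ^ (2*d-2) * poly (wronskian f g) (c + 1 / x)"
    using assms(3) by (intro poly_rev_poly degree_wronskian assms x) simp
  moreover have "poly (wronskian (rev_poly d c f) (rev_poly d c g)) x =
      - (x ^ (d - 2) * x ^ d) * poly (wronskian f g) (c + 1 / x)"
    unfolding wronskian_def poly_diff poly_mult poly_rev_poly[OF assms(1) x] poly_rev_poly[OF assms(2) x]
      pderiv_rev_poly[OF assms(1) x assms(3)] pderiv_rev_poly[OF assms(2) x assms(3)]
    by (simp add: algebra_simps)
  ultimately show "poly (wronskian (rev_poly d c f) (rev_poly d c g)) x = poly (- rev_poly (2*d-2) c (wronskian f g)) x"
    by simp
qed

text \<open>Order of contact in the two coordinates; \<open>a = 0\<close> corresponds to the point at infinity.\<close>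
lemma rev_poly_contact:
  assumes p: "degree p \<le> d" and a: "a \<noteq> 0" and dvd: "lin a ^ k dvd rev_poly d c p"
  shows "lin (c + 1 / a) ^ k dvd p"
proof (cases "rev_poly d c p = 0")
  case True
  have "p = 0"
  proof (rule poly_eqI_cofinite[of c])
    fix x assume x: "x \<noteq> c"
    then show "poly p x = poly 0 x" using poly_rev_poly[OF p, of "1 / (x - c)" c] True by simp
  qed
  then show ?thesis by simp
next
  case False
  obtain q where q: "rev_poly d c p = lin a ^ k * q" using dvd by (elim dvdE)
  then have "q \<noteq> 0" using False by auto
  then have "degree (rev_poly d c p) = k + degree q" unfolding q by (simp add: degree_mult_eq degree_power_eq)
  then have kq: "k + degree q \<le> d" using degree_rev_poly[of d c p] by simp
  \<comment> \<open>\<open>Q\<close> is \<open>(x - c)^(d - k) q(1 / (x - c))\<close>, the quotient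
    carried back to the old coordinate.\<close>
  define Q where "Q = (\<Sum>i\<le>d-k. smult (coeff q i) (lin c ^ (d - k - i)))"
  have "p = lin (c + 1 / a) ^ k * smult ((- a) ^ k) Q"
  proof (rule poly_eqI_cofinite[of c])
    fix x assume x: "x \<noteq> c"
    define z where "z = 1 / (x - c)"
    have z: "z \<noteq> 0" "c + 1 / z = x" using x by (auto simp: z_def)
    have "poly q z = (\<Sum>i\<le>d-k. coeff q i * z ^ i)" by (rule poly_bounded_sum) (use kq in auto)
    moreover have "(x - c) ^ (d - k) * (coeff q i * z ^ i) = coeff q i * (x - c) ^ (d - k - i)" if "i \<le> d - k" for i
      using that x by (simp add: z_def power_one_over power_diff del: diff_diff_left)
    ultimately have "(x - c) ^ (d - k) * poly q z = poly Q x"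
      by (auto simp: Q_def poly_sum sum_distrib_left intro!: sum.cong)
    moreover have "z ^ d * poly p x = (z - a) ^ k * poly q z"
      using poly_rev_poly[OF p z(1), of c] unfolding z(2) q by simp
    moreover have "(x - c) ^ d * z ^ d = 1" using x by (simp add: z_def power_one_over)
    moreover have "(x - c) ^ d = (x - c) ^ k * (x - c) ^ (d - k)" using kq by (simp add: power_add[symmetric])
    moreover have "(x - c) ^ k * (z - a) ^ k = (x - (c + 1 / a)) ^ k * (- a) ^ k"
    proof -
      have "(x - c) * (z - a) = (x - (c + 1 / a)) * (- a)" using x a by (simp add: z_def field_simps)
      then show ?thesis by (simp only: power_mult_distrib[symmetric])
    qed
    ultimately have "poly p x = (x - (c + 1 / a)) ^ k * (- a) ^ k * poly Q x"
      by (metis (no_types, lifting) mult.assoc mult.left_commute mult_1)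
    then show "poly p x = poly (lin (c + 1 / a) ^ k * smult ((- a) ^ k) Q) x" by simp
  qed
  then show ?thesis by (metis dvd_triv_left)
qed

lemma rev_poly_contact_0:
  assumes p: "degree p \<le> d" "k \<le> d" and dvd: "lin 0 ^ k dvd rev_poly d c p"
  shows "degree p + k \<le> d"
proof -
  obtain q where q: "rev_poly d c p = lin 0 ^ k * q" using dvd by (elim dvdE)
  have "coeff (lin 0 ^ k * q) i = 0" if "i < k" for i
  proof -
    have "lin 0 ^ k = monom 1 k" by (simp add: lin_def monom_altdef)
    then show ?thesis using that by (simp add: coeff_monom_mult)
  qed
  then have 0: "tc p (d - i) c = 0" if "i < k" for i
    using that p(2) q coeff_rev_poly[of d c p i] by simp
  have "p = (\<Sum>m\<le>d. smult (tc p m c) (lin c ^ m))"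
    using poly_recentre[OF p(1), of c] by (simp add: tc_def lin_def)
  also have "\<dots> = (\<Sum>m\<le>d-k. smult (tc p m c) (lin c ^ m))"
  proof (rule sum.mono_neutral_right)
    show "\<forall>i\<in>{..d} - {..d - k}. smult (tc p i c) (lin c ^ i) = 0"
    proof
      fix i assume i: "i \<in> {..d} - {..d - k}"
      then have "tc p (d - (d - i)) c = 0" using p(2) by (intro 0) auto
      then show "smult (tc p i c) (lin c ^ i) = 0" using i by simp
    qed
  qed auto
  also have "degree \<dots> \<le> d - k"
    by (intro degree_sum_le) (auto intro: order_trans[OF degree_smult_le] simp: degree_power_eq)
  finally show ?thesis using p(2) by simp
qed

text \<open>Up to sign each ordered pair contributes \<open>(X1 i * X1 j) ^ (d - 3)\<close>, so the
  product of all \<open>X1 i\<close> appears to the power \<open>2 * (2*d-3) * (d-3)\<close>. The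
  new leading coefficient of the Wronskian times this product is the old one up to sign, so the same
  power of it absorbs the change; this is the origin of that exponent. All signs enter an even
  number of times.\<close>

lemma bifun_rev_poly:
  assumes d: "d \<ge> 3" and deg: "degree f \<le> d" "degree g \<le> d"
    and X: "splits (2*d-2) (wronskian f g) X" "inj_on X {..<2*d-2}" and Z: "splits d g Z"
    and c: "poly (wronskian f g) c \<noteq> 0" "poly g c \<noteq> 0"
  shows "bifun d (rev_poly d c f) (rev_poly d c g) = bifun d f g"
proof -
  let ?n = "2*d-2" and ?W = "wronskian f g" and ?f = "rev_poly d c f" and ?g = "rev_poly d c g"
  have split_rev: "splits n (rev_poly n c p) (\<lambda>i. 1 / (Y i - c)) \<and>
     coeff (rev_poly n c p) n * (\<Prod>i<n. 1 / (Y i - c)) = (-1)^n * coeff p n"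
    if Y: "splits n p Y" and pc: "poly p c \<noteq> 0" for n p Y
  proof -
    have Yc: "Y i - c \<noteq> 0" if "i < n" for i using splits_root_iff[OF Y, of c] pc that by auto
    have lc: "coeff (rev_poly n c p) n = poly p c" by (simp add: coeff_rev_poly tc_0)
    have pcx: "poly p c = coeff p n * (-1)^n * (\<Prod>i<n. Y i - c)"
    proof -
      have "(\<Prod>i<n. c - Y i) = (\<Prod>i<n. -1 * (Y i - c))" by (rule prod.cong) auto
      also have "\<dots> = (-1)^n * (\<Prod>i<n. Y i - c)" by (simp only: prod.distrib prod_constant card_lessThan)
      finally show ?thesis unfolding splits_poly[OF Y] by simp
    qed
    have "rev_poly n c p = smult (poly p c) (\<Prod>i<n. lin (1 / (Y i - c)))"
    proof (rule poly_eqI_cofinite[of 0])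
      fix x :: complex assume x: "x \<noteq> 0"
      have "poly (rev_poly n c p) x = x ^ n * (coeff p n * (\<Prod>i<n. c + 1 / x - Y i))"
        using poly_rev_poly[OF _ x] splits_degree[OF Y] splits_poly[OF Y] by simp
      also have "\<dots> = coeff p n * (\<Prod>i<n. x * (c + 1 / x - Y i))" by (simp add: prod.distrib)
      also have "(\<Prod>i<n. x * (c + 1 / x - Y i)) = (\<Prod>i<n. - (Y i - c) * (x - 1 / (Y i - c)))"
        using x Yc by (intro prod.cong) (auto simp: field_simps)
      also have "\<dots> = (-1)^n * (\<Prod>i<n. Y i - c) * (\<Prod>i<n. x - 1 / (Y i - c))"
        by (simp only: prod.distrib mult_minus1[symmetric, of "_ - c"] prod_constant card_lessThan)
      finally show "poly (rev_poly n c p) x = poly (smult (poly p c) (\<Prod>i<n. lin (1 / (Y i - c)))) x"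
        by (simp add: pcx poly_prod mult.assoc)
    qed
    moreover have "poly p c * (\<Prod>i<n. 1 / (Y i - c)) = (-1)^n * coeff p n"
    proof -
      have "(\<Prod>i<n. Y i - c) * (\<Prod>i<n. 1 / (Y i - c)) = 1"
        using Yc by (simp add: prod.distrib[symmetric])
      then show ?thesis unfolding pcx by (simp add: mult.assoc)
    qed
    ultimately show ?thesis unfolding splits_def lc using pc by simp
  qed
  define X1 where "X1 = (\<lambda>i. 1 / (X i - c))"
  define Z1 where "Z1 = (\<lambda>j. 1 / (Z j - c))"
  have Xc: "X i - c \<noteq> 0" if "i < ?n" for i using splits_root_iff[OF X(1), of c] c that by auto
  have Zc: "Z i - c \<noteq> 0" if "i < d" for i using splits_root_iff[OF Z, of c] c that by auto
  have W1: "wronskian ?f ?g = - rev_poly ?n c ?W" using d by (intro wronskian_rev_poly deg) simp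
  have lcW: "coeff (wronskian ?f ?g) ?n * (\<Prod>i<?n. X1 i) = - coeff ?W ?n"
    using split_rev[OF X(1) c(1)] unfolding W1 by (simp add: X1_def)
  have "splits ?n (rev_poly ?n c ?W) X1" using split_rev[OF X(1) c(1)] by (simp add: X1_def)
  then have X1: "splits ?n (wronskian ?f ?g) X1" unfolding W1 splits_def by (metis coeff_minus neg_equal_0_iff_equal smult_minus_left)
  have Z1: "splits d ?g Z1" and lcg: "coeff ?g d * (\<Prod>i<d. Z1 i) = (-1)^d * coeff g d"
    using split_rev[OF Z c(2)] by (simp_all add: Z1_def)
  have ev: "poly (rev_poly d c p) (1 / (x - c)) = (1 / (x - c)) ^ d * poly p x" if "degree p \<le> d" "x - c \<noteq> 0" for p x
    using that poly_rev_poly[OF that(1), of "1 / (x - c)" c] by simp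
  have pr: "(\<Prod>(i, j)\<in>offdiag {..<?n}. kern d ?f ?g (X1 i) (X1 j)) =
    (\<Prod>(i, j)\<in>offdiag {..<?n}. kern d f g (X i) (X j) * ((X1 i * X1 j) ^ (d - 3) / (-1) ^ 3))"
  proof (rule bival_transform[OF d deg degree_rev_poly degree_rev_poly X X1])
    fix i assume "i < ?n"
    then show "poly ?f (X1 i) = X1 i ^ d * poly f (X i) \<and> poly ?g (X1 i) = X1 i ^ d * poly g (X i)" "X1 i \<noteq> 0"
      using ev[OF deg(1) Xc] ev[OF deg(2) Xc] Xc by (simp_all add: X1_def)
  next
    fix i j assume "i < ?n" "j < ?n"
    then show "X1 j - X1 i = - 1 * (X1 i * X1 j) * (X j - X i)"
    proof -
      have "1 / v - 1 / u = - 1 * (1 / u * (1 / v)) * (v - u)" if "u \<noteq> 0" "v \<noteq> 0" for u v :: complex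
        using that by (simp add: field_simps)
      from this[of "X i - c" "X j - c"] show ?thesis
        using Xc \<open>i < ?n\<close> \<open>j < ?n\<close> by (simp add: X1_def)
    qed
  qed simp
  have "(\<Prod>(i, j)\<in>offdiag {..<?n}. kern d f g (X i) (X j) * ((X1 i * X1 j) ^ (d - 3) / (-1) ^ 3)) =
     (\<Prod>(i, j)\<in>offdiag {..<?n}. kern d f g (X i) (X j)) *
     ((\<Prod>(i, j)\<in>offdiag {..<?n}. X1 i * X1 j) ^ (d - 3) * (\<Prod>p\<in>offdiag {..<?n}. -1))"
  proof -
    have "(\<Prod>p\<in>S. a p * (b p ^ m / (-1) ^ 3)) = (\<Prod>p\<in>S. a p) * ((\<Prod>p\<in>S. b p) ^ m * (\<Prod>p\<in>S. -1))"
      for S :: "(nat \<times> nat) set" and a b :: "nat \<times> nat \<Rightarrow> complex" and m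
      by (induction S rule: infinite_finite_induct) (auto simp: power_mult_distrib)
    then show ?thesis by (simp only: case_prod_unfold)
  qed
  also have "(\<Prod>p\<in>offdiag {..<?n}. -1 :: complex) = 1" using d by (simp add: card_offdiag)
  also have "(\<Prod>(i, j)\<in>offdiag {..<?n}. X1 i * X1 j) ^ (d - 3) = (\<Prod>i<?n. X1 i) ^ (2*(2*d-3)*(d-3))"
  proof -
    have "2 * (?n - 1) * (d - 3) = 2*(2*d-3)*(d-3)" using d by simp
    then show ?thesis by (simp add: prod_offdiag_pair power_mult[symmetric])
  qed
  finally have pr': "(\<Prod>(i, j)\<in>offdiag {..<?n}. kern d ?f ?g (X1 i) (X1 j)) =
    (\<Prod>(i, j)\<in>offdiag {..<?n}. kern d f g (X i) (X j)) * (\<Prod>i<?n. X1 i) ^ (2*(2*d-3)*(d-3))"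
    unfolding pr by simp
  have num: "coeff (wronskian ?f ?g) ?n ^ (2*(2*d-3)*(d-3)) *
      (\<Prod>(i, j)\<in>offdiag {..<?n}. kern d ?f ?g (X1 i) (X1 j)) =
    coeff ?W ?n ^ (2*(2*d-3)*(d-3)) * (\<Prod>(i, j)\<in>offdiag {..<?n}. kern d f g (X i) (X j))"
  proof -
    have "coeff (wronskian ?f ?g) ?n ^ (2*(2*d-3)*(d-3)) * (\<Prod>i<?n. X1 i) ^ (2*(2*d-3)*(d-3)) =
        (- coeff ?W ?n) ^ (2*(2*d-3)*(d-3))"
      unfolding power_mult_distrib[symmetric] lcW ..
    also have "\<dots> = coeff ?W ?n ^ (2*(2*d-3)*(d-3))" by (simp add: power_minus_even)
    finally have e: "coeff (wronskian ?f ?g) ?n ^ (2*(2*d-3)*(d-3)) * (\<Prod>i<?n. X1 i) ^ (2*(2*d-3)*(d-3)) =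
      coeff ?W ?n ^ (2*(2*d-3)*(d-3))" .
    have "coeff (wronskian ?f ?g) ?n ^ (2*(2*d-3)*(d-3)) * (A * (\<Prod>i<?n. X1 i) ^ (2*(2*d-3)*(d-3))) =
      coeff ?W ?n ^ (2*(2*d-3)*(d-3)) * A" for A
      unfolding e[symmetric] by (simp only: mult_ac)
    then show ?thesis unfolding pr' .
  qed
  have den: "coeff ?g d ^ d * (\<Prod>j<d. poly ?f (Z1 j)) = ((-1)^d)^d * (coeff g d ^ d * (\<Prod>j<d. poly f (Z j)))"
  proof -
    have "(\<Prod>j<d. poly ?f (Z1 j)) = (\<Prod>j<d. Z1 j ^ d * poly f (Z j))"
      using ev[OF deg(1) Zc] by (intro prod.cong) (auto simp: Z1_def)
    also have "\<dots> = (\<Prod>j<d. Z1 j) ^ d * (\<Prod>j<d. poly f (Z j))" by (simp add: prod.distrib prod_power_distrib)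
    finally have "coeff ?g d ^ d * (\<Prod>j<d. poly ?f (Z1 j)) =
        (coeff ?g d * (\<Prod>j<d. Z1 j)) ^ d * (\<Prod>j<d. poly f (Z j))" by (simp add: power_mult_distrib mult.assoc)
    then show ?thesis unfolding lcg by (simp add: power_mult_distrib mult.assoc)
  qed
  have "even (4 * d - 8)" by simp
  then have "(((-1)^d)^d :: complex) ^ (4*d-8) = 1" by (simp add: power_mult[symmetric])
  then show ?thesis
    unfolding bifun_eq[OF X(1) Z] bifun_eq[OF X1 Z1] bival_def num den power_mult_distrib[of "((-1)^d)^d"]
    by simp
qed

lemma splits_scale:
  assumes Y: "splits n p Y" and C: "C \<noteq> 0" and w: "w \<noteq> 0" and p1: "\<And>x. poly p1 (w * x) = C * poly p x"
  shows "splits n p1 (\<lambda>i. w * Y i) \<and> coeff p1 n * w ^ n = C * coeff p n"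
proof -
  have e: "p1 = smult (C * coeff p n / w ^ n) (\<Prod>i<n. lin (w * Y i))"
  proof (rule poly_eqI_cofinite)
    fix x
    have "poly p1 x = C * (coeff p n * (\<Prod>i<n. x / w - Y i))"
      using p1[of "x / w"] w splits_poly[OF Y] by simp
    also have "(\<Prod>i<n. x / w - Y i) = (\<Prod>i<n. (x - w * Y i) / w)"
      using w by (intro prod.cong) (auto simp: field_simps)
    finally show "poly p1 x = poly (smult (C * coeff p n / w ^ n) (\<Prod>i<n. lin (w * Y i))) x"
      by (simp add: poly_prod prod_dividef)
  qed
  have "coeff (\<Prod>i<n. lin (w * Y i)) n = 1"
  proof -
    have "lead_coeff (\<Prod>i<n. lin (w * Y i)) = 1" by (simp add: lead_coeff_prod) (simp add: lin_def)
    then show ?thesis using degree_prod_lin[of "{..<n}"] by simp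
  qed
  then have lc: "coeff p1 n = C * coeff p n / w ^ n" by (subst e) simp
  then show ?thesis using e C w Y by (simp add: splits_def)
qed

lemma wronskian_scale:
  assumes d: "d \<ge> 1" and w: "w \<noteq> 0"
    and sc: "\<And>x. poly f1 (w * x) = w ^ d * poly f x" "\<And>x. poly g1 (w * x) = w ^ d * poly g x"
  shows "poly (wronskian f1 g1) (w * x) = w ^ (2*d-1) * poly (wronskian f g) x"
proof -
  have comp: "p1 = smult (w ^ d) (pcompose p [:0, 1 / w:])"
    if "\<And>x. poly p1 (w * x) = w ^ d * poly p x" for p1 p
  proof (rule poly_eqI_cofinite)
    fix x
    show "poly p1 x = poly (smult (w ^ d) (pcompose p [:0, 1 / w:])) x"
      using that[of "x / w"] w by (simp add: poly_pcompose)
  qed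
  have "w ^ (2*d-1) = w ^ d * w ^ d / w" using w d by (simp add: power_add[symmetric] power_diff mult_2)
  then show ?thesis
    unfolding comp[OF sc(1)] comp[OF sc(2)]
    using w by (simp add: wronskian_def pderiv_smult pderiv_pcompose poly_pcompose pderiv_pCons algebra_simps diff_divide_distrib)
qed

text \<open>A count of weights: \<open>e1\<close> from the leading coefficient,
  \<open>2 * d - 3\<close> from each of the \<open>(2*d-2) * (2*d-3)\<close> ordered pairs, minus
  \<open>e3\<close> from the resultant. This is where the degree
  \<open>4 * d * (d - 2) * (d - 3)\<close> comes from.\<close>

lemma bifun_scale:
  assumes d: "d \<ge> 3" and deg: "degree f \<le> d" "degree g \<le> d" "degree f1 \<le> d" "degree g1 \<le> d"
    and X: "splits (2*d-2) (wronskian f g) X" "inj_on X {..<2*d-2}" and Z: "splits d g Z"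
    and w: "w \<noteq> 0" and sc: "\<And>x. poly f1 (w * x) = w ^ d * poly f x" "\<And>x. poly g1 (w * x) = w ^ d * poly g x"
  shows "bifun d f1 g1 = w ^ (4 * d * (d - 2) * (d - 3)) * bifun d f g"
proof -
  let ?n = "2*d-2"
  have W1: "poly (wronskian f1 g1) (w * x) = w ^ (2*d-1) * poly (wronskian f g) x" for x
    by (rule wronskian_scale[OF _ w sc]) (use d in simp)
  have X1: "splits ?n (wronskian f1 g1) (\<lambda>i. w * X i)"
    and lcW: "coeff (wronskian f1 g1) ?n * w ^ ?n = w ^ (2*d-1) * coeff (wronskian f g) ?n"
    using splits_scale[OF X(1) _ w W1] w by simp_all
  have Z1: "splits d g1 (\<lambda>i. w * Z i)" and lcg: "coeff g1 d * w ^ d = w ^ d * coeff g d"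
    using splits_scale[OF Z _ w sc(2)] w by simp_all
  have lcW': "coeff (wronskian f1 g1) ?n = w * coeff (wronskian f g) ?n"
  proof -
    have "2*d-1 = Suc ?n" using d by simp
    then have "w ^ (2*d-1) = w * w ^ ?n" by (simp only: power_Suc)
    then show ?thesis using lcW w by simp
  qed
  have pr: "(\<Prod>(i, j)\<in>offdiag {..<?n}. kern d f1 g1 (w * X i) (w * X j)) =
    (\<Prod>(i, j)\<in>offdiag {..<?n}. kern d f g (X i) (X j) * ((w * w) ^ (d - 3) / (1 / w) ^ 3))"
  proof (rule bival_transform[OF d deg X X1], goal_cases)
    case 1
    show ?case by (simp add: sc)
  next
    case 2
    then show ?case using w by (simp add: field_simps)
  qed (use w in auto)
  also have "(w * w) ^ (d - 3) / (1 / w) ^ 3 = w ^ (2*d-3)"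
  proof -
    have "2 * d - 3 = 2 * (d - 3) + 3" using d by simp
    then show ?thesis by (simp only: power_add power_mult) (simp add: power2_eq_square power_one_over)
  qed
  also have "(\<Prod>(i, j)\<in>offdiag {..<?n}. kern d f g (X i) (X j) * w ^ (2*d-3)) =
    (\<Prod>(i, j)\<in>offdiag {..<?n}. kern d f g (X i) (X j)) * w ^ ((2*d-3) * (?n * (?n - 1)))"
    by (simp add: case_prod_unfold prod.distrib card_offdiag power_mult[symmetric])
  finally have pr': "(\<Prod>(i, j)\<in>offdiag {..<?n}. kern d f1 g1 (w * X i) (w * X j)) = \<dots>" .
  have den: "coeff g1 d ^ d * (\<Prod>j<d. poly f1 (w * Z j)) = w ^ (d * d) * (coeff g d ^ d * (\<Prod>j<d. poly f (Z j)))"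
    using lcg w sc by (simp add: prod.distrib power_mult[symmetric])
  define e1 where "e1 = 2*(2*d-3)*(d-3)"
  define e2 where "e2 = (2*d-3) * (?n * (?n - 1))"
  define e3 where "e3 = d * d * (4*d-8)"
  define e4 where "e4 = 4 * d * (d - 2) * (d - 3)"
  have e: "e1 + e2 = e4 + e3"
  proof -
    obtain m where m: "d = m + 3" using d by (metis add.commute le_iff_add)
    show ?thesis unfolding e1_def e2_def e3_def e4_def m by (simp add: algebra_simps)
  qed
  have den': "(w ^ (d * d) * B) ^ (4*d-8) = w ^ e3 * B ^ (4*d-8)" for B
    by (simp add: e3_def power_mult_distrib power_mult[symmetric])
  have "bifun d f1 g1 = (w ^ e1 * w ^ e2) * (coeff (wronskian f g) ?n ^ e1 *
     (\<Prod>(i, j)\<in>offdiag {..<?n}. kern d f g (X i) (X j))) /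
     (w ^ e3 * (coeff g d ^ d * (\<Prod>j<d. poly f (Z j))) ^ (4*d-8))"
    unfolding bifun_eq[OF X1 Z1] bival_def pr' den den' lcW' e1_def[symmetric] e2_def[symmetric] power_mult_distrib[of w]
    by (simp only: mult_ac)
  also have "w ^ e1 * w ^ e2 = w ^ e4 * w ^ e3" unfolding power_add[symmetric] e ..
  finally show ?thesis unfolding bifun_eq[OF X(1) Z] bival_def e1_def[symmetric] e4_def[symmetric]
    using w by simp
qed

section \<open>Finiteness of the exceptional lines\<close>

text \<open>A determinant in disguise: elimination without division keeps the entries polynomial in
  \<open>y\<close>, and \<open>D\<close> is the product of the pivots met on the way.\<close>

lemma kernel_generic:
  fixes c :: "complex \<Rightarrow> 'i \<Rightarrow> 'j \<Rightarrow> complex"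
  assumes "finite J" "finite I" "card I = card J"
    and "\<And>i j. i \<in> I \<Longrightarrow> j \<in> J \<Longrightarrow> \<exists>p. \<forall>y. c y i j = poly p y"
    and "\<And>l. (\<forall>j\<in>J. (\<Sum>i\<in>I. l i * c y0 i j) = 0) \<Longrightarrow> (\<forall>i\<in>I. l i = 0)"
  shows "\<exists>D. poly D y0 \<noteq> 0 \<and>
    (\<forall>y l. poly D y \<noteq> 0 \<longrightarrow> (\<forall>j\<in>J. (\<Sum>i\<in>I. l i * c y i j) = 0) \<longrightarrow> (\<forall>i\<in>I. l i = 0))"
  using assms
proof (induction J arbitrary: I c rule: finite_induct)
  case empty
  then show ?case by (intro exI[of _ 1]) auto
next
  case (insert j0 J)
  have "\<exists>i0\<in>I. c y0 i0 j0 \<noteq> 0"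
  proof (rule ccontr)
    assume a: "\<not> (\<exists>i0\<in>I. c y0 i0 j0 \<noteq> 0)"
    have "card J < card I" using insert by simp
    from homogeneous_system_nontrivial[OF insert.hyps(1) insert.prems(1) this, of "c y0"] obtain l where
      l: "\<exists>i\<in>I. l i \<noteq> 0" "\<forall>j\<in>J. (\<Sum>i\<in>I. l i * c y0 i j) = 0" by blast
    moreover have "(\<Sum>i\<in>I. l i * c y0 i j0) = 0" using a by simp
    ultimately have "\<forall>j\<in>insert j0 J. (\<Sum>i\<in>I. l i * c y0 i j) = 0" by simp
    from insert.prems(4)[OF this] l(1) show False by blast
  qed
  then obtain i0 where i0: "i0 \<in> I" "c y0 i0 j0 \<noteq> 0" by blast
  let ?I = "I - {i0}"
  let ?c = "\<lambda>y i j. c y i0 j0 * c y i j - c y i j0 * c y i0 j"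
  have red: "(\<Sum>i\<in>?I. l i * ?c y i j) = c y i0 j0 * (\<Sum>i\<in>I. l i * c y i j) - c y i0 j * (\<Sum>i\<in>I. l i * c y i j0)"
    for l y j
  proof -
    have "(\<Sum>i\<in>I. l i * ?c y i j) = (\<Sum>i\<in>?I. l i * ?c y i j)"
      using i0 insert.prems(1) by (simp add: sum.remove)
    moreover have "(\<Sum>i\<in>I. l i * ?c y i j) =
        c y i0 j0 * (\<Sum>i\<in>I. l i * c y i j) - c y i0 j * (\<Sum>i\<in>I. l i * c y i j0)"
      by (simp add: algebra_simps sum_subtractf sum_distrib_left)
    ultimately show ?thesis by simp
  qed
  have "\<exists>D. poly D y0 \<noteq> 0 \<and>
    (\<forall>y l. poly D y \<noteq> 0 \<longrightarrow> (\<forall>j\<in>J. (\<Sum>i\<in>?I. l i * ?c y i j) = 0) \<longrightarrow> (\<forall>i\<in>?I. l i = 0))"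
  proof (rule insert.IH)
    show "finite ?I" "card ?I = card J" using insert i0 by auto
    fix i j assume ij: "i \<in> ?I" "j \<in> J"
    have mem: "i \<in> I" "j \<in> insert j0 J" "j0 \<in> insert j0 J" using ij by auto
    obtain p1 where p1: "\<forall>y. c y i0 j0 = poly p1 y" using insert.prems(3)[OF i0(1) mem(3)] ..
    obtain p2 where p2: "\<forall>y. c y i j = poly p2 y" using insert.prems(3)[OF mem(1,2)] ..
    obtain p3 where p3: "\<forall>y. c y i j0 = poly p3 y" using insert.prems(3)[OF mem(1,3)] ..
    obtain p4 where "\<forall>y. c y i0 j = poly p4 y" using insert.prems(3)[OF i0(1) mem(2)] ..
    with p1 p2 p3 show "\<exists>p. \<forall>y. ?c y i j = poly p y" by (intro exI[of _ "p1 * p2 - p3 * p4"]) simp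
  next
    fix l assume l: "\<forall>j\<in>J. (\<Sum>i\<in>?I. l i * ?c y0 i j) = 0"
    define s where "s = - (\<Sum>i\<in>?I. l i * c y0 i j0) / c y0 i0 j0"
    define l' where "l' = l(i0 := s)"
    have l'l: "(\<Sum>i\<in>?I. l' i * h i) = (\<Sum>i\<in>?I. l i * h i)" for h by (rule sum.cong) (auto simp: l'_def)
    have "(\<Sum>i\<in>I. l' i * c y0 i j0) = l' i0 * c y0 i0 j0 + (\<Sum>i\<in>?I. l i * c y0 i j0)"
      using i0 insert.prems(1) l'l by (simp add: sum.remove)
    then have j0: "(\<Sum>i\<in>I. l' i * c y0 i j0) = 0" using i0 by (simp add: l'_def s_def)
    have "(\<Sum>i\<in>I. l' i * c y0 i j) = 0" if "j \<in> J" for j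
      using red[of l' y0 j] l'l[of "\<lambda>i. ?c y0 i j"] l that j0 i0 by simp
    then have "\<forall>i\<in>I. l' i = 0" using insert.prems(4)[of l'] j0 by blast
    then have "l' i = 0" if "i \<in> ?I" for i using that by blast
    then show "\<forall>i\<in>?I. l i = 0" by (simp add: l'_def)
  qed
  then obtain D where D: "poly D y0 \<noteq> 0"
    "\<And>y l. poly D y \<noteq> 0 \<Longrightarrow> (\<forall>j\<in>J. (\<Sum>i\<in>?I. l i * ?c y i j) = 0) \<Longrightarrow> (\<forall>i\<in>?I. l i = 0)" by blast
  obtain p where p: "\<forall>y. c y i0 j0 = poly p y" using insert.prems(3)[OF i0(1)] by blast
  show ?case
  proof (intro exI[of _ "p * D"] conjI allI impI ballI)
    show "poly (p * D) y0 \<noteq> 0" using D(1) p i0 by simp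
    fix y l i assume a: "poly (p * D) y \<noteq> 0" "\<forall>j\<in>insert j0 J. (\<Sum>i\<in>I. l i * c y i j) = 0" "i \<in> I"
    have l: "\<forall>i\<in>?I. l i = 0" by (rule D(2)) (use a red in auto)
    have "(\<Sum>i\<in>I. l i * c y i j0) = l i0 * c y i0 j0"
      using i0 insert.prems(1) l by (simp add: sum.remove)
    then have "l i0 = 0" using a p by auto
    then show "l i = 0" using l a(3) by blast
  qed
qed

text \<open>The linear system is Sylvester's for \<open>p\<close> and its derivative: with
  \<open>degree A < n - 1\<close> and \<open>degree B < n\<close>, the relation
  \<open>A p + B p' = 0\<close> has only the trivial solution if the roots are simple. Being
  nonsingular at \<open>y0\<close>, it is singular for finitely many \<open>y\<close> only.\<close>

lemma finite_not_squarefree: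
  assumes p: "family p" and deg: "\<And>y. degree (p y) \<le> n" and n: "n \<ge> 1"
    and X0: "splits n (p y0) X0" "inj_on X0 {..<n}"
  shows "finite {y. \<not> (\<exists>X. splits n (p y) X \<and> inj_on X {..<n})}"
proof -
  define I :: "(nat + nat) set" where "I = Inl ` {..<n-1} \<union> Inr ` {..<n}"
  define J where "J = {..<2*n-1}"
  define c where "c = (\<lambda>y i j. case i of Inl a \<Rightarrow> coeff (monom 1 a * p y) j | Inr b \<Rightarrow> coeff (monom 1 b * pderiv (p y)) j)"
  have fin: "finite I" "finite J" by (auto simp: I_def J_def)
  have card: "card I = card J"
  proof -
    have "card I = (n - 1) + n" unfolding I_def by (subst card_Un_disjoint) (auto simp: card_image)
    then show ?thesis using n by (simp add: J_def)
  qed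
  have combo: "(\<Sum>i\<in>I. l i * c y i j) =
      coeff ((\<Sum>a<n-1. monom (l (Inl a)) a) * p y + (\<Sum>b<n. monom (l (Inr b)) b) * pderiv (p y)) j" for l y j
  proof -
    have "(\<Sum>i\<in>I. l i * c y i j) = (\<Sum>a<n-1. l (Inl a) * c y (Inl a) j) + (\<Sum>b<n. l (Inr b) * c y (Inr b) j)"
      unfolding I_def by (subst sum.union_disjoint) (auto simp: sum.reindex)
    moreover have "l z * coeff (monom 1 a * q) j = coeff (monom (l z) a * q) j" for z a q
      by (simp add: coeff_monom_mult)
    ultimately show ?thesis by (simp add: c_def coeff_sum sum_distrib_right)
  qed
  have polyc: "\<exists>q. \<forall>y. c y i j = poly q y" for i j
  proof -
    have "(\<lambda>y. c y i j) \<in> polyfun {\<lambda>y. y}"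
    proof (cases i)
      case (Inl a)
      then show ?thesis using family_coeff[OF p]
        by (cases "j < a") (simp_all add: c_def coeff_monom_mult polyfun.const)
    next
      case (Inr b)
      then show ?thesis using family_coeff[OF family_pderiv[OF p]]
        by (cases "j < b") (simp_all add: c_def coeff_monom_mult polyfun.const)
    qed
    then show ?thesis by (simp add: polyfun_id)
  qed
  have degc: "degree (A * p y + B * pderiv (p y)) < 2*n-1" if "degree A < n - 1 \<or> A = 0" "degree B < n" for A B y
  proof -
    have "degree (A * p y) \<le> 2*n-2"
      using that(1) degree_mult_le[of A "p y"] deg[of y] by auto
    moreover have "degree (B * pderiv (p y)) \<le> 2*n-2"
      using that(2) degree_mult_le[of B "pderiv (p y)"] deg[of y] by (simp add: degree_pderiv)
    ultimately have "degree (A * p y + B * pderiv (p y)) \<le> 2*n-2" by (rule degree_add_le)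
    then show ?thesis using n by simp
  qed
  have degsum: "degree (\<Sum>b<k. monom (l b) b) < k \<or> (\<Sum>b<k. monom (l b) b) = 0" for k and l :: "nat \<Rightarrow> complex"
  proof (cases k)
    case (Suc m)
    have "degree (\<Sum>b<k. monom (l b) b) \<le> m"
      using Suc by (intro degree_sum_le) (auto intro: order_trans[OF degree_monom_le])
    then show ?thesis using Suc by simp
  qed simp
  have sum0: "l b = 0" if "(\<Sum>b<k. monom (l b) b) = 0" "b < k" for k b and l :: "nat \<Rightarrow> complex"
  proof -
    have "coeff (\<Sum>b<k. monom (l b) b) b = l b" using that(2) by (simp add: coeff_sum)
    then show ?thesis using that(1) by simp
  qed
  have "\<exists>D. poly D y0 \<noteq> 0 \<and>
    (\<forall>y l. poly D y \<noteq> 0 \<longrightarrow> (\<forall>j\<in>J. (\<Sum>i\<in>I. l i * c y i j) = 0) \<longrightarrow> (\<forall>i\<in>I. l i = 0))"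
  proof (rule kernel_generic[OF fin(2,1) card polyc])
    fix l assume l: "\<forall>j\<in>J. (\<Sum>i\<in>I. l i * c y0 i j) = 0"
    define A where "A = (\<Sum>a<n-1. monom (l (Inl a)) a)"
    define B where "B = (\<Sum>b<n. monom (l (Inr b)) b)"
    have dB: "degree B < n" using degsum[of "\<lambda>b. l (Inr b)" n] n by (auto simp: B_def)
    have dA: "degree A < n - 1 \<or> A = 0" using degsum[of "\<lambda>b. l (Inl b)" "n - 1"] by (simp add: A_def)
    have AB: "A * p y0 + B * pderiv (p y0) = 0"
    proof (rule poly_eqI)
      fix j
      show "coeff (A * p y0 + B * pderiv (p y0)) j = coeff 0 j"
      proof (cases "j < 2*n-1")
        case True
        then show ?thesis using l combo[of l y0 j] by (simp add: J_def A_def B_def)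
      next
        case False
        then show ?thesis
          using degc[OF dA dB, of y0] coeff_eq_0[of "A * p y0 + B * pderiv (p y0)" j] by simp
      qed
    qed
    have "poly B (X0 i) = 0" if "i < n" for i
    proof -
      have "poly (pderiv (p y0)) (X0 i) \<noteq> 0"
        by (rule splits_simple_root[OF X0(1) that]) (use X0(2) that in \<open>auto simp: inj_on_def\<close>)
      moreover have "poly (p y0) (X0 i) = 0" using splits_root_iff[OF X0(1)] that by blast
      moreover have "poly (A * p y0 + B * pderiv (p y0)) (X0 i) = 0" using AB by simp
      ultimately show ?thesis by simp
    qed
    then have sub: "X0 ` {..<n} \<subseteq> {x. poly B x = 0}" by auto
    have "B = 0"
    proof (rule ccontr)
      assume B: "B \<noteq> 0"
      have "n = card (X0 ` {..<n})" using X0(2) by (simp add: card_image)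
      also have "\<dots> \<le> card {x. poly B x = 0}" by (rule card_mono[OF poly_roots_finite[OF B] sub])
      also have "\<dots> \<le> degree B" by (rule card_poly_roots_bound[OF B])
      finally show False using dB by simp
    qed
    moreover have "p y0 \<noteq> 0" using X0(1) by (auto simp: splits_def)
    ultimately have "A = 0" using AB by simp
    then show "\<forall>i\<in>I. l i = 0" using \<open>B = 0\<close> sum0 by (auto simp: I_def A_def B_def)
  qed
  then obtain D where D: "poly D y0 \<noteq> 0"
    "\<And>y l. poly D y \<noteq> 0 \<Longrightarrow> (\<forall>j\<in>J. (\<Sum>i\<in>I. l i * c y i j) = 0) \<Longrightarrow> (\<forall>i\<in>I. l i = 0)" by blast
  obtain q where q: "\<forall>y. coeff (p y) n = poly q y"
    using family_coeff[OF p, of n] by (auto simp: polyfun_id)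
  have "poly q y0 \<noteq> 0" using X0(1) q by (simp add: splits_def)
  have nz: "D * q \<noteq> 0" using D(1) \<open>poly q y0 \<noteq> 0\<close> by auto
  have "{y. \<not> (\<exists>X. splits n (p y) X \<and> inj_on X {..<n})} \<subseteq> {y. poly (D * q) y = 0}"
  proof (rule ccontr)
    assume "\<not> ?thesis"
    then obtain y where y: "\<not> (\<exists>X. splits n (p y) X \<and> inj_on X {..<n})" "poly (D * q) y \<noteq> 0" by blast
    then have lc: "coeff (p y) n \<noteq> 0" using q by auto
    then have "degree (p y) = n" "p y \<noteq> 0" using deg[of y] by (auto intro: le_antisym le_degree)
    from splits_exists[OF this] obtain X where X: "splits n (p y) X" by blast
    then obtain i j where ij: "i < n" "j < n" "i \<noteq> j" "X i = X j" using y(1) by (auto simp: inj_on_def)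
    from splits_double_root[OF X ij] have "lin (X i) dvd p y" "lin (X i) dvd pderiv (p y)"
      by (auto simp: lin_dvd_iff)
    then obtain r s where r: "p y = lin (X i) * r" and s: "pderiv (p y) = lin (X i) * s" by (elim dvdE)
    have r0: "r \<noteq> 0" using \<open>p y \<noteq> 0\<close> r by auto
    then have dr: "degree r < n" using \<open>degree (p y) = n\<close> unfolding r by (simp add: degree_mult_eq)
    have ds: "s = 0 \<or> degree s < n - 1"
    proof (cases "s = 0")
      case False
      then have "degree (pderiv (p y)) = 1 + degree s" unfolding s by (simp add: degree_mult_eq)
      then show ?thesis using \<open>degree (p y) = n\<close> by (simp add: degree_pderiv)
    qed simp
    \<comment> \<open>A common factor \<open>lin (X i)\<close> produces the nontrivial relation
      \<open>- s p + r p' = 0\<close>.\<close>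
    define l where "l = case_sum (\<lambda>a. - coeff s a) (\<lambda>b. coeff r b)"
    have "(\<Sum>b<n. monom (coeff r b) b) = r"
      using small_eq_sum[of r n] dr by (simp add: small_def coeff_eq_0)
    moreover have "(\<Sum>a<n-1. monom (- coeff s a) a) = - s"
      using small_eq_sum[of "- s" "n-1"] ds by (auto simp: small_def coeff_eq_0)
    moreover have "s * p y = r * pderiv (p y)" by (subst r, subst s) (simp add: mult_ac)
    ultimately have "(\<Sum>i\<in>I. l i * c y i j) = 0" for j
      unfolding combo by (simp add: l_def)
    then have "\<forall>i\<in>I. l i = 0" using D(2)[of y l] y(2) by auto
    then have "l (Inr b) = 0" if "b < n" for b using that by (simp add: I_def)
    then have "coeff r b = 0" if "b < n" for b using that by (simp add: l_def)
    then have "r = 0" using dr by (intro poly_eqI) (metis coeff_0 coeff_eq_0 less_le_trans not_le)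
    then show False using r0 by simp
  qed
  then show ?thesis using poly_roots_finite[OF nz] by (rule finite_subset)
qed

section \<open>Counting bitangent lines\<close>

lemma sum_order_roots:
  fixes p :: "complex poly"
  assumes "p \<noteq> 0"
  shows "(\<Sum>x\<in>{x. poly p x = 0}. order x p) = degree p"
proof -
  obtain A where A: "size A = degree p" "p = smult (lead_coeff p) (\<Prod>x\<in>#A. [:- x, 1:])"
    using alg_closed_imp_factorization[OF assms] by blast
  have "proots p = proots (\<Prod>x\<in>#A. [:- x, 1:])" by (subst A(2)) (use assms in simp)
  also have "\<dots> = A"
  proof (induction A)
    case (add x A)
    have "proots ([:- x, 1:] * (\<Prod>x\<in>#A. [:- x, 1:])) = proots [:- x, 1:] + proots (\<Prod>x\<in>#A. [:- x, 1:])"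
      by (rule proots_mult) (auto simp: prod_mset_zero_iff)
    then show ?case using add by simp
  qed simp
  finally have "proots p = A" .
  then have "degree p = size (proots p)" using A by simp
  also have "\<dots> = (\<Sum>x\<in>set_mset (proots p). count (proots p) x)" by (simp add: size_multiset_overloaded_eq)
  finally show ?thesis using assms by simp
qed

lemma eventually_notin_finite:
  fixes y :: "'a::t1_space"
  assumes "finite T"
  shows "eventually (\<lambda>z. z \<notin> T) (at y)"
proof -
  have "open (- (T - {y}))" by (intro open_Compl finite_imp_closed finite_Diff assms)
  then have "eventually (\<lambda>z. z \<in> - (T - {y})) (nhds y)" by (intro eventually_nhds_in_open) auto
  then show ?thesis unfolding eventually_at_filter by eventually_elim auto
qed

lemma order_eqI_nzlim:
  assumes p: "p \<noteq> 0" and lim: "nzlim (at a) (\<lambda>y. poly p y / (y - a) ^ m)"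
  shows "order a p = m"
proof -
  define k where "k = order a p"
  obtain q where q: "p = [:- a, 1:] ^ k * q" "\<not> [:- a, 1:] dvd q"
    using order_decomp[OF p, of a] k_def by blast
  have q0: "poly q a \<noteq> 0" using q(2) by (simp add: poly_eq_0_iff_dvd)
  obtain c where c: "c \<noteq> 0" "((\<lambda>y. poly p y / (y - a) ^ m) \<longlongrightarrow> c) (at a)" using lim by (auto simp: nzlim_def)
  have py: "poly p y = (y - a) ^ k * poly q y" for y by (simp add: q(1))
  have ne: "eventually (\<lambda>y. y \<noteq> a) (at a)" by (simp add: eventually_at_filter)
  consider "k = m" | "k > m" | "k < m" by linarith
  then show ?thesis
  proof cases
    case 2
    have "((\<lambda>y. (y - a) ^ (k - m) * poly q y) \<longlongrightarrow> (a - a) ^ (k - m) * poly q a) (at a)"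
      by (intro tendsto_intros)
    moreover have "eventually (\<lambda>y. poly p y / (y - a) ^ m = (y - a) ^ (k - m) * poly q y) (at a)"
      using ne by eventually_elim (use 2 in \<open>simp add: py power_diff\<close>)
    ultimately have "((\<lambda>y. poly p y / (y - a) ^ m) \<longlongrightarrow> (a - a) ^ (k - m) * poly q a) (at a)"
      by (simp add: tendsto_cong)
    from tendsto_unique[OF _ c(2) this] have "c = (a - a) ^ (k - m) * poly q a" by simp
    then show ?thesis using 2 c(1) by simp
  next
    case 3
    have "((\<lambda>y. (y - a) ^ (m - k) * (poly p y / (y - a) ^ m)) \<longlongrightarrow> (a - a) ^ (m - k) * c) (at a)"
      by (intro tendsto_intros c)
    moreover have "eventually (\<lambda>y. (y - a) ^ (m - k) * (poly p y / (y - a) ^ m) = poly q y) (at a)"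
      using ne by eventually_elim (use 3 in \<open>simp add: py power_diff\<close>)
    ultimately have "(poly q \<longlongrightarrow> (a - a) ^ (m - k) * c) (at a)" by (simp add: tendsto_cong)
    moreover have "(poly q \<longlongrightarrow> poly q a) (at a)" by (rule tendsto_poly[OF tendsto_ident_at])
    ultimately have "poly q a = (a - a) ^ (m - k) * c" using tendsto_unique[OF trivial_limit_at] by blast
    then show ?thesis using 3 q0 by simp
  qed (simp add: k_def)
qed

text \<open>
  By Liouville's theorem \<open>b\<close> extends to a polynomial of degree \<open>D\<close>, whose roots are counted.
\<close>
lemma sum_orders:
  fixes b :: "complex \<Rightarrow> complex" and m :: "complex \<Rightarrow> nat"
  assumes T: "finite T" and hol: "\<And>y. y \<notin> T \<Longrightarrow> b field_differentiable (at y)"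
    and lim: "\<And>y. nzlim (at y) (\<lambda>z. b z / (z - y) ^ m y)"
    and inf: "nzlim (at 0) (\<lambda>w. w ^ D * b (1 / w))"
  shows "finite {y. m y \<noteq> 0} \<and> (\<Sum>y\<in>{y. m y \<noteq> 0}. m y) = D"
proof -
  have "\<exists>l. (b \<longlongrightarrow> l) (at y)" for y
  proof -
    obtain c where c: "((\<lambda>z. b z / (z - y) ^ m y) \<longlongrightarrow> c) (at y)" using lim[of y] by (auto simp: nzlim_def)
    have "((\<lambda>z. (z - y) ^ m y * (b z / (z - y) ^ m y)) \<longlongrightarrow> (y - y) ^ m y * c) (at y)"
      by (intro tendsto_intros c)
    moreover have "eventually (\<lambda>z. (z - y) ^ m y * (b z / (z - y) ^ m y) = b z) (at y)"
      unfolding eventually_at_filter by (rule always_eventually) simp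
    ultimately have "(b \<longlongrightarrow> (y - y) ^ m y * c) (at y)" by (simp add: tendsto_cong)
    then show ?thesis by blast
  qed
  then obtain l where l: "\<And>y. (b \<longlongrightarrow> l y) (at y)" by metis
  \<comment> \<open>On the finite set \<open>T\<close> the values of \<open>b\<close> are replaced
    by its limits, which removes the singularities.\<close>
  define B where "B = (\<lambda>y. if y \<in> T then l y else b y)"
  note evT = eventually_notin_finite[OF T]
  have evB: "eventually (\<lambda>z. B z = b z) (at y)" for y
    using evT by eventually_elim (simp add: B_def)
  have "B holomorphic_on UNIV"
  proof (rule no_isolated_singularity'[OF _ _ open_UNIV T])
    fix z assume "z \<in> T"
    then show "(B \<longlongrightarrow> B z) (at z within UNIV)"
      using l[of z] tendsto_cong[OF evB[of z]] by (simp add: B_def)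
  next
    have op: "open (- T)" using T by (simp add: finite_imp_closed open_Compl)
    show "B holomorphic_on UNIV - T"
    proof (rule holomorphic_transform[of b])
      show "b holomorphic_on UNIV - T"
        using hol by (auto simp: holomorphic_on_def intro: field_differentiable_at_within)
    qed (auto simp: B_def)
  qed
  moreover have "\<exists>A C. \<forall>z. A \<le> norm z \<longrightarrow> norm (B z) \<le> C * norm z ^ D"
  proof -
    obtain c where c: "((\<lambda>w. w ^ D * b (1 / w)) \<longlongrightarrow> c) (at 0)" using inf by (auto simp: nzlim_def)
    have "eventually (\<lambda>w. dist (w ^ D * b (1 / w)) c < 1) (at 0)" using c by (rule tendstoD) simp
    then obtain e where e: "e > 0" "\<And>w. w \<noteq> 0 \<Longrightarrow> norm w < e \<Longrightarrow> dist (w ^ D * b (1 / w)) c < 1"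
      by (auto simp: eventually_at)
    obtain K where K: "\<And>t. t \<in> T \<Longrightarrow> norm t \<le> K"
      using finite_imp_bounded[OF T] by (auto simp: bounded_iff)
    have "norm (B z) \<le> (norm c + 1) * norm z ^ D" if z: "max (K + 1) (1 + 1 / e) \<le> norm z" for z
    proof -
      have "z \<notin> T" using K[of z] z by auto
      then have Bz: "B z = b z" by (simp add: B_def)
      have "1 / e > 0" using e(1) by simp
      then have nz: "norm z > 1 / e" "norm z > 0" using z by linarith+
      have "norm (1 / z) < e" using nz e(1) by (simp add: norm_divide field_simps)
      then have "dist ((1 / z) ^ D * b z) c < 1" using e(2)[of "1 / z"] nz by auto
      then have "norm ((1 / z) ^ D * b z) \<le> norm c + 1"
        using norm_triangle_sub[of "(1 / z) ^ D * b z" c] by (simp add: dist_norm)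
      then have "norm (b z) / norm z ^ D \<le> norm c + 1" by (simp add: norm_mult norm_power norm_divide power_divide)
      then show ?thesis using nz by (simp add: Bz field_simps)
    qed
    then show ?thesis by blast
  qed
  then obtain A C where "\<And>z. A \<le> norm z \<Longrightarrow> norm (B z) \<le> C * norm z ^ D" by blast
  ultimately have Liou: "B z = (\<Sum>k\<le>D. (deriv^^k) B 0 / fact k * z ^ k)" for z by (rule Liouville_polynomial)
  define p where "p = (\<Sum>k\<le>D. monom ((deriv^^k) B 0 / fact k) k)"
  have pB: "poly p z = B z" for z unfolding Liou[of z] p_def by (simp add: poly_sum poly_monom)
  have degp: "degree p \<le> D" unfolding p_def by (intro degree_sum_le) (auto intro: order_trans[OF degree_monom_le])
  obtain c where c: "c \<noteq> 0" "((\<lambda>w. w ^ D * b (1 / w)) \<longlongrightarrow> c) (at 0)" using inf by (auto simp: nzlim_def)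
  \<comment> \<open>Growth of exact order \<open>D\<close>: the reversed polynomial tends to the
    coefficient at \<open>D\<close> as \<open>w\<close> tends to 0, and by assumption this limit is
    not 0.\<close>
  have "coeff p D \<noteq> 0"
  proof -
    have "((\<lambda>w. \<Sum>i\<le>D. coeff p i * w ^ (D - i)) \<longlongrightarrow> (\<Sum>i\<le>D. coeff p i * 0 ^ (D - i))) (at 0)"
      by (intro tendsto_intros)
    also have "(\<Sum>i\<le>D. coeff p i * 0 ^ (D - i)) = (\<Sum>i\<in>{D}. coeff p i * 0 ^ (D - i))"
      by (rule sum.mono_neutral_right) auto
    finally have 1: "((\<lambda>w. \<Sum>i\<le>D. coeff p i * w ^ (D - i)) \<longlongrightarrow> coeff p D) (at 0)" by simp
    have "finite ((\<lambda>t. 1 / t) ` T)" using T by simp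
    then have "eventually (\<lambda>w. w \<notin> insert 0 ((\<lambda>t. 1 / t) ` T)) (at 0)" by (intro eventually_notin_finite) simp
    then have ev: "eventually (\<lambda>w. w ^ D * b (1 / w) = (\<Sum>i\<le>D. coeff p i * w ^ (D - i))) (at 0)"
    proof eventually_elim
      case (elim w)
      then have w: "w \<noteq> 0" by simp
      have "w = 1 / (1 / w)" by simp
      then have "1 / w \<notin> T" using elim by (metis image_eqI insertCI)
      then have "b (1 / w) = poly p (1 / w)" by (simp add: pB B_def)
      also have "\<dots> = (\<Sum>i\<le>D. coeff p i * (1 / w) ^ i)" by (rule poly_bounded_sum[OF degp])
      finally have "w ^ D * b (1 / w) = (\<Sum>i\<le>D. w ^ D * (coeff p i * (1 / w) ^ i))"
        by (simp add: sum_distrib_left)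
      also have "\<dots> = (\<Sum>i\<le>D. coeff p i * w ^ (D - i))"
        using w by (intro sum.cong) (auto simp: power_diff power_one_over field_simps)
      finally show ?case .
    qed
    have "((\<lambda>w. w ^ D * b (1 / w)) \<longlongrightarrow> coeff p D) (at 0)" unfolding tendsto_cong[OF ev] by (rule 1)
    from tendsto_unique[OF _ c(2) this] have "c = coeff p D" by simp
    then show ?thesis using c(1) by simp
  qed
  then have degp': "degree p = D" and p0: "p \<noteq> 0" using degp by (auto intro: le_antisym le_degree)
  have ord: "order y p = m y" for y
  proof (rule order_eqI_nzlim[OF p0])
    show "nzlim (at y) (\<lambda>z. poly p z / (z - y) ^ m y)"
      by (rule nzlim_cong[OF _ lim[of y]]) (use evB[of y] in eventually_elim, simp add: pB)
  qed
  have eq: "{y. m y \<noteq> 0} = {y. poly p y = 0}" using ord order_root[of p] p0 by auto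
  show ?thesis unfolding eq using poly_roots_finite[OF p0] sum_order_roots[OF p0] by (simp add: ord degp')
qed

text \<open>Reversal at 0 turns the coefficient into a value: the reversed Wronskian at 0 is minus
  the coefficient sought, and the 1-jets at 0 of the reversed forms are their two top
  coefficients.\<close>

lemma coeff_wronskian_top:
  assumes "degree f \<le> d" "degree g \<le> d" "d \<ge> 2"
  shows "coeff (wronskian f g) (2*d-2) = coeff f d * coeff g (d - 1) - coeff f (d - 1) * coeff g d"
proof -
  have 0: "tc p k 0 = coeff p k" for p k by (simp add: tc_def pcompose_idR[of p])
  have "poly (wronskian (rev_poly d 0 f) (rev_poly d 0 g)) 0 = - coeff (wronskian f g) (2*d-2)"
    unfolding wronskian_rev_poly[OF assms] using poly_rev_poly_0[OF degree_wronskian[OF assms(1,2)]] assms(3)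
    by simp
  moreover have "poly (pderiv (rev_poly d 0 p)) 0 = coeff p (d - 1)" for p
    using assms(3) by (simp add: poly_0_coeff_0 coeff_pderiv coeff_rev_poly 0)
  ultimately show ?thesis
    using assms by (simp add: wronskian_def poly_rev_poly_0 algebra_simps)
qed

text \<open>The line is tangent at \<open>P\<close>, the point at infinity of the line, to the curve through \<open>P\<close>.\<close>
lemma tangent_member_degree:
  assumes "degree f \<le> d" "degree g \<le> d" "d \<ge> 2" "coeff g d \<noteq> 0" "coeff (wronskian f g) (2*d-2) = 0"
  shows "degree (f + smult (- coeff f d / coeff g d) g) + 2 \<le> d"
proof -
  let ?h = "f + smult (- coeff f d / coeff g d) g"
  have 1: "coeff ?h d = 0" using assms(4) by simp
  have "coeff f d * coeff g (d - 1) = coeff f (d - 1) * coeff g d"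
    using assms(5) coeff_wronskian_top[OF assms(1-3)] by simp
  then have 2: "coeff ?h (d - 1) = 0" using assms(4) by (simp add: field_simps)
  have "degree ?h \<le> d - 2"
  proof (intro degree_le allI impI)
    fix i assume "d - 2 < i"
    then consider "i = d - 1" | "i = d" | "i > d" by linarith
    then show "coeff ?h i = 0" using 1 2 assms(1,2) by cases (auto simp: coeff_eq_0)
  qed
  then show ?thesis using assms(3) by simp
qed

lemma double_root_flex:
  assumes W: "poly (wronskian f g) a = 0" "poly (pderiv (wronskian f g)) a = 0"
    and nb: "\<not> (poly f a = 0 \<and> poly g a = 0)"
  shows "\<exists>m\<in>members f g. lin a ^ 3 dvd m"
proof -
  have aux: "lin a ^ 3 dvd h" if "poly (wronskian h k) a = 0" "poly (pderiv (wronskian h k)) a = 0"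
    "poly h a = 0" "poly k a \<noteq> 0" for h k
  proof -
    have "poly (pderiv h) a = 0" using that by (simp add: wronskian_def)
    moreover have "poly (pderiv (pderiv h)) a = 0" using that by (simp add: pderiv_wronskian)
    ultimately have "tc h 0 a = 0" "tc h 1 a = 0" "tc h 2 a = 0"
      using that(3) tc_2[of h a] by (simp_all only: tc_0 tc_1) simp_all
    moreover have "k = 0 \<or> k = 1 \<or> k = 2" if "k < 3" for k :: nat using that by linarith
    ultimately show ?thesis by (intro lin_power_dvd) metis
  qed
  show ?thesis
  proof (cases "poly g a = 0")
    case False
    define t where "t = - poly f a / poly g a"
    have "poly (f + smult t g) a = 0" using False by (simp add: t_def)
    then have "lin a ^ 3 dvd f + smult t g"
      by (intro aux[of _ g]) (use False W in \<open>simp_all add: wronskian_member\<close>)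
    then show ?thesis by (auto simp: members_def)
  next
    case True
    have "lin a ^ 3 dvd g"
      by (rule aux[of _ f]) (use True W nb in \<open>simp_all add: wronskian_swap[of g f] pderiv_minus\<close>)
    then show ?thesis by (auto simp: members_def)
  qed
qed

text \<open>The version of \<open>kern_zero\<close> for pencils not known to satisfy
  \<open>generic_line\<close>: it serves after an inversion, where genericity is available in the
  old coordinate, and on the line \<open>y = infinity\<close>.\<close>

lemma kern_zero_members:
  assumes d: "d \<ge> 3" and deg: "degree f \<le> d" "degree g \<le> d"
    and X: "splits n (wronskian f g) X" and ij: "(i, j) \<in> offdiag {..<n}"
    and nb: "\<not> (poly f (X i) = 0 \<and> poly g (X i) = 0)" "\<not> (poly f (X j) = 0 \<and> poly g (X j) = 0)"
    and K: "kern d f g (X i) (X j) = 0"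
  shows "\<exists>m\<in>members f g. (X i = X j \<and> lin (X i) ^ 4 dvd m) \<or>
    (X i \<noteq> X j \<and> lin (X i) ^ 2 dvd m \<and> lin (X j) ^ 2 dvd m)"
proof -
  have i: "i < n" "j < n" "i \<noteq> j" using ij by (auto simp: offdiag_def)
  have Wi: "poly (wronskian f g) (X i) = 0" "poly (wronskian f g) (X j) = 0"
    using splits_root_iff[OF X] i by auto
  show ?thesis
  proof (cases "X i = X j")
    case True
    then have "poly (pderiv (wronskian f g)) (X i) = 0" using splits_double_root[OF X i] by simp
    from hyperflex[OF d Wi(1) this nb(1)] K True show ?thesis by auto
  next
    case False
    obtain m where m: "m \<in> members f g" "poly m (X i) = 0" using member_through by blast
    have "poly f (X j) * poly g (X i) = poly f (X i) * poly g (X j)"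
      using kern_root[OF deg d Wi(2,1)] K by simp
    from member_shared[OF m nb(1) this] have m': "poly m (X j) = 0" .
    show ?thesis using False m(1) member_critical[OF m Wi(1) nb(1)] member_critical[OF m(1) m' Wi(2) nb(2)]
      by blast
  qed
qed

text \<open>Let \<open>h\<close> be the member of degree below \<open>d\<close>. A vanishing
  Wronskian means \<open>h' g = h g'\<close>, and comparing leading coefficients would give
  \<open>degree h = degree g\<close>.\<close>

lemma wronskian_nonzero:
  assumes "degree g = d" "d \<ge> 1" "\<And>t. f + smult t g \<noteq> 0" "degree f \<le> d"
  shows "wronskian f g \<noteq> 0"
proof
  assume W: "wronskian f g = 0"
  have gd: "coeff g d \<noteq> 0" using assms(1,2) by auto
  define t where "t = - coeff f d / coeff g d"
  define h where "h = f + smult t g"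
  have h0: "h \<noteq> 0" using assms(3) by (simp add: h_def)
  have "coeff h d = 0" using gd by (simp add: h_def t_def)
  moreover have "degree h \<le> d" unfolding h_def using assms(1,4)
    by (intro degree_add_le) (auto intro: order_trans[OF degree_smult_le])
  ultimately have hd: "degree h < d" using h0 by (metis le_neq_implies_less leading_coeff_0_iff)
  have "wronskian h g = 0" using W by (simp add: h_def wronskian_member)
  then have eq: "pderiv h * g = h * pderiv g" by (simp add: wronskian_def)
  have "lead_coeff (pderiv p) = of_nat (degree p) * lead_coeff p" for p :: "complex poly"
    by (cases "degree p") (simp_all add: degree_pderiv coeff_pderiv pderiv_eq_0_iff[THEN iffD2])
  then have "of_nat (degree h) * lead_coeff h * lead_coeff g = lead_coeff h * (of_nat d * lead_coeff g)"
    using arg_cong[OF eq, of lead_coeff] assms(1) by (simp add: lead_coeff_mult)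
  then have "(of_nat (degree h) :: complex) = of_nat d" using h0 gd assms(1) by simp
  then show False using hd by (simp del: of_nat_eq_iff add: of_nat_eq_iff[where ?'a = complex])
qed

lemma family_eval_polyfun:
  assumes "family p"
  shows "(\<lambda>y. poly (p y) c) \<in> polyfun {\<lambda>y. y}"
proof -
  from family_eval[OF assms] obtain N q where *: "\<And>y x. poly (p y) x = (\<Sum>i\<le>N. poly (q i) y * x ^ i)" by blast
  have "(\<lambda>y. poly (q i) y) \<in> polyfun {\<lambda>y. y}" for i by (auto simp: polyfun_id)
  then show ?thesis unfolding * by (intro polyfun_sum polyfun.mult polyfun.const)
qed

lemma family_rev_poly:
  assumes "family p"
  shows "family (\<lambda>y. rev_poly d c (p y))"
proof -
  have "(\<lambda>y. coeff (rev_poly d c (p y)) i) \<in> polyfun {\<lambda>y. y}" for i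
  proof (cases "i \<le> d")
    case True
    have "(\<lambda>y. poly ((pderiv ^^ (d - i)) (p y)) c * (1 / fact (d - i))) \<in> polyfun {\<lambda>y. y}"
      by (intro polyfun.mult polyfun.const family_eval_polyfun family_pderivs assms)
    then show ?thesis using True by (simp add: coeff_rev_poly tc_eq)
  qed (simp add: coeff_rev_poly polyfun.const)
  then show ?thesis unfolding family_def polyfam_def using degree_rev_poly by blast
qed

lemma members_rev_poly: "m \<in> members (rev_poly d c f) (rev_poly d c g) \<Longrightarrow> \<exists>m'\<in>members f g. m = rev_poly d c m'"
  unfolding members_def rev_poly_member[symmetric] by auto

context pencil_family
begin

abbreviation "bif y \<equiv> bifun d (f y) (g y)"

text \<open>Outside this set all critical points and all roots of \<open>g\<close> are finite and
  simple, so \<open>bif\<close> is differentiable. Lines through a base point belong to it, because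
  a base point is a double root of the Wronskian.\<close>

definition exceptional :: "complex set" where
  "exceptional = {y. \<not> ((\<exists>X. splits (2*d-2) (W y) X \<and> inj_on X {..<2*d-2}) \<and>
     (\<exists>Z. splits d (g y) Z \<and> inj_on Z {..<d}))}"

lemma base_exceptional:
  assumes "poly (f y) a = 0" "poly (g y) a = 0"
  shows "y \<in> exceptional"
proof (rule ccontr)
  assume "y \<notin> exceptional"
  then obtain X where X: "splits (2*d-2) (W y) X" "inj_on X {..<2*d-2}" by (auto simp: exceptional_def)
  have W: "poly (W y) a = 0" "poly (pderiv (W y)) a = 0"
    using assms by (simp_all add: wronskian_def pderiv_diff pderiv_mult)
  obtain i where i: "i < 2*d-2" "a = X i" using W(1) splits_root_iff[OF X(1)] by blast
  have "poly (pderiv (W y)) (X i) \<noteq> 0"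
    by (rule splits_simple_root[OF X(1) i(1)]) (use X(2) i in \<open>auto simp: inj_on_def\<close>)
  then show False using W i by simp
qed

lemma bif_differentiable:
  assumes "y \<notin> exceptional"
  shows "bif field_differentiable (at y)"
proof -
  obtain X Z where "splits (2*d-2) (W y) X" "inj_on X {..<2*d-2}" "splits d (g y) Z" "inj_on Z {..<d}"
    using assms by (auto simp: exceptional_def)
  then show ?thesis using base_exceptional assms by (intro bifun_differentiable) blast+
qed

text \<open>Here a critical point has escaped to infinity. An inverted coordinate brings it to 0 and
  does not change \<open>bif\<close> on neighbouring lines, so the regular case applies. Vanishing
  factors are excluded by carrying contact back, where contact at 0 becomes contact at
  \<open>P\<close>.\<close>

lemma bif_lim_tangent:
  assumes fin: "finite exceptional" and gen: "generic_pencil d (f y0) (g y0)"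
    and gd: "coeff (g y0) d \<noteq> 0" and W0: "coeff (W y0) (2*d-2) = 0"
  shows "nzlim (at y0) bif"
proof -
  interpret gp: generic_pencil d "f y0" "g y0" by (rule gen)
  let ?n = "2*d-2" and ?f = "f y0" and ?g = "g y0"
  define t where "t = - coeff ?f d / coeff ?g d"
  have hd: "degree (?f + smult t ?g) + 2 \<le> d"
    unfolding t_def using d by (intro tangent_member_degree degf degg gd W0) simp
  have dg: "degree ?g = d" using gd degg[of y0] by (auto intro: le_antisym le_degree)
  have "W y0 \<noteq> 0" using d by (intro wronskian_nonzero[OF dg] gp.member_nz degf) simp
  then have "W y0 * ?g \<noteq> 0" using gp.g_nz by simp
  \<comment> \<open>The centre of the inversion has to avoid the critical points and the roots of
    \<open>g\<close>, so that none of them is sent to infinity.\<close>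
  then obtain c where c: "poly (W y0 * ?g) c \<noteq> 0" using poly_all_0_iff_0 by blast
  define f1 where "f1 = (\<lambda>y. rev_poly d c (f y))"
  define g1 where "g1 = (\<lambda>y. rev_poly d c (g y))"
  interpret r: pencil_family d f1 g1
    by unfold_locales (auto simp: f1_def g1_def d degree_rev_poly intro: family_rev_poly famf famg)
  have W1: "r.W y = - rev_poly ?n c (W y)" for y
    unfolding f1_def g1_def using d by (intro wronskian_rev_poly degf degg) simp
  have "coeff (r.W y0) ?n = - poly (W y0) c" by (simp add: W1 coeff_rev_poly tc_0)
  then have lcW: "coeff (r.W y0) ?n \<noteq> 0" using c by simp
  then have "degree (r.W y0) = ?n" "r.W y0 \<noteq> 0" using r.degW[of y0] by (auto intro: le_antisym le_degree)
  from splits_exists[OF this] obtain X where X: "splits ?n (r.W y0) X" by blast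
  have "coeff (g1 y0) d = poly ?g c" by (simp add: g1_def coeff_rev_poly tc_0)
  then have lcg: "coeff (g1 y0) d \<noteq> 0" using c by simp
  then have "degree (g1 y0) = d" "g1 y0 \<noteq> 0" using r.degg[of y0] by (auto intro: le_antisym le_degree)
  from splits_exists[OF this] obtain Z where Z: "splits d (g1 y0) Z" by blast
  have nb: "\<not> (poly (f1 y0) a = 0 \<and> poly (g1 y0) a = 0)" for a
  proof (cases "a = 0")
    case True
    then show ?thesis using gd by (simp add: g1_def poly_rev_poly_0[OF degg])
  next
    case False
    have "\<not> (poly ?f (c + 1 / a) = 0 \<and> poly ?g (c + 1 / a) = 0)"
      using gp.no_base_P[OF hd, of "c + 1 / a"] by (auto simp: lin_dvd_iff)
    then show ?thesis using False by (simp add: f1_def g1_def poly_rev_poly[OF degf] poly_rev_poly[OF degg])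
  qed
  have K: "kern d (f1 y0) (g1 y0) (X i) (X j) \<noteq> 0" if ij: "(i, j) \<in> offdiag {..<?n}" for i j
  proof
    assume "kern d (f1 y0) (g1 y0) (X i) (X j) = 0"
    from kern_zero_members[OF d r.degf r.degg X ij nb nb this] obtain m1 where
      m1: "m1 \<in> members (f1 y0) (g1 y0)" "(X i = X j \<and> lin (X i) ^ 4 dvd m1) \<or>
        (X i \<noteq> X j \<and> lin (X i) ^ 2 dvd m1 \<and> lin (X j) ^ 2 dvd m1)" by blast
    obtain m where m: "m \<in> members ?f ?g" "m1 = rev_poly d c m"
      using members_rev_poly m1(1) unfolding f1_def g1_def by blast
    have dm: "degree m \<le> d" using m(1) gp.deg_member degg by (auto simp: members_def)
    have mg: "m = ?g \<or> (\<exists>t. m = ?f + smult t ?g)" using m(1) by (auto simp: members_def)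
    have bad0: False if h: "lin 0 ^ 2 dvd m1" "m = ?g \<or> lin b ^ 2 dvd m" for b
    proof -
      have dm2: "degree m + 2 \<le> d" using rev_poly_contact_0[OF dm _ h(1)[unfolded m(2)]] d by simp
      then have "m \<noteq> ?g" using dg by auto
      then obtain t' where t': "m = ?f + smult t' ?g" "lin b ^ 2 dvd m" using mg h(2) by blast
      show False using gp.no_tangent_P[of t' b] dm2 t' by blast
    qed
    have bad1: False if "a \<noteq> b" "lin a ^ 2 dvd m" "lin b ^ 2 dvd m" for a b
    proof -
      have ab: "lin a ^ 2 * lin b ^ 2 dvd m" by (rule lin_mult_dvd[OF that])
      from mg show False
      proof
        assume "m = ?g"
        then show False using ab gp.no_bitangent_g by blast
      next
        assume "\<exists>t. m = ?f + smult t ?g"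
        then obtain t' where t': "m = ?f + smult t' ?g" by blast
        show False
        proof (cases "t = t'")
          case True
          then show False using gp.no_tangent_P[OF hd] that(2) t' by blast
        next
          case False
          then show False using gp.no_P_bitangent[OF _ hd] ab t' by blast
        qed
      qed
    qed
    from m1(2) show False
    proof
      assume h: "X i = X j \<and> lin (X i) ^ 4 dvd m1"
      show False
      proof (cases "X i = 0")
        case False
        then have "lin (c + 1 / X i) ^ 4 dvd m" using rev_poly_contact[OF dm False] h m(2) by blast
        then show False using mg gp.no_4_g gp.no_member4 by blast
      next
        case True
        have "lin 0 ^ 3 dvd lin 0 ^ 4" by (rule le_imp_power_dvd) simp
        then have "lin 0 ^ 3 dvd m1" using h True dvd_trans by metis
        then have "degree m + 3 \<le> d" using rev_poly_contact_0[OF dm, of 3 c] d m(2) by simp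
        then show False using mg gp.no_flex_P dg by auto
      qed
    next
      assume h: "X i \<noteq> X j \<and> lin (X i) ^ 2 dvd m1 \<and> lin (X j) ^ 2 dvd m1"
      consider "X i = 0" "X j \<noteq> 0" | "X j = 0" "X i \<noteq> 0" | "X i \<noteq> 0" "X j \<noteq> 0" using h by metis
      then show False
      proof cases
        case 1
        then show False using bad0[of "c + 1 / X j"] rev_poly_contact[OF dm 1(2)] h m(2) by metis
      next
        case 2
        then show False using bad0[of "c + 1 / X i"] rev_poly_contact[OF dm 2(2)] h m(2) by metis
      next
        case 3
        have "c + 1 / X i \<noteq> c + 1 / X j" using h 3 by (metis add_left_cancel div_by_1 divide_divide_eq_right mult_1)
        then show False using bad1 rev_poly_contact[OF dm 3(1)] rev_poly_contact[OF dm 3(2)] h m(2) by metis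
      qed
    qed
  qed
  have nzl: "nzlim (at y0) r.bif" by (rule r.bifun_lim_regular[OF X Z nb K])
  have ev: "eventually (\<lambda>y. poly (W y) c \<noteq> 0) (at y0)" "eventually (\<lambda>y. poly (g y) c \<noteq> 0) (at y0)"
    using tendsto_imp_eventually_ne[OF family_tendsto[OF family_W tendsto_const]]
      tendsto_imp_eventually_ne[OF family_tendsto[OF famg tendsto_const]] c by auto
  with ev eventually_notin_finite[OF fin] have "eventually (\<lambda>y. bif y = r.bif y) (at y0)"
  proof eventually_elim
    case (elim y)
    then obtain X Z where "splits ?n (W y) X" "inj_on X {..<?n}" "splits d (g y) Z" by (auto simp: exceptional_def)
    from bifun_rev_poly[OF d degf degg this elim(1,2)] show ?case by (simp add: f1_def g1_def)
  qed
  then show ?thesis by (rule nzlim_cong[OF _ nzl])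
qed

lemma bif_lim:
  assumes fin: "finite exceptional" and gen: "generic_pencil d (f y0) (g y0)"
    and gd: "coeff (g y0) d \<noteq> 0"
    and fd: "\<And>i. ((\<lambda>y. coeff (f y) i) has_field_derivative coeff fd i) (at y0)" "degree fd \<le> d"
    and gd': "\<And>i. ((\<lambda>y. coeff (g y) i) has_field_derivative coeff gd i) (at y0)" "degree gd \<le> d"
    and tr: "transversal (f y0) (g y0) fd gd"
  shows "nzlim (at y0) (\<lambda>y. bif y / (y - y0) ^
    (if \<exists>t x1 x2. x1 \<noteq> x2 \<and> lin x1 ^ 2 * lin x2 ^ 2 dvd f y0 + smult t (g y0) then 2 else 0))"
proof -
  interpret gp: generic_pencil d "f y0" "g y0" by (rule gen)
  let ?n = "2*d-2"
  show ?thesis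
  proof (cases "coeff (W y0) ?n = 0")
    case True
    have "degree (f y0 + smult (- coeff (f y0) d / coeff (g y0) d) (g y0)) + 2 \<le> d"
      using d by (intro tangent_member_degree degf degg gd True) simp
    \<comment> \<open>On a line tangent at \<open>P\<close>, a bitangent member would be either the
      member tangent at \<open>P\<close>, which then has a further tangency, or a different one;
      both are excluded.\<close>
    then have nob: "\<not> (\<exists>t x1 x2. x1 \<noteq> x2 \<and> lin x1 ^ 2 * lin x2 ^ 2 dvd f y0 + smult t (g y0))"
      using gp.no_P_bitangent gp.no_tangent_P dvd_mult_left by metis
    show ?thesis using bif_lim_tangent[OF fin gen gd True] by (simp only: nob if_False power_0 div_by_1)
  next
    case False
    then have "degree (W y0) = ?n" "W y0 \<noteq> 0" using degW[of y0] by (auto intro: le_antisym le_degree)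
    from splits_exists[OF this] obtain X where X: "splits ?n (W y0) X" by blast
    have "degree (g y0) = d" "g y0 \<noteq> 0" using gd degg[of y0] by (auto intro: le_antisym le_degree)
    from splits_exists[OF this] obtain Z where Z: "splits d (g y0) Z" by blast
    show ?thesis
    proof (cases "\<exists>t x1 x2. x1 \<noteq> x2 \<and> lin x1 ^ 2 * lin x2 ^ 2 dvd f y0 + smult t (g y0)")
      case True
      then obtain t x1 x2 where "x1 \<noteq> x2" "lin x1 ^ 2 * lin x2 ^ 2 dvd f y0 + smult t (g y0)" by blast
      from bifun_lim_bitangent[OF X Z gen this fd gd' tr] show ?thesis by (simp only: True if_True)
    next
      case nob: False
      have "nzlim (at y0) bif"
      proof (cases "\<exists>b. poly (f y0) b = 0 \<and> poly (g y0) b = 0")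
        case True
        then obtain b where b: "poly (f y0) b = 0" "poly (g y0) b = 0" by blast
        have "eventually (\<lambda>y. \<forall>a. \<not> (poly (f y) a = 0 \<and> poly (g y) a = 0)) (at y0)"
          using eventually_notin_finite[OF fin] by eventually_elim (use base_exceptional in blast)
        from bifun_lim_base[OF X Z gen b this] show ?thesis .
      next
        case nb: False
        show ?thesis
        proof (rule bifun_lim_regular[OF X Z])
          fix i j assume "(i, j) \<in> offdiag {..<?n}"
          then show "kern d (f y0) (g y0) (X i) (X j) \<noteq> 0" using gp.kern_zero[OF X] nb nob by blast
        qed (use nb in blast)
      qed
      then show ?thesis by (simp only: nob if_False power_0 div_by_1)
    qed
  qed
qed

end

section \<open>The line at infinity of the parameter, and the count\<close>

definition bitangent_member :: "complex poly \<Rightarrow> complex poly \<Rightarrow> bool" where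
  "bitangent_member f g \<longleftrightarrow> (\<exists>t x1 x2. x1 \<noteq> x2 \<and> lin x1 ^ 2 * lin x2 ^ 2 dvd f + smult t g)"

text \<open>The family \<^const>\<open>slice\<close> in the coordinate \<open>w = 1/y\<close>.\<close>
definition slice_flip :: "nat \<Rightarrow> vec \<Rightarrow> bool \<Rightarrow> complex \<Rightarrow> complex poly" where
  "slice_flip d v s w = (\<Sum>i\<le>d. monom (\<Sum>j\<le>d - i. v (s, i, j) * w ^ (d - i - j)) i)"

lemma coeff_slice_flip:
  "coeff (slice_flip d v s w) i = (if i \<le> d then \<Sum>j\<le>d - i. v (s, i, j) * w ^ (d - i - j) else 0)"
  by (simp add: slice_flip_def coeff_sum)

lemma degree_slice_flip: "degree (slice_flip d v s w) \<le> d"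
  by (intro degree_le) (auto simp: coeff_slice_flip)

lemma slice_flip_0: "slice_flip d v s 0 = slice_inf d v s"
proof (rule poly_eqI)
  fix i
  have "(\<Sum>j\<le>d - i. v (s, i, j) * 0 ^ (d - i - j)) = (\<Sum>j\<in>{d - i}. v (s, i, j) * 0 ^ (d - i - j))"
    by (rule sum.mono_neutral_right) auto
  then show "coeff (slice_flip d v s 0) i = coeff (slice_inf d v s) i"
    by (simp add: coeff_slice_flip coeff_slice_inf)
qed

lemma family_slice: "family (slice d v s)"
  unfolding family_def polyfam_def
proof (intro conjI allI)
  fix i
  show "(\<lambda>y. coeff (slice d v s y) i) \<in> polyfun {\<lambda>y. y}"
    unfolding polyfun_id coeff_slice by (cases "i \<le> d") (auto intro: exI[of _ "0 :: complex poly"])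
qed (use degree_slice in blast)

lemma family_slice_flip: "family (slice_flip d v s)"
  unfolding family_def polyfam_def
proof (intro conjI allI)
  fix i
  have "(\<lambda>w. w) \<in> polyfun {\<lambda>y. y}" by (rule polyfun.coord) simp
  then have "(\<lambda>w. \<Sum>j\<le>d - i. v (s, i, j) * w ^ (d - i - j)) \<in> polyfun {\<lambda>y. y}"
    by (intro polyfun_sum polyfun.mult polyfun.const polyfun_power)
  then show "(\<lambda>w. coeff (slice_flip d v s w) i) \<in> polyfun {\<lambda>y. y}"
    unfolding coeff_slice_flip by (cases "i \<le> d") (simp_all add: polyfun.const)
qed (use degree_slice_flip in blast)

lemma poly_slice_scale:
  assumes "y \<noteq> 0"
  shows "poly (slice d v s y) (y * x) = y ^ d * poly (slice_flip d v s (1 / y)) x"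
proof -
  have "poly (col d v s i) y * y ^ i = y ^ d * (\<Sum>j\<le>d - i. v (s, i, j) * (1 / y) ^ (d - i - j))" if i: "i \<le> d" for i
  proof -
    have "y ^ j * y ^ i = y ^ d * (1 / y) ^ (d - i - j)" if "j \<le> d - i" for j
    proof -
      have "y ^ d = y ^ j * y ^ i * y ^ (d - i - j)" using that i by (simp flip: power_add)
      then show ?thesis using assms by (simp add: power_one_over)
    qed
    then have "v (s, i, j) * y ^ j * y ^ i = y ^ d * (v (s, i, j) * (1 / y) ^ (d - i - j))" if "j \<le> d - i" for j
      using that by (metis mult.assoc mult.left_commute)
    then have "(\<Sum>j\<le>d - i. v (s, i, j) * y ^ j * y ^ i) = (\<Sum>j\<le>d - i. y ^ d * (v (s, i, j) * (1 / y) ^ (d - i - j)))"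
      by (intro sum.cong refl) (simp only: atMost_iff)
    then show ?thesis using i
      by (simp only: col_def poly_sum poly_monom sum_distrib_left sum_distrib_right if_True)
  qed
  note eq = this
  define S where "S = (\<lambda>i. \<Sum>j\<le>d - i. v (s, i, j) * (1 / y) ^ (d - i - j))"
  have "poly (slice d v s y) (y * x) = (\<Sum>i\<le>d. (poly (col d v s i) y * y ^ i) * x ^ i)"
    by (simp add: slice_def poly_sum poly_monom power_mult_distrib mult.assoc)
  also have "\<dots> = (\<Sum>i\<le>d. y ^ d * (S i * x ^ i))"
    by (intro sum.cong refl) (simp only: eq atMost_iff mult.assoc S_def)
  also have "\<dots> = y ^ d * poly (slice_flip d v s (1 / y)) x"
  proof -
    have "slice_flip d v s (1 / y) = (\<Sum>i\<le>d. monom (S i) i)" by (simp add: slice_flip_def S_def)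
    then show ?thesis by (simp add: poly_sum poly_monom sum_distrib_left)
  qed
  finally show ?thesis .
qed

context generic_pencil_inf
begin

lemma wronskian_squarefree:
  assumes "coeff g d \<noteq> 0"
  shows "\<exists>X. splits (2*d-2) (wronskian f g) X \<and> inj_on X {..<2*d-2}"
proof -
  have lc: "coeff (wronskian f g) (2*d-2) \<noteq> 0"
  proof
    assume "coeff (wronskian f g) (2*d-2) = 0"
    then have "degree (f + smult (- coeff f d / coeff g d) g) + 2 \<le> d"
      using d by (intro tangent_member_degree deg_f deg_g assms) simp
    then show False using no_P by blast
  qed
  then have "degree (wronskian f g) = 2*d-2" "wronskian f g \<noteq> 0"
    using degree_wronskian[OF deg_f deg_g] d by (auto intro!: le_antisym le_degree)
  from splits_exists[OF this] obtain X where X: "splits (2*d-2) (wronskian f g) X" by blast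
  have "X i \<noteq> X j" if ij: "i < 2*d-2" "j < 2*d-2" "i \<noteq> j" for i j
  proof
    assume "X i = X j"
    from splits_double_root[OF X ij this]
    have W: "poly (wronskian f g) (X i) = 0" "poly (pderiv (wronskian f g)) (X i) = 0" by auto
    obtain m where m: "m \<in> members f g" "lin (X i) ^ 3 dvd m"
      using double_root_flex[OF W] no_base by (auto simp: lin_dvd_iff)
    have "lin (X i) ^ 2 dvd lin (X i) ^ 3" by (rule le_imp_power_dvd) simp
    then have "lin (X i) ^ 2 dvd m" using m(2) dvd_trans by blast
    then show False using m no_flex no_tangent_g unfolding members_def by blast
  qed
  then show ?thesis using X by (auto simp: inj_on_def)
qed

lemma g_squarefree:
  assumes "coeff g d \<noteq> 0"
  shows "\<exists>Z. splits d g Z \<and> inj_on Z {..<d}"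
proof -
  have "degree g = d" using assms deg_g by (auto intro!: le_antisym le_degree)
  from splits_exists[OF this g_nz] obtain Z where Z: "splits d g Z" by blast
  have "Z i \<noteq> Z j" if ij: "i < d" "j < d" "i \<noteq> j" for i j
    using splits_double_root[OF Z ij] no_tangent_g[of "Z i"] by (auto simp: lin_square_dvd)
  then show ?thesis using Z by (auto simp: inj_on_def)
qed

lemma kern_nonzero:
  assumes X: "splits (2*d-2) (wronskian f g) X" "inj_on X {..<2*d-2}" and ij: "(i, j) \<in> offdiag {..<2*d-2}"
  shows "kern d f g (X i) (X j) \<noteq> 0"
proof
  assume K: "kern d f g (X i) (X j) = 0"
  have nb: "\<not> (poly f a = 0 \<and> poly g a = 0)" for a using no_base[of a] by (simp add: lin_dvd_iff)
  from kern_zero_members[OF d deg_f deg_g X(1) ij nb nb K] obtain m where m: "m \<in> members f g"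
    "(X i = X j \<and> lin (X i) ^ 4 dvd m) \<or> (X i \<noteq> X j \<and> lin (X i) ^ 2 dvd m \<and> lin (X j) ^ 2 dvd m)" by blast
  have "X i \<noteq> X j" using X(2) ij by (auto simp: offdiag_def inj_on_def)
  with m(2) have dv: "X i \<noteq> X j" "lin (X i) ^ 2 dvd m" "lin (X j) ^ 2 dvd m" by auto
  show False using m(1) lin_mult_dvd[OF dv] dv(2) no_tangent_g no_bitangent unfolding members_def by blast
qed

end

lemma splits_scale_inj:
  assumes "\<exists>Y. splits n p Y \<and> inj_on Y {..<n}" "C \<noteq> 0" "w \<noteq> 0" "\<And>x. poly p1 (w * x) = C * poly p x"
  shows "\<exists>Y. splits n p1 Y \<and> inj_on Y {..<n}"
proof -
  obtain Y where Y: "splits n p Y" "inj_on Y {..<n}" using assms(1) by blast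
  from splits_scale[OF Y(1) assms(2-4)] have "splits n p1 (\<lambda>i. w * Y i)" by blast
  moreover have "inj_on (\<lambda>i. w * Y i) {..<n}" using Y(2) assms(3) by (auto simp: inj_on_def)
  ultimately show ?thesis by blast
qed

text \<open>The line \<open>y = infinity\<close> serves twice. Being generic, it has simple critical
  points, which makes the exceptional set finite; and the invariant has a nonzero limit there in the
  rescaled coordinate. By \<open>bifun_scale\<close> the two coordinates differ by a power of
  \<open>w\<close>, which is the growth of the invariant at infinity.\<close>

lemma generic_bitangent_count:
  assumes d: "d \<ge> 3" and gen: "generic d v"
  shows "finite {y. bitangent_member (slice d v False y) (slice d v True y)} \<and>
    card {y. bitangent_member (slice d v False y) (slice d v True y)} = 2 * d * (d - 2) * (d - 3)"
proof -
  let ?n = "2*d-2" and ?D = "4 * d * (d - 2) * (d - 3)"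
  define B where "B = {y. bitangent_member (slice d v False y) (slice d v True y)}"
  interpret s: pencil_family d "slice d v False" "slice d v True"
    by unfold_locales (auto simp: d family_slice degree_slice)
  interpret t: pencil_family d "slice_flip d v False" "slice_flip d v True"
    by unfold_locales (auto simp: d family_slice_flip degree_slice_flip)
  have "generic_line_inf d (slice_inf d v False) (slice_inf d v True)" using gen by (simp add: generic_def)
  then interpret gi: generic_pencil_inf d "slice_flip d v False 0" "slice_flip d v True 0"
    unfolding slice_flip_0 by unfold_locales (use d in auto)
  have lead: "coeff (slice d v True y) d \<noteq> 0" "coeff (slice_flip d v True y) d \<noteq> 0" for y
    using gen by (simp_all add: generic_def coeff_slice coeff_slice_flip col_def poly_monom)
  obtain X where X: "splits ?n (t.W 0) X" "inj_on X {..<?n}" using gi.wronskian_squarefree[OF lead(2)] by blast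
  obtain Z where Z: "splits d (slice_flip d v True 0) Z" "inj_on Z {..<d}" using gi.g_squarefree[OF lead(2)] by blast
  have lim0: "nzlim (at 0) t.bif"
    by (rule t.bifun_lim_regular[OF X(1) Z(1)])
      (use gi.no_base gi.kern_nonzero[OF X] in \<open>auto simp: lin_dvd_iff\<close>)
  have "finite {y. \<not> (\<exists>X. splits ?n (t.W y) X \<and> inj_on X {..<?n})}"
    by (rule finite_not_squarefree[OF t.family_W t.degW _ X]) (use d in simp)
  moreover have "finite {y. \<not> (\<exists>Z. splits d (slice_flip d v True y) Z \<and> inj_on Z {..<d})}"
    by (rule finite_not_squarefree[OF t.famg t.degg _ Z]) (use d in simp)
  moreover have "t.exceptional \<subseteq> {y. \<not> (\<exists>X. splits ?n (t.W y) X \<and> inj_on X {..<?n})} \<union>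
     {y. \<not> (\<exists>Z. splits d (slice_flip d v True y) Z \<and> inj_on Z {..<d})}"
    by (auto simp: t.exceptional_def)
  ultimately have fint: "finite t.exceptional" by (meson finite_UnI finite_subset)
  have exc: "y \<notin> s.exceptional" if y: "y \<noteq> 0" "1 / y \<notin> t.exceptional" for y
  proof -
    from y(2) have tt: "\<exists>X. splits ?n (t.W (1 / y)) X \<and> inj_on X {..<?n}"
      "\<exists>Z. splits d (slice_flip d v True (1 / y)) Z \<and> inj_on Z {..<d}" by (auto simp: t.exceptional_def)
    have Wsc: "poly (s.W y) (y * x) = y ^ (2*d-1) * poly (t.W (1 / y)) x" for x
      by (rule wronskian_scale[OF _ y(1)]) (use d poly_slice_scale[OF y(1)] in auto)
    have "\<exists>X. splits ?n (s.W y) X \<and> inj_on X {..<?n}"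
      by (rule splits_scale_inj[OF tt(1) _ y(1) Wsc]) (use y in simp)
    moreover have "\<exists>Z. splits d (slice d v True y) Z \<and> inj_on Z {..<d}"
      by (rule splits_scale_inj[OF tt(2) _ y(1) poly_slice_scale[OF y(1)]]) (use y in simp)
    ultimately show ?thesis by (auto simp: s.exceptional_def)
  qed
  have "s.exceptional \<subseteq> insert 0 ((\<lambda>w. 1 / w) ` t.exceptional)"
  proof
    fix y assume "y \<in> s.exceptional"
    then have "y = 0 \<or> 1 / y \<in> t.exceptional" using exc by blast
    moreover have "y = 1 / (1 / y)" by simp
    ultimately show "y \<in> insert 0 ((\<lambda>w. 1 / w) ` t.exceptional)" by (metis image_eqI insertCI)
  qed
  then have fins: "finite s.exceptional" by (rule finite_subset) (use fint in simp)
  have "eventually (\<lambda>w. w \<notin> insert 0 t.exceptional) (at 0)" by (rule eventually_notin_finite) (use fint in simp)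
  then have "eventually (\<lambda>w. w ^ ?D * s.bif (1 / w) = t.bif w) (at 0)"
  proof eventually_elim
    case (elim w)
    then have w: "1 / w \<noteq> 0" "w \<notin> t.exceptional" "w \<noteq> 0" by auto
    then obtain X Z where XZ: "splits ?n (t.W w) X" "inj_on X {..<?n}" "splits d (slice_flip d v True w) Z"
      by (auto simp: t.exceptional_def)
    have sc: "poly (slice d v s (1 / w)) (1 / w * x) = (1 / w) ^ d * poly (slice_flip d v s w) x" for s x
      using poly_slice_scale[OF w(1), of d v s x] by simp
    have "s.bif (1 / w) = (1 / w) ^ ?D * t.bif w"
      by (rule bifun_scale[OF d t.degf t.degg s.degf s.degg XZ w(1) sc sc])
    then show ?case using w by (simp add: power_one_over)
  qed
  then have inf: "nzlim (at 0) (\<lambda>w. w ^ ?D * s.bif (1 / w))" by (rule nzlim_cong[OF _ lim0])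
  have der: "((\<lambda>y. coeff (slice d v s y) i) has_field_derivative coeff (slice_deriv d v s y0) i) (at y0)" for s i y0
    by (cases "i \<le> d") (simp_all add: coeff_slice coeff_slice_deriv poly_DERIV)
  have dd: "degree (slice_deriv d v s y) \<le> d" for s y by (intro degree_le) (auto simp: coeff_slice_deriv)
  have lim: "nzlim (at y) (\<lambda>z. s.bif z / (z - y) ^ (if y \<in> B then 2 else 0))" for y
    unfolding B_def mem_Collect_eq bitangent_member_def
    by (rule s.bif_lim[OF fins _ lead(1) der dd der dd])
      (use gen d in \<open>auto simp: generic_def generic_pencil_def\<close>)
  have "finite {y. (if y \<in> B then 2 else 0 :: nat) \<noteq> 0} \<and>
     (\<Sum>y\<in>{y. (if y \<in> B then 2 else 0 :: nat) \<noteq> 0}. if y \<in> B then 2 else 0) = ?D"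
    by (rule sum_orders[OF fins s.bif_differentiable lim inf])
  moreover have "{y. (if y \<in> B then 2 else 0 :: nat) \<noteq> 0} = B" by auto
  ultimately have "finite B" "2 * card B = ?D" by auto
  then show ?thesis unfolding B_def by auto
qed

section \<open>Restriction of forms to lines\<close>

definition feval :: "nat \<Rightarrow> form \<Rightarrow> complex^3 \<Rightarrow> complex" where
  "feval d F v = (\<Sum>(i, j, k)\<in>exponents d. F (i, j, k) * (v$1 ^ i * v$2 ^ j * v$3 ^ k))"

lemma finite_exponents: "finite (exponents d)"
  by (rule finite_subset[of _ "{..d} \<times> {..d} \<times> {..d}"]) (auto simp: exponents_def)

lemma poly_restrict_form: "poly (restrict_form d F p q) \<tau> = feval d F (p + \<tau> *s q)"
  unfolding restrict_form_def feval_def by (auto simp: poly_sum intro!: sum.cong)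

lemma degree_restrict_form: "degree (restrict_form d F p q) \<le> d"
proof -
  have lin: "degree ([:a, b:] ^ n) \<le> n" for a b :: complex and n
    using degree_power_le[of "[:a, b:]" n] by (cases "b = 0") auto
  have "degree (smult c ([:p$1, q$1:] ^ i * [:p$2, q$2:] ^ j * [:p$3, q$3:] ^ k)) \<le> i + j + k" for c i j k
    by (intro order_trans[OF degree_smult_le] order_trans[OF degree_mult_le] add_mono lin)
  then show ?thesis unfolding restrict_form_def
    by (intro degree_sum_le finite_exponents) (auto simp: exponents_def)
qed

lemma restrict_form_linear:
  "restrict_form d (\<lambda>m. s * F m + t * G m) p q = smult s (restrict_form d F p q) + smult t (restrict_form d G p q)"
  by (rule poly_eqI)
    (simp add: restrict_form_def coeff_sum case_prod_unfold sum_distrib_left sum.distrib algebra_simps)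

lemma restrict_form_scale: "restrict_form d (\<lambda>m. c * F m) p q = smult c (restrict_form d F p q)"
  using restrict_form_linear[of d c F 0 F p q] by simp

lemma feval_scale: "feval d F (c *s v) = c ^ d * feval d F v"
  unfolding feval_def sum_distrib_left
  by (intro sum.cong refl) (auto simp: exponents_def power_mult_distrib power_add algebra_simps)

text \<open>For nonzero \<open>\<alpha>\<close> this is homogeneity, and both sides are polynomials
  in \<open>\<alpha>\<close>.\<close>

lemma feval_binary:
  "feval d F (\<alpha> *s p + \<beta> *s q) = (\<Sum>k\<le>d. coeff (restrict_form d F p q) k * \<alpha> ^ (d - k) * \<beta> ^ k)"
proof -
  define A where "A = restrict_form d F (\<beta> *s q) p"
  define B where "B = (\<Sum>k\<le>d. monom (coeff (restrict_form d F p q) k * \<beta> ^ k) (d - k))"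
  have polyB: "poly B x = (\<Sum>k\<le>d. coeff (restrict_form d F p q) k * x ^ (d - k) * \<beta> ^ k)" for x
    by (simp add: B_def poly_sum poly_monom mult_ac)
  have "A = B"
  proof (rule poly_eqI_cofinite[of 0])
    fix x :: complex assume x: "x \<noteq> 0"
    have "\<beta> *s q + x *s p = x *s (p + (\<beta> / x) *s q)"
      using x by (simp add: vec_eq_iff algebra_simps)
    from arg_cong[OF this, of "feval d F"] have "poly A x = x ^ d * poly (restrict_form d F p q) (\<beta> / x)"
      by (simp only: A_def poly_restrict_form feval_scale)
    also have "\<dots> = (\<Sum>k\<le>d. x ^ d * (coeff (restrict_form d F p q) k * (\<beta> / x) ^ k))"
      by (simp add: poly_bounded_sum[OF degree_restrict_form] sum_distrib_left)
    also have "\<dots> = poly B x" unfolding polyB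
      using x by (intro sum.cong refl) (simp add: power_diff power_divide)
    finally show "poly A x = poly B x" .
  qed
  then have "poly A \<alpha> = poly B \<alpha>" by simp
  then show ?thesis by (simp add: polyB) (simp add: A_def poly_restrict_form add.commute)
qed

lemma restrict_form_change:
  "restrict_form d F (c *s p) (a *s p + b *s q) =
     (\<Sum>k\<le>d. smult (coeff (restrict_form d F p q) k) ([:c, a:] ^ (d - k) * [:0, b:] ^ k))"
proof (rule poly_eqI_cofinite[of 0])
  fix x :: complex
  have "c *s p + x *s (a *s p + b *s q) = (c + x * a) *s p + (x * b) *s q"
    by (simp add: vec_eq_iff algebra_simps)
  then show "poly (restrict_form d F (c *s p) (a *s p + b *s q)) x =
     poly (\<Sum>k\<le>d. smult (coeff (restrict_form d F p q) k) ([:c, a:] ^ (d - k) * [:0, b:] ^ k)) x"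
    by (simp only: poly_restrict_form feval_binary) (simp add: poly_sum mult.assoc)
qed

lemma lin_0_power_dvd_iff: "lin 0 ^ k dvd p \<longleftrightarrow> (\<forall>i<k. coeff p i = 0)"
proof
  assume "lin 0 ^ k dvd p"
  then obtain q where "p = monom 1 k * q" by (auto simp: lin_def monom_altdef elim: dvdE)
  then show "\<forall>i<k. coeff p i = 0" by (simp add: coeff_monom_mult)
next
  assume h: "\<forall>i<k. coeff p i = 0"
  then have "tc p i 0 = 0" if "i < k" for i using that by (simp add: tc_def pcompose_idR[of p])
  then show "lin 0 ^ k dvd p" by (rule lin_power_dvd)
qed

text \<open>The reason why the order of contact depends neither on the representative of the point
  nor on the second point of the line: the new restriction is a sum of multiples of
  \<open>(c + a x)^(d - j) (b x)^j\<close>, in which low powers of \<open>x\<close> come only from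
  low coefficients.\<close>

lemma contact_change:
  assumes "lin 0 ^ k dvd restrict_form d F p q"
  shows "lin 0 ^ k dvd restrict_form d F (c *s p) (a *s p + b *s q)"
  unfolding restrict_form_change
proof (rule dvd_sum)
  fix j assume "j \<in> {..d}"
  show "lin 0 ^ k dvd smult (coeff (restrict_form d F p q) j) ([:c, a:] ^ (d - j) * [:0, b:] ^ j)"
  proof (cases "j < k")
    case True
    then show ?thesis using assms by (simp add: lin_0_power_dvd_iff)
  next
    case False
    have "[:0, b:] = lin 0 * [:b:]" by (simp add: lin_def)
    then have "lin 0 ^ j dvd [:0, b:] ^ j" by (metis dvd_triv_left power_mult_distrib)
    moreover have "lin 0 ^ k dvd lin 0 ^ j" using False by (intro le_imp_power_dvd) simp
    ultimately show ?thesis by (intro dvd_smult dvd_mult) (metis dvd_trans)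
  qed
qed

lemma restrict_form_shift: "restrict_form d F (w + x *s p) p = pcompose (restrict_form d F w p) [:x, 1:]"
proof (rule poly_eqI_cofinite[of 0])
  fix t :: complex
  have "w + x *s p + t *s p = w + (x + t) *s p" by (simp add: vec_eq_iff algebra_simps)
  then have "feval d F (w + x *s p + t *s p) = feval d F (w + (x + t) *s p)" by (rule arg_cong)
  then show "poly (restrict_form d F (w + x *s p) p) t = poly (pcompose (restrict_form d F w p) [:x, 1:]) t"
    by (simp only: poly_restrict_form poly_pcompose poly_pCons poly_0) simp
qed

lemma contact_shift: "lin 0 ^ k dvd restrict_form d F (w + x *s p) p \<longleftrightarrow> lin x ^ k dvd restrict_form d F w p"
proof -
  have "pcompose (lin 0) [:x, 1:] = [:x, 1:]" "pcompose (lin x) [:x, 1:] = lin 0"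
    "pcompose (lin 0) [:- x, 1:] = lin x" for x by (simp_all add: lin_def pcompose_pCons)
  note comp = this
  let ?h = "restrict_form d F w p"
  have inv_shift: "pcompose (pcompose ?h [:x, 1:]) [:- x, 1:] = ?h"
    by (simp add: pcompose_assoc[symmetric] pcompose_pCons)
  show ?thesis unfolding restrict_form_shift
  proof
    assume "lin 0 ^ k dvd pcompose ?h [:x, 1:]"
    then obtain q where "pcompose ?h [:x, 1:] = lin 0 ^ k * q" by (elim dvdE)
    then have "?h = lin x ^ k * pcompose q [:- x, 1:]"
      by (metis inv_shift comp(3) pcompose_mult pcompose_power)
    then show "lin x ^ k dvd ?h" by simp
  next
    assume "lin x ^ k dvd ?h"
    then obtain q where "?h = lin x ^ k * q" by (elim dvdE)
    then have "pcompose ?h [:x, 1:] = lin 0 ^ k * pcompose q [:x, 1:]"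
      by (simp add: pcompose_mult pcompose_power comp)
    then show "lin 0 ^ k dvd pcompose ?h [:x, 1:]" by simp
  qed
qed

lemma restrict_form_swap:
  assumes "k \<le> d"
  shows "coeff (restrict_form d F p w) k = coeff (restrict_form d F w p) (d - k)"
proof -
  have "restrict_form d F p w = (\<Sum>j\<le>d. monom (coeff (restrict_form d F w p) j) (d - j))"
  proof (rule poly_eqI_cofinite[of 0])
    fix x :: complex
    have "p + x *s w = x *s w + 1 *s p" by (simp add: add.commute)
    then show "poly (restrict_form d F p w) x = poly (\<Sum>j\<le>d. monom (coeff (restrict_form d F w p) j) (d - j)) x"
      by (simp only: poly_restrict_form feval_binary) (simp add: poly_sum poly_monom)
  qed
  then have "coeff (restrict_form d F p w) k = (\<Sum>j\<le>d. if d - j = k then coeff (restrict_form d F w p) j else 0)"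
    by (simp add: coeff_sum)
  also have "\<dots> = (\<Sum>j\<in>{d - k}. if d - j = k then coeff (restrict_form d F w p) j else 0)"
    by (rule sum.mono_neutral_right) (use assms in auto)
  finally show ?thesis using assms by simp
qed

text \<open>Exchanging the two points reverses the coefficients, so contact at \<open>p\<close>, the
  point at infinity of the coordinate, is a drop in degree.\<close>

lemma contact_infinity:
  assumes "k \<le> d" "lin 0 ^ k dvd restrict_form d F p w"
  shows "degree (restrict_form d F w p) + k \<le> d"
proof -
  have "degree (restrict_form d F w p) \<le> d - k"
  proof (intro degree_le allI impI)
    fix i assume i: "d - k < i"
    show "coeff (restrict_form d F w p) i = 0"
    proof (cases "i \<le> d")
      case True
      then have "coeff (restrict_form d F p w) (d - i) = 0"
        using assms i by (simp add: lin_0_power_dvd_iff)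
      then show ?thesis using restrict_form_swap[of "d - i" d F p w] True by simp
    qed (use degree_restrict_form[of d F w p] in \<open>simp add: coeff_eq_0\<close>)
  qed
  then show ?thesis using assms by simp
qed

section \<open>Points on a line\<close>

definition cross :: "complex^3 \<Rightarrow> complex^3 \<Rightarrow> complex^3" where
  "cross a b = vector [a$2 * b$3 - a$3 * b$2, a$3 * b$1 - a$1 * b$3, a$1 * b$2 - a$2 * b$1]"

lemma cross_components [simp]:
  "cross a b $ 1 = a$2 * b$3 - a$3 * b$2" "cross a b $ 2 = a$3 * b$1 - a$1 * b$3"
  "cross a b $ 3 = a$1 * b$2 - a$2 * b$1"
  by (simp_all add: cross_def)

lemma pairing_simp: "pairing l p = l$1 * p$1 + l$2 * p$2 + l$3 * p$3"
  by (simp add: pairing_def sum_3)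

lemma vec3_eq_iff: "v = w \<longleftrightarrow> v$1 = w$1 \<and> v$2 = w$2 \<and> v$3 = w$3" for v w :: "complex^3"
  by (simp add: vec_eq_iff forall_3)

lemma pairing_linear: "pairing l (a *s p + b *s q) = a * pairing l p + b * pairing l q"
  "pairing (a *s l) p = a * pairing l p" "pairing l (a *s p) = a * pairing l p"
  by (simp_all add: pairing_simp algebra_simps)

lemma pairing_cross: "pairing l (cross l e) = 0"
  by (simp add: pairing_simp algebra_simps)

lemma mem_pt: "v \<in> pt w \<longleftrightarrow> (\<exists>c. v = c *s w)"
  by (auto simp: pt_def)

lemma pt_eqD: assumes "pt v = pt w" shows "\<exists>c. v = c *s w"
proof -
  have "v \<in> pt v" unfolding mem_pt by (intro exI[of _ 1]) simp
  then show ?thesis using assms by (simp add: mem_pt)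
qed

lemma pt_scale: "c \<noteq> 0 \<Longrightarrow> pt (c *s v) = pt v"
  unfolding pt_def
  by (auto simp: image_iff vector_smult_assoc) (metis nonzero_divide_eq_eq)

lemma pt_eq_iff: "v \<noteq> 0 \<Longrightarrow> pt v = pt w \<longleftrightarrow> v \<in> pt w"
  using pt_eqD[of v w] pt_scale[of _ w] by (auto simp: mem_pt)

text \<open>The coordinates of the identity \<open>det(p, q, r) e\<^sub>i = (q \<times> r)\<^sub>i p + (r \<times> p)\<^sub>i q + (p \<times> q)\<^sub>i r\<close>.\<close>
lemma line_relation:
  assumes "l \<noteq> 0" "pairing l p = 0" "pairing l q = 0" "pairing l r = 0"
  shows "cross p q $ i *s r = cross r q $ i *s p + cross p r $ i *s q"
proof -
  define D where "D = p$1 * cross q r $ 1 + p$2 * cross q r $ 2 + p$3 * cross q r $ 3"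
  have "D * l$1 = pairing l p * cross q r $ 1 + pairing l q * cross r p $ 1 + pairing l r * cross p q $ 1"
    "D * l$2 = pairing l p * cross q r $ 2 + pairing l q * cross r p $ 2 + pairing l r * cross p q $ 2"
    "D * l$3 = pairing l p * cross q r $ 3 + pairing l q * cross r p $ 3 + pairing l r * cross p q $ 3"
    by (simp_all add: D_def pairing_simp algebra_simps)
  then have "D * l$1 = 0" "D * l$2 = 0" "D * l$3 = 0" using assms by simp_all
  then have D0: "D = 0" using assms(1) by (auto simp: vec3_eq_iff)
  have "(cross p q $ i *s r - (cross r q $ i *s p + cross p r $ i *s q)) $ j = (if i = j then D else 0)" for j
    using exhaust_3[of i] exhaust_3[of j] by (elim disjE) (simp_all add: D_def algebra_simps)
  then have "cross p q $ i *s r - (cross r q $ i *s p + cross p r $ i *s q) = 0"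
    using D0 by (simp add: vec_eq_iff)
  then show ?thesis by simp
qed

lemma cross_eq_0:
  assumes "cross p q = 0" "p \<noteq> 0"
  shows "q \<in> pt p"
proof -
  have e: "p$2 * q$3 = p$3 * q$2" "p$3 * q$1 = p$1 * q$3" "p$1 * q$2 = p$2 * q$1"
    using assms(1) by (simp_all add: vec3_eq_iff)
  consider "p$1 \<noteq> 0" | "p$2 \<noteq> 0" | "p$3 \<noteq> 0" using assms(2) by (auto simp: vec3_eq_iff)
  then show ?thesis
  proof cases
    case 1
    then have "q = (q$1 / p$1) *s p" using e by (simp add: vec3_eq_iff field_simps)
    then show ?thesis unfolding mem_pt by blast
  next
    case 2
    then have "q = (q$2 / p$2) *s p" using e by (simp add: vec3_eq_iff field_simps)
    then show ?thesis unfolding mem_pt by blast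
  next
    case 3
    then have "q = (q$3 / p$3) *s p" using e by (simp add: vec3_eq_iff field_simps)
    then show ?thesis unfolding mem_pt by blast
  qed
qed

lemma line_span:
  assumes "l \<noteq> 0" "p \<noteq> 0" "pairing l p = 0" "pairing l q = 0" "q \<notin> pt p" "pairing l r = 0"
  shows "\<exists>a b. r = a *s p + b *s q"
proof -
  obtain i where i: "cross p q $ i \<noteq> 0" using cross_eq_0[of p q] assms by (auto simp: vec_eq_iff)
  have "r = (1 / cross p q $ i) *s (cross p q $ i *s r)" using i by (simp add: vector_smult_assoc)
  also have "\<dots> = (cross r q $ i / cross p q $ i) *s p + (cross p r $ i / cross p q $ i) *s q"
    unfolding line_relation[OF assms(1,3,4,6)] by (simp add: vec_eq_iff field_simps)
  finally show ?thesis by blast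
qed

text \<open>The points \<open>cross l (axis j 1)\<close> lie on the line and depend polynomially on
  it, which lets them serve as second points in the equations of the incidence variety.\<close>

lemma second_point:
  assumes "l \<noteq> 0" "p \<noteq> 0"
  shows "\<exists>j. cross l (axis j 1) \<notin> pt p"
proof (rule ccontr)
  assume "\<not> ?thesis"
  then have "\<forall>j. \<exists>c. cross l (axis j 1) = c *s p" by (simp add: mem_pt)
  then obtain c where c: "\<And>j. cross l (axis j 1) = c j *s p" by metis
  from c[of 1] c[of 2] c[of 3] assms show False
    by (auto simp: vec3_eq_iff axis_def)
qed

section \<open>The closure of the incidence correspondence\<close>

text \<open>Quantifying over all representatives and all second points makes this a property of the
  classes; \<open>touches_iff\<close> reduces it to one choice.\<close>

definition touches :: "nat \<Rightarrow> nat \<Rightarrow> (complex^3) set \<Rightarrow> (complex^3) set \<Rightarrow> form set \<Rightarrow> bool" where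
  "touches d k L P C \<longleftrightarrow> (\<forall>l\<in>L - {0}. \<forall>p\<in>P - {0}. \<forall>F\<in>C. pairing l p = 0 \<and>
     (\<forall>q. pairing l q = 0 \<longrightarrow> lin 0 ^ k dvd restrict_form d F p q))"

lemma touches_iff:
  assumes "l \<noteq> 0" "p \<noteq> 0" "pairing l u = 0" "u \<notin> pt p"
  shows "touches d k (pt l) (pt p) (curve F) \<longleftrightarrow> pairing l p = 0 \<and> lin 0 ^ k dvd restrict_form d F p u"
proof
  have "l \<in> pt l" "p \<in> pt p" unfolding mem_pt by (intro exI[of _ 1], simp)+
  moreover have "F \<in> curve F" unfolding curve_def by (intro range_eqI[of _ _ 1]) simp
  moreover assume "touches d k (pt l) (pt p) (curve F)"
  ultimately show "pairing l p = 0 \<and> lin 0 ^ k dvd restrict_form d F p u"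
    using assms unfolding touches_def by blast
next
  assume h: "pairing l p = 0 \<and> lin 0 ^ k dvd restrict_form d F p u"
  show "touches d k (pt l) (pt p) (curve F)"
    unfolding touches_def
  proof (intro ballI conjI allI impI)
    fix l' p' F' assume "l' \<in> pt l - {0}" "p' \<in> pt p - {0}" "F' \<in> curve F"
    then obtain c c' e where *: "l' = c *s l" "c \<noteq> 0" "p' = c' *s p" "F' = (\<lambda>m. e * F m)"
      by (auto simp: mem_pt curve_def)
    show "pairing l' p' = 0" using h by (simp add: * pairing_linear)
    fix q assume "pairing l' q = 0"
    then have "pairing l q = 0" by (simp add: * pairing_linear)
    then obtain a b where "q = a *s p + b *s u" using line_span[OF assms(1,2) conjunct1[OF h] assms(3,4)] by blast
    then show "lin 0 ^ k dvd restrict_form d F' p' q"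
      using contact_change[OF conjunct2[OF h]] by (simp add: * restrict_form_scale dvd_smult)
  qed
qed

lemma vanishing_order_iff: "vanishing_order f \<ge> enat k \<longleftrightarrow> lin 0 ^ k dvd f"
  unfolding vanishing_order_def lin_def by (auto simp: order_divides[of 0 k f, simplified])

lemma intersection_mult_iff:
  assumes "l \<noteq> 0" "p \<noteq> 0"
  shows "intersection_mult d l F p \<ge> 2 \<longleftrightarrow> touches d 2 (pt l) (pt p) (curve F)"
proof -
  define q where "q = (SOME q. pairing l q = 0 \<and> q \<notin> pt p)"
  have "\<exists>q. pairing l q = 0 \<and> q \<notin> pt p" using second_point[OF assms] pairing_cross by blast
  then have q: "pairing l q = 0" "q \<notin> pt p" unfolding q_def by (metis (mono_tags, lifting) someI_ex)+
  have "intersection_mult d l F p \<ge> 2 \<longleftrightarrow> pairing l p = 0 \<and> lin 0 ^ 2 dvd restrict_form d F p q"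
    using vanishing_order_iff[of 2] unfolding intersection_mult_def q_def[symmetric]
    by (auto simp: numeral_eq_enat zero_enat_def)
  then show ?thesis using touches_iff[OF assms q] by simp
qed

text \<open>
  If the line meets the curve at \<open>p\<close> with multiplicity at least 2, then \<open>F(\<alpha> p + \<beta> u)\<close> equals \<open>\<beta>\<^sup>2\<close>
  times the value at \<open>\<beta>\<close> of this polynomial.
\<close>
definition residual :: "nat \<Rightarrow> form \<Rightarrow> complex^3 \<Rightarrow> complex^3 \<Rightarrow> complex \<Rightarrow> complex poly" where
  "residual d F p u \<alpha> = (\<Sum>k\<in>{2..d}. monom (coeff (restrict_form d F p u) k * \<alpha> ^ (d - k)) (k - 2))"

lemma coeff_residual:
  assumes "n + 2 \<le> d"
  shows "coeff (residual d F p u \<alpha>) n = coeff (restrict_form d F p u) (n + 2) * \<alpha> ^ (d - (n + 2))"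
proof -
  have "coeff (residual d F p u \<alpha>) n =
      (\<Sum>k\<in>{2..d}. if k - 2 = n then coeff (restrict_form d F p u) k * \<alpha> ^ (d - k) else 0)"
    by (simp add: residual_def coeff_sum)
  also have "\<dots> = (\<Sum>k\<in>{n + 2}. if k - 2 = n then coeff (restrict_form d F p u) k * \<alpha> ^ (d - k) else 0)"
    by (rule sum.mono_neutral_right) (use assms in auto)
  finally show ?thesis by simp
qed

lemma feval_residual:
  assumes "lin 0 ^ 2 dvd restrict_form d F p u" "d \<ge> 2"
  shows "feval d F (\<alpha> *s p + \<beta> *s u) = \<beta> ^ 2 * poly (residual d F p u \<alpha>) \<beta>"
proof -
  let ?h = "restrict_form d F p u"
  have "(\<Sum>k\<le>d. coeff ?h k * \<alpha> ^ (d - k) * \<beta> ^ k) = (\<Sum>k\<in>{2..d}. coeff ?h k * \<alpha> ^ (d - k) * \<beta> ^ k)"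
    by (rule sum.mono_neutral_right) (use assms(1) in \<open>auto simp: lin_0_power_dvd_iff\<close>)
  also have "\<dots> = (\<Sum>k\<in>{2..d}. \<beta> ^ 2 * (coeff ?h k * \<alpha> ^ (d - k) * \<beta> ^ (k - 2)))"
  proof (rule sum.cong)
    fix k assume "k \<in> {2..d}"
    then have "2 + (k - 2) = k" by (intro le_add_diff_inverse) simp
    then have "\<beta> ^ k = \<beta> ^ 2 * \<beta> ^ (k - 2)" by (metis power_add)
    then show "coeff ?h k * \<alpha> ^ (d - k) * \<beta> ^ k = \<beta> ^ 2 * (coeff ?h k * \<alpha> ^ (d - k) * \<beta> ^ (k - 2))" by simp
  qed simp
  finally show ?thesis unfolding feval_binary residual_def
    by (simp add: poly_sum poly_monom sum_distrib_left)
qed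

text \<open>Equations that keep their force when \<open>p2\<close> merges with \<open>p1\<close>. By
  \<open>line_relation\<close> a multiple of \<open>p2\<close> is
  \<open>\<alpha> p1 + \<beta> u\<close> with \<open>\<alpha> = cross p2 u $ i\<close> and
  \<open>\<beta> = cross p1 p2 $ i\<close>. Once the factor \<open>\<beta>^2\<close> due to the
  contact at \<open>p1\<close> is divided out, contact at \<open>p2\<close> says that the residual
  has a double root at \<open>\<beta>\<close>. For merged points \<open>\<beta> = 0\<close>, and the
  equations express fourfold contact. The factor in front of the derivative takes care of
  \<open>\<alpha> = \<beta> = 0\<close> with \<open>d = 3\<close>, where the derivative of the
  residual need not vanish.\<close>

definition tangency :: "nat \<Rightarrow> form \<Rightarrow> complex^3 \<Rightarrow> complex^3 \<Rightarrow> complex^3 \<Rightarrow> bool" where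
  "tangency d F p1 p2 u \<longleftrightarrow> (\<forall>i. let R = residual d F p1 u (cross p2 u $ i) in
     poly R (cross p1 p2 $ i) = 0 \<and> cross p2 u $ i * poly (pderiv R) (cross p1 p2 $ i) = 0)"

lemma cross_collinear: "p2 \<in> pt p1 \<Longrightarrow> cross p1 p2 = 0"
  by (auto simp: mem_pt vec3_eq_iff)

lemma tangencyI:
  assumes d: "d \<ge> 3" and l: "l \<noteq> 0" "p1 \<noteq> 0" "pairing l p1 = 0" "pairing l p2 = 0" "pairing l u = 0"
    and c: "lin 0 ^ 2 dvd restrict_form d F p1 u" "lin 0 ^ 2 dvd restrict_form d F p2 u"
    and c4: "p2 \<in> pt p1 \<Longrightarrow> lin 0 ^ 4 dvd restrict_form d F p1 u"
  shows "tangency d F p1 p2 u"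
  unfolding tangency_def Let_def
proof
  fix i
  define \<alpha> \<beta> \<gamma> where "\<alpha> = cross p2 u $ i" and "\<beta> = cross p1 p2 $ i" and "\<gamma> = cross p1 u $ i"
  have rel: "\<gamma> *s p2 = \<alpha> *s p1 + \<beta> *s u"
    unfolding \<alpha>_def \<beta>_def \<gamma>_def by (rule line_relation[OF l(1,3,5,4)])
  let ?R = "residual d F p1 u \<alpha>"
  have "poly ?R \<beta> = 0 \<and> \<alpha> * poly (pderiv ?R) \<beta> = 0"
  proof (cases "\<beta> = 0")
    case True
    have co: "poly ?R 0 = coeff (restrict_form d F p1 u) 2 * \<alpha> ^ (d - 2)"
      "poly (pderiv ?R) 0 = coeff (restrict_form d F p1 u) 3 * \<alpha> ^ (d - 3)"
      using coeff_residual[of 0 d F p1 u \<alpha>] coeff_residual[of 1 d F p1 u \<alpha>] d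
      by (simp_all add: poly_0_coeff_0 coeff_pderiv numeral_3_eq_3 numeral_2_eq_2)
    show ?thesis
    proof (cases "p2 \<in> pt p1")
      case p: True
      then show ?thesis using c4[OF p] co True by (simp add: lin_0_power_dvd_iff)
    next
      case False
      \<comment> \<open>The coordinate \<open>i\<close> can be degenerate although the points
        differ; then \<open>\<alpha>\<close> is zero as well and the equations hold
        trivially.\<close>
      have "\<gamma> = 0"
      proof (rule ccontr)
        assume \<gamma>: "\<gamma> \<noteq> 0"
        have "p2 = (1 / \<gamma>) *s (\<gamma> *s p2)" using \<gamma> by (simp add: vector_smult_assoc)
        also have "\<dots> = (\<alpha> / \<gamma>) *s p1" unfolding rel True by (simp add: vector_smult_assoc)
        finally show False using False unfolding mem_pt by blast
      qed
      then have "\<alpha> = 0" using rel True l(2) by simp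
      then show ?thesis using co d True by simp
    qed
  next
    case False
    \<comment> \<open>\<open>r\<close> is \<open>F\<close> on the line near the multiple
      \<open>\<gamma> p2\<close> of \<open>p2\<close>. Since \<open>\<beta> \<noteq> 0\<close>, the
      factor \<open>\<beta>^2\<close> is a unit there and the double zero falls on the
      residual.\<close>
    define r where "r = pcompose (monom 1 2 * ?R) [:\<beta>, 1:]"
    have "restrict_form d F (\<gamma> *s p2) (0 *s p2 + 1 *s u) = r"
    proof (rule poly_eqI_cofinite[of 0])
      fix \<tau> :: complex
      have "\<gamma> *s p2 + \<tau> *s (0 *s p2 + 1 *s u) = \<alpha> *s p1 + (\<beta> + \<tau>) *s u"
        unfolding rel by (simp add: vec_eq_iff algebra_simps)
      from arg_cong[OF this, of "feval d F"]
      show "poly (restrict_form d F (\<gamma> *s p2) (0 *s p2 + 1 *s u)) \<tau> = poly r \<tau>"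
        unfolding poly_restrict_form r_def using feval_residual[OF c(1), of \<alpha> "\<beta> + \<tau>"] d
        by (simp add: poly_pcompose poly_monom)
    qed
    then have "lin 0 ^ 2 dvd r" using contact_change[OF c(2), of \<gamma> 0 1] by simp
    then have "poly r 0 = 0" "poly (pderiv r) 0 = 0" unfolding lin_square_dvd by auto
    then have "poly ?R \<beta> = 0" "poly (pderiv ?R) \<beta> = 0"
      using False by (auto simp: r_def poly_pcompose poly_monom pderiv_pcompose pderiv_mult pderiv_monom pderiv_pCons)
    then show ?thesis by simp
  qed
  then show "poly (residual d F p1 u (cross p2 u $ i)) (cross p1 p2 $ i) = 0 \<and>
      cross p2 u $ i * poly (pderiv (residual d F p1 u (cross p2 u $ i))) (cross p1 p2 $ i) = 0"
    by (simp add: \<alpha>_def \<beta>_def)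
qed

text \<open>Some coordinate of \<open>cross p2 u\<close> is nonzero, and for it the residual and its
  derivative at 0 read off the coefficients of orders 2 and 3.\<close>

lemma tangencyD:
  assumes d: "d \<ge> 3" and p: "p2 \<noteq> 0" "p2 \<in> pt p1" "u \<notin> pt p1"
    and c: "lin 0 ^ 2 dvd restrict_form d F p1 u" and t: "tangency d F p1 p2 u"
  shows "lin 0 ^ 4 dvd restrict_form d F p1 u"
proof -
  have "u \<notin> pt p2" using p pt_eq_iff[of p2 p1] by auto
  then have "cross p2 u \<noteq> 0" using cross_eq_0 p(1) by blast
  then obtain i where i: "cross p2 u $ i \<noteq> 0" by (auto simp: vec_eq_iff)
  have "cross p1 p2 = 0" by (rule cross_collinear[OF p(2)])
  then have "poly (residual d F p1 u (cross p2 u $ i)) 0 = 0" "poly (pderiv (residual d F p1 u (cross p2 u $ i))) 0 = 0"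
    using t i by (auto simp: tangency_def Let_def dest: spec[of _ i])
  then have "coeff (residual d F p1 u (cross p2 u $ i)) 0 = 0" "coeff (residual d F p1 u (cross p2 u $ i)) 1 = 0"
    by (simp_all add: poly_0_coeff_0 coeff_pderiv)
  then have "coeff (restrict_form d F p1 u) (0 + 2) = 0" "coeff (restrict_form d F p1 u) (1 + 2) = 0"
    using i d coeff_residual[of 0 d F p1 u "cross p2 u $ i"] coeff_residual[of 1 d F p1 u "cross p2 u $ i"] by auto
  then have h: "coeff (restrict_form d F p1 u) 2 = 0" "coeff (restrict_form d F p1 u) 3 = 0"
    by (simp_all add: numeral_2_eq_2 numeral_3_eq_3)
  have "k = 0 \<or> k = 1 \<or> k = 2 \<or> k = 3" if "k < 4" for k :: nat using that by linarith
  then show ?thesis using c h unfolding lin_0_power_dvd_iff by (metis one_less_numeral_iff pos2 semiring_norm(76))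
qed

lemma polyfam_restrict_form:
  fixes p q :: "'v \<Rightarrow> complex^3"
  assumes "\<And>m. m \<in> exponents d \<Longrightarrow> (\<lambda>v. F v m) \<in> polyfun C"
    "\<And>i. (\<lambda>v. p v $ i) \<in> polyfun C" "\<And>i. (\<lambda>v. q v $ i) \<in> polyfun C"
  shows "polyfam C (\<lambda>v. restrict_form d (F v) (p v) (q v))"
  unfolding restrict_form_def case_prod_unfold
  by (intro polyfam_sum polyfam_smult polyfam_mult polyfam_power polyfam_pCons polyfam_const assms) simp

lemma polyfun_cross:
  fixes p q :: "'v \<Rightarrow> complex^3"
  assumes "\<And>i. (\<lambda>v. p v $ i) \<in> polyfun C" "\<And>i. (\<lambda>v. q v $ i) \<in> polyfun C"
  shows "(\<lambda>v. cross (p v) (q v) $ i) \<in> polyfun C"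
  using exhaust_3[of i] by (elim disjE) (simp_all add: polyfun_diff polyfun.mult assms)

definition flag_cone :: "nat \<Rightarrow> ((complex^3) \<times> ((complex^3) \<times> (complex^3)) \<times> form) set" where
  "flag_cone d = {(l, (p1, p2), F). l \<noteq> 0 \<and> p1 \<noteq> 0 \<and> p2 \<noteq> 0 \<and> F \<in> forms d \<and> F \<noteq> (\<lambda>_. 0)}"

definition flag_of :: "(complex^3) \<times> ((complex^3) \<times> (complex^3)) \<times> form \<Rightarrow> flag" where
  "flag_of = (\<lambda>(l, (p1, p2), F). (pt l, (pt p1, pt p2), curve F))"

abbreviation flag_coords :: "nat \<Rightarrow> ((complex^3) \<times> ((complex^3) \<times> (complex^3)) \<times> form \<Rightarrow> complex) set" where
  "flag_coords d \<equiv> prod_coords coords3 (prod_coords (prod_coords coords3 coords3) (form_coords d))"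

text \<open>An upper bound for the closure. Two tangencies whose points merge produce contact of
  order four, and this is the condition imposed on the diagonal.\<close>

definition bitangent_flags :: "nat \<Rightarrow> flag set" where
  "bitangent_flags d = {(L, (P1, P2), C). (L, (P1, P2), C) \<in> flag_of ` flag_cone d \<and>
     touches d 2 L P1 C \<and> touches d 2 L P2 C \<and> (P1 = P2 \<longrightarrow> touches d 4 L P1 C)}"

text \<open>All three points \<open>cross l (axis j 1)\<close> are used at once, because which of
  them is distinct from \<open>p1\<close> or from \<open>p2\<close> varies with the flag, whereas
  the equations must be the same everywhere.\<close>

lemma bitangent_flags_iff:
  assumes d: "d \<ge> 3" and c: "(l, (p1, p2), F) \<in> flag_cone d"
  shows "flag_of (l, (p1, p2), F) \<in> bitangent_flags d \<longleftrightarrow> pairing l p1 = 0 \<and> pairing l p2 = 0 \<and>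
    (\<forall>j. (\<forall>k<2. coeff (restrict_form d F p1 (cross l (axis j 1))) k = 0) \<and>
      (\<forall>k<2. coeff (restrict_form d F p2 (cross l (axis j 1))) k = 0) \<and>
      tangency d F p1 p2 (cross l (axis j 1)))"
  unfolding lin_0_power_dvd_iff[symmetric]
proof
  have nz: "l \<noteq> 0" "p1 \<noteq> 0" "p2 \<noteq> 0" using c by (auto simp: flag_cone_def)
  have touchD: "pairing l p = 0" "pairing l q = 0 \<Longrightarrow> lin 0 ^ k dvd restrict_form d F p q"
    if t: "touches d k (pt l) (pt p) (curve F)" "p \<noteq> 0" for k p q
  proof -
    obtain j where "cross l (axis j 1) \<notin> pt p" using second_point[OF nz(1) t(2)] by blast
    from touches_iff[OF nz(1) t(2) pairing_cross this] t(1) show "pairing l p = 0" by blast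
    have "l \<in> pt l" "p \<in> pt p" unfolding mem_pt by (intro exI[of _ 1], simp)+
    moreover have "F \<in> curve F" unfolding curve_def by (intro range_eqI[of _ _ 1]) simp
    ultimately show "lin 0 ^ k dvd restrict_form d F p q" if "pairing l q = 0"
      using t nz(1) that unfolding touches_def by blast
  qed
  {
    assume "flag_of (l, (p1, p2), F) \<in> bitangent_flags d"
    then have t: "touches d 2 (pt l) (pt p1) (curve F)" "touches d 2 (pt l) (pt p2) (curve F)"
      "pt p1 = pt p2 \<Longrightarrow> touches d 4 (pt l) (pt p1) (curve F)"
      by (auto simp: bitangent_flags_def flag_of_def)
    have "pt p1 = pt p2" if "p2 \<in> pt p1" using pt_eq_iff[of p2 p1] that nz by simp
    then have "tangency d F p1 p2 (cross l (axis j 1))" for j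
      using touchD t nz pairing_cross by (intro tangencyI[OF d nz(1,2)]) auto
    then show "pairing l p1 = 0 \<and> pairing l p2 = 0 \<and>
      (\<forall>j. lin 0 ^ 2 dvd restrict_form d F p1 (cross l (axis j 1)) \<and>
        lin 0 ^ 2 dvd restrict_form d F p2 (cross l (axis j 1)) \<and> tangency d F p1 p2 (cross l (axis j 1)))"
      using touchD t nz pairing_cross by auto
  }
  assume h: "pairing l p1 = 0 \<and> pairing l p2 = 0 \<and>
      (\<forall>j. lin 0 ^ 2 dvd restrict_form d F p1 (cross l (axis j 1)) \<and>
        lin 0 ^ 2 dvd restrict_form d F p2 (cross l (axis j 1)) \<and> tangency d F p1 p2 (cross l (axis j 1)))"
  obtain j1 where j1: "cross l (axis j1 1) \<notin> pt p1" using second_point[OF nz(1,2)] by blast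
  obtain j2 where j2: "cross l (axis j2 1) \<notin> pt p2" using second_point[OF nz(1,3)] by blast
  have "touches d 2 (pt l) (pt p1) (curve F)" using touches_iff[OF nz(1,2) pairing_cross j1] h by blast
  moreover have "touches d 2 (pt l) (pt p2) (curve F)" using touches_iff[OF nz(1,3) pairing_cross j2] h by blast
  moreover have "touches d 4 (pt l) (pt p1) (curve F)" if "pt p1 = pt p2"
  proof -
    have "p2 \<in> pt p1" using that pt_eq_iff[of p2 p1] nz by simp
    then have "lin 0 ^ 4 dvd restrict_form d F p1 (cross l (axis j1 1))"
      using tangencyD[OF d nz(3) _ j1] h by blast
    then show ?thesis using touches_iff[OF nz(1,2) pairing_cross j1] h by blast
  qed
  ultimately show "flag_of (l, (p1, p2), F) \<in> bitangent_flags d"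
    using imageI[OF c, of flag_of] unfolding bitangent_flags_def by (simp add: flag_of_def)
qed

lemma prod_coords_fst: "x \<in> C \<Longrightarrow> (\<lambda>v. x (fst v)) \<in> prod_coords C D"
  unfolding prod_coords_def by (intro UnI1 image_eqI[of _ _ x]) (simp_all add: comp_def)

lemma prod_coords_snd: "x \<in> D \<Longrightarrow> (\<lambda>v. x (snd v)) \<in> prod_coords C D"
  unfolding prod_coords_def by (intro UnI2 image_eqI[of _ _ x]) (simp_all add: comp_def)

lemma coords3_mem: "(\<lambda>v. v $ i) \<in> coords3"
  by (simp add: coords3_def)

lemma form_coords_mem: "m \<in> exponents d \<Longrightarrow> (\<lambda>F. F m) \<in> form_coords d"
  by (simp add: form_coords_def)

lemmas flag_coords_mem = prod_coords_fst[OF coords3_mem]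
  prod_coords_snd[OF prod_coords_fst[OF prod_coords_fst[OF coords3_mem]]]
  prod_coords_snd[OF prod_coords_fst[OF prod_coords_snd[OF coords3_mem]]]
  prod_coords_snd[OF prod_coords_snd[OF form_coords_mem]]

lemma closedin_bitangent_flags:
  assumes d: "d \<ge> 3"
  shows "closedin (ambient d) (bitangent_flags d)"
proof -
  define l p1 p2 F where "l = (\<lambda>v :: (complex^3) \<times> ((complex^3) \<times> (complex^3)) \<times> form. fst v)"
    and "p1 = (\<lambda>v :: (complex^3) \<times> ((complex^3) \<times> (complex^3)) \<times> form. fst (fst (snd v)))"
    and "p2 = (\<lambda>v :: (complex^3) \<times> ((complex^3) \<times> (complex^3)) \<times> form. snd (fst (snd v)))"
    and "F = (\<lambda>v :: (complex^3) \<times> ((complex^3) \<times> (complex^3)) \<times> form. snd (snd v))"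
  define u where "u = (\<lambda>v j. cross (l v) (axis j 1))"
  define h1 h2 where "h1 = (\<lambda>j k v. coeff (restrict_form d (F v) (p1 v) (u v j)) k)"
    and "h2 = (\<lambda>j k v. coeff (restrict_form d (F v) (p2 v) (u v j)) k)"
  define R where "R = (\<lambda>j i v. residual d (F v) (p1 v) (u v j) (cross (p2 v) (u v j) $ i))"
  define r0 r1 where "r0 = (\<lambda>j i v. poly (R j i v) (cross (p1 v) (p2 v) $ i))"
    and "r1 = (\<lambda>j i v. cross (p2 v) (u v j) $ i * poly (pderiv (R j i v)) (cross (p1 v) (p2 v) $ i))"
  define E where "E = {\<lambda>v. pairing (l v) (p1 v), \<lambda>v. pairing (l v) (p2 v)} \<union>
    (\<Union>j. \<Union>k\<in>{..<2}. {h1 j k, h2 j k}) \<union> (\<Union>j. \<Union>i. {r0 j i, r1 j i})"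
  let ?C = "flag_coords d"
  have co: "(\<lambda>v. l v $ i) \<in> polyfun ?C" "(\<lambda>v. p1 v $ i) \<in> polyfun ?C" "(\<lambda>v. p2 v $ i) \<in> polyfun ?C"
    "m \<in> exponents d \<Longrightarrow> (\<lambda>v. F v m) \<in> polyfun ?C" for i m
    unfolding l_def p1_def p2_def F_def
    by (rule polyfun.coord[OF flag_coords_mem(1)] polyfun.coord[OF flag_coords_mem(2)]
        polyfun.coord[OF flag_coords_mem(3)] polyfun.coord[OF flag_coords_mem(4)]; assumption?)+
  have u: "(\<lambda>v. u v j $ i) \<in> polyfun ?C" for i j
    unfolding u_def by (intro polyfun_cross co polyfun.const)
  have h: "h1 j k \<in> polyfun ?C" "h2 j k \<in> polyfun ?C" for j k
    using polyfam_restrict_form[of d F ?C p1 "\<lambda>v. u v j"] polyfam_restrict_form[of d F ?C p2 "\<lambda>v. u v j"] co u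
    by (auto simp: h1_def h2_def polyfam_def)
  have al: "(\<lambda>v. cross (p2 v) (u v j) $ i) \<in> polyfun ?C" "(\<lambda>v. cross (p1 v) (p2 v) $ i) \<in> polyfun ?C" for i j
    by (intro polyfun_cross co u)+
  have "r0 j i \<in> polyfun ?C" for j i
  proof -
    have "(\<lambda>v. \<Sum>k\<in>{2..d}. h1 j k v * (cross (p2 v) (u v j) $ i) ^ (d - k) * (cross (p1 v) (p2 v) $ i) ^ (k - 2)) \<in> polyfun ?C"
      by (intro polyfun_sum polyfun.mult polyfun_power al h)
    then show ?thesis by (simp add: r0_def R_def residual_def h1_def poly_sum poly_monom)
  qed
  moreover have "r1 j i \<in> polyfun ?C" for j i
  proof -
    have "(\<lambda>v. cross (p2 v) (u v j) $ i * (\<Sum>k\<in>{2..d}. of_nat (k - 2) *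
       (h1 j k v * (cross (p2 v) (u v j) $ i) ^ (d - k)) * (cross (p1 v) (p2 v) $ i) ^ (k - 2 - 1))) \<in> polyfun ?C"
      by (intro polyfun_sum polyfun.mult polyfun_power polyfun.const al h)
    then show ?thesis by (simp add: r1_def R_def residual_def h1_def poly_sum poly_monom higher_pderiv_sum[of 1, simplified] pderiv_monom mult.assoc)
  qed
  moreover have "(\<lambda>v. pairing (l v) (p1 v)) \<in> polyfun ?C" "(\<lambda>v. pairing (l v) (p2 v)) \<in> polyfun ?C"
    unfolding pairing_def by (intro polyfun_sum polyfun.mult co)+
  ultimately have E: "E \<subseteq> polyfun ?C" using h by (auto simp: E_def)
  have key: "{v \<in> flag_cone d. flag_of v \<in> bitangent_flags d} = {v \<in> flag_cone d. \<forall>f\<in>E. f v = 0}"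
  proof (intro Collect_cong conj_cong refl)
    fix v assume v: "v \<in> flag_cone d"
    have vv: "v = (l v, (p1 v, p2 v), F v)" by (simp add: l_def p1_def p2_def F_def)
    have "flag_of v \<in> bitangent_flags d \<longleftrightarrow> pairing (l v) (p1 v) = 0 \<and> pairing (l v) (p2 v) = 0 \<and>
      (\<forall>j. (\<forall>k<2. h1 j k v = 0) \<and> (\<forall>k<2. h2 j k v = 0) \<and> (\<forall>i. r0 j i v = 0 \<and> r1 j i v = 0))"
      using bitangent_flags_iff[OF d, of "l v" "p1 v" "p2 v" "F v"] v vv
      unfolding h1_def h2_def r0_def r1_def R_def u_def tangency_def Let_def by simp
    also have "\<dots> \<longleftrightarrow> (\<forall>f\<in>E. f v = 0)" unfolding E_def by (auto simp: ball_Un)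
    finally show "flag_of v \<in> bitangent_flags d \<longleftrightarrow> (\<forall>f\<in>E. f v = 0)" .
  qed
  have amb: "ambient d = quotient_topology (zariski ?C (flag_cone d)) flag_of"
    unfolding ambient_def flag_cone_def flag_of_def ..
  have top: "topspace (ambient d) = flag_of ` flag_cone d"
    unfolding amb topspace_quotient_topology topspace_zariski ..
  have "{v \<in> flag_cone d. flag_of v \<in> flag_of ` flag_cone d - bitangent_flags d} =
      flag_cone d - {v \<in> flag_cone d. flag_of v \<in> bitangent_flags d}" by auto
  then have "openin (ambient d) (flag_of ` flag_cone d - bitangent_flags d)"
    unfolding amb openin_quotient_topology topspace_zariski openin_zariski
    using E key by (intro conjI exI[of _ E]) auto
  then show ?thesis unfolding closedin_def top by (auto simp: bitangent_flags_def)
qed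

lemma incidence_subset:
  assumes "d \<ge> 3"
  shows "incidence d \<subseteq> bitangent_flags d"
  unfolding incidence_def
proof (rule closure_of_minimal[OF _ closedin_bitangent_flags[OF assms]], clarify)
  fix l p1 p2 :: "complex^3" and F
  assume h: "l \<noteq> 0" "p1 \<noteq> 0" "p2 \<noteq> 0" "F \<in> forms d" "F \<noteq> (\<lambda>_. 0)" "pt p1 \<noteq> pt p2"
    "2 \<le> intersection_mult d l F p1" "2 \<le> intersection_mult d l F p2"
  have "flag_of (l, (p1, p2), F) \<in> flag_of ` flag_cone d"
    by (rule imageI) (use h in \<open>auto simp: flag_cone_def\<close>)
  then show "(pt l, (pt p1, pt p2), curve F) \<in> bitangent_flags d"
    using h intersection_mult_iff[OF h(1,2)] intersection_mult_iff[OF h(1,3)]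
    by (auto simp: bitangent_flags_def flag_of_def)
qed

lemma incidenceI:
  assumes "l \<noteq> 0" "p1 \<noteq> 0" "p2 \<noteq> 0" "F \<in> forms d" "F \<noteq> (\<lambda>_. 0)" "pt p1 \<noteq> pt p2"
    "touches d 2 (pt l) (pt p1) (curve F)" "touches d 2 (pt l) (pt p2) (curve F)"
  shows "(pt l, (pt p1, pt p2), curve F) \<in> incidence d"
proof -
  define S where "S = {(pt l, (pt p1, pt p2), curve F) | l p1 p2 F.
        l \<noteq> 0 \<and> p1 \<noteq> 0 \<and> p2 \<noteq> 0 \<and> F \<in> forms d \<and> F \<noteq> (\<lambda>_. 0) \<and>
        pt p1 \<noteq> pt p2 \<and> intersection_mult d l F p1 \<ge> 2 \<and> intersection_mult d l F p2 \<ge> 2}"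
  have top: "topspace (ambient d) = flag_of ` flag_cone d"
    unfolding ambient_def flag_cone_def[symmetric] flag_of_def[symmetric] topspace_quotient_topology topspace_zariski ..
  have "flag_of (l, (p1, p2), F) \<in> flag_of ` flag_cone d"
    by (rule imageI) (use assms in \<open>auto simp: flag_cone_def\<close>)
  then have "(pt l, (pt p1, pt p2), curve F) \<in> topspace (ambient d)" unfolding top by (simp add: flag_of_def)
  moreover have "(pt l, (pt p1, pt p2), curve F) \<in> S"
    unfolding S_def mem_Collect_eq
    by (rule exI[of _ l], rule exI[of _ p1], rule exI[of _ p2], rule exI[of _ F])
      (intro conjI refl assms(1-6) intersection_mult_iff[THEN iffD2, OF assms(1,2,7)]
        intersection_mult_iff[THEN iffD2, OF assms(1,3,8)])
  ultimately have "(pt l, (pt p1, pt p2), curve F) \<in> topspace (ambient d) \<inter> S" by (rule IntI)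
  then show ?thesis unfolding incidence_def S_def[symmetric] using closure_of_subset_Int by (rule subsetD[rotated])
qed

section \<open>Affine coordinates at a point\<close>

text \<open>
  The coefficients of \<open>F(x p + y e\<^sub>2 + e\<^sub>3)\<close>; the outer variable of the polynomial is \<open>x\<close>, the inner one \<open>y\<close>.
\<close>
definition affine :: "nat \<Rightarrow> form \<Rightarrow> complex^3 \<Rightarrow> complex poly poly" where
  "affine d F p = (\<Sum>(i, j, k)\<in>exponents d. smult [:F (i, j, k):]
     ([:0, [:p$1:]:] ^ i * [:[:0, 1:], [:p$2:]:] ^ j * [:[:1:], [:p$3:]:] ^ k))"

definition affine_vec :: "nat \<Rightarrow> form \<Rightarrow> form \<Rightarrow> complex^3 \<Rightarrow> vec" where
  "affine_vec d F G p = (\<lambda>(s, i, j). coeff (coeff (affine d (if s then G else F) p) i) j)"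

text \<open>The points of the line where the first coordinate is 0. For
  \<open>p$1 \<noteq> 0\<close> they parametrise the lines through \<open>p\<close>, with
  \<open>dir_inf\<close> for the one left out by \<open>dir\<close>.\<close>

definition dir :: "complex \<Rightarrow> complex^3" where "dir y = vector [0, y, 1]"
definition dir_inf :: "complex^3" where "dir_inf = vector [0, 1, 0]"

lemma dir_components [simp]: "dir y $ 1 = 0" "dir y $ 2 = y" "dir y $ 3 = 1"
  "dir_inf $ 1 = 0" "dir_inf $ 2 = 1" "dir_inf $ 3 = 0"
  by (simp_all add: dir_def dir_inf_def)

lemma poly_affine: "poly (poly (affine d F p) [:x:]) y = feval d F (dir y + x *s p)"
  unfolding affine_def feval_def
  by (auto simp: poly_sum algebra_simps intro!: sum.cong)

definition total_degree_le :: "nat \<Rightarrow> complex poly poly \<Rightarrow> bool" where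
  "total_degree_le n R \<longleftrightarrow> (\<forall>i j. n < i + j \<longrightarrow> coeff (coeff R i) j = 0)"

lemma total_degree_le_mult:
  assumes "total_degree_le m R" "total_degree_le n S"
  shows "total_degree_le (m + n) (R * S)"
  unfolding total_degree_le_def
proof (intro allI impI)
  fix i j assume ij: "m + n < i + j"
  have "coeff (coeff R a) b * coeff (coeff S (i - a)) (j - b) = 0" if "a \<le> i" "b \<le> j" for a b
  proof -
    have "m < a + b \<or> n < (i - a) + (j - b)" using that ij by linarith
    then show ?thesis using assms by (auto simp: total_degree_le_def)
  qed
  then show "coeff (coeff (R * S) i) j = 0" by (auto simp: coeff_mult coeff_sum intro!: sum.neutral)
qed

lemma total_degree_le_power: "total_degree_le 1 R \<Longrightarrow> total_degree_le n (R ^ n)"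
proof (induction n)
  case 0
  show ?case by (auto simp: total_degree_le_def one_pCons coeff_pCons split: nat.split)
next
  case (Suc n)
  then show ?case using total_degree_le_mult[of 1 R n "R ^ n"] by simp
qed

lemma total_degree_le_linear: "total_degree_le 1 [:[:a, b:], [:c:]:]"
  by (auto simp: total_degree_le_def coeff_pCons split: nat.split)

lemma total_degree_affine: "total_degree_le d (affine d F p)"
proof -
  have "total_degree_le d (smult [:F (i, j, k):]
     ([:0, [:p$1:]:] ^ i * [:[:0, 1:], [:p$2:]:] ^ j * [:[:1:], [:p$3:]:] ^ k))" if "(i, j, k) \<in> exponents d" for i j k
  proof -
    have "total_degree_le (i + j + k) ([:0, [:p$1:]:] ^ i * [:[:0, 1:], [:p$2:]:] ^ j * [:[:1:], [:p$3:]:] ^ k)"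
      using total_degree_le_linear[of 0 0 "p$1"] total_degree_le_linear[of 0 1 "p$2"] total_degree_le_linear[of 1 0 "p$3"]
      by (intro total_degree_le_mult total_degree_le_power) simp_all
    then show ?thesis using that by (simp add: total_degree_le_def exponents_def)
  qed
  then show ?thesis unfolding affine_def total_degree_le_def by (force simp: coeff_sum intro!: sum.neutral)
qed

lemma slice_affine:
  "slice d (affine_vec d F G p) s y = restrict_form d (if s then G else F) (dir y) p"
proof (rule poly_eqI_cofinite[of 0])
  fix x :: complex
  let ?H = "if s then G else F"
  define R where "R = affine d ?H p"
  have R: "coeff (coeff R i) j = 0" if "d < i + j" for i j
    using total_degree_affine that unfolding R_def total_degree_le_def by blast
  have col: "col d (affine_vec d F G p) s i = coeff R i" if "i \<le> d" for i
  proof (rule poly_eqI)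
    fix j show "coeff (col d (affine_vec d F G p) s i) j = coeff (coeff R i) j"
      using R[of i j] by (simp add: coeff_col affine_vec_def R_def)
  qed
  have "coeff R i = 0" if "i > d" for i by (rule poly_eqI) (use R that in simp)
  then have "degree R \<le> d" by (intro degree_le) simp
  then have "poly R [:x:] = (\<Sum>i\<le>d. coeff R i * [:x:] ^ i)" by (rule poly_bounded_sum)
  then have "poly (poly R [:x:]) y = (\<Sum>i\<le>d. poly (coeff R i) y * x ^ i)" by (simp add: poly_sum)
  then show "poly (slice d (affine_vec d F G p) s y) x = poly (restrict_form d ?H (dir y) p) x"
    unfolding poly_restrict_form poly_affine[symmetric] R_def[symmetric]
    by (simp add: slice_def poly_sum poly_monom col)
qed

text \<open>In the coordinate \<open>w = 1/y\<close> homogeneity gives the identity for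
  \<open>w \<noteq> 0\<close>; both sides are polynomials in \<open>w\<close>, and the claim is
  their value at 0.\<close>

lemma slice_inf_affine:
  "slice_inf d (affine_vec d F G p) s = restrict_form d (if s then G else F) dir_inf p"
proof (rule poly_eqI_cofinite[of 0])
  fix x :: complex
  let ?H = "if s then G else F" and ?v = "affine_vec d F G p"
  have "(\<lambda>w. poly (slice_flip d ?v s w) x) \<in> polyfun {\<lambda>y. y}"
    by (rule family_eval_polyfun[OF family_slice_flip])
  then obtain q where q: "\<And>w. poly (slice_flip d ?v s w) x = poly q w" unfolding polyfun_id by blast
  have "q = restrict_form d ?H (dir_inf + x *s p) (dir 0)"
  proof (rule poly_eqI_cofinite[of 0])
    fix w :: complex assume w: "w \<noteq> 0"
    have "(1 / w) ^ d * poly q w = poly (slice d ?v s (1 / w)) (1 / w * x)"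
      using poly_slice_scale[of "1 / w" d ?v s x] w q by simp
    also have "\<dots> = feval d ?H (dir (1 / w) + (1 / w * x) *s p)" by (simp add: slice_affine poly_restrict_form)
    also have "dir (1 / w) + (1 / w * x) *s p = (1 / w) *s (dir_inf + x *s p + w *s dir 0)"
      using w by (simp add: vec3_eq_iff field_simps)
    also have "feval d ?H \<dots> = (1 / w) ^ d * poly (restrict_form d ?H (dir_inf + x *s p) (dir 0)) w"
      by (simp only: feval_scale poly_restrict_form)
    finally show "poly q w = poly (restrict_form d ?H (dir_inf + x *s p) (dir 0)) w" using w by simp
  qed
  then have "poly (slice_flip d ?v s 0) x = feval d ?H (dir_inf + x *s p)"
    unfolding q by (simp add: poly_restrict_form)
  then show "poly (slice_inf d ?v s) x = poly (restrict_form d ?H dir_inf p) x"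
    by (simp add: slice_flip_0 poly_restrict_form)
qed

section \<open>Bitangent lines through a general point\<close>

text \<open>A point of the line is either \<open>p\<close>, the infinity of the coordinate
  \<open>x\<close>, or of the form \<open>w + x p\<close>. Contact shows up as a drop in degree in
  the first case and as a root in the second.\<close>

lemma touch_cases:
  assumes l: "l \<noteq> 0" "p \<noteq> 0" "pairing l p = 0" "pairing l w = 0" "w \<notin> pt p"
    and p1: "p1 \<noteq> 0" and t: "touches d k (pt l) (pt p1) (curve H)"
  shows "(pt p1 = pt p \<and> (\<forall>j. j \<le> d \<and> j \<le> k \<longrightarrow> degree (restrict_form d H w p) + j \<le> d)) \<or>
    (\<exists>x. pt p1 = pt (w + x *s p) \<and> lin x ^ k dvd restrict_form d H w p)"
proof -
  have H: "H \<in> curve H" unfolding curve_def by (intro range_eqI[of _ _ 1]) simp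
  have mem: "v \<in> pt v" for v unfolding mem_pt by (intro exI[of _ 1]) simp
  have tD: "pairing l q = 0 \<and> (\<forall>r. pairing l r = 0 \<longrightarrow> lin 0 ^ k dvd restrict_form d H q r)" if "q \<in> pt p1" "q \<noteq> 0" for q
    using t H mem[of l] l(1) that unfolding touches_def by blast
  have "pairing l p1 = 0" using tD[OF mem p1] by blast
  then obtain \<beta> \<alpha> where p1e: "p1 = \<beta> *s p + \<alpha> *s w" using line_span[OF l(1,2,3,4,5)] by blast
  show ?thesis
  proof (cases "\<alpha> = 0")
    case True
    then have "p1 = \<beta> *s p" "\<beta> \<noteq> 0" using p1e p1 by auto
    then have pp: "pt p1 = pt p" using pt_scale by simp
    then have "lin 0 ^ k dvd restrict_form d H p w" using tD[of p] mem[of p] l by simp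
    then have "lin 0 ^ j dvd restrict_form d H p w" if "j \<le> k" for j
      using le_imp_power_dvd[OF that] dvd_trans by blast
    then show ?thesis using pp contact_infinity by blast
  next
    case False
    define x where "x = \<beta> / \<alpha>"
    have p1': "p1 = \<alpha> *s (w + x *s p)" unfolding p1e x_def using False by (simp add: vec_eq_iff field_simps)
    have pp: "pt p1 = pt (w + x *s p)" unfolding p1' by (rule pt_scale[OF False])
    have "w + x *s p \<noteq> 0" 
    proof
      assume "w + x *s p = 0"
      then have "w = (- x) *s p" by (simp add: eq_neg_iff_add_eq_0)
      then show False using l(5) unfolding mem_pt by blast
    qed
    then have "lin 0 ^ k dvd restrict_form d H (w + x *s p) p" using tD[of "w + x *s p"] mem pp l by simp
    then show ?thesis using pp contact_shift by blast
  qed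
qed

text \<open>The alternatives after the first come from the diagonal flags and from contact at
  \<open>p\<close> itself; genericity will rule them out. Fourfold contact at \<open>p\<close> is
  recorded as a drop by only 3, since \<open>d\<close> may be 3.\<close>

lemma bitangent_flag_cases:
  assumes d: "d \<ge> 3" and l: "l \<noteq> 0" "p \<noteq> 0" "pairing l p = 0" "pairing l w = 0" "w \<notin> pt p"
    and b: "(pt l, (P1, P2), curve H) \<in> bitangent_flags d"
  defines "h \<equiv> restrict_form d H w p"
  shows "(\<exists>x1 x2. x1 \<noteq> x2 \<and> lin x1 ^ 2 * lin x2 ^ 2 dvd h) \<or> (\<exists>x. lin x ^ 4 dvd h) \<or>
    (degree h + 2 \<le> d \<and> (\<exists>x. lin x ^ 2 dvd h)) \<or> degree h + 3 \<le> d"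
proof -
  have t: "touches d 2 (pt l) P1 (curve H)" "touches d 2 (pt l) P2 (curve H)"
      "P1 = P2 \<Longrightarrow> touches d 4 (pt l) P1 (curve H)"
    using b by (auto simp: bitangent_flags_def)
  obtain p1 p2 where p: "P1 = pt p1" "P2 = pt p2" "p1 \<noteq> 0" "p2 \<noteq> 0"
    using b by (auto simp: bitangent_flags_def flag_of_def flag_cone_def)
  note c1 = touch_cases[OF l p(3) t(1)[unfolded p(1)], folded h_def]
  note c2 = touch_cases[OF l p(4) t(2)[unfolded p(2)], folded h_def]
  show ?thesis
  proof (cases "P1 = P2")
    case True
    from touch_cases[OF l p(3) t(3)[OF True, unfolded p(1)], folded h_def] d show ?thesis by fastforce
  next
    case False
    from c1 show ?thesis
    proof
      assume 1: "pt p1 = pt p \<and> (\<forall>j. j \<le> d \<and> j \<le> 2 \<longrightarrow> degree h + j \<le> d)"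
      from conjunct2[OF this, rule_format, of 2] have "degree h + 2 \<le> d" using d by simp
      moreover have "pt p2 \<noteq> pt p" using False conjunct1[OF 1] p by simp
      ultimately show ?thesis using c2 by blast
    next
      assume "\<exists>x. pt p1 = pt (w + x *s p) \<and> lin x ^ 2 dvd h"
      then obtain x1 where x1: "pt p1 = pt (w + x1 *s p)" "lin x1 ^ 2 dvd h" by blast
      from c2 show ?thesis
      proof
        assume "pt p2 = pt p \<and> (\<forall>j. j \<le> d \<and> j \<le> 2 \<longrightarrow> degree h + j \<le> d)"
        from conjunct2[OF this, rule_format, of 2] have "degree h + 2 \<le> d" using d by simp
        then show ?thesis using x1 by blast
      next
        assume "\<exists>x. pt p2 = pt (w + x *s p) \<and> lin x ^ 2 dvd h"
        then obtain x2 where x2: "pt p2 = pt (w + x2 *s p)" "lin x2 ^ 2 dvd h" by blast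
        have "x1 \<noteq> x2" using False p x1 x2 by auto
        from lin_mult_dvd[OF this x1(2) x2(2)] this show ?thesis by blast
      qed
    qed
  qed
qed

lemma smult_member:
  fixes f g :: "complex poly"
  assumes "s \<noteq> 0"
  shows "smult s f + smult t g = smult s (f + smult (t / s) g)"
  using assms by (simp add: smult_add_right)

lemma (in generic_pencil) bitangent_line:
  assumes gd: "coeff g d \<noteq> 0" and st: "(s, t) \<noteq> (0, 0)" and h: "h = smult s f + smult t g"
    and c: "(\<exists>x1 x2. x1 \<noteq> x2 \<and> lin x1 ^ 2 * lin x2 ^ 2 dvd h) \<or> (\<exists>x. lin x ^ 4 dvd h) \<or>
      (degree h + 2 \<le> d \<and> (\<exists>x. lin x ^ 2 dvd h)) \<or> degree h + 3 \<le> d"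
  shows "bitangent_member f g"
proof (cases "s = 0")
  case True
  then have "h = smult t g" "t \<noteq> 0" using st h by auto
  moreover have "degree g = d" using gd deg_g by (auto intro!: le_antisym le_degree)
  ultimately show ?thesis using c no_bitangent_g no_4_g by (auto simp: dvd_smult_iff)
next
  case False
  have "h = smult s (f + smult (t / s) g)" using smult_member[OF False] h by simp
  then show ?thesis
    using c False no_member4[of _ "t / s"] no_tangent_P[of "t / s"] no_flex_P[of "t / s"]
    unfolding bitangent_member_def by (simp add: dvd_smult_iff) blast
qed

lemma (in generic_pencil_inf) no_bitangent_line:
  assumes gd: "coeff g d \<noteq> 0" and st: "(s, t) \<noteq> (0, 0)" and h: "h = smult s f + smult t g"
    and c: "(\<exists>x1 x2. x1 \<noteq> x2 \<and> lin x1 ^ 2 * lin x2 ^ 2 dvd h) \<or> (\<exists>x. lin x ^ 4 dvd h) \<or>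
      (degree h + 2 \<le> d \<and> (\<exists>x. lin x ^ 2 dvd h)) \<or> degree h + 3 \<le> d"
  shows False
proof (cases "s = 0")
  case True
  then have h: "h = smult t g" "t \<noteq> 0" using st h by auto
  have dg: "degree g = d" using gd deg_g by (auto intro!: le_antisym le_degree)
  have "lin x ^ 2 dvd lin x ^ 4" for x by (rule le_imp_power_dvd) simp
  then have "\<not> lin x ^ 4 dvd g" for x using no_tangent_g[of x] dvd_trans by blast
  moreover have "\<not> lin x ^ 2 * lin y ^ 2 dvd g" for x y using no_tangent_g[of x] dvd_mult_left by blast
  ultimately show ?thesis using c dg h no_tangent_g by (auto simp: dvd_smult_iff)
next
  case False
  have h: "h = smult s (f + smult (t / s) g)" using smult_member[OF False] h by simp
  have "lin x ^ 3 dvd lin x ^ 4" for x by (rule le_imp_power_dvd) simp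
  then have "\<not> lin x ^ 4 dvd f + smult (t / s) g" for x using no_flex[of x] dvd_trans by blast
  then show ?thesis
    using c False no_P[of "t / s"] no_bitangent[of _ _ "t / s"] h by (auto simp: dvd_smult_iff)
qed

text \<open>The line joining \<open>p\<close> and \<open>dir y\<close>. Its middle coordinate is
  normalised to 1, so the only line through \<open>p\<close> that is missed is the one containing
  \<open>dir_inf\<close>.\<close>

definition line_through :: "complex^3 \<Rightarrow> complex \<Rightarrow> complex^3" where
  "line_through p y = vector [- (p$2 - y * p$3) / p$1, 1, - y]"

lemma line_through_components [simp]: "line_through p y $ 1 = - (p$2 - y * p$3) / p$1"
  "line_through p y $ 2 = 1" "line_through p y $ 3 = - y"
  by (simp_all add: line_through_def)

lemma line_through_nz: "line_through p y \<noteq> 0"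
  by (simp add: vec3_eq_iff)

lemma pairing_line_through:
  fixes p :: "complex^3"
  shows "p$1 \<noteq> 0 \<Longrightarrow> pairing (line_through p y) p = 0" "pairing (line_through p y) (dir y) = 0"
  by (simp_all add: pairing_simp field_simps)

lemma inj_line_through: "pt (line_through p y) = pt (line_through p z) \<Longrightarrow> y = z"
  using pt_eqD[of "line_through p y" "line_through p z"] by (auto simp: vec3_eq_iff)

lemma line_cases:
  fixes p l :: "complex^3"
  assumes "p$1 \<noteq> 0" "l \<noteq> 0" "pairing l p = 0"
  shows "(\<exists>y. pt l = pt (line_through p y)) \<or> pairing l dir_inf = 0"
proof (cases "l$2 = 0")
  case True
  then show ?thesis by (simp add: pairing_simp)
next
  case False
  have "l$1 * p$1 = - (l$2 * p$2 + l$3 * p$3)" using assms(3) by (simp only: pairing_simp eq_neg_iff_add_eq_0 add.assoc)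
  moreover have "l$2 * (- (p$2 - - (l$3 / l$2) * p$3) / p$1) = - (l$2 * p$2 + l$3 * p$3) / p$1"
    using False by (simp add: algebra_simps diff_divide_distrib)
  ultimately have "l$1 = l$2 * (- (p$2 - - (l$3 / l$2) * p$3) / p$1)"
    using assms(1) by (metis nonzero_mult_div_cancel_right)
  then have "l = l$2 *s line_through p (- (l$3 / l$2))"
    using False by (simp add: vec3_eq_iff)
  then have "pt l = pt (line_through p (- (l$3 / l$2)))" using pt_scale[OF False] by metis
  then show ?thesis by blast
qed

lemma on_line_pt: "on_line (pt p) (pt l) \<longleftrightarrow> pairing l p = 0"
proof
  assume "on_line (pt p) (pt l)"
  moreover have "l \<in> pt l" "p \<in> pt p" unfolding mem_pt by (intro exI[of _ 1], simp)+
  ultimately show "pairing l p = 0" unfolding on_line_def by blast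
qed (auto simp: on_line_def mem_pt pairing_linear)

text \<open>The bitangent lines through \<open>p\<close> correspond to the parameters
  \<open>y\<close> with a bitangent member. The closure in the incidence variety contributes no
  further line here, because its limit flags are degenerate.\<close>

lemma bitangent_lines_count:
  fixes p :: "complex^3"
  assumes d: "d \<ge> 3" and FG: "F \<in> forms d" "G \<in> forms d" and p: "p$1 \<noteq> 0"
    and gen: "generic d (affine_vec d F G p)"
  shows "finite {L \<in> bitangent_lines d (pencil (F, G)). on_line (pt p) L} \<and>
    card {L \<in> bitangent_lines d (pencil (F, G)). on_line (pt p) L} = 2 * d * (d - 2) * (d - 3)"
proof -
  let ?v = "affine_vec d F G p"
  define f g where "f = (\<lambda>y. restrict_form d F (dir y) p)" and "g = (\<lambda>y. restrict_form d G (dir y) p)"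
  have sl: "slice d ?v False y = f y" "slice d ?v True y = g y" for y
    by (simp_all add: slice_affine f_def g_def)
  have gp: "generic_pencil d (f y) (g y)" for y
    using gen d by (simp add: generic_def generic_pencil_def sl)
  have gi: "generic_pencil_inf d (restrict_form d F dir_inf p) (restrict_form d G dir_inf p)"
    using gen d by (simp add: generic_def generic_pencil_inf_def slice_inf_affine)
  have "?v (True, d, 0) \<noteq> 0" using gen by (simp add: generic_def)
  then have lead: "coeff (g y) d \<noteq> 0" "coeff (restrict_form d G dir_inf p) d \<noteq> 0" for y
    using coeff_slice[of d ?v True y d] coeff_slice_inf[of d ?v True d]
    by (simp_all add: sl slice_inf_affine col_def poly_monom)
  define B where "B = {y. bitangent_member (f y) (g y)}"
  have p0: "p \<noteq> 0" using p by auto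
  have nw: "dir y \<notin> pt p" "dir_inf \<notin> pt p" for y using p by (auto simp: mem_pt vec3_eq_iff)
  have "{L \<in> bitangent_lines d (pencil (F, G)). on_line (pt p) L} = (\<lambda>y. pt (line_through p y)) ` B" (is "?M = _")
  proof (intro equalityI subsetI)
    fix L assume "L \<in> ?M"
    then obtain P1 P2 C where L: "on_line (pt p) L" "C \<in> pencil (F, G)" "(L, (P1, P2), C) \<in> incidence d"
      by (auto simp: bitangent_lines_def)
    from L(2) obtain s t where C: "C = curve (\<lambda>m. s * F m + t * G m)" "(s, t) \<noteq> (0, 0)"
      by (auto simp: pencil_def)
    have b: "(L, (P1, P2), C) \<in> bitangent_flags d" using L(3) incidence_subset[OF d] by blast
    then obtain l where l: "L = pt l" "l \<noteq> 0" by (auto simp: bitangent_flags_def flag_of_def flag_cone_def)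
    have lp: "pairing l p = 0" using L(1) l by (simp add: on_line_pt)
    from line_cases[OF p l(2) lp] show "L \<in> (\<lambda>y. pt (line_through p y)) ` B"
    proof
      assume "\<exists>y. pt l = pt (line_through p y)"
      then obtain y where y: "L = pt (line_through p y)" using l by blast
      have hh: "restrict_form d (\<lambda>m. s * F m + t * G m) (dir y) p = smult s (f y) + smult t (g y)"
        by (simp add: restrict_form_linear f_def g_def)
      have "bitangent_member (f y) (g y)"
        using generic_pencil.bitangent_line[OF gp lead(1) C(2) hh]
          bitangent_flag_cases[OF d line_through_nz p0 pairing_line_through(1)[OF p] pairing_line_through(2) nw(1)
            b[unfolded y C(1)]] by blast
      then show ?thesis using y by (auto simp: B_def)
    next
      \<comment> \<open>The one line through \<open>p\<close> outside the family is the line at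
        \<open>y = infinity\<close>, which carries no bitangency by
        \<open>generic_line_inf\<close>.\<close>
      assume "pairing l dir_inf = 0"
      from generic_pencil_inf.no_bitangent_line[OF gi lead(2) C(2) restrict_form_linear
          bitangent_flag_cases[OF d l(2) p0 lp this nw(2) b[unfolded l(1) C(1)]]]
      show ?thesis ..
    qed
  next
    fix L assume "L \<in> (\<lambda>y. pt (line_through p y)) ` B"
    then obtain y where y: "L = pt (line_through p y)" "bitangent_member (f y) (g y)" by (auto simp: B_def)
    then obtain t x1 x2 where b: "x1 \<noteq> x2" "lin x1 ^ 2 * lin x2 ^ 2 dvd f y + smult t (g y)"
      by (auto simp: bitangent_member_def)
    define H where "H = (\<lambda>m. 1 * F m + t * G m)"
    have h: "restrict_form d H (dir y) p = f y + smult t (g y)"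
      unfolding H_def restrict_form_linear by (simp add: f_def g_def)
    define q where "q = (\<lambda>x. dir y + x *s p)"
    have q0: "q x \<noteq> 0" "p \<notin> pt (q x)" for x
    proof -
      have "q x = c *s p \<Longrightarrow> False" for c
      proof -
        assume "q x = c *s p"
        then have "dir y = (c - x) *s p" by (simp add: q_def vec_eq_iff algebra_simps eq_diff_eq)
        then show False using nw(1) unfolding mem_pt by blast
      qed
      note nq = this
      show "q x \<noteq> 0" using nq[of 0] by auto
      show "p \<notin> pt (q x)"
      proof
        assume "p \<in> pt (q x)"
        then obtain c where c: "p = c *s q x" by (auto simp: mem_pt)
        then have "c \<noteq> 0" using p0 by auto
        then have "q x = (1 / c) *s p" using c by (metis divide_self vector_smult_assoc vector_smult_lid times_divide_eq_left mult_1)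
        then show False by (rule nq)
      qed
    qed
    have qne: "pt (q x1) \<noteq> pt (q x2)"
    proof
      assume "pt (q x1) = pt (q x2)"
      from pt_eqD[OF this] obtain c where c: "q x1 = c *s q x2" by blast
      then have e: "x1 * p$1 = c * (x2 * p$1)" "y + x1 * p$2 = c * (y + x2 * p$2)" "1 + x1 * p$3 = c * (1 + x2 * p$3)"
        by (simp_all add: q_def vec3_eq_iff distrib_left mult.assoc)
      then have "x1 = c * x2" using p by simp
      then have "c = 1" using e(3) by (simp add: algebra_simps)
      then show False using \<open>x1 = c * x2\<close> b(1) by simp
    qed
    have touch: "touches d 2 (pt (line_through p y)) (pt (q x)) (curve H)" if "lin x ^ 2 dvd f y + smult t (g y)" for x
    proof -
      have "lin 0 ^ 2 dvd restrict_form d H (q x) p"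
        unfolding q_def contact_shift h by (rule that)
      moreover have "pairing (line_through p y) (q x) = 0"
        using pairing_line_through(1)[OF p, of y] pairing_line_through(2)[of p y] pairing_linear(1)[of _ 1 "dir y" x p] 
        by (simp add: q_def)
      ultimately show ?thesis using touches_iff[OF line_through_nz q0(1) pairing_line_through(1)[OF p] q0(2)] by blast
    qed
    have "H \<in> forms d" using FG by (simp add: forms_def H_def)
    moreover have "H \<noteq> (\<lambda>_. 0)"
    proof
      assume "H = (\<lambda>_. 0)"
      then have "restrict_form d H (dir y) p = 0" by (simp add: restrict_form_def case_prod_unfold)
      then show False using h generic_pencil.member_nz[OF gp] by simp
    qed
    ultimately have "(L, (pt (q x1), pt (q x2)), curve H) \<in> incidence d"
      unfolding y(1) using b(2) dvd_mult_left dvd_mult_right touch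
      by (intro incidenceI line_through_nz q0(1) qne) blast+
    moreover have "curve H \<in> pencil (F, G)" unfolding pencil_def H_def
      by (simp only: prod.case mem_Collect_eq) (intro exI[of _ 1] exI[of _ t] conjI refl, simp)
    ultimately show "L \<in> ?M"
      using y(1) pairing_line_through(1)[OF p] by (auto simp: bitangent_lines_def on_line_pt)
  qed
  moreover have "inj_on (\<lambda>y. pt (line_through p y)) B" by (rule inj_onI) (rule inj_line_through)
  moreover have "finite B \<and> card B = 2 * d * (d - 2) * (d - 3)"
    using generic_bitangent_count[OF d gen] unfolding sl B_def .
  ultimately show ?thesis by (simp add: card_image)
qed

section \<open>General pencils and general points\<close>

lemma openin_basic: "\<psi> \<in> polyfun C \<Longrightarrow> openin (zariski C S) {v \<in> S. \<psi> v \<noteq> 0}"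
  unfolding openin_zariski by (intro conjI exI[of _ "{\<psi>}"]) auto

text \<open>
  In the applications \<open>S\<close> is an open subset of an affine space and the fibres of \<open>q\<close> are orbits of a
  linear group: density is checked along the lines through \<open>v1\<close>, openness by translating \<open>\<phi>\<close>.
\<close>
lemma generally_quotient:
  assumes \<phi>: "\<phi> \<in> polyfun C" and v1: "v1 \<in> S" "\<phi> v1 \<noteq> 0"
    and Q: "\<And>v. v \<in> S \<Longrightarrow> \<phi> v \<noteq> 0 \<Longrightarrow> Q (q v)"
    and line: "\<And>v. v \<in> S \<Longrightarrow> \<exists>\<psi>\<in>polyfun C. \<exists>\<gamma>. \<psi> v \<noteq> 0 \<and> \<gamma> 0 = v \<and> \<gamma> 1 = v1 \<and>
      (\<forall>c\<in>C. \<exists>p. \<forall>\<tau>. c (\<gamma> \<tau>) = poly p \<tau>) \<and> (\<forall>\<tau>. \<psi> (\<gamma> \<tau>) \<noteq> 0 \<longrightarrow> \<gamma> \<tau> \<in> S)"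
    and orbit: "\<And>u v. u \<in> S \<Longrightarrow> v \<in> S \<Longrightarrow> q v = q u \<Longrightarrow> \<exists>T. T v = u \<and>
      (\<forall>c\<in>C. (\<lambda>w. c (T w)) \<in> polyfun C) \<and> (\<forall>w\<in>S. T w \<in> S \<and> q (T w) = q w)"
  shows "generally (quotient_topology (zariski C S) q) Q"
proof -
  let ?X = "quotient_topology (zariski C S) q"
  define O' where "O' = {v \<in> S. \<phi> v \<noteq> 0}"
  have "openin (zariski C S) {v \<in> S. q v \<in> q ` O'}"
  proof (subst openin_subopen, clarify)
    fix v u assume v: "v \<in> S" "q v = q u" "u \<in> O'"
    then obtain T where T: "T v = u" "\<And>c. c \<in> C \<Longrightarrow> (\<lambda>w. c (T w)) \<in> polyfun C"
      "\<And>w. w \<in> S \<Longrightarrow> T w \<in> S \<and> q (T w) = q w" using orbit[of u v] by (auto simp: O'_def)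
    have "openin (zariski C S) {w \<in> S. \<phi> (T w) \<noteq> 0}"
      by (rule openin_basic) (rule polyfun_subst[OF \<phi> T(2)])
    moreover have "v \<in> {w \<in> S. \<phi> (T w) \<noteq> 0}" using v T(1) by (simp add: O'_def)
    moreover have "{w \<in> S. \<phi> (T w) \<noteq> 0} \<subseteq> {v \<in> S. q v \<in> q ` O'}"
    proof
      fix w assume w: "w \<in> {w \<in> S. \<phi> (T w) \<noteq> 0}"
      then have "T w \<in> O'" "q w = q (T w)" using T(3) by (simp_all add: O'_def)
      then show "w \<in> {v \<in> S. q v \<in> q ` O'}" using w by simp
    qed
    ultimately show "\<exists>T. openin (zariski C S) T \<and> v \<in> T \<and> T \<subseteq> {v \<in> S. q v \<in> q ` O'}" by blast
  qed
  moreover have "q ` O' \<subseteq> q ` S" by (auto simp: O'_def)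
  ultimately have op: "openin ?X (q ` O')"
    by (simp add: openin_quotient_topology topspace_zariski)
  have "?X closure_of (q ` O') = topspace ?X"
    unfolding dense_intersects_open
  proof (intro allI impI)
    fix V assume V: "openin ?X V \<and> V \<noteq> {}"
    then have "openin (zariski C S) {v \<in> S. q v \<in> V}" "V \<subseteq> q ` S"
      by (simp_all add: openin_quotient_topology topspace_zariski)
    then obtain E where E: "E \<subseteq> polyfun C" "S - {v \<in> S. q v \<in> V} = {v \<in> S. \<forall>f\<in>E. f v = 0}"
      by (auto simp: openin_zariski)
    obtain v where v: "v \<in> S" "q v \<in> V" using V \<open>V \<subseteq> q ` S\<close> by blast
    then have "v \<notin> {v \<in> S. \<forall>f\<in>E. f v = 0}" unfolding E(2)[symmetric] by simp
    then obtain f where f: "f \<in> E" "f v \<noteq> 0" using v by blast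
    from line[OF v(1)] obtain \<psi> \<gamma> where \<psi>: "\<psi> \<in> polyfun C" "\<psi> v \<noteq> 0" "\<gamma> 0 = v" "\<gamma> 1 = v1"
      "\<And>c. c \<in> C \<Longrightarrow> \<exists>p. \<forall>\<tau>. c (\<gamma> \<tau>) = poly p \<tau>" "\<And>\<tau>. \<psi> (\<gamma> \<tau>) \<noteq> 0 \<Longrightarrow> \<gamma> \<tau> \<in> S" by blast
    obtain a where a: "\<And>\<tau>. f (\<gamma> \<tau>) = poly a \<tau>" using polyfun_along_line[of f C \<gamma>] E(1) f(1) \<psi>(5) by blast
    obtain b where b: "\<And>\<tau>. \<phi> (\<gamma> \<tau>) = poly b \<tau>" using polyfun_along_line[OF \<phi>, of \<gamma>] \<psi>(5) by blast
    obtain c where c: "\<And>\<tau>. \<psi> (\<gamma> \<tau>) = poly c \<tau>" using polyfun_along_line[OF \<psi>(1), of \<gamma>] \<psi>(5) by blast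
    have "poly a 0 \<noteq> 0" "poly b 1 \<noteq> 0" "poly c 0 \<noteq> 0"
      using a[of 0] b[of 1] c[of 0] f(2) v1(2) \<psi>(2,3,4) by simp_all
    then have "a * b * c \<noteq> 0" by auto
    then obtain \<tau> where "poly (a * b * c) \<tau> \<noteq> 0" using poly_all_0_iff_0 by blast
    then have t: "f (\<gamma> \<tau>) \<noteq> 0" "\<phi> (\<gamma> \<tau>) \<noteq> 0" "\<psi> (\<gamma> \<tau>) \<noteq> 0" unfolding a b c by auto
    then have S: "\<gamma> \<tau> \<in> S" using \<psi>(6) by blast
    then have "\<gamma> \<tau> \<notin> S - {v \<in> S. q v \<in> V}" unfolding E(2) using t(1) f(1) by blast
    then have "q (\<gamma> \<tau>) \<in> V" using S by simp
    moreover have "q (\<gamma> \<tau>) \<in> q ` O'" using S t by (simp add: O'_def)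
    ultimately show "q ` O' \<inter> V \<noteq> {}" by blast
  qed
  moreover have "\<forall>P\<in>q ` O'. Q P" using Q by (auto simp: O'_def)
  ultimately show ?thesis unfolding generally_def using op by blast
qed

lemma polyfun_line_poly: "\<exists>p. \<forall>\<tau>. a + \<tau> * (b - a) = poly p \<tau>" for a b :: complex
  by (intro exI[of _ "[:a, b - a:]"]) simp

lemma generally_plane:
  fixes v1 :: "complex^3"
  assumes \<phi>: "\<phi> \<in> polyfun coords3" "\<phi> v1 \<noteq> 0" "v1 \<noteq> 0"
    and Q: "\<And>v. v \<noteq> 0 \<Longrightarrow> \<phi> v \<noteq> 0 \<Longrightarrow> Q (pt v)"
  shows "generally plane Q"
  unfolding plane_def
proof (rule generally_quotient[OF \<phi>(1) _ \<phi>(2)])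
  fix v :: "complex^3" assume "v \<in> {v. v \<noteq> 0}"
  then obtain i where i: "v $ i \<noteq> 0" by (auto simp: vec_eq_iff)
  define \<gamma> where "\<gamma> = (\<lambda>\<tau>. v + \<tau> *s (v1 - v))"
  show "\<exists>\<psi>\<in>polyfun coords3. \<exists>\<gamma>. \<psi> v \<noteq> 0 \<and> \<gamma> 0 = v \<and> \<gamma> 1 = v1 \<and>
      (\<forall>c\<in>coords3. \<exists>p. \<forall>\<tau>. c (\<gamma> \<tau>) = poly p \<tau>) \<and> (\<forall>\<tau>. \<psi> (\<gamma> \<tau>) \<noteq> 0 \<longrightarrow> \<gamma> \<tau> \<in> {v. v \<noteq> 0})"
  proof (intro bexI[of _ "\<lambda>v. v $ i"] exI[of _ \<gamma>] polyfun.coord[OF coords3_mem] conjI ballI allI impI)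
    fix c :: "complex^3 \<Rightarrow> complex" assume "c \<in> coords3"
    then obtain j where "c = (\<lambda>v. v $ j)" by (auto simp: coords3_def)
    then show "\<exists>p. \<forall>\<tau>. c (\<gamma> \<tau>) = poly p \<tau>" using polyfun_line_poly[of "v $ j" "v1 $ j"] by (simp add: \<gamma>_def algebra_simps)
  next
    fix \<tau> assume "\<gamma> \<tau> $ i \<noteq> 0"
    then show "\<gamma> \<tau> \<in> {v. v \<noteq> 0}" by auto
  qed (use i in \<open>simp_all add: \<gamma>_def\<close>)
next
  fix u v :: "complex^3" assume u: "u \<in> {v. v \<noteq> 0}" "v \<in> {v. v \<noteq> 0}" "pt v = pt u"
  then obtain c where c: "u = c *s v" using pt_eqD[of u v] by auto
  then have "c \<noteq> 0" using u by auto
  then show "\<exists>T. T v = u \<and> (\<forall>c\<in>coords3. (\<lambda>w. c (T w)) \<in> polyfun coords3) \<and>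
      (\<forall>w\<in>{v. v \<noteq> 0}. T w \<in> {v. v \<noteq> 0} \<and> pt (T w) = pt w)"
    using c by (intro exI[of _ "\<lambda>w. c *s w"])
      (auto simp: coords3_def pt_scale intro!: polyfun.mult[OF polyfun.const polyfun.coord])
qed (use \<phi> Q in auto)

lemma pencil_change_basis:
  assumes "(F, G) \<in> independent_pairs d" "(F', G') \<in> independent_pairs d" "pencil (F', G') = pencil (F, G)"
  shows "\<exists>a b c e. a * e - b * c \<noteq> 0 \<and> F = (\<lambda>m. a * F' m + b * G' m) \<and> G = (\<lambda>m. c * F' m + e * G' m)"
proof -
  have rep: "\<exists>a b. H = (\<lambda>m. a * F' m + b * G' m)" if "curve H \<in> pencil (F, G)" for H
  proof -
    from that[unfolded assms(3)[symmetric]] obtain s t where "curve H = curve (\<lambda>m. s * F' m + t * G' m)"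
      by (auto simp: pencil_def)
    moreover have "H \<in> curve H" unfolding curve_def by (intro range_eqI[of _ _ 1]) simp
    ultimately obtain c where "H = (\<lambda>m. c * (s * F' m + t * G' m))" by (auto simp: curve_def)
    then have "H = (\<lambda>m. (c * s) * F' m + (c * t) * G' m)" by (simp add: algebra_simps)
    then show ?thesis by blast
  qed
  have "curve F \<in> pencil (F, G)" unfolding pencil_def
    by (simp only: prod.case mem_Collect_eq) (intro exI[of _ 1] exI[of _ 0], simp)
  from rep[OF this] obtain a b where ab: "F = (\<lambda>m. a * F' m + b * G' m)" by blast
  have "curve G \<in> pencil (F, G)" unfolding pencil_def
    by (simp only: prod.case mem_Collect_eq) (intro exI[of _ 0] exI[of _ 1], simp)
  from rep[OF this] obtain c e where ce: "G = (\<lambda>m. c * F' m + e * G' m)" by blast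
  have ind: "(\<lambda>m. s * F m + t * G m) = (\<lambda>_. 0) \<Longrightarrow> s = 0 \<and> t = 0" for s t
    using assms(1) by (auto simp: independent_pairs_def)
  have "a * e - b * c \<noteq> 0"
  proof
    assume D: "a * e - b * c = 0"
    have *: "(\<lambda>m. e * F m + (- b) * G m) = (\<lambda>_. 0)" "(\<lambda>m. (- c) * F m + a * G m) = (\<lambda>_. 0)"
    proof -
      have "e * F m + (- b) * G m = (a * e - b * c) * F' m" "(- c) * F m + a * G m = (a * e - b * c) * G' m" for m
        unfolding ab ce by (simp_all add: algebra_simps)
      then show "(\<lambda>m. e * F m + (- b) * G m) = (\<lambda>_. 0)" "(\<lambda>m. (- c) * F m + a * G m) = (\<lambda>_. 0)"
        using D by simp_all
    qed
    then have "a = 0" "b = 0" using ind[OF *(1)] ind[OF *(2)] by auto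
    then show False using ind[of 1 0] ab by auto
  qed
  then show ?thesis using ab ce by blast
qed

text \<open>A nonvanishing minor is the open condition that keeps most points of a line of pairs
  independent, as density in the space of pencils requires.\<close>

lemma independent_pairs_minor:
  assumes "(F, G) \<in> independent_pairs d"
  shows "\<exists>m\<in>exponents d. \<exists>n\<in>exponents d. F m * G n - F n * G m \<noteq> 0"
proof (rule ccontr)
  assume "\<not> ?thesis"
  then have z: "F m * G n = F n * G m" if "m \<in> exponents d" "n \<in> exponents d" for m n using that by force
  have FG: "F \<in> forms d" "G \<in> forms d" and ind: "\<And>s t. (\<lambda>m. s * F m + t * G m) = (\<lambda>_. 0) \<Longrightarrow> s = 0 \<and> t = 0"
    using assms by (auto simp: independent_pairs_def)
  have zero: "F m = 0" "G m = 0" if "m \<notin> exponents d" for m using FG that unfolding forms_def by blast+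
  have "F n = 0" if n: "n \<in> exponents d" for n
  proof -
    have "G n * F m + (- F n) * G m = 0" for m
      using z[OF _ n, of m] zero by (cases "m \<in> exponents d") (auto simp: algebra_simps)
    then have "(\<lambda>m. G n * F m + (- F n) * G m) = (\<lambda>_. 0)" by blast
    from ind[OF this] show ?thesis by simp
  qed
  then have "F n = 0" for n using zero by blast
  then show False using ind[of 1 0] by simp
qed

lemma independent_pairsI:
  assumes "F \<in> forms d" "G \<in> forms d" "F m * G n - F n * G m \<noteq> 0"
  shows "(F, G) \<in> independent_pairs d"
  unfolding independent_pairs_def mem_Collect_eq prod.case
proof (intro conjI assms allI impI)
  fix s t assume "(\<lambda>m. s * F m + t * G m) = (\<lambda>_. 0)"
  then have e: "s * F m + t * G m = 0" "s * F n + t * G n = 0" by meson+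
  have "s * (F m * G n - F n * G m) = G n * (s * F m + t * G m) - G m * (s * F n + t * G n)"
    "t * (F m * G n - F n * G m) = F m * (s * F n + t * G n) - F n * (s * F m + t * G m)"
    by (simp_all add: algebra_simps)
  then show "s = 0" "t = 0" using e assms(3) by auto
qed

lemma pencil_change_basis_eq:
  assumes "a * e - b * c \<noteq> 0"
  shows "pencil ((\<lambda>m. a * F m + b * G m), (\<lambda>m. c * F m + e * G m)) = pencil (F, G)"
proof -
  have 1: "(\<lambda>m. s * (a * F m + b * G m) + t * (c * F m + e * G m)) =
      (\<lambda>m. (s * a + t * c) * F m + (s * b + t * e) * G m)" for s t
    by (simp add: algebra_simps)
  have sol: "\<exists>x y. x * a + y * c = s \<and> x * b + y * e = t" for s t
  proof -
    define D where "D = a * e - b * c"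
    have D: "D \<noteq> 0" using assms by (simp add: D_def)
    have "(s * e - t * c) * a + (t * a - s * b) * c = s * D" "(s * e - t * c) * b + (t * a - s * b) * e = t * D"
      by (simp_all add: D_def algebra_simps)
    then have "(s * e - t * c) / D * a + (t * a - s * b) / D * c = s" "(s * e - t * c) / D * b + (t * a - s * b) / D * e = t"
      using D by (simp_all add: add_divide_distrib[symmetric])
    then show ?thesis by blast
  qed
  have nz: "(s * a + t * c, s * b + t * e) = (0, 0) \<Longrightarrow> (s, t) = (0, 0)" for s t
  proof -
    assume "(s * a + t * c, s * b + t * e) = (0, 0)"
    then have z: "s * a + t * c = 0" "s * b + t * e = 0" by auto
    have "s * (a * e - b * c) = e * (s * a + t * c) - c * (s * b + t * e)"
      "t * (a * e - b * c) = a * (s * b + t * e) - b * (s * a + t * c)" by (simp_all add: algebra_simps)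
    then show "(s, t) = (0, 0)" using z assms by auto
  qed
  show ?thesis unfolding pencil_def prod.case 1
  proof (intro equalityI subsetI)
    fix C assume "C \<in> {curve (\<lambda>m. (s * a + t * c) * F m + (s * b + t * e) * G m) |s t. (s, t) \<noteq> (0, 0)}"
    then obtain s t where "C = curve (\<lambda>m. (s * a + t * c) * F m + (s * b + t * e) * G m)" "(s, t) \<noteq> (0, 0)" by blast
    then show "C \<in> {curve (\<lambda>m. s * F m + t * G m) |s t. (s, t) \<noteq> (0, 0)}" using nz by blast
  next
    fix C assume "C \<in> {curve (\<lambda>m. s * F m + t * G m) |s t. (s, t) \<noteq> (0, 0)}"
    then obtain s t where C: "C = curve (\<lambda>m. s * F m + t * G m)" "(s, t) \<noteq> (0, 0)" by blast
    obtain x y where xy: "x * a + y * c = s" "x * b + y * e = t" using sol by blast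
    then have "(x, y) \<noteq> (0, 0)" using C(2) by auto
    then show "C \<in> {curve (\<lambda>m. (s * a + t * c) * F m + (s * b + t * e) * G m) |s t. (s, t) \<noteq> (0, 0)}"
      using C xy by blast
  qed
qed

lemma forms_combination: "F \<in> forms d \<Longrightarrow> G \<in> forms d \<Longrightarrow> (\<lambda>m. s * F m + t * G m) \<in> forms d"
  by (simp add: forms_def)

lemma generally_pencils:
  assumes \<phi>: "\<phi> \<in> polyfun (prod_coords (form_coords d) (form_coords d))"
    and v1: "(F1, G1) \<in> independent_pairs d" "\<phi> (F1, G1) \<noteq> 0"
    and Q: "\<And>F G. (F, G) \<in> independent_pairs d \<Longrightarrow> \<phi> (F, G) \<noteq> 0 \<Longrightarrow> Q (pencil (F, G))"
  shows "generally (pencils d) Q"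
  unfolding pencils_def
proof (rule generally_quotient[OF \<phi> v1])
  let ?C = "prod_coords (form_coords d) (form_coords d)"
  have co: "(\<lambda>v. fst v m) \<in> polyfun ?C" "(\<lambda>v. snd v m) \<in> polyfun ?C" if "m \<in> exponents d" for m
    by (intro polyfun.coord prod_coords_fst[OF form_coords_mem] prod_coords_snd[OF form_coords_mem] that)+
  have C: "\<exists>m\<in>exponents d. c = (\<lambda>v. fst v m) \<or> c = (\<lambda>v. snd v m)" if "c \<in> ?C" for c
    using that by (auto simp: prod_coords_def form_coords_def comp_def)
  {
    fix v assume v: "v \<in> independent_pairs d"
    obtain F G where FG: "v = (F, G)" by (cases v)
    obtain m n where mn: "m \<in> exponents d" "n \<in> exponents d" "F m * G n - F n * G m \<noteq> 0"
      using independent_pairs_minor v FG by blast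
    define \<psi> where "\<psi> = (\<lambda>v :: form \<times> form. fst v m * snd v n - fst v n * snd v m)"
    define \<gamma> where "\<gamma> = (\<lambda>\<tau>. ((\<lambda>m. F m + \<tau> * (F1 m - F m)), (\<lambda>m. G m + \<tau> * (G1 m - G m))))"
    have forms: "F \<in> forms d" "G \<in> forms d" "F1 \<in> forms d" "G1 \<in> forms d"
      using v FG v1(1) by (auto simp: independent_pairs_def)
    have "\<psi> \<in> polyfun ?C" unfolding \<psi>_def by (intro polyfun_diff polyfun.mult co mn)
    moreover have "\<psi> v \<noteq> 0" "\<gamma> 0 = v" "\<gamma> 1 = (F1, G1)" using mn FG by (simp_all add: \<psi>_def \<gamma>_def)
    moreover have "\<exists>p. \<forall>\<tau>. c (\<gamma> \<tau>) = poly p \<tau>" if "c \<in> ?C" for c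
      using C[OF that] polyfun_line_poly by (auto simp: \<gamma>_def)
    moreover have "\<gamma> \<tau> \<in> independent_pairs d" if "\<psi> (\<gamma> \<tau>) \<noteq> 0" for \<tau>
      unfolding \<gamma>_def by (rule independent_pairsI[of _ _ _ m n]) (use that forms in \<open>auto simp: \<psi>_def \<gamma>_def forms_def\<close>)
    ultimately show "\<exists>\<psi>\<in>polyfun ?C. \<exists>\<gamma>. \<psi> v \<noteq> 0 \<and> \<gamma> 0 = v \<and> \<gamma> 1 = (F1, G1) \<and>
      (\<forall>c\<in>?C. \<exists>p. \<forall>\<tau>. c (\<gamma> \<tau>) = poly p \<tau>) \<and> (\<forall>\<tau>. \<psi> (\<gamma> \<tau>) \<noteq> 0 \<longrightarrow> \<gamma> \<tau> \<in> independent_pairs d)"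
      by (intro bexI[of _ \<psi>] exI[of _ \<gamma>]) auto
  }
  {
    fix u v assume uv: "u \<in> independent_pairs d" "v \<in> independent_pairs d" "pencil v = pencil u"
    obtain F G F' G' where FG: "u = (F, G)" "v = (F', G')" by (cases u, cases v)
    from pencil_change_basis[of F G d F' G'] uv FG obtain a b c e where
      abce: "a * e - b * c \<noteq> 0" "F = (\<lambda>m. a * F' m + b * G' m)" "G = (\<lambda>m. c * F' m + e * G' m)" by blast
    define T where "T = (\<lambda>w :: form \<times> form. ((\<lambda>m. a * fst w m + b * snd w m), (\<lambda>m. c * fst w m + e * snd w m)))"
    have "T v = u" using abce FG by (simp add: T_def)
    moreover have "(\<lambda>w. x (T w)) \<in> polyfun ?C" if "x \<in> ?C" for x
      using C[OF that] by (auto simp: T_def intro!: polyfun.add polyfun.mult polyfun.const co)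
    moreover have "T w \<in> independent_pairs d \<and> pencil (T w) = pencil w" if w: "w \<in> independent_pairs d" for w
    proof -
      obtain H K where HK: "w = (H, K)" by (cases w)
      obtain m n where mn: "H m * K n - H n * K m \<noteq> 0" using independent_pairs_minor w HK by blast
      have "H \<in> forms d" "K \<in> forms d" using w HK by (auto simp: independent_pairs_def)
      moreover have "(a * H m + b * K m) * (c * H n + e * K n) - (a * H n + b * K n) * (c * H m + e * K m) =
         (a * e - b * c) * (H m * K n - H n * K m)" by (simp add: algebra_simps)
      ultimately show ?thesis unfolding T_def HK fst_conv snd_conv using mn abce(1)
        by (intro conjI independent_pairsI[of _ _ _ m n] pencil_change_basis_eq forms_combination) auto
    qed
    ultimately show "\<exists>T. T v = u \<and> (\<forall>c\<in>?C. (\<lambda>w. c (T w)) \<in> polyfun ?C) \<and>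
      (\<forall>w\<in>independent_pairs d. T w \<in> independent_pairs d \<and> pencil (T w) = pencil w)"
      by (intro exI[of _ T]) auto
  }
qed (use Q in auto)

section \<open>Polynomial dependence of the affine coefficients on pencil and point\<close>

definition polyfam2 :: "('v \<Rightarrow> complex) set \<Rightarrow> ('v \<Rightarrow> complex poly poly) \<Rightarrow> bool" where
  "polyfam2 C R \<longleftrightarrow> (\<forall>i. polyfam C (\<lambda>v. coeff (R v) i))"

lemma polyfam2_mult: "polyfam2 C R \<Longrightarrow> polyfam2 C S \<Longrightarrow> polyfam2 C (\<lambda>v. R v * S v)"
  unfolding polyfam2_def coeff_mult by (intro allI polyfam_sum polyfam_mult) auto

lemma polyfam2_const: "polyfam2 C (\<lambda>_. R)"
  by (simp add: polyfam2_def polyfam_const)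

lemma polyfam2_power: "polyfam2 C R \<Longrightarrow> polyfam2 C (\<lambda>v. R v ^ n)"
  by (induction n) (auto intro: polyfam2_const polyfam2_mult)

lemma polyfam2_smult: "polyfam C c \<Longrightarrow> polyfam2 C R \<Longrightarrow> polyfam2 C (\<lambda>v. smult (c v) (R v))"
  unfolding polyfam2_def coeff_smult by (intro allI polyfam_mult) auto

lemma polyfam2_sum: "(\<And>i. i \<in> I \<Longrightarrow> polyfam2 C (R i)) \<Longrightarrow> polyfam2 C (\<lambda>v. \<Sum>i\<in>I. R i v)"
  unfolding polyfam2_def coeff_sum by (intro allI polyfam_sum) auto

lemma polyfam2_linear:
  assumes "f \<in> polyfun C"
  shows "polyfam2 C (\<lambda>v. [:p, [:f v:]:])"
  unfolding polyfam2_def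
proof
  fix i
  consider "i = 0" | "i = 1" | k where "i = Suc (Suc k)" by (metis One_nat_def not0_implies_Suc)
  then show "polyfam C (\<lambda>v. coeff [:p, [:f v:]:] i)"
    by cases (simp_all add: polyfam_const polyfam_pCons assms)
qed

lemma polyfun_affine_vec:
  fixes p :: "'v \<Rightarrow> complex^3"
  assumes F: "\<And>m. m \<in> exponents d \<Longrightarrow> (\<lambda>v. F v m) \<in> polyfun C" "\<And>m. m \<in> exponents d \<Longrightarrow> (\<lambda>v. G v m) \<in> polyfun C"
    and p: "\<And>i. (\<lambda>v. p v $ i) \<in> polyfun C"
  shows "(\<lambda>v. affine_vec d (F v) (G v) (p v) b) \<in> polyfun C"
proof -
  have "polyfam2 C (\<lambda>v. affine d (H v) (p v))" if "\<And>m. m \<in> exponents d \<Longrightarrow> (\<lambda>v. H v m) \<in> polyfun C" for H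
    unfolding affine_def case_prod_unfold
    by (intro polyfam2_sum polyfam2_smult polyfam2_mult polyfam2_power polyfam2_linear polyfam_pCons polyfam_const p that) simp
  from this[of F] this[of G] F show ?thesis
    by (cases b; cases "fst b") (auto simp: affine_vec_def polyfam2_def polyfam_def)
qed

definition form_of :: "nat \<Rightarrow> (nat \<Rightarrow> nat \<Rightarrow> complex) \<Rightarrow> form" where
  "form_of d c = (\<lambda>(i, j, k). if i + j + k = d then c i j else 0)"

lemma form_of: "form_of d c \<in> forms d"
  by (auto simp: form_of_def forms_def exponents_def)

text \<open>At the point \<open>e1\<close> the affine coefficients are the given ones, so every
  vector of coefficients comes from a pair of forms. This supplies a pencil on which the equation of
  the bad locus does not vanish.\<close>

lemma affine_form_of:
  fixes e1 :: "complex^3"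
  assumes "i + j \<le> d" and e1: "e1 $ 1 = 1" "e1 $ 2 = 0" "e1 $ 3 = 0"
  shows "coeff (coeff (affine d (form_of d c) e1) i) j = c i j"
proof -
  have "affine d (form_of d c) e1 = (\<Sum>(i, j, k)\<in>exponents d. monom (monom (c i j) j) i)"
    unfolding affine_def
  proof (intro sum.cong refl, clarify)
    fix i j k assume ijk: "(i, j, k) \<in> exponents d"
    have "[:0, [:e1 $ 1:]:] = [:0, 1:]" by (simp add: e1 one_pCons)
    then have "[:0, [:e1 $ 1:]:] ^ i = monom 1 i" by (simp add: monom_altdef)
    moreover have "[:[:0, 1:], [:e1 $ 2:]:] ^ j = monom (monom 1 j) 0"
      by (simp add: e1 monom_0 poly_const_pow) (simp add: monom_altdef)
    moreover have "[:[:1:], [:e1 $ 3:]:] ^ k = 1" by (simp add: e1 one_pCons[symmetric])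
    ultimately show "smult [:form_of d c (i, j, k):] ([:0, [:e1 $ 1:]:] ^ i * [:[:0, 1:], [:e1 $ 2:]:] ^ j *
        [:[:1:], [:e1 $ 3:]:] ^ k) = monom (monom (c i j) j) i"
      using ijk by (simp add: mult_monom smult_monom form_of_def exponents_def)
  qed
  also have "coeff (coeff \<dots> i) j = (\<Sum>m\<in>exponents d. if m = (i, j, d - i - j) then c i j else 0)"
    unfolding coeff_sum
    by (intro sum.cong refl) (use assms in \<open>auto simp: exponents_def case_prod_unfold\<close>)
  also have "\<dots> = c i j" using assms finite_exponents by (simp add: exponents_def)
  finally show ?thesis .
qed

theorem corollary2p5:
  fixes d :: nat
  assumes "d \<ge> 3"
  shows "generally (pencils d)
           (\<lambda>P. has_degree (bitangent_lines d P) (2 * d * (d - 2) * (d - 3)))"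
proof -
  obtain \<Phi> v where \<Phi>: "\<Phi> \<in> polyfun (coords (triangle d))" "\<Phi> v \<noteq> 0" "\<And>v. \<Phi> v \<noteq> 0 \<Longrightarrow> generic d v"
    using thin_not_generic[OF assms] unfolding thin_def by blast
  define e1 :: "complex^3" where "e1 = axis 1 1"
  have e1: "e1 $ 1 = 1" "e1 $ 2 = 0" "e1 $ 3 = 0" by (simp_all add: e1_def axis_def)
  define F1 G1 where "F1 = form_of d (\<lambda>i j. v (False, i, j))" and "G1 = form_of d (\<lambda>i j. v (True, i, j))"
  have "affine_vec d F1 G1 e1 b = v b" if "b \<in> triangle d" for b
    using that by (cases b) (auto simp: triangle_def affine_vec_def F1_def G1_def affine_form_of e1)
  then have "\<Phi> (affine_vec d F1 G1 e1) = \<Phi> v" by (rule polyfun_coords_cong[OF \<Phi>(1)])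
  then have \<Phi>1: "\<Phi> (affine_vec d F1 G1 e1) \<noteq> 0" using \<Phi>(2) by simp
  then have gen1: "generic d (affine_vec d F1 G1 e1)" by (rule \<Phi>(3))
  have ind: "(F1, G1) \<in> independent_pairs d"
    unfolding independent_pairs_def mem_Collect_eq prod.case
  proof (intro conjI allI impI)
    fix s t assume z: "(\<lambda>m. s * F1 m + t * G1 m) = (\<lambda>_. 0)"
    define f g where "f = restrict_form d F1 (dir 0) e1" and "g = restrict_form d G1 (dir 0) e1"
    interpret generic_pencil d f g
      by unfold_locales (use gen1 assms in \<open>auto simp: generic_def slice_affine f_def g_def\<close>)
    have "smult s f + smult t g = 0"
      unfolding f_def g_def restrict_form_linear[symmetric] z by (simp add: restrict_form_def case_prod_unfold)
    then show "s = 0" "t = 0" using smult_member[of s f t g] member_nz g_nz by (cases "s = 0"; simp)+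
  qed (simp_all add: F1_def G1_def form_of)
  show ?thesis
  \<comment> \<open>The pencil is tested at the single point \<open>e1\<close>. If
    \<open>\<Phi>\<close> is nonzero there, it is nonzero as a polynomial in the point, hence at a
    general point of the plane.\<close>
  proof (rule generally_pencils[of "\<lambda>(F, G). \<Phi> (affine_vec d F G e1)", OF _ ind])
    have "(\<lambda>v. \<Phi> (affine_vec d (fst v) (snd v) e1)) \<in> polyfun (prod_coords (form_coords d) (form_coords d))"
      by (rule polyfun_subst[OF \<Phi>(1)])
        (auto intro!: polyfun_affine_vec polyfun.const polyfun.coord[OF prod_coords_fst[OF form_coords_mem]]
          polyfun.coord[OF prod_coords_snd[OF form_coords_mem]])
    then show "(\<lambda>(F, G). \<Phi> (affine_vec d F G e1)) \<in> polyfun (prod_coords (form_coords d) (form_coords d))"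
      by (simp add: case_prod_unfold)
  next
    fix F G assume FG: "(F, G) \<in> independent_pairs d" "(case (F, G) of (F, G) \<Rightarrow> \<Phi> (affine_vec d F G e1)) \<noteq> 0"
    then have forms: "F \<in> forms d" "G \<in> forms d" by (auto simp: independent_pairs_def)
    show "has_degree (bitangent_lines d (pencil (F, G))) (2 * d * (d - 2) * (d - 3))"
      unfolding has_degree_def
    \<comment> \<open>The factor \<open>p $ 1\<close> keeps the point off the line that carries the
      directions \<open>dir y\<close> and \<open>dir_inf\<close>.\<close>
    proof (rule generally_plane[of "\<lambda>p. \<Phi> (affine_vec d F G p) * p $ 1" e1])
      show "(\<lambda>p. \<Phi> (affine_vec d F G p) * p $ 1) \<in> polyfun coords3"
        by (intro polyfun.mult polyfun_subst[OF \<Phi>(1)] polyfun.coord[OF coords3_mem])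
          (auto intro!: polyfun_affine_vec polyfun.const polyfun.coord[OF coords3_mem])
    next
      fix p :: "complex^3" assume "\<Phi> (affine_vec d F G p) * p $ 1 \<noteq> 0"
      then show "finite {L \<in> bitangent_lines d (pencil (F, G)). on_line (pt p) L} \<and>
          card {L \<in> bitangent_lines d (pencil (F, G)). on_line (pt p) L} = 2 * d * (d - 2) * (d - 3)"
        using bitangent_lines_count[OF assms forms] \<Phi>(3) by simp
    qed (use FG e1 in auto)
  qed (use \<Phi>1 in simp)
qed

end
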